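(* Let $n\ge2$, $1\le k\le n-1$, and $\mathfrak q=\mathfrak{sl}_n\ltimes(k(\mathbb C^n)^*\oplus k\mathbb C^n)$. Then $\mathbb C[\mathfrak q^*]^{\mathfrak q}$ is a polynomial ring if and only if $k\in\{n-2,n-1\}$. In the case $k=n-2$, $\mathfrak q$ has the "codim-2" property, i.e. $\mathbf p_{\mathfrak q}=1$.
   Context: $\mathfrak q=\mathfrak g\ltimes V$ with $\mathfrak g=\mathfrak{sl}_n$ and $V=k(\mathbb C^n)^*\oplus k\mathbb C^n$ ($k$ copies each of the dual and defining representations) an abelian ideal; $\mathbb C[\mathfrak q^*]^{\mathfrak q}=\mathcal S(\mathfrak q)^{\mathfrak q}$ is the algebra of symmetric invariants. "Codim-2" property: the set $\{\gamma\in\mathfrak q^*:\dim\mathfrak q_\gamma>\operatorname{ind}\mathfrak q\}$ has codimension at least $2$ in $\mathfrak q^*$, where $\operatorname{ind}\mathfrak q=\min_{\gamma\in\mathfrak q^*}\dim\mathfrak q_\gamma$; equivalently, the fundamental semi-invariant $\mathbf p_{\mathfrak q}$ (gcd of the Pfaffians of the principal minors of size $\dim\mathfrak q-\operatorname{ind}\mathfrak q$ of the structure matrix $([\xi_i,\xi_j])$) equals $1$. *)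

theory Defs
  imports Complex_Main "HOL-Library.Poly_Mapping" "HOL-Library.Function_Algebras" "HOL-Combinatorics.Permutations"
begin

type_synonym 'v mpoly = "('v \<Rightarrow>\<^sub>0 nat) \<Rightarrow>\<^sub>0 complex"

definition mvar :: "'v \<Rightarrow> 'v mpoly" where
  "mvar v = Poly_Mapping.single (Poly_Mapping.single v 1) 1"

definition mconst :: "complex \<Rightarrow> 'v mpoly" where
  "mconst c = Poly_Mapping.single 0 c"

definition mvars :: "'v mpoly \<Rightarrow> 'v set" where
  "mvars p = (\<Union>m\<in>Poly_Mapping.keys p. Poly_Mapping.keys m)"

definition meval :: "'v mpoly \<Rightarrow> ('v \<Rightarrow> complex) \<Rightarrow> complex" where
  "meval p x = (\<Sum>m\<in>Poly_Mapping.keys p. Poly_Mapping.lookup p m * (\<Prod>v\<in>Poly_Mapping.keys m. x v ^ Poly_Mapping.lookup m v))"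

definition msubst :: "nat mpoly \<Rightarrow> (nat \<Rightarrow> 'v mpoly) \<Rightarrow> 'v mpoly" where
  "msubst P F = (\<Sum>m\<in>Poly_Mapping.keys P. mconst (Poly_Mapping.lookup P m) * (\<Prod>i\<in>Poly_Mapping.keys m. F i ^ Poly_Mapping.lookup m i))"

definition mderiv :: "'v \<Rightarrow> 'v mpoly \<Rightarrow> 'v mpoly" where
  "mderiv v p = (\<Sum>m\<in>Poly_Mapping.keys p.
      Poly_Mapping.single (m - Poly_Mapping.single v 1) (of_nat (Poly_Mapping.lookup m v) * Poly_Mapping.lookup p m))"

definition is_polynomial_ring :: "'v mpoly set \<Rightarrow> bool" where
  "is_polynomial_ring A \<longleftrightarrow>
     (\<exists>m F. (\<forall>i<m. F i \<in> A)
        \<and> (\<forall>P. mvars P \<subseteq> {..<m} \<and> msubst P F = 0 \<longrightarrow> P = 0)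
        \<and> A = {msubst P F | P. mvars P \<subseteq> {..<m}})"

text \<open>An element of q is a triple (X, U, W): X an n x n traceless matrix
  (entries X i j, i,j < n), U a i the i-th coordinate of the a-th copy of C^n (a < k),
  W a j the j-th coordinate of the a-th copy of (C^n)^* (a < k, a row vector).\<close>
type_synonym qelt = "(nat \<Rightarrow> nat \<Rightarrow> complex) \<times> (nat \<Rightarrow> nat \<Rightarrow> complex) \<times> (nat \<Rightarrow> nat \<Rightarrow> complex)"

text \<open>Lie bracket: [X,Y] matrix commutator, X acts on vectors u by X u and on
  covectors w by - w X; the ideal V is abelian.\<close>
definition qbr :: "nat \<Rightarrow> qelt \<Rightarrow> qelt \<Rightarrow> qelt" where
  "qbr n a b = (case a of (X, U, W) \<Rightarrow> case b of (Y, U', W') \<Rightarrow>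
     ((\<lambda>i j. \<Sum>l<n. X i l * Y l j - Y i l * X l j),
      (\<lambda>c i. \<Sum>l<n. X i l * U' c l - Y i l * U c l),
      (\<lambda>c j. \<Sum>l<n. W c l * Y l j - W' c l * X l j)))"

text \<open>Basis of q: E i j (i \<noteq> j), H t = E t t - E (t+1) (t+1) (t < n-1),
  the standard basis vectors of the k copies of C^n (U) and of (C^n)^* (W).\<close>
datatype qidx = E nat nat | H nat | U nat nat | W nat nat

definition qbasis :: "nat \<Rightarrow> nat \<Rightarrow> qidx set" where
  "qbasis n k = {E i j | i j. i < n \<and> j < n \<and> i \<noteq> j} \<union> {H t | t. t + 1 < n}
     \<union> {U a i | a i. a < k \<and> i < n} \<union> {W a i | a i. a < k \<and> i < n}"

fun belt :: "qidx \<Rightarrow> qelt" where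
  "belt (E i j) = ((\<lambda>a b. if a = i \<and> b = j then 1 else 0), (\<lambda>_ _. 0), (\<lambda>_ _. 0))"
| "belt (H t) = ((\<lambda>a b. if a = b \<and> a = t then 1 else if a = b \<and> a = t + 1 then -1 else 0),
                  (\<lambda>_ _. 0), (\<lambda>_ _. 0))"
| "belt (U c i) = ((\<lambda>_ _. 0), (\<lambda>a b. if a = c \<and> b = i then 1 else 0), (\<lambda>_ _. 0))"
| "belt (W c i) = ((\<lambda>_ _. 0), (\<lambda>_ _. 0), (\<lambda>a b. if a = c \<and> b = i then 1 else 0))"

text \<open>Coordinates of an element of q with respect to the basis above.
  For a traceless X, X = sum_{i\<noteq>j} X i j E i j + sum_t (sum_{s\<le>t} X s s) H t.\<close>
fun coord :: "qidx \<Rightarrow> qelt \<Rightarrow> complex" where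
  "coord (E i j) (X, _, _) = X i j"
| "coord (H t) (X, _, _) = (\<Sum>s\<le>t. X s s)"
| "coord (U c i) (_, V, _) = V c i"
| "coord (W c i) (_, _, V) = V c i"

definition brpoly :: "nat \<Rightarrow> nat \<Rightarrow> qidx \<Rightarrow> qidx \<Rightarrow> qidx mpoly" where
  "brpoly n k i j = (\<Sum>l\<in>qbasis n k. mconst (coord l (qbr n (belt i) (belt j))) * mvar l)"

text \<open>The symmetric algebra S(q) = C[q^*]: polynomials in the basis elements.\<close>
definition Sq :: "nat \<Rightarrow> nat \<Rightarrow> qidx mpoly set" where
  "Sq n k = {p. mvars p \<subseteq> qbasis n k}"

text \<open>Adjoint action of a basis element xi_i on S(q) (the derivation extending ad xi_i).\<close>
definition ad_poly :: "nat \<Rightarrow> nat \<Rightarrow> qidx \<Rightarrow> qidx mpoly \<Rightarrow> qidx mpoly" where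
  "ad_poly n k i f = (\<Sum>j\<in>qbasis n k. brpoly n k i j * mderiv j f)"

definition invariants :: "nat \<Rightarrow> nat \<Rightarrow> qidx mpoly set" where
  "invariants n k = {f \<in> Sq n k. \<forall>i\<in>qbasis n k. ad_poly n k i f = 0}"

definition cdim :: "(qidx \<Rightarrow> complex) set \<Rightarrow> nat" where
  "cdim S = vector_space.dim (\<lambda>c f. (\<lambda>v. c * f v)) S"

text \<open>Stabiliser q_gamma of gamma \<in> q^* (gamma given by its values on the basis),
  in coordinates: {xi \<in> q. gamma([xi, q]) = 0}.\<close>
definition stab :: "nat \<Rightarrow> nat \<Rightarrow> (qidx \<Rightarrow> complex) \<Rightarrow> (qidx \<Rightarrow> complex) set" where
  "stab n k \<gamma> = {x. (\<forall>j. j \<notin> qbasis n k \<longrightarrow> x j = 0) \<and>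
      (\<forall>i\<in>qbasis n k. (\<Sum>j\<in>qbasis n k. x j * meval (brpoly n k j i) \<gamma>) = 0)}"

definition qind :: "nat \<Rightarrow> nat \<Rightarrow> nat" where
  "qind n k = (LEAST d. \<exists>\<gamma>. cdim (stab n k \<gamma>) = d)"

definition pfaff :: "(nat \<Rightarrow> nat \<Rightarrow> 'v mpoly) \<Rightarrow> nat \<Rightarrow> 'v mpoly" where
  "pfaff M r = mconst (1 / (2 ^ r * fact r)) *
     (\<Sum>\<sigma>\<in>{\<sigma>. \<sigma> permutes {..<2*r}}. of_int (sign \<sigma>) * (\<Prod>i<r. M (\<sigma> (2*i)) (\<sigma> (2*i+1))))"

text \<open>The codim-2 property: p_q = 1, i.e. the Pfaffians of the principal minors of
  size dim q - ind q of the structure matrix ([xi_i, xi_j]) have no common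
  non-unit divisor (their gcd is 1, up to a nonzero scalar).\<close>
definition codim2 :: "nat \<Rightarrow> nat \<Rightarrow> bool" where
  "codim2 n k \<longleftrightarrow> (let s = card (qbasis n k) - qind n k in
     \<forall>d :: qidx mpoly.
       (\<forall>xs. distinct xs \<and> set xs \<subseteq> qbasis n k \<and> length xs = s \<longrightarrow>
          d dvd pfaff (\<lambda>a b. brpoly n k (xs ! a) (xs ! b)) (s div 2))
       \<longrightarrow> d dvd 1)"

end

theory Submission
  imports Defs "Jordan_Normal_Form.Char_Poly" "HOL-Computational_Algebra.Fundamental_Theorem_Algebra"
begin

text \<open>A generic point \<open>(a, u, w)\<close> of the dual can be moved to a normal form with \<open>w = [1 0]\<close>, \<open>u = [M; 0]\<close>,
  \<open>a = diag(0, A)\<close>, where \<open>M = w u\<close> and \<open>A\<close> is a square block of size \<open>l = n - k\<close>, taken up to conjugation and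
  scalar shifts. For \<open>l = 1\<close> the entries of \<open>M\<close> therefore generate the invariants freely. For \<open>l = 2\<close> an
  invariant is a polynomial in \<open>M\<close> and the discriminant of \<open>A\<close> over powers of \<open>det M\<close>; restricting it to a
  section that crosses \<open>det M = 0\<close> and using that \<open>det M\<close> is coprime to its leading minor, the invariants are
  polynomials in \<open>M\<close> and \<open>S2\<close>. For \<open>l \<ge> 3\<close> consider, on that section with \<open>M = diag(1, ..., 1, 0)\<close>, the
  cubic Taylor coefficient along the section parameter: the linear coefficient of every invariant
  vanishes there, so the cubic one is a point derivation and lifts to a curve if the ring is polynomial. This contradicts
  the syzygy \<open>(l - 2)\<^sup>2 S2\<^sup>3 + (l - 1) S3\<^sup>2 = det M \<cdot> S6\<close>.

  For \<open>l = 2\<close>, a common divisor of the Pfaffians has no zero at a regular point, hence is constant along every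
  polynomial curve of regular points, and such curves connect generic points even across \<open>det M = 0\<close>.\<close>

section \<open>Polynomial functions\<close>

text \<open>The obstacle for \<open>l = 2\<close> is a denominator: in the generic normal form with
  traceless block of determinant \<open>- h\<close> one has \<open>h = - S2 / (4 det M^2)\<close>,
  so poles along \<open>det M = 0\<close> have to be excluded. For \<open>l \<ge> 3\<close> the
  chosen curve has \<open>det M = 0\<close>, \<open>S2 = - (l - 1) s^2\<close> and
  \<open>S3 = (l - 1) (l - 2) s^3\<close>. This is a cusp, and modulo \<open>det M\<close> the
  syzygy is its equation. The cubic coefficient is a tangent vector at the cusp point in the
  direction of \<open>S3\<close>. If it were the velocity of a line with parameter \<open>e\<close>,
  then \<open>det M\<close> would have order at least 2 in \<open>e\<close>, \<open>S2\<close> and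
  \<open>S6\<close> order at least 1, but \<open>S3\<close> order exactly 1; the coefficient of
  \<open>e^2\<close> in the syzygy forbids that. For \<open>l = 2\<close> the constant
  \<open>(l - 1) (l - 2)\<close> is 0 and no obstruction arises. The group enters through
  \<open>1 + Y\<close> with \<open>Y^2 = 0\<close> only: such elements move points along polynomial
  curves of degree two, so that invariance, derivatives and the constancy of divisors all become
  statements about polynomials in one variable. Density arguments are likewise restricted to
  lines.\<close>

abbreviation mmon :: "('v \<Rightarrow>\<^sub>0 nat) \<Rightarrow> ('v \<Rightarrow> complex) \<Rightarrow> complex" where
  "mmon m x \<equiv> \<Prod>v\<in>Poly_Mapping.keys m. x v ^ Poly_Mapping.lookup m v"

lemma mon_superset:
  assumes "finite S" "Poly_Mapping.keys m \<subseteq> S"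
  shows "mmon m x = (\<Prod>v\<in>S. x v ^ Poly_Mapping.lookup m v)"
  by (rule prod.mono_neutral_left) (use assms in \<open>auto simp: in_keys_iff\<close>)

lemma mon_add: "mmon (m + m') x = mmon m x * mmon m' x"
proof -
  let ?S = "Poly_Mapping.keys m \<union> Poly_Mapping.keys m'"
  have "mmon (m + m') x = (\<Prod>v\<in>?S. x v ^ Poly_Mapping.lookup (m + m') v)"
    by (rule mon_superset) (auto dest: set_mp[OF Poly_Mapping.keys_add])
  also have "\<dots> = (\<Prod>v\<in>?S. x v ^ Poly_Mapping.lookup m v) * (\<Prod>v\<in>?S. x v ^ Poly_Mapping.lookup m' v)"
    by (simp add: lookup_add power_add prod.distrib)
  also have "\<dots> = mmon m x * mmon m' x"
    using mon_superset[of ?S m x] mon_superset[of ?S m' x] by simp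
  finally show ?thesis .
qed

lemma meval_superset:
  assumes "finite S" "Poly_Mapping.keys p \<subseteq> S"
  shows "meval p x = (\<Sum>m\<in>S. Poly_Mapping.lookup p m * mmon m x)"
  unfolding meval_def
  by (rule sum.mono_neutral_left) (use assms in \<open>auto simp: in_keys_iff\<close>)

lemma meval_single [simp]: "meval (Poly_Mapping.single m c) x = c * mmon m x"
  by (subst meval_superset[of "{m}"]) auto

lemma meval_0 [simp]: "meval 0 x = 0"
  by (simp add: meval_def)

lemma meval_add [simp]: "meval (p + q) x = meval p x + meval q x"
proof -
  let ?S = "Poly_Mapping.keys p \<union> Poly_Mapping.keys q"
  have "meval (p + q) x = (\<Sum>m\<in>?S. Poly_Mapping.lookup (p + q) m * mmon m x)"
    by (rule meval_superset) (auto dest: set_mp[OF Poly_Mapping.keys_add])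
  also have "\<dots> = (\<Sum>m\<in>?S. Poly_Mapping.lookup p m * mmon m x) + (\<Sum>m\<in>?S. Poly_Mapping.lookup q m * mmon m x)"
    by (simp add: lookup_add sum.distrib algebra_simps)
  also have "\<dots> = meval p x + meval q x"
    using meval_superset[of ?S p x] meval_superset[of ?S q x] by simp
  finally show ?thesis .
qed

lemma meval_sum [simp]: "meval (\<Sum>i\<in>I. f i) x = (\<Sum>i\<in>I. meval (f i) x)"
  by (induction I rule: infinite_finite_induct) auto

lemma mpoly_sum_monomials: "p = (\<Sum>m\<in>Poly_Mapping.keys p. Poly_Mapping.single m (Poly_Mapping.lookup p m))"
proof (rule poly_mapping_eqI)
  fix m
  have "(\<Sum>i\<in>Poly_Mapping.keys p. Poly_Mapping.lookup p i when i = m) = Poly_Mapping.lookup p m"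
    by (cases "m \<in> Poly_Mapping.keys p") (auto simp: when_def in_keys_iff sum.delta')
  then show "Poly_Mapping.lookup p m =
    Poly_Mapping.lookup (\<Sum>m\<in>Poly_Mapping.keys p. Poly_Mapping.single m (Poly_Mapping.lookup p m)) m"
    by (simp add: lookup_sum lookup_single)
qed

lemma meval_mult [simp]: "meval (p * q) x = meval p x * meval q x"
proof -
  have "p * q = (\<Sum>m\<in>Poly_Mapping.keys p. Poly_Mapping.single m (Poly_Mapping.lookup p m))
      * (\<Sum>m'\<in>Poly_Mapping.keys q. Poly_Mapping.single m' (Poly_Mapping.lookup q m'))"
    by (rule arg_cong2[of _ _ _ _ "(*)"]) (rule mpoly_sum_monomials)+
  also have "\<dots> = (\<Sum>m\<in>Poly_Mapping.keys p. \<Sum>m'\<in>Poly_Mapping.keys q.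
      Poly_Mapping.single (m + m') (Poly_Mapping.lookup p m * Poly_Mapping.lookup q m'))"
    by (simp add: sum_product mult_single)
  finally have "meval (p * q) x = (\<Sum>m\<in>Poly_Mapping.keys p. \<Sum>m'\<in>Poly_Mapping.keys q.
      (Poly_Mapping.lookup p m * Poly_Mapping.lookup q m') * mmon (m + m') x)"
    by simp
  also have "\<dots> = meval p x * meval q x"
    unfolding mon_add meval_def sum_product by (simp add: algebra_simps)
  finally show ?thesis .
qed

lemma meval_mconst [simp]: "meval (mconst c) x = c"
  by (simp add: mconst_def)

lemma meval_mvar [simp]: "meval (mvar v) x = x v"
  by (simp add: mvar_def)

lemma meval_1 [simp]: "meval 1 x = 1"
  using meval_mconst[of 1 x] by (simp add: mconst_def)

lemma meval_power [simp]: "meval (p ^ n) x = meval p x ^ n"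
  by (induction n) auto

lemma meval_prod [simp]: "meval (\<Prod>i\<in>I. f i) x = (\<Prod>i\<in>I. meval (f i) x)"
  by (induction I rule: infinite_finite_induct) auto

lemma meval_of_nat [simp]: "meval (of_nat n) x = of_nat n"
  by (induction n) auto

lemma meval_uminus [simp]: "meval (- p) x = - meval p x"
proof -
  have "meval (- p) x + meval p x = meval (- p + p) x"
    by (rule meval_add[symmetric])
  then show ?thesis by (simp add: eq_neg_iff_add_eq_0)
qed

lemma meval_diff [simp]: "meval (p - q) x = meval p x - meval q x"
  using meval_add[of p "- q" x] by simp

lemma meval_of_int [simp]: "meval (of_int n) x = of_int n"
  by (cases n) (auto simp del: of_nat_Suc)

lemma meval_msubst [simp]: "meval (msubst P F) x = meval P (\<lambda>i. meval (F i) x)"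
  by (simp add: msubst_def meval_def[of P])

lemma meval_cong:
  assumes "mvars p \<subseteq> V" "\<And>v. v \<in> V \<Longrightarrow> x v = y v"
  shows "meval p x = meval p y"
  unfolding meval_def
  by (intro sum.cong refl arg_cong2[of _ _ _ _ "(*)"] prod.cong)
     (use assms in \<open>auto simp: mvars_def subset_iff\<close>)

lemma mvars_mconst [simp]: "mvars (mconst c) = {}"
  by (auto simp: mvars_def mconst_def)

lemma mvars_mvar [simp]: "mvars (mvar v) = {v}"
  by (auto simp: mvars_def mvar_def)

lemma mvars_add: "mvars (p + q) \<subseteq> mvars p \<union> mvars q"
  using Poly_Mapping.keys_add[of p q] by (fastforce simp: mvars_def)

lemma mvars_mult: "mvars (p * q) \<subseteq> mvars p \<union> mvars q"
proof
  fix v assume "v \<in> mvars (p * q)"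
  then obtain m where m: "m \<in> Poly_Mapping.keys (p * q)" "v \<in> Poly_Mapping.keys m"
    by (auto simp: mvars_def)
  then obtain a b where "m = a + b" "a \<in> Poly_Mapping.keys p" "b \<in> Poly_Mapping.keys q"
    using keys_mult[of p q] by blast
  then show "v \<in> mvars p \<union> mvars q"
    using m(2) Poly_Mapping.keys_add[of a b] by (auto simp: mvars_def)
qed

text \<open>Distinct monomials are distinct multiplicative characters, hence linearly independent
  (Dedekind's argument).\<close>

lemma monomials_independent:
  fixes c :: "('v \<Rightarrow>\<^sub>0 nat) \<Rightarrow> complex"
  assumes "finite S" "\<And>x. (\<Sum>m\<in>S. c m * mmon m x) = 0" "m \<in> S"
  shows "c m = 0"
  using assms
proof (induction S arbitrary: c m rule: finite_induct)
  case empty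
  then show ?case by simp
next
  case (insert m0 S)
  have *: "c m1 = 0" if m1: "m1 \<in> S" for m1
  proof -
    have "m1 \<noteq> m0" using m1 insert.hyps by auto
    then obtain v where v: "Poly_Mapping.lookup m1 v \<noteq> Poly_Mapping.lookup m0 v"
      using poly_mapping_eqI[of m1 m0] by blast
    \<comment> \<open>Powers of 2 are pairwise distinct, so this point separates the two monomials
      by their exponent of \<open>v\<close>.\<close>
    define y :: "'v \<Rightarrow> complex" where "y = (\<lambda>_. 1)(v := 2)"
    have mon_y: "mmon m y = 2 ^ Poly_Mapping.lookup m v" for m
    proof -
      have "mmon m y = (\<Prod>u\<in>insert v (Poly_Mapping.keys m). y u ^ Poly_Mapping.lookup m u)"
        by (rule mon_superset) auto
      also have "\<dots> = (\<Prod>u\<in>insert v (Poly_Mapping.keys m). if u = v then 2 ^ Poly_Mapping.lookup m v else 1)"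
        by (rule prod.cong) (auto simp: y_def)
      also have "\<dots> = 2 ^ Poly_Mapping.lookup m v"
        by (subst prod.delta) auto
      finally show ?thesis .
    qed
    \<comment> \<open>Subtracting \<open>mmon m0 y\<close> times the relation at \<open>x\<close>
      from the relation at the pointwise product of \<open>x\<close> and \<open>y\<close> cancels
      the term of \<open>m0\<close> and leaves a shorter relation.\<close>
    let ?c = "\<lambda>m. c m * (mmon m y - mmon m0 y)"
    have "(\<Sum>m\<in>S. ?c m * mmon m x) = 0" for x
    proof -
      have xy: "mmon m (\<lambda>u. x u * y u) = mmon m x * mmon m y" for m
        by (simp only: power_mult_distrib prod.distrib)
      have "(\<Sum>m\<in>insert m0 S. ?c m * mmon m x) =
          (\<Sum>m\<in>insert m0 S. c m * mmon m (\<lambda>u. x u * y u)) - mmon m0 y * (\<Sum>m\<in>insert m0 S. c m * mmon m x)"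
        unfolding xy sum_distrib_left sum_subtractf[symmetric]
        by (rule sum.cong) (auto simp only: algebra_simps)
      also have "\<dots> = 0" by (simp only: insert.prems(1)) simp
      finally show ?thesis using insert.hyps by simp
    qed
    from insert.IH[OF this m1] have "c m1 * (mmon m1 y - mmon m0 y) = 0" .
    moreover have "mmon m1 y \<noteq> mmon m0 y"
    proof
      assume "mmon m1 y = mmon m0 y"
      then have "norm ((2::complex) ^ Poly_Mapping.lookup m1 v) = norm ((2::complex) ^ Poly_Mapping.lookup m0 v)"
        by (simp add: mon_y)
      then show False using v by (simp add: norm_power)
    qed
    ultimately show ?thesis by simp
  qed
  have "(\<Sum>m\<in>S. c m * mmon m (\<lambda>_. 1)) = 0"
    by (rule sum.neutral) (simp add: *)
  then have "c m0 = 0"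
    using insert.prems(1)[of "\<lambda>_. 1"] insert.hyps by simp
  with * insert.prems(2) show ?case by auto
qed

lemma meval_eq_0_imp:
  assumes "\<And>x. meval p x = 0"
  shows "p = 0"
proof -
  have "Poly_Mapping.lookup p m = 0" if "m \<in> Poly_Mapping.keys p" for m
    by (rule monomials_independent[OF finite_keys _ that]) (rule assms[unfolded meval_def])
  then have "Poly_Mapping.keys p = {}" using in_keys_iff by fast
  then show ?thesis by simp
qed

text \<open>Monomials are independent as functions, so identities between formal polynomials can be
  checked pointwise.\<close>

lemma meval_inject:
  assumes "\<And>x. meval p x = meval q x"
  shows "p = q"
proof -
  have "p - q = 0" by (rule meval_eq_0_imp) (simp only: meval_diff assms diff_self)
  then show ?thesis by simp
qed

text \<open>A polynomial is the finite sum of its terms, hence built from constants and its own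
  variables by sums and products. Facts about evaluation then follow without touching exponent
  vectors.\<close>

lemma mpoly_induct [consumes 1, case_names const var add mult]:
  assumes "mvars p \<subseteq> V"
    and "\<And>c. P (mconst c)" and "\<And>v. v \<in> V \<Longrightarrow> P (mvar v)"
    and add: "\<And>p q. P p \<Longrightarrow> P q \<Longrightarrow> P (p + q)" and mult: "\<And>p q. P p \<Longrightarrow> P q \<Longrightarrow> P (p * q)"
  shows "P p"
proof -
  have 0: "P 0" using assms(2)[of 0] by (simp add: mconst_def)
  have 1: "P 1" using assms(2)[of 1] by (simp add: mconst_def)
  have sum: "P (sum f I)" if "\<And>i. i \<in> I \<Longrightarrow> P (f i)" for f :: "'c \<Rightarrow> 'a mpoly" and I
    using that by (induction I rule: infinite_finite_induct) (auto intro: 0 add)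
  have pow: "P (q ^ i)" if "P q" for q i using that by (induction i) (auto intro: 1 mult)
  have prod: "P (prod f I)" if "\<And>i. i \<in> I \<Longrightarrow> P (f i)" for f :: "'a \<Rightarrow> 'a mpoly" and I
    using that by (induction I rule: infinite_finite_induct) (auto intro: 1 mult)
  have "P (\<Sum>m\<in>Poly_Mapping.keys p. mconst (Poly_Mapping.lookup p m) *
      (\<Prod>v\<in>Poly_Mapping.keys m. mvar v ^ Poly_Mapping.lookup m v))"
    using assms(1) by (intro sum mult prod pow assms) (auto simp: mvars_def)
  also have "\<dots> = p"
    by (rule meval_inject)
       (simp only: meval_sum meval_mult meval_mconst meval_prod meval_power meval_mvar meval_def[of p])
  finally show ?thesis .
qed

text \<open>Polynomials are handled as functions together with a bound on their variables. Composite
  expressions, determinants included, are then recognised as polynomial by the closure rules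
  \<open>pf\<close>, and substitution is composition of functions.\<close>

definition polyfun :: "'v set \<Rightarrow> (('v \<Rightarrow> complex) \<Rightarrow> complex) \<Rightarrow> bool" where
  "polyfun V f \<longleftrightarrow> (\<exists>p. mvars p \<subseteq> V \<and> f = meval p)"

named_theorems pf "closure properties of polynomial functions"

lemma polyfun_meval [pf]: "mvars p \<subseteq> V \<Longrightarrow> polyfun V (meval p)"
  by (auto simp: polyfun_def)

lemma polyfun_const [pf]: "polyfun V (\<lambda>x. c)"
  unfolding polyfun_def by (rule exI[of _ "mconst c"]) auto

lemma polyfun_var [pf]: "v \<in> V \<Longrightarrow> polyfun V (\<lambda>x. x v)"
  unfolding polyfun_def by (rule exI[of _ "mvar v"]) auto

lemma polyfun_add [pf]: "polyfun V f \<Longrightarrow> polyfun V g \<Longrightarrow> polyfun V (\<lambda>x. f x + g x)"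
  unfolding polyfun_def
proof (elim exE conjE)
  fix p q assume "mvars p \<subseteq> V" "mvars q \<subseteq> V" "f = meval p" "g = meval q"
  then show "\<exists>p. mvars p \<subseteq> V \<and> (\<lambda>x. f x + g x) = meval p"
    using mvars_add[of p q] by (intro exI[of _ "p + q"]) auto
qed

lemma polyfun_mult [pf]: "polyfun V f \<Longrightarrow> polyfun V g \<Longrightarrow> polyfun V (\<lambda>x. f x * g x)"
  unfolding polyfun_def
proof (elim exE conjE)
  fix p q assume "mvars p \<subseteq> V" "mvars q \<subseteq> V" "f = meval p" "g = meval q"
  then show "\<exists>p. mvars p \<subseteq> V \<and> (\<lambda>x. f x * g x) = meval p"
    using mvars_mult[of p q] by (intro exI[of _ "p * q"]) auto
qed

lemma polyfun_uminus [pf]: "polyfun V f \<Longrightarrow> polyfun V (\<lambda>x. - f x)"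
  using polyfun_mult[OF polyfun_const[of V "-1"], of f] by simp

lemma polyfun_diff [pf]: "polyfun V f \<Longrightarrow> polyfun V g \<Longrightarrow> polyfun V (\<lambda>x. f x - g x)"
  using polyfun_add[OF _ polyfun_uminus, of V f g] by simp

lemma polyfun_power [pf]: "polyfun V f \<Longrightarrow> polyfun V (\<lambda>x. f x ^ n)"
  by (induction n) (auto intro: polyfun_const polyfun_mult)

lemma polyfun_sum [pf]: "(\<And>i. i \<in> I \<Longrightarrow> polyfun V (f i)) \<Longrightarrow> polyfun V (\<lambda>x. \<Sum>i\<in>I. f i x)"
  by (induction I rule: infinite_finite_induct) (auto intro: polyfun_const polyfun_add)

lemma polyfun_prod [pf]: "(\<And>i. i \<in> I \<Longrightarrow> polyfun V (f i)) \<Longrightarrow> polyfun V (\<lambda>x. \<Prod>i\<in>I. f i x)"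
  by (induction I rule: infinite_finite_induct) (auto intro: polyfun_const polyfun_mult)

lemma polyfun_divide_const [pf]: "polyfun V f \<Longrightarrow> polyfun V (\<lambda>x. f x / c)"
  using polyfun_mult[OF _ polyfun_const[of V "inverse c"]] by (simp add: divide_inverse)

lemma polyfun_mono: "polyfun V f \<Longrightarrow> V \<subseteq> V' \<Longrightarrow> polyfun V' f"
  by (auto simp: polyfun_def)

lemma polyfun_if [pf]: "(b \<Longrightarrow> polyfun V f) \<Longrightarrow> (\<not> b \<Longrightarrow> polyfun V g) \<Longrightarrow> polyfun V (\<lambda>x. if b then f x else g x)"
  by (cases b) auto

lemma polyfun_det [pf]:
  assumes "\<And>i j. i < n \<Longrightarrow> j < n \<Longrightarrow> polyfun V (\<lambda>x. f x i j)"
  shows "polyfun V (\<lambda>x. det (mat n n (\<lambda>(i, j). f x i j)))"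
  unfolding det_def by (auto simp: permutes_in_image atLeast0LessThan intro!: pf assms)

lemma polyfun_comp:
  assumes "polyfun V f" "\<And>v. v \<in> V \<Longrightarrow> polyfun V' (\<lambda>y. g y v)"
  shows "polyfun V' (\<lambda>y. f (g y))"
proof -
  obtain p where p: "mvars p \<subseteq> V" "f = meval p" using assms(1) by (auto simp: polyfun_def)
  from p(1) have "polyfun V' (\<lambda>y. meval p (g y))"
    by (induction rule: mpoly_induct) (auto intro: pf assms(2))
  then show ?thesis by (simp add: p)
qed

lemma polyfun_cong:
  assumes "polyfun V f" "\<And>v. v \<in> V \<Longrightarrow> x v = y v"
  shows "f x = f y"
  using assms by (auto simp: polyfun_def intro: meval_cong)

lemma polyfun_obtain:
  assumes "polyfun V f"
  obtains p where "mvars p \<subseteq> V" "\<And>x. meval p x = f x"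
  using assms by (auto simp: polyfun_def)

lemma polyfun_imp_mvars: "polyfun V (meval p) \<Longrightarrow> mvars p \<subseteq> V"
  unfolding polyfun_def using meval_inject by (auto simp: fun_eq_iff)

section \<open>Polynomial curves and density arguments\<close>

definition pcurve :: "(complex \<Rightarrow> complex) \<Rightarrow> bool" where
  "pcurve g \<longleftrightarrow> (\<exists>q. \<forall>t. g t = poly q t)"

lemma pcurve_const [pf]: "pcurve (\<lambda>t. c)"
  unfolding pcurve_def by (rule exI[of _ "[:c:]"]) auto

lemma pcurve_id [pf]: "pcurve (\<lambda>t. t)"
  unfolding pcurve_def by (rule exI[of _ "[:0, 1:]"]) auto

lemma pcurve_add [pf]: "pcurve f \<Longrightarrow> pcurve g \<Longrightarrow> pcurve (\<lambda>t. f t + g t)"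
  unfolding pcurve_def by (metis poly_add)

lemma pcurve_mult [pf]: "pcurve f \<Longrightarrow> pcurve g \<Longrightarrow> pcurve (\<lambda>t. f t * g t)"
  unfolding pcurve_def by (metis poly_mult)

lemma pcurve_uminus [pf]: "pcurve f \<Longrightarrow> pcurve (\<lambda>t. - f t)"
  unfolding pcurve_def by (metis poly_minus)

lemma pcurve_diff [pf]: "pcurve f \<Longrightarrow> pcurve g \<Longrightarrow> pcurve (\<lambda>t. f t - g t)"
  unfolding pcurve_def by (metis poly_diff)

lemma pcurve_sum [pf]: "(\<And>i. i \<in> I \<Longrightarrow> pcurve (f i)) \<Longrightarrow> pcurve (\<lambda>x. \<Sum>i\<in>I. f i x)"
  by (induction I rule: infinite_finite_induct) (auto intro: pcurve_const pcurve_add)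

lemma pcurve_if [pf]: "(b \<Longrightarrow> pcurve f) \<Longrightarrow> (\<not> b \<Longrightarrow> pcurve g) \<Longrightarrow> pcurve (\<lambda>x. if b then f x else g x)"
  by (cases b) auto

lemma pcurve_comp:
  assumes "polyfun V f" "\<And>v. v \<in> V \<Longrightarrow> pcurve (\<lambda>t. g t v)"
  shows "pcurve (\<lambda>t. f (g t))"
proof -
  obtain p where p: "mvars p \<subseteq> V" "f = meval p" using assms(1) by (auto simp: polyfun_def)
  from p(1) have "pcurve (\<lambda>t. meval p (g t))"
    by (induction rule: mpoly_induct) (auto intro: pf assms(2))
  then show ?thesis by (simp add: p)
qed

lemma pcurve_finite_zeros:
  assumes "pcurve g" "g t0 \<noteq> 0"
  shows "finite {t. g t = 0}"
proof -
  obtain q where q: "\<And>t. g t = poly q t" using assms(1) by (auto simp: pcurve_def)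
  with assms(2) have "q \<noteq> 0" by auto
  then show ?thesis by (simp add: q poly_roots_finite)
qed

text \<open>A nonzero polynomial in one variable has finitely many zeros. Often applied with a
  single excluded parameter, in place of a limit.\<close>

lemma pcurve_dense:
  assumes "pcurve g" "finite S" "\<And>t. t \<notin> S \<Longrightarrow> g t = 0"
  shows "g t = 0"
proof (rule ccontr)
  assume "g t \<noteq> 0"
  then have "finite ({t. g t = 0} \<union> S)" using assms pcurve_finite_zeros by auto
  moreover have "UNIV \<subseteq> {t. g t = 0} \<union> S" using assms(3) by auto
  ultimately show False using infinite_UNIV_char_0 by (metis finite_subset)
qed

text \<open>A nonconstant complex polynomial has a zero. This is the mechanism behind the
  codimension two statement: a divisor without zeros on a curve cannot vary along it.\<close>

lemma pcurve_no_zero_imp_const: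
  assumes "pcurve g" "\<And>t. g t \<noteq> 0"
  shows "g s = g t"
proof -
  obtain q where q: "\<And>t. g t = poly q t" using assms(1) by (auto simp: pcurve_def)
  have "constant (poly q)"
    using fundamental_theorem_of_algebra[of q] assms(2) q by auto
  then show ?thesis by (simp add: q constant_def)
qed

text \<open>The substitute for Zariski density of \<open>q \<noteq> 0\<close>: on the line through
  \<open>y0\<close> and \<open>y\<close> the function \<open>q\<close> is not identically zero, so
  \<open>p\<close> vanishes at all but finitely many points of the line, hence at
  \<open>y\<close>.\<close>

lemma polyfun_dense:
  assumes "polyfun V p" "polyfun V q" "q y0 \<noteq> 0" "\<And>y. q y \<noteq> 0 \<Longrightarrow> p y = 0"
  shows "p y = 0"
proof -
  define L where "L t v = y0 v + t * (y v - y0 v)" for t :: complex and v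
  have L: "pcurve (\<lambda>t. L t v)" for v unfolding L_def by (intro pf)
  have L0: "L 0 = y0" by (simp add: L_def fun_eq_iff)
  have L1: "L 1 = y" by (simp add: L_def fun_eq_iff)
  have "finite {t. q (L t) = 0}"
    by (rule pcurve_finite_zeros[of _ 0]) (use assms in \<open>auto intro: pcurve_comp L simp: L0\<close>)
  then have "p (L 1) = 0"
    by (rule pcurve_dense[rotated]) (use assms in \<open>auto intro: pcurve_comp L\<close>)
  then show ?thesis by (simp add: L1)
qed

text \<open>Two nonempty open subsets of an affine space meet.\<close>

lemma polyfun_nonzero_mult:
  assumes "polyfun V p" "polyfun V q" "q y0 \<noteq> 0" "p y1 \<noteq> 0"
  obtains y where "p y \<noteq> 0" "q y \<noteq> 0"
  using polyfun_dense[OF assms(1-3), of y1] assms(4) by blast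

section \<open>Formal and analytic derivatives\<close>

lemma meval_mderiv:
  "meval (mderiv v p) x = (\<Sum>m\<in>Poly_Mapping.keys p. Poly_Mapping.lookup p m *
     (of_nat (Poly_Mapping.lookup m v) * mmon (m - Poly_Mapping.single v 1) x))"
  by (simp add: mderiv_def algebra_simps)

lemma mmon_minus_single:
  assumes "v \<in> Poly_Mapping.keys m"
  shows "mmon (m - Poly_Mapping.single v 1) x =
    x v ^ (Poly_Mapping.lookup m v - 1) * (\<Prod>u\<in>Poly_Mapping.keys m - {v}. x u ^ Poly_Mapping.lookup m u)"
proof -
  have "mmon (m - Poly_Mapping.single v 1) x =
      (\<Prod>u\<in>Poly_Mapping.keys m. x u ^ Poly_Mapping.lookup (m - Poly_Mapping.single v 1) u)"
    by (rule mon_superset) (auto simp: in_keys_iff lookup_minus)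
  also have "\<dots> = x v ^ Poly_Mapping.lookup (m - Poly_Mapping.single v 1) v *
      (\<Prod>u\<in>Poly_Mapping.keys m - {v}. x u ^ Poly_Mapping.lookup (m - Poly_Mapping.single v 1) u)"
    using assms by (intro prod.remove) auto
  also have "\<dots> = x v ^ (Poly_Mapping.lookup m v - 1) * (\<Prod>u\<in>Poly_Mapping.keys m - {v}. x u ^ Poly_Mapping.lookup m u)"
    by (intro arg_cong2[of _ _ _ _ "(*)"] prod.cong) (auto simp: lookup_minus lookup_single when_def)
  finally show ?thesis .
qed

lemma meval_has_field_derivative:
  assumes "mvars p \<subseteq> V" "finite V" "\<And>v. v \<in> V \<Longrightarrow> ((\<lambda>t. c t v) has_field_derivative c' v) (at t)"
  shows "((\<lambda>t. meval p (c t)) has_field_derivative (\<Sum>v\<in>V. meval (mderiv v p) (c t) * c' v)) (at t)"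
proof -
  have mono: "((\<lambda>t. mmon m (c t)) has_field_derivative
      (\<Sum>v\<in>V. of_nat (Poly_Mapping.lookup m v) * mmon (m - Poly_Mapping.single v 1) (c t) * c' v)) (at t)"
    if m: "m \<in> Poly_Mapping.keys p" for m
  proof -
    have sub: "Poly_Mapping.keys m \<subseteq> V" using assms(1) m by (auto simp: mvars_def)
    have "((\<lambda>t. mmon m (c t)) has_field_derivative
      (\<Sum>v\<in>Poly_Mapping.keys m. (of_nat (Poly_Mapping.lookup m v) * (c t v ^ (Poly_Mapping.lookup m v - 1) * c' v)) *
         (\<Prod>u\<in>Poly_Mapping.keys m - {v}. c t u ^ Poly_Mapping.lookup m u))) (at t)"
      using sub assms(3)
      by (intro has_field_derivative_prod) (auto intro!: derivative_eq_intros)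
    also have "(\<Sum>v\<in>Poly_Mapping.keys m. (of_nat (Poly_Mapping.lookup m v) * (c t v ^ (Poly_Mapping.lookup m v - 1) * c' v)) *
         (\<Prod>u\<in>Poly_Mapping.keys m - {v}. c t u ^ Poly_Mapping.lookup m u)) =
      (\<Sum>v\<in>Poly_Mapping.keys m. of_nat (Poly_Mapping.lookup m v) * mmon (m - Poly_Mapping.single v 1) (c t) * c' v)"
      by (rule sum.cong[OF refl], subst mmon_minus_single) (auto simp only: mult_ac)
    also have "\<dots> = (\<Sum>v\<in>V. of_nat (Poly_Mapping.lookup m v) * mmon (m - Poly_Mapping.single v 1) (c t) * c' v)"
      by (rule sum.mono_neutral_left) (use sub assms(2) in \<open>auto simp: in_keys_iff\<close>)
    finally show ?thesis .
  qed
  have "((\<lambda>t. meval p (c t)) has_field_derivative (\<Sum>m\<in>Poly_Mapping.keys p. Poly_Mapping.lookup p m *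
     (\<Sum>v\<in>V. of_nat (Poly_Mapping.lookup m v) * mmon (m - Poly_Mapping.single v 1) (c t) * c' v))) (at t)"
    unfolding meval_def by (intro DERIV_sum DERIV_cmult mono)
  also have "(\<Sum>m\<in>Poly_Mapping.keys p. Poly_Mapping.lookup p m *
     (\<Sum>v\<in>V. of_nat (Poly_Mapping.lookup m v) * mmon (m - Poly_Mapping.single v 1) (c t) * c' v)) =
     (\<Sum>v\<in>V. meval (mderiv v p) (c t) * c' v)"
    unfolding meval_mderiv sum_distrib_left sum_distrib_right
    by (subst sum.swap) (simp only: mult_ac)
  finally show ?thesis .
qed

lemma pcurve_zero_derivative_imp_const:
  assumes "pcurve g" "\<And>t. (g has_field_derivative 0) (at t)"
  shows "g s = g t"
proof -
  obtain q where q: "g = poly q" using assms(1) by (auto simp: pcurve_def)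
  have "poly (pderiv q) t = 0" for t
    using DERIV_unique[OF poly_DERIV[of q t]] assms(2)[of t] unfolding q by auto
  then have "pderiv q = 0" using poly_all_0_iff_0[of "pderiv q"] by blast
  then have "degree q = 0" by (simp add: pderiv_eq_0_iff)
  then obtain c where "q = [:c:]" by (rule degree_eq_zeroE)
  then show ?thesis by (simp add: q)
qed

lemma pcurve_coeff_1_eq_0:
  assumes "(poly q has_field_derivative 0) (at 0)"
  shows "coeff q 1 = (0 :: complex)"
  using DERIV_unique[OF poly_DERIV[of q 0] assms] by (simp add: poly_0_coeff_0 coeff_pderiv)

text \<open>Represents a polynomial in one further variable with coefficients in the polynomial ring
  over \<open>V\<close>. The degree bound is uniform in \<open>x\<close>: coefficientwise
  polynomiality alone would admit unboundedly many powers.\<close>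

definition polyfam :: "'v set \<Rightarrow> (('v \<Rightarrow> complex) \<Rightarrow> complex poly) \<Rightarrow> bool" where
  "polyfam V G \<longleftrightarrow> (\<forall>i. polyfun V (\<lambda>x. coeff (G x) i)) \<and> (\<exists>d. \<forall>x. degree (G x) \<le> d)"

lemma polyfam_coeff [pf]: "polyfam V G \<Longrightarrow> polyfun V (\<lambda>x. coeff (G x) i)"
  by (simp add: polyfam_def)

lemma polyfam_const [pf]: "polyfam V (\<lambda>x. p)"
  by (auto simp: polyfam_def intro: pf)

lemma polyfam_pCons [pf]: "polyfun V f \<Longrightarrow> polyfam V G \<Longrightarrow> polyfam V (\<lambda>x. pCons (f x) (G x))"
  unfolding polyfam_def
proof (safe, goal_cases)
  case (1 d i)
  then show ?case by (cases i) auto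
next
  case (2 d)
  then show ?case by (intro exI[of _ "Suc d"]) (auto simp: degree_pCons_eq_if)
qed

lemma polyfam_add [pf]: "polyfam V F \<Longrightarrow> polyfam V G \<Longrightarrow> polyfam V (\<lambda>x. F x + G x)"
  unfolding polyfam_def
proof (safe, goal_cases)
  case (1 d1 d2 i)
  then show ?case by (simp add: polyfun_add)
next
  case (2 d1 d2)
  then show ?case by (intro exI[of _ "max d1 d2"] allI degree_add_le) (metis max.coboundedI1 max.coboundedI2)+
qed

lemma polyfam_mult [pf]: "polyfam V F \<Longrightarrow> polyfam V G \<Longrightarrow> polyfam V (\<lambda>x. F x * G x)"
  unfolding polyfam_def
proof (safe, goal_cases)
  case (1 d1 d2 i)
  then show ?case by (auto simp: coeff_mult intro!: polyfun_sum polyfun_mult)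
next
  case (2 d1 d2)
  then show ?case by (intro exI[of _ "d1 + d2"]) (meson add_mono degree_mult_le order_trans)
qed

lemma polyfam_smult [pf]: "polyfun V f \<Longrightarrow> polyfam V G \<Longrightarrow> polyfam V (\<lambda>x. Polynomial.smult (f x) (G x))"
  using polyfam_mult[OF polyfam_pCons[OF _ polyfam_const[of V 0], of f], of G] by simp

lemma polyfam_sum [pf]: "(\<And>i. i \<in> I \<Longrightarrow> polyfam V (f i)) \<Longrightarrow> polyfam V (\<lambda>x. \<Sum>i\<in>I. f i x)"
  by (induction I rule: infinite_finite_induct) (auto intro: polyfam_const polyfam_add)

lemma polyfam_prod [pf]: "(\<And>i. i \<in> I \<Longrightarrow> polyfam V (f i)) \<Longrightarrow> polyfam V (\<lambda>x. \<Prod>i\<in>I. f i x)"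
  by (induction I rule: infinite_finite_induct) (auto intro: polyfam_const polyfam_mult)

lemma polyfam_det [pf]:
  assumes "\<And>i j. i < n \<Longrightarrow> j < n \<Longrightarrow> polyfam V (\<lambda>x. f x i j)"
  shows "polyfam V (\<lambda>x. det (mat n n (\<lambda>(i, j). f x i j)))"
  unfolding det_def by (auto simp: permutes_in_image atLeast0LessThan intro!: pf assms)

lemma polyfun_expand:
  assumes "polyfun V f"
  obtains G where "polyfam (V - {v}) G" "\<And>x. f x = poly (G x) (x v)"
proof -
  obtain p where p: "mvars p \<subseteq> V" "f = meval p" using assms by (auto simp: polyfun_def)
  from p(1) have "\<exists>G. polyfam (V - {v}) G \<and> (\<forall>x. meval p x = poly (G x) (x v))"
  proof (induction rule: mpoly_induct)
    case (const c)
    show ?case by (rule exI[of _ "\<lambda>x. [:c:]"]) (auto intro: pf)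
  next
    case (var u)
    show ?case
    proof (cases "u = v")
      case True
      then show ?thesis by (intro exI[of _ "\<lambda>x. [:0, 1:]"]) (auto intro: pf)
    next
      case False
      then show ?thesis using var by (intro exI[of _ "\<lambda>x. [:x u:]"]) (auto intro!: pf)
    qed
  next
    case (add p q)
    then obtain G G' where "polyfam (V - {v}) G" "polyfam (V - {v}) G'"
      "\<forall>x. meval p x = poly (G x) (x v)" "\<forall>x. meval q x = poly (G' x) (x v)" by blast
    then show ?case by (intro exI[of _ "\<lambda>x. G x + G' x"]) (auto intro: pf)
  next
    case (mult p q)
    then obtain G G' where "polyfam (V - {v}) G" "polyfam (V - {v}) G'"
      "\<forall>x. meval p x = poly (G x) (x v)" "\<forall>x. meval q x = poly (G' x) (x v)" by blast
    then show ?case by (intro exI[of _ "\<lambda>x. G x * G' x"]) (auto intro: pf)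
  qed
  then show ?thesis using that p(2) by blast
qed

text \<open>Neither family depends on the coordinate \<open>v\<close>, so this coordinate may be
  varied freely while the families stay fixed; two polynomials with equal values everywhere
  coincide.\<close>

lemma polyfam_unique:
  assumes "polyfam (V - {v}) G" "polyfam (V - {v}) G'" "\<And>x. poly (G x) (x v) = poly (G' x) (x v)"
  shows "G x = G' x"
proof -
  have inv: "H x = H (x(v := t))" if "polyfam (V - {v}) H" for H t
    by (rule poly_eqI, rule polyfun_cong[OF polyfam_coeff[OF that]]) auto
  have "poly (G x) t = poly (G' x) t" for t
    using assms(3)[of "x(v := t)"] inv[OF assms(1), of t] inv[OF assms(2), of t] by simp
  then show ?thesis by (simp add: poly_eq_poly_eq_iff[symmetric] fun_eq_iff)
qed

subsection \<open>Divisibility and coprimality of leading minors\<close>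

definition dvdp :: "'v set \<Rightarrow> (('v \<Rightarrow> complex) \<Rightarrow> complex) \<Rightarrow> (('v \<Rightarrow> complex) \<Rightarrow> complex) \<Rightarrow> bool" where
  "dvdp V D y \<longleftrightarrow> (\<exists>z. polyfun V z \<and> (\<forall>x. y x = D x * z x))"

text \<open>\<open>F\<close> is a nonzerodivisor modulo \<open>D\<close>. For nonzero
  \<open>D\<close> this amounts to coprimality, the ring being factorial; cancellation is the form
  in which it is applied.\<close>

definition nzd :: "'v set \<Rightarrow> (('v \<Rightarrow> complex) \<Rightarrow> complex) \<Rightarrow> (('v \<Rightarrow> complex) \<Rightarrow> complex) \<Rightarrow> bool" where
  "nzd V D F \<longleftrightarrow> (\<forall>y. polyfun V y \<longrightarrow> dvdp V D (\<lambda>x. F x * y x) \<longrightarrow> dvdp V D y)"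

text \<open>The leading coefficient in \<open>v\<close> is a nonzerodivisor modulo \<open>D\<close>,
  and \<open>D\<close> is free of \<open>v\<close>. If \<open>D\<close> divides the product with
  \<open>y\<close>, it divides \<open>F1\<close> times the top coefficient of \<open>y\<close> in
  \<open>v\<close>, hence that coefficient; subtracting its term lowers the degree.\<close>

lemma nzd_linear:
  assumes D: "polyfun (V - {v}) D" and F0: "polyfun (V - {v}) F0" and F1: "polyfun (V - {v}) F1"
    and v: "v \<in> V" and nz: "nzd V D F1"
  shows "nzd V D (\<lambda>x. F0 x + F1 x * x v)"
proof -
  have mono: "polyfun V f" if "polyfun (V - {v}) f" for f
    using that by (rule polyfun_mono) auto
  have key: "dvdp V D y"
    if "polyfam (V - {v}) G" "\<And>x. y x = poly (G x) (x v)" "\<And>x i. i \<ge> d \<Longrightarrow> coeff (G x) i = 0"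
      "dvdp V D (\<lambda>x. (F0 x + F1 x * x v) * y x)" for d y G
    using that
  proof (induction d arbitrary: y G)
    case 0
    then have "G x = 0" for x by (intro poly_eqI) auto
    then have "\<And>x. y x = 0" using 0(2) by simp
    then show ?case unfolding dvdp_def by (intro exI[of _ "\<lambda>_. 0"]) (auto intro: pf)
  next
    case (Suc d)
    obtain z where z: "polyfun V z" "\<And>x. (F0 x + F1 x * x v) * y x = D x * z x"
      using Suc.prems(4) by (auto simp: dvdp_def)
    obtain Z where Z: "polyfam (V - {v}) Z" "\<And>x. z x = poly (Z x) (x v)"
      using polyfun_expand[OF z(1)] by blast
    \<comment> \<open>Both sides have coefficients free of \<open>v\<close>, so equal values force
      equal coefficients.\<close>
    have "[:F0 x, F1 x:] * G x = [:D x:] * Z x" for x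
      by (rule polyfam_unique[of V v "\<lambda>x. [:F0 x, F1 x:] * G x" "\<lambda>x. [:D x:] * Z x"])
         (use z(2) Z Suc.prems in \<open>auto intro!: pf D F0 F1 simp: algebra_simps\<close>)
    then have "coeff ([:F0 x, F1 x:] * G x) (Suc d) = coeff ([:D x:] * Z x) (Suc d)" for x by simp
    then have "F1 x * coeff (G x) d = D x * coeff (Z x) (Suc d)" for x
      using Suc.prems(3)[of "Suc d" x] by (simp add: coeff_pCons) (metis add_0 mult_zero_right)
    then have "dvdp V D (\<lambda>x. F1 x * coeff (G x) d)"
      unfolding dvdp_def using Z(1) by (intro exI[of _ "\<lambda>x. coeff (Z x) (Suc d)"]) (auto intro: mono pf)
    then have "dvdp V D (\<lambda>x. coeff (G x) d)"
      using nz Suc.prems(1) unfolding nzd_def by (auto intro: mono pf)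
    then obtain r where r: "polyfun V r" "\<And>x. coeff (G x) d = D x * r x"
      by (auto simp: dvdp_def)
    let ?y = "\<lambda>x. y x - coeff (G x) d * x v ^ d"
    have "dvdp V D ?y"
    proof (rule Suc.IH[of "\<lambda>x. G x - monom (coeff (G x) d) d"])
      have "polyfam (V - {v}) (\<lambda>x. G x + [:- coeff (G x) d:] * monom 1 d)"
        using Suc.prems(1) by (intro pf)
      then show "polyfam (V - {v}) (\<lambda>x. G x - monom (coeff (G x) d) d)"
        by (simp add: smult_monom minus_monom[symmetric])
      show "coeff (G x - monom (coeff (G x) d) d) i = 0" if "i \<ge> d" for x i
        using Suc.prems(3)[of i x] that by (cases "i = d") auto
      show "dvdp V D (\<lambda>x. (F0 x + F1 x * x v) * (y x - coeff (G x) d * x v ^ d))"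
        unfolding dvdp_def
      proof (intro exI conjI allI)
        show "polyfun V (\<lambda>x. z x - (F0 x + F1 x * x v) * r x * x v ^ d)"
          using v by (intro pf mono[OF F0] mono[OF F1] z r)
        show "(F0 x + F1 x * x v) * (y x - coeff (G x) d * x v ^ d) =
           D x * (z x - (F0 x + F1 x * x v) * r x * x v ^ d)" for x
          unfolding right_diff_distrib z(2) r(2) by (simp add: mult_ac)
      qed
    qed (auto simp: Suc.prems(2) poly_monom)
    then obtain s where s: "polyfun V s" "\<And>x. ?y x = D x * s x"
      by (auto simp: dvdp_def)
    show ?case unfolding dvdp_def
    proof (intro exI conjI allI)
      show "polyfun V (\<lambda>x. s x + r x * x v ^ d)" using v by (intro pf s r)
      show "y x = D x * (s x + r x * x v ^ d)" for x
        using s(2)[of x] by (simp add: r(2) algebra_simps)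
    qed
  qed
  show ?thesis unfolding nzd_def
  proof (intro allI impI)
    fix y assume y: "polyfun V y" and dv: "dvdp V D (\<lambda>x. (F0 x + F1 x * x v) * y x)"
    obtain G where G: "polyfam (V - {v}) G" "\<And>x. y x = poly (G x) (x v)"
      using polyfun_expand[OF y] by blast
    obtain d where "\<And>x. degree (G x) \<le> d" using G(1) by (auto simp: polyfam_def)
    then have "\<And>x i. i \<ge> Suc d \<Longrightarrow> coeff (G x) i = 0"
      by (meson coeff_eq_0 le_imp_less_Suc not_less_eq_eq order_le_less_trans not_le)
    from key[OF G this dv] show "dvdp V D y" .
  qed
qed

text \<open>All factors \<open>F\<close> cancel modulo a single \<open>D\<close>; then the relation
  is divided by this \<open>D\<close> and the argument repeats. The division is legitimate because
  \<open>D\<close> is nonzero on a dense set.\<close>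

lemma dvdp_power_cancel:
  assumes D: "polyfun V D" "D x0 \<noteq> 0" and F: "polyfun V F" and nz: "nzd V D F"
    and y: "polyfun V y" and dv: "dvdp V (\<lambda>x. D x ^ N) (\<lambda>x. F x ^ e * y x)"
  shows "dvdp V (\<lambda>x. D x ^ N) y"
  using y dv
proof (induction N arbitrary: y)
  case 0
  then show ?case by (auto simp: dvdp_def intro!: exI[of _ y])
next
  case (Suc N)
  obtain z where z: "polyfun V z" "\<And>x. F x ^ e * y x = D x ^ Suc N * z x"
    using Suc.prems(2) by (auto simp: dvdp_def)
  have "dvdp V D y" if "polyfun V y" "dvdp V D (\<lambda>x. F x ^ e * y x)" for y
    using that
  proof (induction e arbitrary: y)
    case (Suc e)
    have "dvdp V D (\<lambda>x. F x ^ e * (F x * y x))" using Suc.prems by (simp add: mult_ac)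
    from Suc.IH[OF _ this] have "dvdp V D (\<lambda>x. F x * y x)" using Suc.prems F by (auto intro: pf)
    then show ?case using nz Suc.prems by (auto simp: nzd_def)
  qed auto
  moreover have "dvdp V D (\<lambda>x. F x ^ e * y x)"
    unfolding dvdp_def z(2) by (intro exI[of _ "\<lambda>x. D x ^ N * z x"]) (auto intro!: pf D z)
  ultimately have "dvdp V D y" using Suc.prems(1) by blast
  then obtain y' where y': "polyfun V y'" "\<And>x. y x = D x * y' x"
    by (auto simp: dvdp_def)
  have "F x ^ e * y' x - D x ^ N * z x = 0" for x
  proof (rule polyfun_dense[where p = "\<lambda>x. F x ^ e * y' x - D x ^ N * z x" and q = D and ?y0.0 = x0])
    show "F y ^ e * y' y - D y ^ N * z y = 0" if "D y \<noteq> 0" for y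
    proof -
      have "D y * (F y ^ e * y' y) = D y * (D y ^ N * z y)"
        using z(2)[of y] y'(2)[of y] by (simp add: mult_ac)
      then show ?thesis using that by simp
    qed
  qed (use D F y' z in \<open>auto intro!: pf\<close>)
  then have "dvdp V (\<lambda>x. D x ^ N) (\<lambda>x. F x ^ e * y' x)"
    unfolding dvdp_def using z(1) by (intro exI[of _ z]) auto
  from Suc.IH[OF y'(1) this] obtain w where "polyfun V w" "\<And>x. y' x = D x ^ N * w x"
    by (auto simp: dvdp_def)
  then show ?case unfolding dvdp_def by (intro exI[of _ w]) (auto simp: y')
qed

lemma mat_delete_last: "mat_delete (mat (Suc j) (Suc j) f) j j = mat j j f"
  by (auto simp: mat_delete_def)

text \<open>Expanding along the new last row and then along the new last column shows that the next
  minor is linear in one new entry, with a coefficient linear in another new entry, whose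
  coefficient in turn is \<open>L j\<close> up to sign. Two uses of \<open>nzd_linear\<close> make
  the next minor a nonzerodivisor modulo \<open>L (Suc j)\<close>; it remains to exchange the roles
  of the two minors.\<close>

lemma leading_minors_coprime:
  fixes e :: "nat \<Rightarrow> nat \<Rightarrow> 'v"
  assumes inj: "\<And>a b c d. a < k \<Longrightarrow> b < k \<Longrightarrow> c < k \<Longrightarrow> d < k \<Longrightarrow> e a b = e c d \<Longrightarrow> a = c \<and> b = d"
    and V: "\<And>a b. a < k \<Longrightarrow> b < k \<Longrightarrow> e a b \<in> V"
  defines "L \<equiv> \<lambda>j x. det (mat j j (\<lambda>(a, b). x (e a b)) :: complex mat)"
  shows "Suc j \<le> k \<Longrightarrow> nzd V (L (Suc j)) (L j)"
proof (induction j)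
  case 0
  have "L 0 x = 1" for x by (simp add: L_def)
  then show ?case by (auto simp: nzd_def)
next
  case (Suc j)
  then have k: "Suc j < k" and nz: "nzd V (L (Suc j)) (L j)" by auto
  have L: "polyfun V (L i)" if "i \<le> k" for i
    unfolding L_def using that by (auto intro!: pf V)
  define A where "A x = mat (Suc (Suc j)) (Suc (Suc j)) (\<lambda>(a, b). x (e a b) :: complex)" for x
  define B where "B x = mat_delete (A x) (Suc j) j" for x
  \<comment> \<open>Row \<open>Suc j\<close> and column \<open>Suc j\<close> lie outside the minor
    \<open>L (Suc j)\<close>, so both variables are free over it. \<open>\<rho>\<close> has the
    coefficient \<open>- det (B x)\<close> in the next minor, and \<open>\<kappa>\<close> has the
    coefficient \<open>L j\<close> in \<open>det (B x)\<close>.\<close>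
  define \<rho> where "\<rho> = e (Suc j) j"
  define \<kappa> where "\<kappa> = e j (Suc j)"
  have A: "A x \<in> carrier_mat (Suc (Suc j)) (Suc (Suc j))" for x by (simp add: A_def)
  have B: "B x \<in> carrier_mat (Suc j) (Suc j)" for x by (simp add: A_def B_def mat_delete_def)
  have cofA: "cofactor (A x) (Suc j) b = (-1) ^ (Suc j + b) *
      det (mat (Suc j) (Suc j) (\<lambda>(i, c). x (e i (if c < b then c else Suc c))))" if "b < Suc (Suc j)" for x b
    unfolding cofactor_def mat_delete_def A_def
    by (intro arg_cong2[of _ _ _ _ "(*)"] refl arg_cong[of _ _ det] eq_matI) auto
  have cofB: "cofactor (B x) a j = (-1) ^ (a + j) *
      det (mat j j (\<lambda>(i, c). x (e (if i < a then i else Suc i) c)))" if "a < Suc j" for x a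
    unfolding cofactor_def mat_delete_def B_def A_def
    by (intro arg_cong2[of _ _ _ _ "(*)"] refl arg_cong[of _ _ det] eq_matI) auto
  have detA: "L (Suc (Suc j)) x = (\<Sum>b<j. x (e (Suc j) b) * cofactor (A x) (Suc j) b)
      + x \<rho> * (- det (B x)) + x (e (Suc j) (Suc j)) * L (Suc j) x" for x
  proof -
    have "det (A x) = (\<Sum>b<Suc (Suc j). A x $$ (Suc j, b) * cofactor (A x) (Suc j) b)"
      using laplace_expansion_row[OF A] by simp
    also have "\<dots> = (\<Sum>b<j. A x $$ (Suc j, b) * cofactor (A x) (Suc j) b) +
        A x $$ (Suc j, j) * cofactor (A x) (Suc j) j + A x $$ (Suc j, Suc j) * cofactor (A x) (Suc j) (Suc j)"
      by simp
    also have "cofactor (A x) (Suc j) j = - det (B x)" by (simp add: cofactor_def B_def)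
    also have "cofactor (A x) (Suc j) (Suc j) = L (Suc j) x"
      by (simp add: cofactor_def A_def L_def mat_delete_last)
    finally show ?thesis by (simp add: A_def L_def \<rho>_def)
  qed
  have detB: "det (B x) = (\<Sum>a<j. x (e a (Suc j)) * cofactor (B x) a j) + x \<kappa> * L j x" for x
  proof -
    have Bij: "B x $$ (a, j) = x (e a (Suc j))" if "a < Suc j" for a
      using that by (simp add: B_def A_def mat_delete_def)
    have "det (B x) = (\<Sum>a<Suc j. B x $$ (a, j) * cofactor (B x) a j)"
      using laplace_expansion_column[OF B] by simp
    also have "\<dots> = (\<Sum>a<j. x (e a (Suc j)) * cofactor (B x) a j) + x \<kappa> * cofactor (B x) j j"
      by (simp add: Bij \<kappa>_def)
    also have "cofactor (B x) j j = L j x"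
      unfolding cofB[OF lessI] L_def
      by (auto intro!: arg_cong[of _ _ det] eq_matI)
    finally show ?thesis .
  qed
  define F1 where "F1 x = - det (B x)" for x
  define F0 where "F0 x = (\<Sum>b<j. x (e (Suc j) b) * cofactor (A x) (Suc j) b)" for x
  have ne: "e a b \<in> V - {e c d}" if "a < k" "b < k" "c < k" "d < k" "a \<noteq> c \<or> b \<noteq> d" for a b c d
    using that inj V by blast
  have "nzd V (L (Suc j)) (\<lambda>x. (- (\<Sum>a<j. x (e a (Suc j)) * cofactor (B x) a j)) + (- L j x) * x \<kappa>)"
  proof (rule nzd_linear)
    show "polyfun (V - {\<kappa>}) (L (Suc j))" "polyfun (V - {\<kappa>}) (\<lambda>x. - L j x)"
      unfolding L_def \<kappa>_def by (intro pf ne; use k in simp)+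
    show "polyfun (V - {\<kappa>}) (\<lambda>x. - (\<Sum>a<j. x (e a (Suc j)) * cofactor (B x) a j))"
      unfolding \<kappa>_def by (simp add: cofB cong: sum.cong_simp, intro pf ne; use k in simp)
    show "\<kappa> \<in> V" unfolding \<kappa>_def using k by (auto intro: V)
    show "nzd V (L (Suc j)) (\<lambda>x. - L j x)"
      unfolding nzd_def
    proof (intro allI impI)
      fix y assume y: "polyfun V y" "dvdp V (L (Suc j)) (\<lambda>x. - L j x * y x)"
      then obtain z where z: "polyfun V z" "\<And>x. - L j x * y x = L (Suc j) x * z x" by (auto simp: dvdp_def)
      then have "L j x * y x = L (Suc j) x * (- z x)" for x by (metis minus_mult_left minus_mult_right minus_minus)
      then have "dvdp V (L (Suc j)) (\<lambda>x. L j x * y x)"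
        unfolding dvdp_def using z(1) by (intro exI[of _ "\<lambda>x. - z x"]) (auto intro: pf)
      then show "dvdp V (L (Suc j)) y" using nz y(1) by (simp add: nzd_def)
    qed
  qed
  then have nzF1: "nzd V (L (Suc j)) F1"
    by (simp add: F1_def[abs_def] detB mult.commute)
  have "nzd V (L (Suc j)) (\<lambda>x. F0 x + F1 x * x \<rho>)"
  proof (rule nzd_linear[OF _ _ _ _ nzF1])
    show "polyfun (V - {\<rho>}) (L (Suc j))"
      unfolding L_def \<rho>_def by (intro pf ne; use k in simp)+
    show "polyfun (V - {\<rho>}) F0"
      unfolding F0_def[abs_def] \<rho>_def by (simp add: cofA cong: sum.cong_simp, intro pf ne; use k in simp)
    show "polyfun (V - {\<rho>}) F1"
      unfolding F1_def[abs_def] detB \<rho>_def \<kappa>_def L_def by (simp add: cofB cong: sum.cong_simp, intro pf ne; use k in simp)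
    show "\<rho> \<in> V" unfolding \<rho>_def using k by (auto intro: V)
  qed
  then have nzb: "dvdp V (L (Suc j)) y" if "polyfun V y" "dvdp V (L (Suc j)) (\<lambda>x. (F0 x + F1 x * x \<rho>) * y x)" for y
    using that by (auto simp: nzd_def)
  show ?case unfolding nzd_def
  proof (intro allI impI)
    fix y assume y: "polyfun V y" "dvdp V (L (Suc (Suc j))) (\<lambda>x. L (Suc j) x * y x)"
    then obtain z where z: "polyfun V z" "\<And>x. L (Suc j) x * y x = L (Suc (Suc j)) x * z x"
      by (auto simp: dvdp_def)
    \<comment> \<open>Modulo \<open>L (Suc j)\<close> the corner entry drops out of the next minor,
      which leaves \<open>F0 + F1 \<rho>\<close>. So the known cancellation applies to
      \<open>z\<close>, and a factor \<open>L (Suc j)\<close> can be removed from both sides of the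
      relation.\<close>
    have "dvdp V (L (Suc j)) (\<lambda>x. (F0 x + F1 x * x \<rho>) * z x)"
      unfolding dvdp_def
    proof (intro exI conjI allI)
      show "polyfun V (\<lambda>x. y x - x (e (Suc j) (Suc j)) * z x)"
        using k by (intro pf y z V)
      show "(F0 x + F1 x * x \<rho>) * z x = L (Suc j) x * (y x - x (e (Suc j) (Suc j)) * z x)" for x
        using z(2)[of x] unfolding detA by (simp add: F0_def F1_def algebra_simps)
    qed
    from nzb[OF z(1) this] obtain w where w: "polyfun V w" "\<And>x. z x = L (Suc j) x * w x"
      by (auto simp: dvdp_def)
    define x0 :: "'v \<Rightarrow> complex" where "x0 v = (if \<exists>a<k. v = e a a then 1 else 0)" for v
    have x0: "L (Suc j) x0 \<noteq> 0"
    proof -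
      have "mat (Suc j) (Suc j) (\<lambda>(a, b). x0 (e a b)) = 1\<^sub>m (Suc j)"
      proof (intro eq_matI)
        fix a b assume "a < dim_row (1\<^sub>m (Suc j) :: complex mat)" "b < dim_col (1\<^sub>m (Suc j) :: complex mat)"
        then have ab: "a < Suc j" "b < Suc j" "a < k" "b < k" using k by auto
        then have "(\<exists>c<k. e a b = e c c) \<longleftrightarrow> a = b" using inj by blast
        then show "mat (Suc j) (Suc j) (\<lambda>(a, b). x0 (e a b)) $$ (a, b) = 1\<^sub>m (Suc j) $$ (a, b)"
          using ab by (simp add: x0_def)
      qed auto
      then show ?thesis by (simp add: L_def)
    qed
    have "y x - L (Suc (Suc j)) x * w x = 0" for x
    proof (rule polyfun_dense[where p = "\<lambda>x. y x - L (Suc (Suc j)) x * w x" and q = "L (Suc j)" and ?y0.0 = x0])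
      show "y x - L (Suc (Suc j)) x * w x = 0" if "L (Suc j) x \<noteq> 0" for x
      proof -
        have "L (Suc j) x * y x = L (Suc j) x * (L (Suc (Suc j)) x * w x)"
          using z(2)[of x] w(2)[of x] by (simp add: mult_ac)
        then show ?thesis using that by simp
      qed
    qed (use k x0 y w L in \<open>auto intro!: pf\<close>)
    then show "dvdp V (L (Suc (Suc j))) y"
      unfolding dvdp_def using w(1) by (intro exI[of _ w]) auto
  qed
qed

section \<open>The coadjoint action in matrix form\<close>

text \<open>A point of \<open>q\<^sup>*\<close> is represented by a triple \<open>(a, u, w)\<close> of matrices of sizes
  \<open>n \<times> n\<close>, \<open>n \<times> k\<close>, \<open>k \<times> n\<close>, where \<open>a\<close> only matters modulo scalar matrices. The group acts by
  \<open>(g a g\<^sup>-\<^sup>1, g u, w g\<^sup>-\<^sup>1)\<close> and \<open>(a + u b + c w, u, w)\<close>.\<close>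

type_synonym triple = "complex mat \<times> complex mat \<times> complex mat"

definition carr :: "nat \<Rightarrow> nat \<Rightarrow> triple set" where
  "carr n k = carrier_mat n n \<times> carrier_mat n k \<times> carrier_mat k n"

text \<open>The pairing with the Lie algebra is entrywise, the sum of all \<open>a_ij X_ij\<close>,
  so that coordinates are plain matrix entries. The price is that a Lie algebra element acts on
  triples through its transpose, see \<open>Yof\<close>.\<close>

fun tproj :: "triple \<Rightarrow> qidx \<Rightarrow> complex" where
  "tproj (a, u, w) (E i j) = a $$ (i, j)"
| "tproj (a, u, w) (H t) = a $$ (t, t) - a $$ (t + 1, t + 1)"
| "tproj (a, u, w) (U c i) = u $$ (i, c)"
| "tproj (a, u, w) (W c i) = w $$ (c, i)"

definition proj :: "nat \<Rightarrow> nat \<Rightarrow> triple \<Rightarrow> qidx \<Rightarrow> complex" where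
  "proj n k T l = (if l \<in> qbasis n k then tproj T l else 0)"

definition Tof :: "nat \<Rightarrow> nat \<Rightarrow> (qidx \<Rightarrow> complex) \<Rightarrow> triple" where
  "Tof n k y = (mat n n (\<lambda>(i, j). y (E i j)), mat n k (\<lambda>(i, c). y (U c i)), mat k n (\<lambda>(c, i). y (W c i)))"

text \<open>A polynomial right inverse of the projection to coordinates. The \<open>H\<close>
  coordinates are differences of neighbouring diagonal entries; summing them from the bottom picks
  the representative whose last diagonal entry is 0. The index \<open>E i i\<close>, which is no
  basis element, serves as the name of a diagonal entry.\<close>

definition lift :: "nat \<Rightarrow> nat \<Rightarrow> (qidx \<Rightarrow> complex) \<Rightarrow> qidx \<Rightarrow> complex" where
  "lift n k x v = (case v of E i j \<Rightarrow> if i = j then (\<Sum>t\<in>{i..<n - 1}. x (H t)) else if v \<in> qbasis n k then x v else 0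
     | _ \<Rightarrow> if v \<in> qbasis n k then x v else 0)"

lemma Tof_carr [simp]: "Tof n k y \<in> carr n k"
  by (simp add: Tof_def carr_def)

lemma Tof_surj:
  assumes "T \<in> carr n k"
  obtains y where "T = Tof n k y"
proof -
  obtain a u w where T: "T = (a, u, w)" by (cases T)
  have "T = Tof n k (\<lambda>v. case v of E i j \<Rightarrow> a $$ (i, j) | U c i \<Rightarrow> u $$ (i, c) | W c i \<Rightarrow> w $$ (c, i) | H t \<Rightarrow> 0)"
    using assms by (auto simp: T Tof_def carr_def intro!: eq_matI)
  then show ?thesis by (rule that)
qed

lemma qbasis_mem [simp]:
  "E i j \<in> qbasis n k \<longleftrightarrow> i < n \<and> j < n \<and> i \<noteq> j"
  "H t \<in> qbasis n k \<longleftrightarrow> t + 1 < n"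
  "U c i \<in> qbasis n k \<longleftrightarrow> c < k \<and> i < n"
  "W c i \<in> qbasis n k \<longleftrightarrow> c < k \<and> i < n"
  by (auto simp: qbasis_def)

lemma qbasis_eq:
  "qbasis n k = (\<lambda>(i, j). E i j) ` {(i, j) \<in> {..<n} \<times> {..<n}. i \<noteq> j} \<union> H ` {..<n - 1}
     \<union> (\<lambda>(c, i). U c i) ` ({..<k} \<times> {..<n}) \<union> (\<lambda>(c, i). W c i) ` ({..<k} \<times> {..<n})"
  by (auto simp: qbasis_def)

lemma finite_qbasis [simp]: "finite (qbasis n k)"
  unfolding qbasis_eq by (auto intro: finite_subset[of _ "{..<n} \<times> {..<n}"])

lemma sum_qbasis:
  fixes f :: "qidx \<Rightarrow> 'a :: comm_monoid_add"
  shows "(\<Sum>l\<in>qbasis n k. f l) = (\<Sum>i<n. \<Sum>j<n. if i \<noteq> j then f (E i j) else 0) + (\<Sum>t<n - 1. f (H t))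
     + (\<Sum>c<k. \<Sum>i<n. f (U c i)) + (\<Sum>c<k. \<Sum>i<n. f (W c i))"
proof -
  let ?Es = "{(i, j) \<in> {..<n} \<times> {..<n}. i \<noteq> j}"
  have fin: "finite ?Es" by (rule finite_subset[of _ "{..<n} \<times> {..<n}"]) auto
  have "(\<Sum>l\<in>qbasis n k. f l) = (\<Sum>l\<in>(\<lambda>(i, j). E i j) ` ?Es. f l) + (\<Sum>l\<in>H ` {..<n - 1}. f l)
     + (\<Sum>l\<in>(\<lambda>(c, i). U c i) ` ({..<k} \<times> {..<n}). f l) + (\<Sum>l\<in>(\<lambda>(c, i). W c i) ` ({..<k} \<times> {..<n}). f l)"
    unfolding qbasis_eq using fin
    by (subst sum.union_disjoint; (auto; fail)?)+
  also have "(\<Sum>l\<in>(\<lambda>(i, j). E i j) ` ?Es. f l) = (\<Sum>(i, j)\<in>?Es. f (E i j))"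
    by (subst sum.reindex) (auto simp: inj_on_def case_prod_unfold)
  also have "\<dots> = (\<Sum>(i, j)\<in>{..<n} \<times> {..<n}. if i \<noteq> j then f (E i j) else 0)"
    by (rule sum.mono_neutral_cong_left) (auto split: if_splits)
  also have "\<dots> = (\<Sum>i<n. \<Sum>j<n. if i \<noteq> j then f (E i j) else 0)"
    by (subst sum.cartesian_product) simp
  also have "(\<Sum>l\<in>H ` {..<n - 1}. f l) = (\<Sum>t<n - 1. f (H t))"
    by (subst sum.reindex) (auto simp: inj_on_def)
  also have "(\<Sum>l\<in>(\<lambda>(c, i). U c i) ` ({..<k} \<times> {..<n}). f l) = (\<Sum>c<k. \<Sum>i<n. f (U c i))"
    by (subst sum.reindex, force simp: inj_on_def)
       (subst sum.cartesian_product, simp add: case_prod_unfold)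
  also have "(\<Sum>l\<in>(\<lambda>(c, i). W c i) ` ({..<k} \<times> {..<n}). f l) = (\<Sum>c<k. \<Sum>i<n. f (W c i))"
    by (subst sum.reindex, force simp: inj_on_def)
       (subst sum.cartesian_product, simp add: case_prod_unfold)
  finally show ?thesis .
qed

lemma mult_mat_entry:
  assumes "A \<in> carrier_mat n m" "B \<in> carrier_mat m p" "i < n" "j < p"
  shows "(A * B) $$ (i, j) = (\<Sum>l<m. A $$ (i, l) * B $$ (l, j))"
  using assms by (auto simp: scalar_prod_def lessThan_atLeast0)

definition qpair :: "nat \<Rightarrow> nat \<Rightarrow> triple \<Rightarrow> qelt \<Rightarrow> complex" where
  "qpair n k T \<xi> = (case T of (a, u, w) \<Rightarrow> case \<xi> of (X, Y, Z) \<Rightarrow>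
     (\<Sum>i<n. \<Sum>j<n. a $$ (i, j) * X i j) + (\<Sum>c<k. \<Sum>i<n. u $$ (i, c) * Y c i) + (\<Sum>c<k. \<Sum>i<n. w $$ (c, i) * Z c i))"

text \<open>Summation by parts. The coordinate at \<open>H t\<close> is a partial sum of the
  diagonal, while the functional at \<open>H t\<close> is a difference of diagonal entries; together
  they give the diagonal part of the pairing.\<close>

lemma abel_sum:
  fixes d a :: "nat \<Rightarrow> complex"
  shows "(\<Sum>t<m. (\<Sum>s\<le>t. d s) * (a t - a (t + 1))) = (\<Sum>i\<le>m. d i * a i) - (\<Sum>s\<le>m. d s) * a m"
  by (induction m) (auto simp: algebra_simps)

lemma sum_delta2:
  fixes g :: "nat \<Rightarrow> nat \<Rightarrow> complex"
  assumes "p < n" "q < m"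
  shows "(\<Sum>i<n. \<Sum>j<m. g i j * (if i = p \<and> j = q then 1 else 0)) = g p q"
proof -
  have "(\<Sum>i<n. \<Sum>j<m. g i j * (if i = p \<and> j = q then 1 else 0)) = (\<Sum>i<n. if i = p then g i q else 0)"
    by (rule sum.cong[OF refl]) (use assms in \<open>auto simp: if_distrib cong: if_cong\<close>)
  then show ?thesis using assms by simp
qed

lemma qpair_belt:
  assumes "l \<in> qbasis n k"
  shows "qpair n k T (belt l) = tproj T l"
proof (cases T)
  case (fields a u w)
  show ?thesis
  proof (cases l)
    case (H t)
    have "(\<Sum>i<n. \<Sum>j<n. a $$ (i, j) * (if i = j \<and> i = t then 1 else if i = j \<and> i = t + 1 then - 1 else 0)) =
      (\<Sum>i<n. \<Sum>j<n. a $$ (i, j) * (if i = t \<and> j = t then 1 else 0)) -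
      (\<Sum>i<n. \<Sum>j<n. a $$ (i, j) * (if i = t + 1 \<and> j = t + 1 then 1 else 0))"
      unfolding sum_subtractf[symmetric] by (intro sum.cong) auto
    also have "\<dots> = a $$ (t, t) - a $$ (t + 1, t + 1)"
      using assms H by (subst (1 2) sum_delta2) auto
    finally show ?thesis by (simp add: fields H qpair_def)
  qed (use assms in \<open>simp_all add: fields qpair_def sum_delta2[of _ _ _ _ "\<lambda>i j. _ $$ (j, i)"] sum_delta2\<close>)
qed

lemma coord_expand:
  assumes "(\<Sum>i<n. X i i) = 0"
  shows "(\<Sum>l\<in>qbasis n k. coord l (X, Y, Z) * proj n k T l) = qpair n k T (X, Y, Z)"
proof (cases T)
  case (fields a u w)
  have off: "(\<Sum>i<n. \<Sum>j<n. if i \<noteq> j then X i j * a $$ (i, j) else 0) + (\<Sum>t<n - 1. (\<Sum>s\<le>t. X s s) * (a $$ (t, t) - a $$ (t + 1, t + 1)))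
     = (\<Sum>i<n. \<Sum>j<n. a $$ (i, j) * X i j)"
  proof (cases n)
    case (Suc m)
    have "(\<Sum>t<n - 1. (\<Sum>s\<le>t. X s s) * (a $$ (t, t) - a $$ (t + 1, t + 1))) = (\<Sum>i<n. X i i * a $$ (i, i))"
      using abel_sum[of "\<lambda>s. X s s" "\<lambda>t. a $$ (t, t)" m] assms by (simp add: Suc lessThan_Suc_atMost)
    also have "\<dots> = (\<Sum>i<n. \<Sum>j<n. if i = j then X i j * a $$ (i, j) else 0)"
      by (intro sum.cong) auto
    finally show ?thesis
      by (simp only: sum.distrib[symmetric], intro sum.cong refl) auto
  qed auto
  have "(\<Sum>l\<in>qbasis n k. coord l (X, Y, Z) * proj n k T l) = (\<Sum>l\<in>qbasis n k. coord l (X, Y, Z) * tproj T l)"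
    by (rule sum.cong) (auto simp: proj_def)
  also have "\<dots> = qpair n k T (X, Y, Z)"
    unfolding sum_qbasis fields coord.simps tproj.simps qpair_def prod.case using off by (simp add: mult.commute)
  finally show ?thesis .
qed

lemma qbr_traceless: "(\<Sum>i<n. fst (qbr n \<xi> \<eta>) i i) = 0"
proof -
  obtain X Y Z X' Y' Z' where *: "\<xi> = (X, Y, Z)" "\<eta> = (X', Y', Z')" by (metis prod_cases3)
  have "(\<Sum>i<n. \<Sum>l<n. X i l * X' l i - X' i l * X l i) =
      (\<Sum>i<n. \<Sum>l<n. X i l * X' l i) - (\<Sum>i<n. \<Sum>l<n. X' i l * X l i)"
    by (simp add: sum_subtractf)
  also have "(\<Sum>i<n. \<Sum>l<n. X' i l * X l i) = (\<Sum>i<n. \<Sum>l<n. X i l * X' l i)"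
    by (subst sum.swap) (simp add: mult.commute)
  finally show ?thesis by (simp add: * qbr_def)
qed

lemma meval_brpoly:
  "meval (brpoly n k i j) (proj n k T) = qpair n k T (qbr n (belt i) (belt j))"
proof -
  obtain X Y Z where *: "qbr n (belt i) (belt j) = (X, Y, Z)" by (metis prod_cases3)
  have "(\<Sum>i<n. X i i) = 0" using qbr_traceless[of n "belt i" "belt j"] by (simp add: *)
  from coord_expand[where X = X, OF this, where k = k and Y = Y and Z = Z and T = T] show ?thesis by (simp add: brpoly_def *)
qed

text \<open>The differential of the coadjoint action, in the directions \<open>1 + Y\<close>, \<open>b\<close>, \<open>c\<close>.\<close>

fun dact :: "triple \<Rightarrow> triple \<Rightarrow> triple" where
  "dact (a, u, w) (Y, b, c) = (Y * a - a * Y + (u * b + c * w), Y * u, - (w * Y))"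

text \<open>The value of \<open>T\<close> on the bracket, sorted by the entries of
  \<open>\<xi>\<close>. The bracket and the differential of the action are both brought to this
  shape in order to be compared.\<close>

definition lin :: "nat \<Rightarrow> nat \<Rightarrow> triple \<Rightarrow> qelt \<Rightarrow> qelt \<Rightarrow> complex" where
  "lin n k T \<xi> \<eta> = (case T of (a, u, w) \<Rightarrow> case \<xi> of (X, Y, Z) \<Rightarrow> case \<eta> of (X', Y', Z') \<Rightarrow>
     (\<Sum>p<n. \<Sum>q<n. X p q * ((\<Sum>j<n. a $$ (p, j) * X' q j) - (\<Sum>i<n. a $$ (i, q) * X' i p)
        + (\<Sum>c<k. u $$ (p, c) * Y' c q) - (\<Sum>c<k. w $$ (c, q) * Z' c p)))
     + (\<Sum>c<k. \<Sum>p<n. Y c p * (- (\<Sum>i<n. u $$ (i, c) * X' i p)))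
     + (\<Sum>c<k. \<Sum>p<n. Z c p * (\<Sum>j<n. w $$ (c, j) * X' p j)))"

lemma sum3_rotate:
  fixes f :: "'a \<Rightarrow> 'b \<Rightarrow> 'c \<Rightarrow> complex"
  shows "(\<Sum>i\<in>A. \<Sum>j\<in>B. \<Sum>l\<in>C. f i j l) = (\<Sum>l\<in>C. \<Sum>j\<in>B. \<Sum>i\<in>A. f i j l)"
  by (subst sum.swap, subst (2) sum.swap, rule sum.swap)

lemma sum3_cyc:
  fixes f :: "'a \<Rightarrow> 'b \<Rightarrow> 'c \<Rightarrow> complex"
  shows "(\<Sum>i\<in>A. \<Sum>j\<in>B. \<Sum>l\<in>C. f i j l) = (\<Sum>j\<in>B. \<Sum>l\<in>C. \<Sum>i\<in>A. f i j l)"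
  by (subst sum.swap) (rule sum.cong[OF refl], rule sum.swap)

lemma qpair_qbr: "qpair n k T (qbr n \<xi> \<eta>) = lin n k T \<xi> \<eta>"
proof -
  obtain X Y Z X' Y' Z' a u w where *: "\<xi> = (X, Y, Z)" "\<eta> = (X', Y', Z')" "T = (a, u, w)" by (metis prod_cases3)
  have t1: "(\<Sum>i<n. \<Sum>j<n. \<Sum>l<n. a $$ (i, j) * (X i l * X' l j)) = (\<Sum>p<n. \<Sum>q<n. \<Sum>j<n. X p q * (a $$ (p, j) * X' q j))"
    by (rule sum.cong[OF refl], subst sum.swap) (simp only: mult_ac)
  have t2: "(\<Sum>i<n. \<Sum>j<n. \<Sum>l<n. a $$ (i, j) * (X' i l * X l j)) = (\<Sum>p<n. \<Sum>q<n. \<Sum>i<n. X p q * (a $$ (i, q) * X' i p))"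
    by (subst sum3_rotate) (simp only: mult_ac)
  have t3: "(\<Sum>c<k. \<Sum>i<n. \<Sum>l<n. u $$ (i, c) * (X i l * Y' c l)) = (\<Sum>p<n. \<Sum>q<n. \<Sum>c<k. X p q * (u $$ (p, c) * Y' c q))"
    by (subst sum3_cyc) (simp only: mult_ac)
  have t4: "(\<Sum>c<k. \<Sum>i<n. \<Sum>l<n. u $$ (i, c) * (X' i l * Y c l)) = (\<Sum>c<k. \<Sum>p<n. \<Sum>i<n. Y c p * (u $$ (i, c) * X' i p))"
    by (rule sum.cong[OF refl], subst sum.swap) (simp only: mult_ac)
  have t5: "(\<Sum>c<k. \<Sum>j<n. \<Sum>l<n. w $$ (c, j) * (Z c l * X' l j)) = (\<Sum>c<k. \<Sum>p<n. \<Sum>j<n. Z c p * (w $$ (c, j) * X' p j))"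
    by (rule sum.cong[OF refl], subst sum.swap) (simp only: mult_ac)
  have t6: "(\<Sum>c<k. \<Sum>j<n. \<Sum>l<n. w $$ (c, j) * (Z' c l * X l j)) = (\<Sum>p<n. \<Sum>q<n. \<Sum>c<k. X p q * (w $$ (c, q) * Z' c p))"
    by (subst sum3_rotate) (simp only: mult_ac)
  show ?thesis
    unfolding * qpair_def qbr_def lin_def prod.case
    by (simp only: sum_distrib_left right_diff_distrib distrib_left sum_subtractf sum.distrib mult_minus_right
        sum_negf t1 t2 t3 t4 t5 t6) simp
qed

lemma qpair_dact:
  assumes T: "T \<in> carr n k" and Y: "Y \<in> carrier_mat n n" "b \<in> carrier_mat k n" "c \<in> carrier_mat n k"
  shows "qpair n k (dact T (Y, b, c)) \<eta> =
    lin n k T ((\<lambda>i j. Y $$ (j, i)), (\<lambda>d i. - b $$ (d, i)), (\<lambda>d i. c $$ (i, d))) \<eta>"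
proof -
  obtain X' Y' Z' a u w where *: "\<eta> = (X', Y', Z')" "T = (a, u, w)" by (metis prod_cases3)
  have auw: "a \<in> carrier_mat n n" "u \<in> carrier_mat n k" "w \<in> carrier_mat k n"
    using T by (auto simp: * carr_def)
  have e1: "(Y * a - a * Y + (u * b + c * w)) $$ (i, j) = (\<Sum>l<n. Y $$ (i, l) * a $$ (l, j)) - (\<Sum>l<n. a $$ (i, l) * Y $$ (l, j))
      + (\<Sum>d<k. u $$ (i, d) * b $$ (d, j)) + (\<Sum>d<k. c $$ (i, d) * w $$ (d, j))" if "i < n" "j < n" for i j
    using that auw Y by (simp add: mult_mat_entry[of _ n n _ n] mult_mat_entry[of _ n k _ n] del: index_mult_mat(1))
  have e2: "(Y * u) $$ (i, d) = (\<Sum>l<n. Y $$ (i, l) * u $$ (l, d))" if "i < n" "d < k" for i d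
    using that auw Y by (simp add: mult_mat_entry[of _ n n _ k] del: index_mult_mat(1))
  have e3: "(- (w * Y)) $$ (d, i) = - (\<Sum>l<n. w $$ (d, l) * Y $$ (l, i))" if "i < n" "d < k" for i d
    using that auw Y by (simp add: mult_mat_entry[of _ k n _ n] del: index_mult_mat(1))
  have "qpair n k (dact T (Y, b, c)) \<eta> =
     (\<Sum>i<n. \<Sum>j<n. ((\<Sum>l<n. Y $$ (i, l) * a $$ (l, j)) - (\<Sum>l<n. a $$ (i, l) * Y $$ (l, j))
      + (\<Sum>d<k. u $$ (i, d) * b $$ (d, j)) + (\<Sum>d<k. c $$ (i, d) * w $$ (d, j))) * X' i j)
     + (\<Sum>d<k. \<Sum>i<n. (\<Sum>l<n. Y $$ (i, l) * u $$ (l, d)) * Y' d i)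
     + (\<Sum>d<k. \<Sum>i<n. (- (\<Sum>l<n. w $$ (d, l) * Y $$ (l, i))) * Z' d i)"
    unfolding * qpair_def dact.simps prod.case
    by (intro arg_cong2[of _ _ _ _ "(+)"] sum.cong refl) (auto simp: e1 e2 e3 simp del: index_mult_mat index_add_mat index_minus_mat index_uminus_mat)
  also have "\<dots> = lin n k T ((\<lambda>i j. Y $$ (j, i)), (\<lambda>d i. - b $$ (d, i)), (\<lambda>d i. c $$ (i, d))) \<eta>"
  proof -
    have t1: "(\<Sum>i<n. \<Sum>j<n. \<Sum>l<n. Y $$ (i, l) * a $$ (l, j) * X' i j) = (\<Sum>p<n. \<Sum>q<n. \<Sum>j<n. Y $$ (q, p) * (a $$ (p, j) * X' q j))"
      by (subst sum.swap, subst (2) sum.swap, subst sum3_rotate, subst sum3_cyc, subst sum3_rotate) (simp only: mult_ac)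
    have t2: "(\<Sum>i<n. \<Sum>j<n. \<Sum>l<n. a $$ (i, l) * Y $$ (l, j) * X' i j) = (\<Sum>p<n. \<Sum>q<n. \<Sum>i<n. Y $$ (q, p) * (a $$ (i, q) * X' i p))"
      by (subst sum3_cyc) (simp only: mult_ac)
    have t3: "(\<Sum>i<n. \<Sum>j<n. \<Sum>d<k. u $$ (i, d) * b $$ (d, j) * X' i j) = (\<Sum>d<k. \<Sum>p<n. \<Sum>i<n. b $$ (d, p) * (u $$ (i, d) * X' i p))"
      by (subst sum3_rotate) (simp only: mult_ac)
    have t4: "(\<Sum>i<n. \<Sum>j<n. \<Sum>d<k. c $$ (i, d) * w $$ (d, j) * X' i j) = (\<Sum>d<k. \<Sum>p<n. \<Sum>j<n. c $$ (p, d) * (w $$ (d, j) * X' p j))"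
      by (subst sum3_rotate, rule sum.cong[OF refl], rule trans[OF sum.swap]) (simp only: mult_ac)
    have t5: "(\<Sum>d<k. \<Sum>i<n. \<Sum>l<n. Y $$ (i, l) * u $$ (l, d) * Y' d i) = (\<Sum>p<n. \<Sum>q<n. \<Sum>d<k. Y $$ (q, p) * (u $$ (p, d) * Y' d q))"
      by (subst sum3_rotate) (simp only: mult_ac)
    have t6: "(\<Sum>d<k. \<Sum>i<n. \<Sum>l<n. w $$ (d, l) * Y $$ (l, i) * Z' d i) = (\<Sum>p<n. \<Sum>q<n. \<Sum>d<k. Y $$ (q, p) * (w $$ (d, q) * Z' d p))"
      by (subst sum3_cyc) (simp only: mult_ac)
    show ?thesis
      unfolding * lin_def prod.case
      by (simp only: sum_distrib_left sum_distrib_right left_diff_distrib distrib_right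
        right_diff_distrib distrib_left sum_subtractf sum.distrib mult_minus_right mult_minus_left
        sum_negf t1 t2 t3 t4 t5 t6) simp
  qed
  finally show ?thesis .
qed

text \<open>Off the diagonal the coordinates appear transposed because of the entrywise pairing. On
  it, \<open>H i\<close> contributes 1 at place \<open>i\<close> and -1 at place
  \<open>i + 1\<close>; the two guards cut off the ends of the chain.\<close>

definition Yof :: "nat \<Rightarrow> (qidx \<Rightarrow> complex) \<Rightarrow> complex mat" where
  "Yof n x = mat n n (\<lambda>(i, j). if i = j then (if i + 1 < n then x (H i) else 0) - (if 0 < i then x (H (i - 1)) else 0)
      else x (E j i))"

definition bof :: "nat \<Rightarrow> nat \<Rightarrow> (qidx \<Rightarrow> complex) \<Rightarrow> complex mat" where
  "bof n k x = mat k n (\<lambda>(c, i). - x (U c i))"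

definition cof :: "nat \<Rightarrow> nat \<Rightarrow> (qidx \<Rightarrow> complex) \<Rightarrow> complex mat" where
  "cof n k x = mat n k (\<lambda>(i, c). x (W c i))"

lemma Yof_carrier [simp]: "Yof n x \<in> carrier_mat n n" "bof n k x \<in> carrier_mat k n" "cof n k x \<in> carrier_mat n k"
  by (auto simp: Yof_def bof_def cof_def)

lemma lin_belt_sum:
  "(\<Sum>i\<in>qbasis n k. x i * lin n k T (belt i) \<eta>) =
    lin n k T ((\<lambda>i j. Yof n x $$ (j, i)), (\<lambda>d i. - bof n k x $$ (d, i)), (\<lambda>d i. cof n k x $$ (i, d))) \<eta>"
proof -
  obtain X' Y' Z' a u w where *: "\<eta> = (X', Y', Z')" "T = (a, u, w)" by (metis prod_cases3)
  define \<alpha> where "\<alpha> p q = (\<Sum>j<n. a $$ (p, j) * X' q j) - (\<Sum>i<n. a $$ (i, q) * X' i p)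
        + (\<Sum>c<k. u $$ (p, c) * Y' c q) - (\<Sum>c<k. w $$ (c, q) * Z' c p)" for p q
  define \<beta> where "\<beta> c p = - (\<Sum>i<n. u $$ (i, c) * X' i p)" for c p
  define \<gamma> where "\<gamma> c p = (\<Sum>j<n. w $$ (c, j) * X' p j)" for c p
  have lin: "lin n k T (X, Y, Z) \<eta> = (\<Sum>p<n. \<Sum>q<n. \<alpha> p q * X p q) + (\<Sum>c<k. \<Sum>p<n. \<beta> c p * Y c p) + (\<Sum>c<k. \<Sum>p<n. \<gamma> c p * Z c p)" for X Y Z
    by (simp only: * lin_def prod.case \<alpha>_def \<beta>_def \<gamma>_def mult.commute)
  have lE: "lin n k T (belt (E i j)) \<eta> = \<alpha> i j" if "i < n" "j < n" for i j
    using that by (simp add: lin sum_delta2)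
  have lH: "lin n k T (belt (H t)) \<eta> = \<alpha> t t - \<alpha> (t + 1) (t + 1)" if "t + 1 < n" for t
  proof -
    have "(\<Sum>i<n. \<Sum>j<n. \<alpha> i j * (if i = j \<and> i = t then 1 else if i = j \<and> i = t + 1 then - 1 else 0)) =
      (\<Sum>i<n. \<Sum>j<n. \<alpha> i j * (if i = t \<and> j = t then 1 else 0)) -
      (\<Sum>i<n. \<Sum>j<n. \<alpha> i j * (if i = t + 1 \<and> j = t + 1 then 1 else 0))"
      unfolding sum_subtractf[symmetric] by (intro sum.cong) auto
    also have "\<dots> = \<alpha> t t - \<alpha> (t + 1) (t + 1)"
      using that by (subst (1 2) sum_delta2) auto
    finally show ?thesis by (simp add: lin)
  qed
  have lU: "lin n k T (belt (U c i)) \<eta> = \<beta> c i" if "i < n" "c < k" for c i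
    using that by (simp add: lin sum_delta2)
  have lW: "lin n k T (belt (W c i)) \<eta> = \<gamma> c i" if "i < n" "c < k" for c i
    using that by (simp add: lin sum_delta2)
  have diag: "(\<Sum>t<n - 1. x (H t) * (\<alpha> t t - \<alpha> (t + 1) (t + 1))) =
      (\<Sum>p<n. \<alpha> p p * ((if p + 1 < n then x (H p) else 0) - (if 0 < p then x (H (p - 1)) else 0)))"
  proof (cases n)
    case (Suc m)
    have "(\<Sum>p<n. \<alpha> p p * (if p + 1 < n then x (H p) else 0)) = (\<Sum>t<m. x (H t) * \<alpha> t t)"
      by (simp add: Suc mult.commute)
    moreover have "(\<Sum>p<n. \<alpha> p p * (if 0 < p then x (H (p - 1)) else 0)) = (\<Sum>t<m. x (H t) * \<alpha> (t + 1) (t + 1))"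
      unfolding Suc by (subst sum.lessThan_Suc_shift) (simp add: mult.commute)
    ultimately show ?thesis by (simp add: Suc right_diff_distrib sum_subtractf del: sum.lessThan_Suc)
  qed auto
  have "(\<Sum>i\<in>qbasis n k. x i * lin n k T (belt i) \<eta>) = (\<Sum>i<n. \<Sum>j<n. if i \<noteq> j then x (E i j) * \<alpha> i j else 0)
     + (\<Sum>t<n - 1. x (H t) * (\<alpha> t t - \<alpha> (t + 1) (t + 1))) + (\<Sum>c<k. \<Sum>i<n. x (U c i) * \<beta> c i) + (\<Sum>c<k. \<Sum>i<n. x (W c i) * \<gamma> c i)"
    unfolding sum_qbasis by (intro arg_cong2[of _ _ _ _ "(+)"] sum.cong refl if_cong) (auto simp: lE lH lU lW simp del: belt.simps)
  also have "(\<Sum>i<n. \<Sum>j<n. if i \<noteq> j then x (E i j) * \<alpha> i j else 0) + (\<Sum>t<n - 1. x (H t) * (\<alpha> t t - \<alpha> (t + 1) (t + 1))) =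
     (\<Sum>p<n. \<Sum>q<n. \<alpha> p q * Yof n x $$ (q, p))"
  proof -
    have "(\<Sum>p<n. \<alpha> p p * ((if p + 1 < n then x (H p) else 0) - (if 0 < p then x (H (p - 1)) else 0))) =
      (\<Sum>p<n. \<Sum>q<n. if p = q then \<alpha> p p * ((if p + 1 < n then x (H p) else 0) - (if 0 < p then x (H (p - 1)) else 0)) else 0)"
      by (intro sum.cong refl) simp
    then show ?thesis
      unfolding diag by (simp only: sum.distrib[symmetric], intro sum.cong refl) (auto simp: Yof_def)
  qed
  finally show ?thesis
    unfolding lin by (simp add: bof_def cof_def mult.commute)
qed

text \<open>The dictionary between the structure matrix and triples: combinations of its rows are
  tangent vectors of coadjoint orbits. Invariants and stabilisers are both translated through
  it.\<close>

lemma br_dact: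
  assumes "T \<in> carr n k" "j \<in> qbasis n k"
  shows "(\<Sum>i\<in>qbasis n k. x i * meval (brpoly n k i j) (proj n k T)) = tproj (dact T (Yof n x, bof n k x, cof n k x)) j"
proof -
  have "(\<Sum>i\<in>qbasis n k. x i * meval (brpoly n k i j) (proj n k T)) =
      qpair n k (dact T (Yof n x, bof n k x, cof n k x)) (belt j)"
    unfolding meval_brpoly qpair_qbr lin_belt_sum qpair_dact[OF assms(1) Yof_carrier] ..
  also have "\<dots> = tproj (dact T (Yof n x, bof n k x, cof n k x)) j"
    by (rule qpair_belt[OF assms(2)])
  finally show ?thesis .
qed

section \<open>Group moves and invariance under them\<close>

fun tconj :: "complex mat \<Rightarrow> complex mat \<Rightarrow> triple \<Rightarrow> triple" where
  "tconj g h (a, u, w) = (g * a * h, g * u, w * h)"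

fun ttrans :: "complex mat \<Rightarrow> complex mat \<Rightarrow> triple \<Rightarrow> triple" where
  "ttrans b c (a, u, w) = (a + (u * b + c * w), u, w)"

fun tshift :: "nat \<Rightarrow> complex \<Rightarrow> triple \<Rightarrow> triple" where
  "tshift n r (a, u, w) = (a + r \<cdot>\<^sub>m 1\<^sub>m n, u, w)"

lemma smult_smult_mat: "s \<cdot>\<^sub>m (t \<cdot>\<^sub>m A) = (s * t) \<cdot>\<^sub>m (A :: complex mat)"
  by (rule eq_matI) auto

lemma uminus_zero_mat [simp]: "- 0\<^sub>m n m = (0\<^sub>m n m :: complex mat)"
  by (rule eq_matI) auto

lemma carr_simps [simp]: "(a, u, w) \<in> carr n k \<longleftrightarrow> a \<in> carrier_mat n n \<and> u \<in> carrier_mat n k \<and> w \<in> carrier_mat k n"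
  by (auto simp: carr_def)

text \<open>If \<open>Y\<close> has square zero, \<open>1 + s Y\<close> has the inverse
  \<open>1 - s Y\<close>, and conjugating \<open>a\<close> gives
  \<open>a + s (Y a - a Y) - s^2 Y a Y\<close>. Such orbit curves are polynomial of degree two, and
  only the first component has a quadratic term.\<close>

definition qcurve :: "triple \<Rightarrow> triple \<Rightarrow> complex mat \<Rightarrow> complex \<Rightarrow> triple" where
  "qcurve T D Q s = (case T of (a, u, w) \<Rightarrow> case D of (P, R, S) \<Rightarrow>
     (a + (s \<cdot>\<^sub>m P + s^2 \<cdot>\<^sub>m Q), u + s \<cdot>\<^sub>m R, w + s \<cdot>\<^sub>m S))"

lemma qcurve_carr: "T \<in> carr n k \<Longrightarrow> D \<in> carr n k \<Longrightarrow> Q \<in> carrier_mat n n \<Longrightarrow> qcurve T D Q s \<in> carr n k"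
  by (cases T; cases D) (auto simp: qcurve_def)

lemma tproj_qcurve:
  assumes "T \<in> carr n k" "D \<in> carr n k" "Q \<in> carrier_mat n n" "l \<in> qbasis n k"
  shows "tproj (qcurve T D Q s) l = tproj T l + s * tproj D l + s^2 * tproj (Q, 0\<^sub>m n k, 0\<^sub>m k n) l"
  using assms by (cases T; cases D; cases l) (auto simp: qcurve_def algebra_simps)

lemma tproj_qcurve_deriv:
  assumes "T \<in> carr n k" "D \<in> carr n k" "Q \<in> carrier_mat n n" "l \<in> qbasis n k"
  shows "((\<lambda>s. tproj (qcurve T D Q s) l) has_field_derivative
     tproj D l + 2 * s * tproj (Q, 0\<^sub>m n k, 0\<^sub>m k n) l) (at s)"
  unfolding tproj_qcurve[OF assms] by (auto intro!: derivative_eq_intros)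

lemma meval_qcurve_deriv:
  assumes "T \<in> carr n k" "D \<in> carr n k" "Q \<in> carrier_mat n n" "mvars f \<subseteq> qbasis n k"
  shows "((\<lambda>s. meval f (proj n k (qcurve T D Q s))) has_field_derivative
     (\<Sum>l\<in>qbasis n k. meval (mderiv l f) (proj n k (qcurve T D Q s)) *
        (tproj D l + 2 * s * tproj (Q, 0\<^sub>m n k, 0\<^sub>m k n) l))) (at s)"
  by (rule meval_has_field_derivative[OF assms(4)]) (auto simp: proj_def intro: tproj_qcurve_deriv[OF assms(1-3)])

lemma meval_ad_poly: "meval (ad_poly n k i f) x = (\<Sum>j\<in>qbasis n k. meval (brpoly n k i j) x * meval (mderiv j f) x)"
  by (simp add: ad_poly_def)

lemma ad_sum_dact:
  assumes T: "T \<in> carr n k"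
  shows "(\<Sum>i\<in>qbasis n k. x i * meval (ad_poly n k i f) (proj n k T)) =
     (\<Sum>j\<in>qbasis n k. meval (mderiv j f) (proj n k T) * tproj (dact T (Yof n x, bof n k x, cof n k x)) j)"
proof -
  have "(\<Sum>i\<in>qbasis n k. x i * meval (ad_poly n k i f) (proj n k T)) =
     (\<Sum>j\<in>qbasis n k. meval (mderiv j f) (proj n k T) * (\<Sum>i\<in>qbasis n k. x i * meval (brpoly n k i j) (proj n k T)))"
    unfolding meval_ad_poly sum_distrib_left by (subst sum.swap) (simp only: mult_ac)
  also have "\<dots> = (\<Sum>j\<in>qbasis n k. meval (mderiv j f) (proj n k T) * tproj (dact T (Yof n x, bof n k x, cof n k x)) j)"
    by (intro sum.cong refl) (simp add: br_dact[OF T])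
  finally show ?thesis .
qed

text \<open>The assumption \<open>dact\<close> says that the velocity is at every time the action of
  one fixed Lie algebra element \<open>x\<close>. Hence the derivative of \<open>f\<close> along the
  curve is a combination of its adjoint derivatives, all of which are zero.\<close>

lemma invariant_on_qcurve:
  assumes f: "f \<in> invariants n k" and T: "T \<in> carr n k" and D: "(P, R, S) \<in> carr n k" and Q: "Q \<in> carrier_mat n n"
    and dact: "\<And>s. dact (qcurve T (P, R, S) Q s) (Yof n x, bof n k x, cof n k x) = (P + (2 * s) \<cdot>\<^sub>m Q, R, S)"
  shows "meval f (proj n k (qcurve T (P, R, S) Q s)) = meval f (proj n k (qcurve T (P, R, S) Q t))"
proof (rule pcurve_zero_derivative_imp_const[where g = "\<lambda>s. meval f (proj n k (qcurve T (P, R, S) Q s))"])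
  have mv: "mvars f \<subseteq> qbasis n k" using f by (simp add: invariants_def Sq_def)
  show "pcurve (\<lambda>s. meval f (proj n k (qcurve T (P, R, S) Q s)))"
    by (rule pcurve_comp[OF polyfun_meval[OF mv]])
       (auto simp: proj_def tproj_qcurve[OF T D Q] power2_eq_square intro!: pf)
  fix s
  have C: "qcurve T (P, R, S) Q s \<in> carr n k" by (rule qcurve_carr[OF T D Q])
  have "(\<Sum>l\<in>qbasis n k. meval (mderiv l f) (proj n k (qcurve T (P, R, S) Q s)) *
        (tproj (P, R, S) l + 2 * s * tproj (Q, 0\<^sub>m n k, 0\<^sub>m k n) l)) =
     (\<Sum>l\<in>qbasis n k. meval (mderiv l f) (proj n k (qcurve T (P, R, S) Q s)) *
        tproj (dact (qcurve T (P, R, S) Q s) (Yof n x, bof n k x, cof n k x)) l)"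
  proof (intro sum.cong refl arg_cong2[of _ _ _ _ "(*)"])
    fix l assume l: "l \<in> qbasis n k"
    show "tproj (P, R, S) l + 2 * s * tproj (Q, 0\<^sub>m n k, 0\<^sub>m k n) l =
        tproj (dact (qcurve T (P, R, S) Q s) (Yof n x, bof n k x, cof n k x)) l"
      unfolding dact using l D Q by (cases l) (auto simp: algebra_simps)
  qed
  also have "\<dots> = (\<Sum>i\<in>qbasis n k. x i * meval (ad_poly n k i f) (proj n k (qcurve T (P, R, S) Q s)))"
    by (rule ad_sum_dact[OF C, symmetric])
  also have "\<dots> = 0" using f by (auto simp: invariants_def intro: sum.neutral)
  finally show "((\<lambda>s. meval f (proj n k (qcurve T (P, R, S) Q s))) has_field_derivative 0) (at s)"
    using meval_qcurve_deriv[OF T D Q mv, of s] by simp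
qed

lemma tconj_qcurve:
  assumes T: "(a, u, w) \<in> carr n k" and Y: "Y \<in> carrier_mat n n"
  shows "tconj (1\<^sub>m n + s \<cdot>\<^sub>m Y) (1\<^sub>m n - s \<cdot>\<^sub>m Y) (a, u, w) =
     qcurve (a, u, w) (Y * a - a * Y, Y * u, - (w * Y)) (- (Y * a * Y)) s"
proof -
  have c: "a \<in> carrier_mat n n" "u \<in> carrier_mat n k" "w \<in> carrier_mat k n" using T by auto
  have "(1\<^sub>m n + s \<cdot>\<^sub>m Y) * a = a + s \<cdot>\<^sub>m (Y * a)"
    using c Y by (simp add: add_mult_distrib_mat[of _ n n] mult_smult_assoc_mat[of _ n n])
  then have "(1\<^sub>m n + s \<cdot>\<^sub>m Y) * a * (1\<^sub>m n - s \<cdot>\<^sub>m Y) = (a + s \<cdot>\<^sub>m (Y * a)) - (a + s \<cdot>\<^sub>m (Y * a)) * (s \<cdot>\<^sub>m Y)"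
    using c Y by (simp add: mult_minus_distrib_mat[of _ n n _ n])
  also have "(a + s \<cdot>\<^sub>m (Y * a)) * (s \<cdot>\<^sub>m Y) = s \<cdot>\<^sub>m (a * Y) + (s * s) \<cdot>\<^sub>m (Y * a * Y)"
    using c Y by (simp add: add_mult_distrib_mat[of _ n n] mult_smult_distrib[of _ n n _ n] mult_smult_assoc_mat[of _ n n _ n] smult_smult_mat add_smult_distrib_left_mat[of _ n n])
  finally have A: "(1\<^sub>m n + s \<cdot>\<^sub>m Y) * a * (1\<^sub>m n - s \<cdot>\<^sub>m Y) = (a + s \<cdot>\<^sub>m (Y * a)) - (s \<cdot>\<^sub>m (a * Y) + (s * s) \<cdot>\<^sub>m (Y * a * Y))" .
  have A': "(1\<^sub>m n + s \<cdot>\<^sub>m Y) * a * (1\<^sub>m n - s \<cdot>\<^sub>m Y) = a + (s \<cdot>\<^sub>m (Y * a - a * Y) + s\<^sup>2 \<cdot>\<^sub>m (- (Y * a * Y)))"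
    unfolding A by (rule eq_matI) (use c Y in \<open>auto simp: power2_eq_square algebra_simps simp del: index_mult_mat(1)\<close>)
  have B: "(1\<^sub>m n + s \<cdot>\<^sub>m Y) * u = u + s \<cdot>\<^sub>m (Y * u)"
    using c Y by (simp add: add_mult_distrib_mat[of _ n n] mult_smult_assoc_mat[of _ n n])
  have C: "w * (1\<^sub>m n - s \<cdot>\<^sub>m Y) = w + s \<cdot>\<^sub>m (- (w * Y))"
    using c Y by (simp add: mult_minus_distrib_mat[of _ k n _ n] mult_smult_distrib[of _ k n _ n])
       (rule eq_matI, auto simp del: index_mult_mat(1))
  show ?thesis by (simp add: qcurve_def A' B C)
qed

text \<open>\<open>Y\<close> commutes with \<open>1 + s Y\<close>, so the velocity at time
  \<open>s\<close> is again the action of \<open>Y\<close>, now on the moved point.\<close>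

lemma dact_nilpotent_qcurve:
  assumes T: "(a, u, w) \<in> carr n k" and Y: "Y \<in> carrier_mat n n" "Y * Y = 0\<^sub>m n n"
  shows "dact (qcurve (a, u, w) (Y * a - a * Y, Y * u, - (w * Y)) (- (Y * a * Y)) s) (Y, 0\<^sub>m k n, 0\<^sub>m n k) =
     (Y * a - a * Y + (2 * s) \<cdot>\<^sub>m (- (Y * a * Y)), Y * u, - (w * Y))"
proof -
  have c: "a \<in> carrier_mat n n" "u \<in> carrier_mat n k" "w \<in> carrier_mat k n" using T by auto
  define P where "P = Y * a - a * Y"
  define Q where "Q = Y * a * Y"
  have PQ: "P \<in> carrier_mat n n" "Q \<in> carrier_mat n n" using c Y by (auto simp: P_def Q_def)
  have YYx: "Y * (Y * x) = 0\<^sub>m n m" if "x \<in> carrier_mat n m" for x m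
    using that Y by (simp add: assoc_mult_mat[symmetric, of _ n n _ n _ m])
  have xYY: "x * Y * Y = 0\<^sub>m m n" if "x \<in> carrier_mat m n" for x m
    using that Y by (simp add: assoc_mult_mat[of _ m n _ n _ n])
  have YP: "Y * P = - Q"
  proof -
    have "Y * P = Y * (Y * a) - Y * (a * Y)"
      unfolding P_def using c Y by (intro mult_minus_distrib_mat) auto
    also have "Y * (a * Y) = Q" unfolding Q_def using c Y by (intro assoc_mult_mat[symmetric]) auto
    finally show ?thesis using YYx[OF c(1)] PQ by (auto intro!: eq_matI)
  qed
  have PY: "P * Y = Q"
    using c Y xYY[OF c(1)] unfolding P_def Q_def
    by (simp add: minus_mult_distrib_mat[of _ n n]) (rule eq_matI, auto simp del: index_mult_mat(1))
  have YQ: "Y * Q = 0\<^sub>m n n" unfolding Q_def using c Y YYx[of "a * Y" n]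
    by (simp add: assoc_mult_mat[of _ n n _ n _ n])
  have QY: "Q * Y = 0\<^sub>m n n" unfolding Q_def using c Y xYY[of "Y * a" n] by simp
  let ?a = "a + (s \<cdot>\<^sub>m P + s\<^sup>2 \<cdot>\<^sub>m (- Q))"
  have l: "Y * ?a = Y * a + s \<cdot>\<^sub>m (- Q)"
  proof -
    have "Y * ?a = Y * a + (s \<cdot>\<^sub>m (Y * P) + s\<^sup>2 \<cdot>\<^sub>m (Y * (- Q)))"
      using c Y PQ by (simp add: mult_add_distrib_mat[of _ n n _ n] mult_smult_distrib[of _ n n _ n])
    also have "Y * (- Q) = 0\<^sub>m n n" using YQ PQ Y by simp
    finally show ?thesis using c Y PQ by (simp add: YP)
  qed
  have r: "?a * Y = a * Y + s \<cdot>\<^sub>m Q"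
  proof -
    have "?a * Y = a * Y + (s \<cdot>\<^sub>m (P * Y) + s\<^sup>2 \<cdot>\<^sub>m ((- Q) * Y))"
      using c Y PQ by (simp add: add_mult_distrib_mat[of _ n n _ _ n] mult_smult_assoc_mat[of _ n n _ n])
    also have "(- Q) * Y = 0\<^sub>m n n" using QY PQ Y by simp
    finally show ?thesis using c Y PQ by (simp add: PY)
  qed
  have "Y * ?a - ?a * Y = P + (2 * s) \<cdot>\<^sub>m (- Q)"
    unfolding l r by (rule eq_matI) (use c Y PQ in \<open>auto simp: P_def algebra_simps simp del: index_mult_mat(1)\<close>)
  moreover have "Y * (u + s \<cdot>\<^sub>m (Y * u)) = Y * u"
    using c Y YYx[OF c(2)] by (simp add: mult_add_distrib_mat[of _ n n _ k] mult_smult_distrib[of _ n n _ k])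
  moreover have "(w + s \<cdot>\<^sub>m (- (w * Y))) * Y = w * Y"
    using c Y xYY[OF c(3)] by (simp add: add_mult_distrib_mat[of _ k n _ _ n] mult_smult_assoc_mat[of _ k n _ n])
  moreover have "(u + s \<cdot>\<^sub>m (Y * u)) * 0\<^sub>m k n + 0\<^sub>m n k * (w + s \<cdot>\<^sub>m (- (w * Y))) = 0\<^sub>m n n"
    using c Y by simp
  ultimately show ?thesis
    unfolding qcurve_def P_def[symmetric] Q_def[symmetric] using c PQ by simp
qed

text \<open>Conjugation is restricted to \<open>1 + Y\<close> with \<open>Y\<close> of square zero:
  these act along polynomial curves, and as they include all transvections they generate the special
  linear group. The zero diagonal makes the \<open>H\<close> coordinates of \<open>Y\<close> vanish.
  The scalar shift changes the matrix but not the point that it represents.\<close>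

inductive move :: "nat \<Rightarrow> nat \<Rightarrow> triple \<Rightarrow> triple \<Rightarrow> bool" for n k where
  move_conj: "T \<in> carr n k \<Longrightarrow> Y \<in> carrier_mat n n \<Longrightarrow> Y * Y = 0\<^sub>m n n \<Longrightarrow> (\<And>i. i < n \<Longrightarrow> Y $$ (i, i) = 0) \<Longrightarrow>
    move n k T (tconj (1\<^sub>m n + Y) (1\<^sub>m n - Y) T)"
| move_trans: "T \<in> carr n k \<Longrightarrow> b \<in> carrier_mat k n \<Longrightarrow> c \<in> carrier_mat n k \<Longrightarrow> move n k T (ttrans b c T)"
| move_shift: "T \<in> carr n k \<Longrightarrow> move n k T (tshift n r T)"

abbreviation moves :: "nat \<Rightarrow> nat \<Rightarrow> triple \<Rightarrow> triple \<Rightarrow> bool" where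
  "moves n k \<equiv> (move n k)\<^sup>*\<^sup>*"

lemma move_carr: "move n k T T' \<Longrightarrow> T \<in> carr n k \<and> T' \<in> carr n k"
proof (induction rule: move.induct)
  case (move_conj T Y)
  then show ?case by (cases T) auto
next
  case (move_trans T b c)
  then show ?case by (cases T) auto
next
  case (move_shift T r)
  then show ?case by (cases T) auto
qed

lemma moves_carr: "moves n k T T' \<Longrightarrow> T \<in> carr n k \<Longrightarrow> T' \<in> carr n k"
  by (induction rule: rtranclp_induct) (auto dest: move_carr)

lemma ttrans_qcurve:
  assumes "(a, u, w) \<in> carr n k" "b \<in> carrier_mat k n" "c \<in> carrier_mat n k"
  shows "ttrans (s \<cdot>\<^sub>m b) (s \<cdot>\<^sub>m c) (a, u, w) = qcurve (a, u, w) (u * b + c * w, 0\<^sub>m n k, 0\<^sub>m k n) (0\<^sub>m n n) s"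
proof -
  have "u * (s \<cdot>\<^sub>m b) + (s \<cdot>\<^sub>m c) * w = s \<cdot>\<^sub>m (u * b + c * w)"
    using assms by (simp add: mult_smult_distrib[of _ n k _ n] mult_smult_assoc_mat[of _ n k _ n])
       (rule add_smult_distrib_left_mat[of _ n n, symmetric], auto)
  then show ?thesis using assms by (simp add: qcurve_def)
qed

lemma proj_tshift [simp]: "T \<in> carr n k \<Longrightarrow> proj n k (tshift n r T) = proj n k T"
proof
  fix l assume "T \<in> carr n k"
  then show "proj n k (tshift n r T) l = proj n k T l"
    by (cases T; cases l) (auto simp: proj_def)
qed

lemma qcurve_0:
  assumes "T \<in> carr n k" "D \<in> carr n k" "Q \<in> carrier_mat n n"
  shows "qcurve T D Q 0 = T"
  using assms by (cases T; cases D) (auto simp: qcurve_def intro!: eq_matI)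

lemma invariant_move:
  assumes "move n k T T'" "f \<in> invariants n k"
  shows "meval f (proj n k T') = meval f (proj n k T)"
  using assms
proof (induction rule: move.induct)
  case (move_conj T Y)
  obtain a u w where T: "T = (a, u, w)" by (cases T)
  \<comment> \<open>The coordinates of \<open>Y\<close>, transposed; those at \<open>H t\<close> are
    0 since the diagonal vanishes.\<close>
  define x where "x v = (case v of E i j \<Rightarrow> Y $$ (j, i) | _ \<Rightarrow> 0)" for v
  have x: "Yof n x = Y" "bof n k x = 0\<^sub>m k n" "cof n k x = 0\<^sub>m n k"
    using move_conj by (auto simp: x_def Yof_def bof_def cof_def intro!: eq_matI)
  have D: "(Y * a - a * Y, Y * u, - (w * Y)) \<in> carr n k" "- (Y * a * Y) \<in> carrier_mat n n"
    using move_conj by (auto simp: T)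
  have "1\<^sub>m n + Y = 1\<^sub>m n + 1 \<cdot>\<^sub>m Y" "1\<^sub>m n - Y = 1\<^sub>m n - 1 \<cdot>\<^sub>m Y"
    using move_conj by (auto intro!: eq_matI)
  then have "tconj (1\<^sub>m n + Y) (1\<^sub>m n - Y) T = qcurve T (Y * a - a * Y, Y * u, - (w * Y)) (- (Y * a * Y)) 1"
    using tconj_qcurve[of a u w n k Y 1] move_conj by (simp add: T)
  moreover have "meval f (proj n k (qcurve T (Y * a - a * Y, Y * u, - (w * Y)) (- (Y * a * Y)) 1)) =
     meval f (proj n k (qcurve T (Y * a - a * Y, Y * u, - (w * Y)) (- (Y * a * Y)) 0))"
    by (rule invariant_on_qcurve[OF move_conj(5) move_conj(1) D, where x = x])
       (unfold x T, rule dact_nilpotent_qcurve, use move_conj T in auto)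
  ultimately show ?case using qcurve_0[OF move_conj(1) D] by simp
next
  case (move_trans T b c)
  obtain a u w where T: "T = (a, u, w)" by (cases T)
  define x where "x v = (case v of U d i \<Rightarrow> - b $$ (d, i) | W d i \<Rightarrow> c $$ (i, d) | _ \<Rightarrow> 0)" for v
  have x: "Yof n x = 0\<^sub>m n n" "bof n k x = b" "cof n k x = c"
    using move_trans by (auto simp: x_def Yof_def bof_def cof_def intro!: eq_matI)
  have D: "(u * b + c * w, 0\<^sub>m n k, 0\<^sub>m k n) \<in> carr n k" "0\<^sub>m n n \<in> carrier_mat n n"
    using move_trans by (auto simp: T)
  have "1 \<cdot>\<^sub>m b = b" "1 \<cdot>\<^sub>m c = c"
    using move_trans by (auto intro!: eq_matI)
  then have "ttrans b c T = qcurve T (u * b + c * w, 0\<^sub>m n k, 0\<^sub>m k n) (0\<^sub>m n n) 1"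
    using ttrans_qcurve[of a u w n k b c 1] move_trans by (simp add: T)
  moreover have "meval f (proj n k (qcurve T (u * b + c * w, 0\<^sub>m n k, 0\<^sub>m k n) (0\<^sub>m n n) 1)) =
     meval f (proj n k (qcurve T (u * b + c * w, 0\<^sub>m n k, 0\<^sub>m k n) (0\<^sub>m n n) 0))"
    by (rule invariant_on_qcurve[OF move_trans(4) move_trans(1) D, where x = x])
       (unfold x T, use move_trans T in \<open>auto simp: qcurve_def intro!: eq_matI simp del: index_mult_mat(1)\<close>)
  ultimately show ?case using qcurve_0[OF move_trans(1) D] by simp
qed simp

lemma invariant_moves:
  assumes "moves n k T T'" "f \<in> invariants n k"
  shows "meval f (proj n k T') = meval f (proj n k T)"
  using assms(1) by (induction rule: rtranclp_induct) (auto simp: invariant_move[OF _ assms(2)])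

lemma rank_one_square_zero:
  assumes "(\<Sum>l<n. g l * f l) = (0::complex)"
  shows "mat n n (\<lambda>(i, j). f i * g j) * mat n n (\<lambda>(i, j). f i * g j) = 0\<^sub>m n n"
proof (rule eq_matI)
  fix i j assume "i < dim_row (0\<^sub>m n n :: complex mat)" "j < dim_col (0\<^sub>m n n :: complex mat)"
  then have ij: "i < n" "j < n" by auto
  have "(mat n n (\<lambda>(i, j). f i * g j) * mat n n (\<lambda>(i, j). f i * g j)) $$ (i, j) = (\<Sum>l<n. f i * g l * (f l * g j))"
    using ij by (subst mult_mat_entry[of _ n n _ n]) auto
  also have "\<dots> = f i * g j * (\<Sum>l<n. g l * f l)" by (simp add: sum_distrib_left mult_ac)
  finally show "(mat n n (\<lambda>(i, j). f i * g j) * mat n n (\<lambda>(i, j). f i * g j)) $$ (i, j) = 0\<^sub>m n n $$ (i, j)"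
    using ij assms by simp
qed auto

text \<open>Invariance under the group is differentiated at \<open>s = 0\<close> along curves with
  square-zero \<open>Y\<close>. The resulting functional \<open>K\<close> of \<open>Y\<close> is
  additive, and the matrix part of every basis element is a sum of square-zero matrices.\<close>

lemma invariantsI:
  assumes f: "mvars f \<subseteq> qbasis n k" and f\<Phi>: "\<And>T. T \<in> carr n k \<Longrightarrow> meval f (proj n k T) = \<Phi> T"
    and conj: "\<And>T g h. T \<in> carr n k \<Longrightarrow> g \<in> carrier_mat n n \<Longrightarrow> h \<in> carrier_mat n n \<Longrightarrow> g * h = 1\<^sub>m n \<Longrightarrow> h * g = 1\<^sub>m n \<Longrightarrow>
       \<Phi> (tconj g h T) = \<Phi> T"
    and trans: "\<And>T b c. T \<in> carr n k \<Longrightarrow> b \<in> carrier_mat k n \<Longrightarrow> c \<in> carrier_mat n k \<Longrightarrow> \<Phi> (ttrans b c T) = \<Phi> T"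
  shows "f \<in> invariants n k"
proof -
  have main: "meval (ad_poly n k i f) (proj n k T) = 0" if i: "i \<in> qbasis n k" and T: "T \<in> carr n k" for i T
  proof -
    obtain a u w where T': "T = (a, u, w)" by (cases T)
    define dL where "dL D = (\<Sum>l\<in>qbasis n k. meval (mderiv l f) (proj n k T) * tproj D l)" for D
    define K where "K Y = dL (Y * a - a * Y, Y * u, - (w * Y))" for Y
    have dL0: "dL D = 0" if "D \<in> carr n k" "Q \<in> carrier_mat n n" "\<And>s. \<Phi> (qcurve T D Q s) = \<Phi> T" for D Q
    proof -
      have "((\<lambda>s. meval f (proj n k (qcurve T D Q s))) has_field_derivative dL D) (at 0)"
        using meval_qcurve_deriv[OF T that(1,2) f, of 0] qcurve_0[OF T that(1,2)] by (simp add: dL_def)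
      moreover have "(\<lambda>s. meval f (proj n k (qcurve T D Q s))) = (\<lambda>s. \<Phi> T)"
        using that T by (auto simp: f\<Phi> qcurve_carr)
      ultimately show ?thesis using DERIV_unique[OF _ DERIV_const] by fastforce
    qed
    have K0: "K Y = 0" if Y: "Y \<in> carrier_mat n n" "Y * Y = 0\<^sub>m n n" for Y
      unfolding K_def
    proof (rule dL0)
      show "(Y * a - a * Y, Y * u, - (w * Y)) \<in> carr n k" "- (Y * a * Y) \<in> carrier_mat n n"
        using T Y by (auto simp: T')
      fix s
      have sY: "(s \<cdot>\<^sub>m Y) * (s \<cdot>\<^sub>m Y) = 0\<^sub>m n n"
        using Y by (simp add: mult_smult_distrib[of _ n n _ n] mult_smult_assoc_mat[of _ n n _ n])
      have "(1\<^sub>m n + s \<cdot>\<^sub>m Y) * (1\<^sub>m n - s \<cdot>\<^sub>m Y) = 1\<^sub>m n + s \<cdot>\<^sub>m Y - (s \<cdot>\<^sub>m Y + (s \<cdot>\<^sub>m Y) * (s \<cdot>\<^sub>m Y))"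
        using Y by (simp add: mult_minus_distrib_mat[of _ n n _ n] add_mult_distrib_mat[of _ n n _ _ n])
      also have "\<dots> = 1\<^sub>m n" unfolding sY using Y by (auto intro!: eq_matI)
      finally have gh: "(1\<^sub>m n + s \<cdot>\<^sub>m Y) * (1\<^sub>m n - s \<cdot>\<^sub>m Y) = 1\<^sub>m n" .
      have "(1\<^sub>m n - s \<cdot>\<^sub>m Y) * (1\<^sub>m n + s \<cdot>\<^sub>m Y) = (1\<^sub>m n - s \<cdot>\<^sub>m Y) * 1\<^sub>m n + (1\<^sub>m n - s \<cdot>\<^sub>m Y) * (s \<cdot>\<^sub>m Y)"
        using Y by (intro mult_add_distrib_mat) auto
      also have "(1\<^sub>m n - s \<cdot>\<^sub>m Y) * (s \<cdot>\<^sub>m Y) = 1\<^sub>m n * (s \<cdot>\<^sub>m Y) - (s \<cdot>\<^sub>m Y) * (s \<cdot>\<^sub>m Y)"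
        using Y by (intro minus_mult_distrib_mat) auto
      also have "(1\<^sub>m n - s \<cdot>\<^sub>m Y) * 1\<^sub>m n + (1\<^sub>m n * (s \<cdot>\<^sub>m Y) - (s \<cdot>\<^sub>m Y) * (s \<cdot>\<^sub>m Y)) = 1\<^sub>m n - s \<cdot>\<^sub>m Y + (s \<cdot>\<^sub>m Y - (s \<cdot>\<^sub>m Y) * (s \<cdot>\<^sub>m Y))"
        using Y by simp
      also have "\<dots> = 1\<^sub>m n" unfolding sY using Y by (auto intro!: eq_matI)
      finally have "(1\<^sub>m n - s \<cdot>\<^sub>m Y) * (1\<^sub>m n + s \<cdot>\<^sub>m Y) = 1\<^sub>m n" .
      with gh have "\<Phi> (tconj (1\<^sub>m n + s \<cdot>\<^sub>m Y) (1\<^sub>m n - s \<cdot>\<^sub>m Y) T) = \<Phi> T"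
        using T Y by (intro conj) auto
      then show "\<Phi> (qcurve T (Y * a - a * Y, Y * u, - (w * Y)) (- (Y * a * Y)) s) = \<Phi> T"
        using tconj_qcurve[of a u w n k Y s] T Y by (simp add: T')
    qed
    have Kadd: "K (Y + Y') = K Y + K Y'" if Y: "Y \<in> carrier_mat n n" "Y' \<in> carrier_mat n n" for Y Y'
    proof -
      have "tproj ((Y + Y') * a - a * (Y + Y'), (Y + Y') * u, - (w * (Y + Y'))) l =
        tproj (Y * a - a * Y, Y * u, - (w * Y)) l + tproj (Y' * a - a * Y', Y' * u, - (w * Y')) l"
        if "l \<in> qbasis n k" for l
        using Y T that
        by (cases l) (auto simp: T' add_mult_distrib_mat[of _ n n] mult_add_distrib_mat[of _ n n _ n]
            mult_add_distrib_mat[of _ k n _ n] simp del: index_mult_mat(1))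
      then show ?thesis
        unfolding K_def dL_def sum.distrib[symmetric] distrib_left[symmetric] by (intro sum.cong refl) simp
    qed
    have tr0: "dL (u * b + c * w, 0\<^sub>m n k, 0\<^sub>m k n) = 0" if "b \<in> carrier_mat k n" "c \<in> carrier_mat n k" for b c
    proof (rule dL0)
      show "\<Phi> (qcurve T (u * b + c * w, 0\<^sub>m n k, 0\<^sub>m k n) (0\<^sub>m n n) s) = \<Phi> T" for s
        using ttrans_qcurve[of a u w n k b c s] T that trans[OF T, of "s \<cdot>\<^sub>m b" "s \<cdot>\<^sub>m c"] by (simp add: T')
    qed (use T that in \<open>auto simp: T'\<close>)
    have split: "dL (dact T (Y, b, c)) = K Y + dL (u * b + c * w, 0\<^sub>m n k, 0\<^sub>m k n)"
      if "Y \<in> carrier_mat n n" "b \<in> carrier_mat k n" "c \<in> carrier_mat n k" for Y b c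
    proof -
      have "tproj (dact T (Y, b, c)) l = tproj (Y * a - a * Y, Y * u, - (w * Y)) l + tproj (u * b + c * w, 0\<^sub>m n k, 0\<^sub>m k n) l"
        if "l \<in> qbasis n k" for l
        using \<open>Y \<in> _\<close> \<open>b \<in> _\<close> \<open>c \<in> _\<close> T that by (cases l) (auto simp: T' simp del: index_mult_mat(1))
      then show ?thesis
        unfolding K_def dL_def sum.distrib[symmetric] distrib_left[symmetric] by (intro sum.cong refl) simp
    qed
    define x :: "qidx \<Rightarrow> complex" where "x v = (if v = i then 1 else 0)" for v
    have "meval (ad_poly n k i f) (proj n k T) = (\<Sum>i'\<in>qbasis n k. x i' * meval (ad_poly n k i' f) (proj n k T))"
      using i by (simp add: x_def if_distrib[of "\<lambda>z. z * _"] cong: if_cong)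
    also have "\<dots> = dL (dact T (Yof n x, bof n k x, cof n k x))"
      unfolding ad_sum_dact[OF T] dL_def ..
    also have "\<dots> = K (Yof n x)"
      by (subst split) (auto simp: tr0)
    also have "K (Yof n x) = 0"
    proof (cases i)
      case (E p q)
      have "Yof n x = mat n n (\<lambda>(i, j). (if i = q then 1 else 0) * (if j = p then 1 else 0))"
        using i E by (auto simp: Yof_def x_def intro!: eq_matI)
      moreover have "(\<Sum>l<n. (if l = p then 1 else 0) * (if l = q then 1 else (0::complex))) = 0"
        using i E by (intro sum.neutral) auto
      ultimately show ?thesis by (auto intro!: K0 rank_one_square_zero)
    next
      case (H t)
      \<comment> \<open>The block diag(1, -1) is not nilpotent, but it is the sum of the square-zero
        matrix with rows (1, -1), (1, -1) and of two multiples of off-diagonal matrix units.\<close>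
      let ?N = "mat n n (\<lambda>(i, j). (if i = t \<or> i = t + 1 then 1 else 0) * (if j = t then 1 else if j = t + 1 then - 1 else 0)) :: complex mat"
      let ?F = "mat n n (\<lambda>(i, j). (if i = t then 1 else 0) * (if j = t + 1 then 1 else 0)) :: complex mat"
      let ?G = "mat n n (\<lambda>(i, j). (if i = t + 1 then -1 else 0) * (if j = t then 1 else 0)) :: complex mat"
      have "Yof n x = ?N + (?F + ?G)"
        using i H by (auto simp: Yof_def x_def intro!: eq_matI)
      moreover have "(\<Sum>l<n. (if l = t then 1 else if l = t + 1 then - 1 else 0) * (if l = t \<or> l = t + 1 then 1 else (0::complex))) = 0"
      proof -
        have "(\<Sum>l<n. (if l = t then 1 else if l = t + 1 then - 1 else 0) * (if l = t \<or> l = t + 1 then 1 else (0::complex))) =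
          (\<Sum>l<n. if l = t then 1 else 0) - (\<Sum>l<n. if l = t + 1 then 1 else 0)"
          unfolding sum_subtractf[symmetric] by (intro sum.cong) auto
        also have "\<dots> = 0" using i H by simp
        finally show ?thesis .
      qed
      then have "K ?N = 0" by (auto intro!: K0 rank_one_square_zero)
      moreover have "(\<Sum>l<n. (if l = t + 1 then 1 else 0) * (if l = t then 1 else (0::complex))) = 0"
        by (intro sum.neutral) auto
      then have "K ?F = 0" by (auto intro!: K0 rank_one_square_zero)
      moreover have "(\<Sum>l<n. (if l = t then 1 else 0) * (if l = t + 1 then -1 else (0::complex))) = 0"
        by (intro sum.neutral) auto
      then have "K ?G = 0" by (auto intro!: K0 rank_one_square_zero)
      ultimately show ?thesis by (simp add: Kadd)
    next
      case (U c p)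
      have "Yof n x = 0\<^sub>m n n" using U by (auto simp: Yof_def x_def intro!: eq_matI)
      then show ?thesis by (auto intro!: K0)
    next
      case (W c p)
      have "Yof n x = 0\<^sub>m n n" using W by (auto simp: Yof_def x_def intro!: eq_matI)
      then show ?thesis by (auto intro!: K0)
    qed
    finally show ?thesis .
  qed
  have "ad_poly n k i f = 0" if i: "i \<in> qbasis n k" for i
  proof (rule meval_eq_0_imp)
    fix x
    have px: "proj n k (Tof n k (lift n k x)) l = x l" if "l \<in> qbasis n k" for l
    proof (cases l)
      case (H t)
      have "{t..<n - 1} = insert t {t + 1..<n - 1}" using that H by auto
      then show ?thesis using that H by (simp add: proj_def Tof_def lift_def)
    qed (use that in \<open>auto simp: proj_def Tof_def lift_def\<close>)
    have br: "meval (brpoly n k i j) y = meval (brpoly n k i j) z" if "\<And>l. l \<in> qbasis n k \<Longrightarrow> y l = z l" for j y z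
      using that by (simp add: brpoly_def)
    have kf: "mvars (mderiv j f) \<subseteq> qbasis n k" for j
    proof -
      have "v \<in> qbasis n k" if v: "v \<in> mvars (mderiv j f)" for v
      proof -
        obtain m where m: "m \<in> Poly_Mapping.keys (mderiv j f)" "v \<in> Poly_Mapping.keys m"
          using v by (auto simp: mvars_def)
        then obtain m' where m': "m' \<in> Poly_Mapping.keys f"
          "m \<in> Poly_Mapping.keys (Poly_Mapping.single (m' - Poly_Mapping.single j 1) (of_nat (Poly_Mapping.lookup m' j) * Poly_Mapping.lookup f m'))"
          unfolding mderiv_def using Poly_Mapping.keys_sum by fastforce
        then have "m = m' - Poly_Mapping.single j 1" by (auto split: if_splits)
        then have "v \<in> Poly_Mapping.keys m'" using m(2) by (auto simp: in_keys_iff lookup_minus)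
        then show ?thesis using m' f by (auto simp: mvars_def)
      qed
      then show ?thesis by blast
    qed
    have "meval (ad_poly n k i f) x = meval (ad_poly n k i f) (proj n k (Tof n k (lift n k x)))"
      unfolding meval_ad_poly
      by (intro sum.cong refl arg_cong2[of _ _ _ _ "(*)"] br meval_cong[OF kf]) (simp_all add: px)
    also have "\<dots> = 0" by (rule main[OF i Tof_carr])
    finally show "meval (ad_poly n k i f) x = 0" .
  qed
  then show ?thesis using f by (auto simp: invariants_def Sq_def)
qed

text \<open>The representative chosen by \<open>lift\<close> differs from the given triple by a
  scalar matrix, so shift invariance makes the function depend on the coordinates only.\<close>

lemma make_invariant:
  assumes n: "0 < n"
    and poly: "polyfun UNIV (\<lambda>y. \<Phi> (Tof n k y))"
    and conj: "\<And>T g h. T \<in> carr n k \<Longrightarrow> g \<in> carrier_mat n n \<Longrightarrow> h \<in> carrier_mat n n \<Longrightarrow> g * h = 1\<^sub>m n \<Longrightarrow> h * g = 1\<^sub>m n \<Longrightarrow>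
       \<Phi> (tconj g h T) = \<Phi> T"
    and trans: "\<And>T b c. T \<in> carr n k \<Longrightarrow> b \<in> carrier_mat k n \<Longrightarrow> c \<in> carrier_mat n k \<Longrightarrow> \<Phi> (ttrans b c T) = \<Phi> T"
    and shift: "\<And>T r. T \<in> carr n k \<Longrightarrow> \<Phi> (tshift n r T) = \<Phi> T"
  obtains f where "f \<in> invariants n k" "\<And>T. T \<in> carr n k \<Longrightarrow> meval f (proj n k T) = \<Phi> T"
proof -
  have "polyfun (qbasis n k) (\<lambda>x. \<Phi> (Tof n k (lift n k x)))"
  proof (rule polyfun_comp[OF poly])
    show "polyfun (qbasis n k) (\<lambda>x. lift n k x v)" for v
      unfolding lift_def by (cases v) (auto intro!: pf)
  qed
  then obtain f where f: "mvars f \<subseteq> qbasis n k" "\<And>x. meval f x = \<Phi> (Tof n k (lift n k x))"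
    by (rule polyfun_obtain) blast
  have eq: "meval f (proj n k T) = \<Phi> T" if T: "T \<in> carr n k" for T
  proof -
    obtain a u w where T': "T = (a, u, w)" by (cases T)
    have tele: "(\<Sum>t\<in>{i..<n - 1}. a $$ (t, t) - a $$ (t + 1, t + 1)) = a $$ (i, i) - a $$ (n - 1, n - 1)" if "i < n" for i
      using sum_Suc_diff'[of i "n - 1" "\<lambda>t. - a $$ (t, t)"] that by simp
    have "Tof n k (lift n k (proj n k T)) = tshift n (- a $$ (n - 1, n - 1)) T"
      using T n by (auto simp: T' Tof_def lift_def proj_def intro!: eq_matI)
         (use tele in \<open>simp add: less_diff_conv\<close>)
    then show ?thesis using shift[OF T] by (simp add: f)
  qed
  show ?thesis
    by (rule that[OF invariantsI[OF f(1) eq conj trans] eq])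
qed

section \<open>Normal forms\<close>

text \<open>Column elimination by \<open>w \<mapsto> w (1 - Y)\<close>, \<open>z \<mapsto> (1 + Y) z\<close> with \<open>Y\<^sup>2 = 0\<close>.
  The first \<open>m\<close> rows of \<open>w\<close> can be normalised as soon as \<open>m\<close> is less than the number of columns:
  the spare column replaces the missing scalings.\<close>

definition std_rows :: "nat \<Rightarrow> nat \<Rightarrow> complex mat \<Rightarrow> bool" where
  "std_rows n m w \<longleftrightarrow> (\<forall>i<m. \<forall>p<n. w $$ (i, p) = (if i = p then 1 else 0))"

text \<open>\<open>1 - Ycol n s g\<close> acts from the right by subtracting \<open>g p\<close>
  times column \<open>s\<close> from column \<open>p\<close>. When \<open>g s = 0\<close> the matrix
  has square zero and zero diagonal, so the operation is an admissible move.\<close>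

definition Ycol :: "nat \<Rightarrow> nat \<Rightarrow> (nat \<Rightarrow> complex) \<Rightarrow> complex mat" where
  "Ycol n s g = mat n n (\<lambda>(i, p). (if i = s then 1 else 0) * g p)"

lemma Ycol_carrier [simp]: "Ycol n s g \<in> carrier_mat n n"
  by (simp add: Ycol_def)

lemma one_minus_carrier [simp]: "Y \<in> carrier_mat n n \<Longrightarrow> 1\<^sub>m n - Y \<in> carrier_mat n n"
  by (rule minus_carrier_mat)

lemma one_plus_mult_carrier [simp]:
  "Y \<in> carrier_mat n n \<Longrightarrow> z \<in> carrier_mat n m \<Longrightarrow> (1\<^sub>m n + Y) * z \<in> carrier_mat n m"
  "Y \<in> carrier_mat n n \<Longrightarrow> z \<in> carrier_mat m n \<Longrightarrow> z * (1\<^sub>m n - Y) \<in> carrier_mat m n"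
  by (auto intro!: mult_carrier_mat[of _ _ n])

lemma Ycol_square: "g s = 0 \<Longrightarrow> Ycol n s g * Ycol n s g = 0\<^sub>m n n"
  unfolding Ycol_def by (rule rank_one_square_zero) (auto intro!: sum.neutral)

lemma Ycol_diag: "g s = 0 \<Longrightarrow> i < n \<Longrightarrow> Ycol n s g $$ (i, i) = 0"
  by (simp add: Ycol_def)

lemma Ycol_col_op:
  assumes "w \<in> carrier_mat r n" "i < r" "p < n" "s < n"
  shows "(w * (1\<^sub>m n - Ycol n s g)) $$ (i, p) = w $$ (i, p) - w $$ (i, s) * g p"
proof -
  have "(w * (1\<^sub>m n - Ycol n s g)) $$ (i, p) = (\<Sum>l<n. w $$ (i, l) * (1\<^sub>m n - Ycol n s g) $$ (l, p))"
    using assms by (intro mult_mat_entry[of _ r n _ n]) auto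
  also have "\<dots> = (\<Sum>l<n. (if l = p then w $$ (i, p) else 0) - (if l = s then w $$ (i, s) * g p else 0))"
    using assms by (intro sum.cong) (auto simp: Ycol_def algebra_simps)
  also have "\<dots> = w $$ (i, p) - w $$ (i, s) * g p"
    using assms by (simp add: sum_subtractf)
  finally show ?thesis .
qed

lemma one_plus_minus_Y:
  assumes "Y \<in> carrier_mat n n" "Y * Y = (0\<^sub>m n n :: complex mat)"
  shows "(1\<^sub>m n - Y) * (1\<^sub>m n + Y) = 1\<^sub>m n" "(1\<^sub>m n + Y) * (1\<^sub>m n - Y) = 1\<^sub>m n"
proof -
  have "(1\<^sub>m n - Y) * (1\<^sub>m n + Y) = (1\<^sub>m n - Y) * 1\<^sub>m n + (1\<^sub>m n - Y) * Y"
    using assms by (intro mult_add_distrib_mat) auto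
  also have "(1\<^sub>m n - Y) * Y = 1\<^sub>m n * Y - Y * Y"
    using assms by (intro minus_mult_distrib_mat) auto
  finally show "(1\<^sub>m n - Y) * (1\<^sub>m n + Y) = 1\<^sub>m n"
    using assms by (auto intro!: eq_matI)
  have "(1\<^sub>m n + Y) * (1\<^sub>m n - Y) = (1\<^sub>m n + Y) * 1\<^sub>m n - (1\<^sub>m n + Y) * Y"
    using assms by (intro mult_minus_distrib_mat) auto
  also have "(1\<^sub>m n + Y) * Y = 1\<^sub>m n * Y + Y * Y"
    using assms by (intro add_mult_distrib_mat) auto
  finally show "(1\<^sub>m n + Y) * (1\<^sub>m n - Y) = 1\<^sub>m n"
    using assms by (auto intro!: eq_matI)
qed

lemma mult_one_minus_plus:
  assumes "w \<in> carrier_mat r n" "z \<in> carrier_mat n q" "Y \<in> carrier_mat n n" "Y * Y = (0\<^sub>m n n :: complex mat)"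
  shows "(w * (1\<^sub>m n - Y)) * ((1\<^sub>m n + Y) * z) = w * z"
proof -
  have "(w * (1\<^sub>m n - Y)) * ((1\<^sub>m n + Y) * z) = w * ((1\<^sub>m n - Y) * ((1\<^sub>m n + Y) * z))"
    using assms by (intro assoc_mult_mat) auto
  also have "(1\<^sub>m n - Y) * ((1\<^sub>m n + Y) * z) = ((1\<^sub>m n - Y) * (1\<^sub>m n + Y)) * z"
    using assms by (intro assoc_mult_mat[symmetric]) auto
  finally show ?thesis using assms by (simp add: one_plus_minus_Y)
qed

lemma det_nonzero_inverse:
  fixes M :: "complex mat"
  assumes "M \<in> carrier_mat k k" "det M \<noteq> 0"
  obtains B where "B \<in> carrier_mat k k" "M * B = 1\<^sub>m k" "B * M = 1\<^sub>m k"
  using det_non_zero_imp_unit[OF assms, of "()"] unfolding Units_def by (auto simp: ring_mat_def)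

lemma det_nonzero_left_kernel:
  fixes M :: "complex mat"
  assumes M: "M \<in> carrier_mat k k" "det M \<noteq> 0" and x: "\<And>c. c < k \<Longrightarrow> (\<Sum>i<k. x i * M $$ (i, c)) = 0" and j: "j < k"
  shows "x j = 0"
proof -
  obtain B where B: "B \<in> carrier_mat k k" "M * B = 1\<^sub>m k" using det_nonzero_inverse[OF M] by metis
  have "x j = (\<Sum>i<k. x i * (M * B) $$ (i, j))"
    using j by (simp add: B(2) if_distrib cong: if_cong)
  also have "\<dots> = (\<Sum>i<k. \<Sum>c<k. x i * M $$ (i, c) * B $$ (c, j))"
    using M B j by (intro sum.cong refl) (subst mult_mat_entry[of _ k k _ k], auto simp: sum_distrib_left mult_ac)
  also have "\<dots> = (\<Sum>c<k. (\<Sum>i<k. x i * M $$ (i, c)) * B $$ (c, j))"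
    by (subst sum.swap) (simp add: sum_distrib_right)
  also have "\<dots> = 0" by (simp add: x)
  finally show ?thesis .
qed

text \<open>Stated for an abstract \<open>P\<close> that can be pulled back along column operations,
  because it serves twice: for the rows \<open>w\<close> of a triple with \<open>m = r < n\<close>,
  and for a square matrix with \<open>m = r - 1\<close>. The companion \<open>z\<close> changes
  oppositely, so \<open>w z\<close> and its nonvanishing determinant persist and keep the rows of
  \<open>w\<close> independent.\<close>

lemma row_elimination:
  assumes step: "\<And>w z Y. w \<in> carrier_mat r n \<Longrightarrow> z \<in> carrier_mat n r \<Longrightarrow> Y \<in> carrier_mat n n \<Longrightarrow> Y * Y = 0\<^sub>m n n \<Longrightarrow>
      (\<And>i. i < n \<Longrightarrow> Y $$ (i, i) = 0) \<Longrightarrow> P (w * (1\<^sub>m n - Y)) ((1\<^sub>m n + Y) * z) \<Longrightarrow> P w z"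
    and m: "m \<le> r" "m < n"
    and base: "\<And>w z. w \<in> carrier_mat r n \<Longrightarrow> z \<in> carrier_mat n r \<Longrightarrow> det (w * z) \<noteq> 0 \<Longrightarrow> std_rows n m w \<Longrightarrow> P w z"
    and w: "w \<in> carrier_mat r n" "z \<in> carrier_mat n r" "det (w * z) \<noteq> 0"
  shows "P w z"
proof -
  have op: "P w z" if w: "w \<in> carrier_mat r n" "z \<in> carrier_mat n r" "det (w * z) \<noteq> 0" and s: "s < n" "g s = 0"
    and next_P: "\<And>w' z'. w' \<in> carrier_mat r n \<Longrightarrow> z' \<in> carrier_mat n r \<Longrightarrow> det (w' * z') \<noteq> 0 \<Longrightarrow>
      (\<And>i p. i < r \<Longrightarrow> p < n \<Longrightarrow> w' $$ (i, p) = w $$ (i, p) - w $$ (i, s) * g p) \<Longrightarrow> P w' z'" for w z s g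
  proof (rule step[OF w(1,2), of "Ycol n s g"])
    show "P (w * (1\<^sub>m n - Ycol n s g)) ((1\<^sub>m n + Ycol n s g) * z)"
    proof (rule next_P)
      show "det (w * (1\<^sub>m n - Ycol n s g) * ((1\<^sub>m n + Ycol n s g) * z)) \<noteq> 0"
        using w(3) mult_one_minus_plus[OF w(1,2) Ycol_carrier Ycol_square[of g s, OF s(2)]] by simp
      show "(w * (1\<^sub>m n - Ycol n s g)) $$ (i, p) = w $$ (i, p) - w $$ (i, s) * g p" if "i < r" "p < n" for i p
        by (rule Ycol_col_op[OF w(1) that s(1)])
    qed (use w in auto)
  qed (use s Ycol_square Ycol_diag in auto)
  have "\<forall>w z. w \<in> carrier_mat r n \<longrightarrow> z \<in> carrier_mat n r \<longrightarrow> det (w * z) \<noteq> 0 \<longrightarrow> std_rows n j w \<longrightarrow> P w z" if "j \<le> m" for j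
    using that
  proof (induction j rule: inc_induct)
    case base
    then show ?case using assms(4) by blast
  next
    case (step j)
    then have j: "j < r" "Suc j < n" using m by auto
    \<comment> \<open>Pivot 1: column \<open>j\<close> clears the rest of row \<open>j\<close>.
      Earlier rows have 0 in column \<open>j\<close> and stay as they are.\<close>
    have A3: "P w z" if w: "w \<in> carrier_mat r n" "z \<in> carrier_mat n r" "det (w * z) \<noteq> 0" "std_rows n j w" "w $$ (j, j) = 1" for w z
    proof (rule op[OF w(1-3), of j "\<lambda>p. if p = j then 0 else w $$ (j, p)"])
      fix w' z' assume w': "w' \<in> carrier_mat r n" "z' \<in> carrier_mat n r" "det (w' * z') \<noteq> 0"
        "\<And>i p. i < r \<Longrightarrow> p < n \<Longrightarrow> w' $$ (i, p) = w $$ (i, p) - w $$ (i, j) * (if p = j then 0 else w $$ (j, p))"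
      have "std_rows n (Suc j) w'"
        using w(4,5) w'(4) j by (auto simp: std_rows_def less_Suc_eq)
      with w' step.IH show "P w' z'" by blast
    qed (use j in auto)
    \<comment> \<open>A nonzero entry to the right of the pivot place produces the pivot 1 by adding
      a multiple of its column.\<close>
    have A2: "P w z" if w: "w \<in> carrier_mat r n" "z \<in> carrier_mat n r" "det (w * z) \<noteq> 0" "std_rows n j w"
      and q: "j < q" "q < n" "w $$ (j, q) \<noteq> 0" for w z q
    proof (rule op[OF w(1-3), of q "\<lambda>p. if p = j then - ((1 - w $$ (j, j)) / w $$ (j, q)) else 0"])
      fix w' z' assume w': "w' \<in> carrier_mat r n" "z' \<in> carrier_mat n r" "det (w' * z') \<noteq> 0"
        "\<And>i p. i < r \<Longrightarrow> p < n \<Longrightarrow> w' $$ (i, p) = w $$ (i, p) - w $$ (i, q) * (if p = j then - ((1 - w $$ (j, j)) / w $$ (j, q)) else 0)"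
      have "std_rows n j w'" using w(4) w'(4) j q by (auto simp: std_rows_def)
      moreover have "w' $$ (j, j) = 1" using w'(4)[of j j] j q by simp
      ultimately show "P w' z'" using A3 w' by blast
    qed (use q in auto)
    show ?case
    proof (intro allI impI)
      fix w z assume w: "w \<in> carrier_mat r n" "z \<in> carrier_mat n r" "det (w * z) \<noteq> 0" "std_rows n j w"
      show "P w z"
      proof (cases "\<exists>q. j < q \<and> q < n \<and> w $$ (j, q) \<noteq> 0")
        case True
        then show ?thesis using A2[OF w] by blast
      next
        case False
        have nz: "w $$ (j, j) \<noteq> 0"
        proof
          assume 0: "w $$ (j, j) = 0"
          \<comment> \<open>With row \<open>j\<close> zero from the pivot place on, this is a linear
            relation between the rows of \<open>w\<close>; it passes to \<open>w z\<close>, which is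
            invertible.\<close>
          define x where "x i = (if i < j then - w $$ (j, i) else if i = j then 1 else 0)" for i
          have xw: "(\<Sum>i<r. x i * w $$ (i, p)) = 0" if p: "p < n" for p
          proof -
            have "(\<Sum>i<r. x i * w $$ (i, p)) = (\<Sum>i\<in>{..<j} \<union> {j}. x i * w $$ (i, p))"
              by (rule sum.mono_neutral_right) (use j in \<open>auto simp: x_def\<close>)
            also have "\<dots> = (\<Sum>i<j. x i * w $$ (i, p)) + w $$ (j, p)"
              by (simp add: x_def)
            also have "(\<Sum>i<j. x i * w $$ (i, p)) = (\<Sum>i<j. if i = p then - w $$ (j, p) else 0)"
              using w(4) p by (intro sum.cong refl) (auto simp: x_def std_rows_def)
            also have "(\<Sum>i<j. if i = p then - w $$ (j, p) else 0) + w $$ (j, p) = 0" using False 0 p by (cases p j rule: linorder_cases) auto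
            finally show ?thesis .
          qed
          have "(\<Sum>i<r. x i * (w * z) $$ (i, c)) = 0" if c: "c < r" for c
          proof -
            have "(\<Sum>i<r. x i * (w * z) $$ (i, c)) = (\<Sum>i<r. \<Sum>p<n. x i * w $$ (i, p) * z $$ (p, c))"
              using w c by (intro sum.cong refl) (subst mult_mat_entry[of _ r n _ r], auto simp: sum_distrib_left mult_ac)
            also have "\<dots> = (\<Sum>p<n. (\<Sum>i<r. x i * w $$ (i, p)) * z $$ (p, c))"
              by (subst sum.swap) (simp add: sum_distrib_right)
            finally show ?thesis by (simp add: xw)
          qed
          from det_nonzero_left_kernel[OF _ w(3) this j(1)] have "x j = 0" using w by auto
          then show False by (simp add: x_def)
        qed
        \<comment> \<open>The pivot is the only nonzero entry from its place on and cannot be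
          rescaled within its own column. It is copied into the next column, which exists because
          \<open>Suc j < n\<close>, and the previous case applies.\<close>
        show ?thesis
        proof (rule op[OF w(1-3), of j "\<lambda>p. if p = Suc j then - 1 else 0"])
          fix w' z' assume w': "w' \<in> carrier_mat r n" "z' \<in> carrier_mat n r" "det (w' * z') \<noteq> 0"
            "\<And>i p. i < r \<Longrightarrow> p < n \<Longrightarrow> w' $$ (i, p) = w $$ (i, p) - w $$ (i, j) * (if p = Suc j then - 1 else 0)"
          have "std_rows n j w'" using w(4) w'(4) j by (auto simp: std_rows_def)
          moreover have "w' $$ (j, Suc j) \<noteq> 0" using w'(4)[of j "Suc j"] j nz False by auto
          ultimately show "P w' z'" using A2[OF w'(1-3)] j by blast
        qed (use j in auto)
      qed
    qed
  qed
  from this[of 0] show ?thesis using w by (auto simp: std_rows_def)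
qed

definition wstd :: "nat \<Rightarrow> nat \<Rightarrow> complex mat" where
  "wstd n k = mat k n (\<lambda>(c, j). if c = j then 1 else 0)"

definition ublk :: "nat \<Rightarrow> nat \<Rightarrow> complex mat \<Rightarrow> complex mat" where
  "ublk n k M = mat n k (\<lambda>(i, c). if i < k then M $$ (i, c) else 0)"

definition ablk :: "nat \<Rightarrow> nat \<Rightarrow> complex mat \<Rightarrow> complex mat" where
  "ablk n k A = mat n n (\<lambda>(i, j). if k \<le> i \<and> k \<le> j then A $$ (i - k, j - k) else 0)"

definition slice :: "nat \<Rightarrow> nat \<Rightarrow> complex mat \<Rightarrow> complex mat \<Rightarrow> triple" where
  "slice n k M A = (ablk n k A, ublk n k M, wstd n k)"

lemma slice_carrier [simp]: "wstd n k \<in> carrier_mat k n" "ublk n k M \<in> carrier_mat n k" "ablk n k A \<in> carrier_mat n n"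
  "slice n k M A \<in> carr n k"
  by (auto simp: wstd_def ublk_def ablk_def slice_def)

lemma slice_dims [simp]: "dim_row (wstd n k) = k" "dim_col (wstd n k) = n" "dim_row (ublk n k M) = n" "dim_col (ublk n k M) = k"
  "dim_row (ablk n k A) = n" "dim_col (ablk n k A) = n"
  by (auto simp: wstd_def ublk_def ablk_def)

lemma wstd_mult_entry:
  assumes "k \<le> n" "x \<in> carrier_mat n m" "c < k" "j < m"
  shows "(wstd n k * x) $$ (c, j) = x $$ (c, j)"
proof -
  have "(wstd n k * x) $$ (c, j) = (\<Sum>l<n. wstd n k $$ (c, l) * x $$ (l, j))"
    using assms by (intro mult_mat_entry) auto
  also have "\<dots> = (\<Sum>l<n. if l = c then x $$ (c, j) else 0)"
    using assms by (intro sum.cong refl) (auto simp: wstd_def)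
  finally show ?thesis using assms by simp
qed

lemma mult_wstd_entry:
  assumes "k \<le> n" "c \<in> carrier_mat m k" "i < m" "j < n"
  shows "(c * wstd n k) $$ (i, j) = (if j < k then c $$ (i, j) else 0)"
proof -
  have "(c * wstd n k) $$ (i, j) = (\<Sum>l<k. c $$ (i, l) * wstd n k $$ (l, j))"
    using assms by (intro mult_mat_entry) auto
  also have "\<dots> = (\<Sum>l<k. if l = j then c $$ (i, j) else 0)"
    using assms by (intro sum.cong refl) (auto simp: wstd_def)
  finally show ?thesis using assms by simp
qed

lemma wstd_ublk: "k \<le> n \<Longrightarrow> M \<in> carrier_mat k k \<Longrightarrow> wstd n k * ublk n k M = M"
  by (rule eq_matI) (auto simp: wstd_mult_entry[of k n _ k] ublk_def simp del: index_mult_mat(1))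

lemma sum_split_lessThan:
  fixes f :: "nat \<Rightarrow> complex"
  assumes "k \<le> n" "\<And>l. k \<le> l \<Longrightarrow> l < n \<Longrightarrow> f l = 0"
  shows "(\<Sum>l<n. f l) = (\<Sum>l<k. f l)"
  by (rule sum.mono_neutral_right) (use assms in auto)

text \<open>Once \<open>w\<close> is standard, invertibility of \<open>M\<close> allows a unipotent
  conjugation to remove the lower part of \<open>u\<close>, and a translation to clear everything
  outside the lower right block of \<open>a\<close>. What remains is the expression
  \<open>a22 - u2 M^-1 a12\<close> of Schur type.\<close>

lemma std_normal_form:
  assumes k: "k \<le> n" and a: "a \<in> carrier_mat n n" and u: "u \<in> carrier_mat n k"
    and M: "M = mat k k (\<lambda>(i, j). u $$ (i, j))" and B: "B \<in> carrier_mat k k" "M * B = 1\<^sub>m k" "B * M = 1\<^sub>m k"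
  shows "moves n k (a, u, wstd n k) (slice n k M (mat (n - k) (n - k)
     (\<lambda>(i, j). a $$ (i + k, j + k) - (\<Sum>d<k. (\<Sum>c<k. u $$ (i + k, c) * B $$ (c, d)) * a $$ (d, j + k)))))"
proof -
  define X where "X i d = (\<Sum>c<k. u $$ (i, c) * B $$ (c, d))" for i d
  \<comment> \<open>Only the lower left block is nonzero. Hence \<open>w Y = 0\<close> and the
    standard \<open>w\<close> survives, while the lower rows \<open>u2\<close> of \<open>u\<close>
    become \<open>u2 - u2 B M = 0\<close>.\<close>
  define Y where "Y = mat n n (\<lambda>(i, j). if k \<le> i \<and> j < k then - X i j else 0)"
  have Y: "Y \<in> carrier_mat n n" by (simp add: Y_def)
  have YY: "Y * Y = 0\<^sub>m n n"
  proof (rule eq_matI)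
    fix i j assume "i < dim_row (0\<^sub>m n n :: complex mat)" "j < dim_col (0\<^sub>m n n :: complex mat)"
    then have ij: "i < n" "j < n" by auto
    have "(Y * Y) $$ (i, j) = (\<Sum>l<n. Y $$ (i, l) * Y $$ (l, j))" using ij Y by (intro mult_mat_entry) auto
    also have "\<dots> = 0" using ij by (intro sum.neutral) (auto simp: Y_def)
    finally show "(Y * Y) $$ (i, j) = 0\<^sub>m n n $$ (i, j)" using ij by simp
  qed (auto simp: Y_def)
  have wY: "wstd n k * (1\<^sub>m n - Y) = wstd n k"
  proof (rule eq_matI)
    fix c j assume "c < dim_row (wstd n k)" "j < dim_col (wstd n k)"
    then have cj: "c < k" "j < n" by (auto simp: wstd_def)
    then show "(wstd n k * (1\<^sub>m n - Y)) $$ (c, j) = wstd n k $$ (c, j)"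
      using k Y by (subst wstd_mult_entry[of k n _ n]) (auto simp: Y_def wstd_def)
  qed (auto simp: Y_def wstd_def)
  have Bu: "(\<Sum>d<k. X i d * u $$ (d, c)) = u $$ (i, c)" if "c < k" for i c
  proof -
    have "(\<Sum>d<k. X i d * u $$ (d, c)) = (\<Sum>e<k. u $$ (i, e) * (\<Sum>d<k. B $$ (e, d) * M $$ (d, c)))"
      unfolding X_def sum_distrib_left sum_distrib_right
      by (subst sum.swap) (use that in \<open>auto simp: M mult_ac intro!: sum.cong\<close>)
    also have "\<dots> = (\<Sum>e<k. u $$ (i, e) * (B * M) $$ (e, c))"
      using B that by (intro sum.cong refl) (subst mult_mat_entry[of _ k k _ k], auto simp: M)
    also have "\<dots> = u $$ (i, c)"
      using that by (simp add: B(3) if_distrib cong: if_cong)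
    finally show ?thesis .
  qed
  have Yx: "((1\<^sub>m n + Y) * x) $$ (i, j) = x $$ (i, j) - (if k \<le> i then (\<Sum>d<k. X i d * x $$ (d, j)) else 0)"
    if "x \<in> carrier_mat n m" "i < n" "j < m" for x i j m
  proof -
    have "((1\<^sub>m n + Y) * x) $$ (i, j) = x $$ (i, j) + (Y * x) $$ (i, j)"
      using that Y by (simp add: add_mult_distrib_mat[of _ n n] del: index_mult_mat(1))
    also have "(Y * x) $$ (i, j) = (\<Sum>l<n. Y $$ (i, l) * x $$ (l, j))"
      using that Y by (intro mult_mat_entry) auto
    also have "\<dots> = (\<Sum>l<k. Y $$ (i, l) * x $$ (l, j))"
      using k that by (intro sum_split_lessThan) (auto simp: Y_def)
    also have "\<dots> = - (if k \<le> i then (\<Sum>d<k. X i d * x $$ (d, j)) else 0)"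
      using k that by (auto simp: Y_def sum_negf[symmetric] intro!: sum.cong)
    finally show ?thesis by simp
  qed
  have Yu: "(1\<^sub>m n + Y) * u = ublk n k M"
    by (rule eq_matI) (use u k Y in \<open>auto simp: Yx[OF u] ublk_def M Bu simp del: index_mult_mat(1)\<close>)
  define a1 where "a1 = (1\<^sub>m n + Y) * a * (1\<^sub>m n - Y)"
  have a1: "a1 \<in> carrier_mat n n" using a Y by (simp add: a1_def)
  have a1e: "a1 $$ (i, j) = a $$ (i, j) - (\<Sum>d<k. X i d * a $$ (d, j))" if "k \<le> i" "i < n" "k \<le> j" "j < n" for i j
  proof -
    let ?b = "(1\<^sub>m n + Y) * a"
    have b: "?b \<in> carrier_mat n n" using a Y by simp
    have "a1 $$ (i, j) = (\<Sum>l<n. ?b $$ (i, l) * (1\<^sub>m n - Y) $$ (l, j))"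
      unfolding a1_def using that b Y by (intro mult_mat_entry) auto
    also have "\<dots> = (\<Sum>l<n. if l = j then ?b $$ (i, j) else 0)"
      using that by (intro sum.cong) (auto simp: Y_def simp del: index_mult_mat(1))
    also have "\<dots> = ?b $$ (i, j)" using that by simp
    finally show ?thesis using that by (simp add: Yx[OF a] del: index_mult_mat(1))
  qed
  have m1: "move n k (a, u, wstd n k) (a1, ublk n k M, wstd n k)"
  proof -
    have "Y $$ (i, i) = 0" if "i < n" for i using that by (auto simp: Y_def)
    then show ?thesis using move_conj[of "(a, u, wstd n k)" n k Y] a u Y YY by (simp add: a1_def[symmetric] Yu wY)
  qed
  \<comment> \<open>\<open>c w\<close> clears the first \<open>k\<close> columns of
    \<open>a1\<close>; \<open>u b\<close> clears the remaining entries of the first \<open>k\<close>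
    rows, where \<open>b\<close> solves \<open>M b = - a1\<close>.\<close>
  define c where "c = mat n k (\<lambda>(i, d). - a1 $$ (i, d))"
  define b where "b = mat k n (\<lambda>(d, j). if j < k then 0 else - (\<Sum>e<k. B $$ (d, e) * a1 $$ (e, j)))"
  have cb: "c \<in> carrier_mat n k" "b \<in> carrier_mat k n" by (auto simp: b_def c_def)
  have ub: "(ublk n k M * b) $$ (i, j) = (if i < k \<and> k \<le> j then - a1 $$ (i, j) else 0)" if "i < n" "j < n" for i j
  proof -
    have *: "(ublk n k M * b) $$ (i, j) = (\<Sum>l<k. ublk n k M $$ (i, l) * b $$ (l, j))"
      using that cb by (intro mult_mat_entry) auto
    show ?thesis
    proof (cases "i < k \<and> k \<le> j")
      case True
      have "(\<Sum>l<k. ublk n k M $$ (i, l) * b $$ (l, j)) = - (\<Sum>l<k. \<Sum>e<k. M $$ (i, l) * B $$ (l, e) * a1 $$ (e, j))"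
        using True that by (auto simp: ublk_def b_def sum_negf[symmetric] sum_distrib_left mult_ac intro!: sum.cong)
      also have "(\<Sum>l<k. \<Sum>e<k. M $$ (i, l) * B $$ (l, e) * a1 $$ (e, j)) = (\<Sum>e<k. (M * B) $$ (i, e) * a1 $$ (e, j))"
        using True B by (subst sum.swap, intro sum.cong refl) (subst mult_mat_entry[of _ k k _ k], auto simp: M sum_distrib_right)
      also have "\<dots> = (\<Sum>e<k. if e = i then a1 $$ (i, j) else 0)"
        unfolding B(2) using True by (intro sum.cong) auto
      finally show ?thesis unfolding * using True by simp
    next
      case False
      then show ?thesis unfolding * using that by (auto simp: ublk_def b_def intro!: sum.neutral)
    qed
  qed
  have m2: "move n k (a1, ublk n k M, wstd n k) (ttrans b c (a1, ublk n k M, wstd n k))"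
    using cb a1 by (intro move_trans) auto
  have "a1 + (ublk n k M * b + c * wstd n k) = ablk n k (mat (n - k) (n - k)
     (\<lambda>(i, j). a $$ (i + k, j + k) - (\<Sum>d<k. X (i + k) d * a $$ (d, j + k))))"
  proof (rule eq_matI)
    fix i j assume "i < dim_row (ablk n k (mat (n - k) (n - k) (\<lambda>(i, j). a $$ (i + k, j + k) - (\<Sum>d<k. X (i + k) d * a $$ (d, j + k)))))"
      "j < dim_col (ablk n k (mat (n - k) (n - k) (\<lambda>(i, j). a $$ (i + k, j + k) - (\<Sum>d<k. X (i + k) d * a $$ (d, j + k)))))"
    then have ij: "i < n" "j < n" by (auto simp: ablk_def)
    have "(a1 + (ublk n k M * b + c * wstd n k)) $$ (i, j) = a1 $$ (i, j) + ((ublk n k M * b) $$ (i, j) + (c * wstd n k) $$ (i, j))"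
      using ij a1 cb by (simp add: wstd_def ublk_def del: index_mult_mat(1))
    also have "\<dots> = (if k \<le> i \<and> k \<le> j then a1 $$ (i, j) else 0)"
      unfolding ub[OF ij] mult_wstd_entry[OF k cb(1) ij] using ij by (auto simp: c_def)
    finally show "(a1 + (ublk n k M * b + c * wstd n k)) $$ (i, j) = ablk n k (mat (n - k) (n - k)
     (\<lambda>(i, j). a $$ (i + k, j + k) - (\<Sum>d<k. X (i + k) d * a $$ (d, j + k)))) $$ (i, j)"
      using ij by (auto simp: ablk_def a1e)
  qed (use a1 cb in \<open>auto simp: ablk_def wstd_def ublk_def\<close>)
  then show ?thesis
    using m1 m2 by (simp add: slice_def X_def)
qed

lemma normal_form:
  assumes k: "k < n" and T: "(a, u, w) \<in> carr n k" and det: "det (w * u) \<noteq> 0"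
  obtains A where "A \<in> carrier_mat (n - k) (n - k)" "moves n k (a, u, w) (slice n k (w * u) A)"
proof -
  have "\<forall>a\<in>carrier_mat n n. \<exists>A\<in>carrier_mat (n - k) (n - k). moves n k (a, u, w) (slice n k (w * u) A)"
  proof (rule row_elimination[where r = k and n = n and m = k and P = "\<lambda>w z. \<forall>a\<in>carrier_mat n n. \<exists>A\<in>carrier_mat (n - k) (n - k). moves n k (a, z, w) (slice n k (w * z) A)"])
    fix w z Y :: "complex mat"
    assume w: "w \<in> carrier_mat k n" and z: "z \<in> carrier_mat n k" and Y: "Y \<in> carrier_mat n n" "Y * Y = 0\<^sub>m n n"
      "\<And>i. i < n \<Longrightarrow> Y $$ (i, i) = 0"
      and IH: "\<forall>a\<in>carrier_mat n n. \<exists>A\<in>carrier_mat (n - k) (n - k).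
        moves n k (a, (1\<^sub>m n + Y) * z, w * (1\<^sub>m n - Y)) (slice n k (w * (1\<^sub>m n - Y) * ((1\<^sub>m n + Y) * z)) A)"
    show "\<forall>a\<in>carrier_mat n n. \<exists>A\<in>carrier_mat (n - k) (n - k). moves n k (a, z, w) (slice n k (w * z) A)"
    proof
      fix a :: "complex mat" assume a: "a \<in> carrier_mat n n"
      have "move n k (a, z, w) ((1\<^sub>m n + Y) * a * (1\<^sub>m n - Y), (1\<^sub>m n + Y) * z, w * (1\<^sub>m n - Y))"
        using move_conj[of "(a, z, w)" n k Y] a w z Y by auto
      moreover have "(1\<^sub>m n + Y) * a * (1\<^sub>m n - Y) \<in> carrier_mat n n" using a Y by auto
      ultimately show "\<exists>A\<in>carrier_mat (n - k) (n - k). moves n k (a, z, w) (slice n k (w * z) A)"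
        using IH unfolding mult_one_minus_plus[OF w z Y(1,2)] by (meson converse_rtranclp_into_rtranclp)
    qed
  next
    fix w z :: "complex mat"
    assume w: "w \<in> carrier_mat k n" and z: "z \<in> carrier_mat n k" and det: "det (w * z) \<noteq> 0" and std: "std_rows n k w"
    have ws: "w = wstd n k" using w std by (intro eq_matI) (auto simp: std_rows_def wstd_def)
    have M: "w * z = mat k k (\<lambda>(i, j). z $$ (i, j))"
      unfolding ws using z k by (intro eq_matI) (auto simp: wstd_mult_entry[of k n _ k] simp del: index_mult_mat(1))
    obtain B where B: "B \<in> carrier_mat k k" "w * z * B = 1\<^sub>m k" "B * (w * z) = 1\<^sub>m k"
      using det_nonzero_inverse[OF mult_carrier_mat[OF w z] det] by metis
    show "\<forall>a\<in>carrier_mat n n. \<exists>A\<in>carrier_mat (n - k) (n - k). moves n k (a, z, w) (slice n k (w * z) A)"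
    proof
      fix a :: "complex mat" assume a: "a \<in> carrier_mat n n"
      show "\<exists>A\<in>carrier_mat (n - k) (n - k). moves n k (a, z, w) (slice n k (w * z) A)"
        using std_normal_form[OF less_imp_le[OF k] a z M B] unfolding ws[symmetric]
        by (intro bexI) auto
    qed
  qed (use k T det in auto)
  then show ?thesis using T that by auto
qed

text \<open>A section through the hypersurface \<open>det (w u) = 0\<close>.\<close>

definition sect :: "nat \<Rightarrow> nat \<Rightarrow> complex mat \<Rightarrow> complex \<Rightarrow> triple" where
  "sect n k M s = (mat n n (\<lambda>(i, j). if i = k - 1 \<and> j = k then s else 0),
     mat n k (\<lambda>(i, c). if i < k then M $$ (i, c) else if i = k \<and> c = k - 1 then 1 else 0), wstd n k)"

lemma sect_carr [simp]: "sect n k M s \<in> carr n k"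
  by (simp add: sect_def)

definition e11 :: "nat \<Rightarrow> complex \<Rightarrow> complex mat" where
  "e11 l x = mat l l (\<lambda>(i, j). if i = 0 \<and> j = 0 then x else 0)"

text \<open>Here \<open>a22 = 0\<close>, \<open>u2\<close> has its single 1 in column
  \<open>k - 1\<close>, and \<open>a12\<close> has its single \<open>s\<close> in row
  \<open>k - 1\<close>, so \<open>- u2 M^-1 a12\<close> is \<open>- s\<close> times the last corner
  of \<open>M^-1\<close>. That corner may have a pole along \<open>det M = 0\<close>, although the
  section itself is polynomial in \<open>M\<close> and \<open>s\<close>.\<close>

lemma sect_moves:
  assumes k: "0 < k" "k < n" and M: "M \<in> carrier_mat k k" and B: "B \<in> carrier_mat k k" "M * B = 1\<^sub>m k" "B * M = 1\<^sub>m k"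
  shows "moves n k (sect n k M s) (slice n k M (e11 (n - k) (- (s * B $$ (k - 1, k - 1)))))"
proof -
  let ?a = "mat n n (\<lambda>(i, j). if i = k - 1 \<and> j = k then s else 0) :: complex mat"
  let ?u = "mat n k (\<lambda>(i, c). if i < k then M $$ (i, c) else if i = k \<and> c = k - 1 then 1 else 0) :: complex mat"
  have M': "M = mat k k (\<lambda>(i, j). ?u $$ (i, j))" using M k by (intro eq_matI) auto
  have "mat (n - k) (n - k) (\<lambda>(i, j). ?a $$ (i + k, j + k) - (\<Sum>d<k. (\<Sum>c<k. ?u $$ (i + k, c) * B $$ (c, d)) * ?a $$ (d, j + k)))
     = e11 (n - k) (- (s * B $$ (k - 1, k - 1)))"
  proof (rule eq_matI)
    fix i j assume "i < dim_row (e11 (n - k) (- (s * B $$ (k - 1, k - 1))))" "j < dim_col (e11 (n - k) (- (s * B $$ (k - 1, k - 1))))"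
    then have ij: "i + k < n" "j + k < n" by (auto simp: e11_def)
    have 1: "(\<Sum>c<k. ?u $$ (i + k, c) * B $$ (c, d)) = (if i = 0 then B $$ (k - 1, d) else 0)" if "d < k" for d
    proof -
      have "(\<Sum>c<k. ?u $$ (i + k, c) * B $$ (c, d)) = (\<Sum>c<k. if c = k - 1 then (if i = 0 then B $$ (k - 1, d) else 0) else 0)"
        using ij by (intro sum.cong) auto
      then show ?thesis using k by simp
    qed
    have "(\<Sum>d<k. (\<Sum>c<k. ?u $$ (i + k, c) * B $$ (c, d)) * ?a $$ (d, j + k)) =
       (\<Sum>d<k. if d = k - 1 then (if i = 0 \<and> j = 0 then B $$ (k - 1, k - 1) * s else 0) else 0)"
    proof (intro sum.cong refl)
      fix d assume "d \<in> {..<k}"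
      then have d: "d < k" by simp
      show "(\<Sum>c<k. ?u $$ (i + k, c) * B $$ (c, d)) * ?a $$ (d, j + k) =
         (if d = k - 1 then (if i = 0 \<and> j = 0 then B $$ (k - 1, k - 1) * s else 0) else 0)"
        unfolding 1[OF d] using d ij k by auto
    qed
    also have "\<dots> = (if i = 0 \<and> j = 0 then B $$ (k - 1, k - 1) * s else 0)" using k by simp
    finally show "mat (n - k) (n - k) (\<lambda>(i, j). ?a $$ (i + k, j + k) - (\<Sum>d<k. (\<Sum>c<k. ?u $$ (i + k, c) * B $$ (c, d)) * ?a $$ (d, j + k))) $$ (i, j)
     = e11 (n - k) (- (s * B $$ (k - 1, k - 1))) $$ (i, j)"
      using ij k by (auto simp: e11_def)
  qed (auto simp: e11_def)
  with std_normal_form[of k n ?a ?u M B] M' k B show ?thesis by (simp add: sect_def)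
qed

section \<open>The bordered characteristic polynomial\<close>

declare minus_carrier_mat [simp]

lemma polyfam_if [pf]: "(b \<Longrightarrow> polyfam V f) \<Longrightarrow> (\<not> b \<Longrightarrow> polyfam V g) \<Longrightarrow> polyfam V (\<lambda>x. if b then f x else g x)"
  by (cases b) auto

text \<open>The determinant of \<open>t - a\<close> bordered by \<open>u\<close> and
  \<open>- w\<close>. The border absorbs the translations \<open>u b + c w\<close>, under which the
  characteristic polynomial of \<open>a\<close> itself would change.\<close>

definition charb :: "nat \<Rightarrow> nat \<Rightarrow> triple \<Rightarrow> complex poly" where
  "charb n k T = (case T of (a, u, w) \<Rightarrow> det (mat (n + k) (n + k) (\<lambda>(i, j).
     if i < n then (if j < n then [:- a $$ (i, j), if i = j then 1 else 0:] else [:u $$ (i, j - n):])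
     else (if j < n then [:- w $$ (i - n, j):] else 0))))"

lemma poly_charb:
  assumes "(a, u, w) \<in> carr n k"
  shows "poly (charb n k (a, u, w)) t = det (four_block_mat (t \<cdot>\<^sub>m 1\<^sub>m n - a) u (- w) (0\<^sub>m k k))"
  unfolding charb_def prod.case
  by (rule poly_det_cong[of _ "n + k"]) (use assms in auto)

lemma charb_eqI: "(\<And>t. poly (charb n k T) t = poly q t) \<Longrightarrow> charb n k T = q"
  by (simp add: poly_eq_poly_eq_iff[symmetric] fun_eq_iff)

lemma four_block_carrier [simp]:
  "A \<in> carrier_mat n n \<Longrightarrow> D \<in> carrier_mat k k \<Longrightarrow> four_block_mat A B C D \<in> carrier_mat (n + k) (n + k)"
  by (rule four_block_carrier_mat)

lemma det_mult3:
  fixes A B C :: "complex mat"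
  assumes "A \<in> carrier_mat m m" "B \<in> carrier_mat m m" "C \<in> carrier_mat m m"
  shows "det (A * B * C) = det A * det B * det C"
  using det_mult[OF mult_carrier_mat[OF assms(1,2)] assms(3)] det_mult[OF assms(1,2)] by simp

lemma charb_tconj:
  assumes T: "T \<in> carr n k" and g: "g \<in> carrier_mat n n" "h \<in> carrier_mat n n" "g * h = 1\<^sub>m n"
  shows "charb n k (tconj g h T) = charb n k T"
proof (rule charb_eqI)
  fix t :: complex
  obtain a u w where T': "T = (a, u, w)" by (cases T)
  have c: "a \<in> carrier_mat n n" "u \<in> carrier_mat n k" "w \<in> carrier_mat k n" using T by (auto simp: T')
  define N where "N = t \<cdot>\<^sub>m 1\<^sub>m n - a"
  have N: "N \<in> carrier_mat n n" using c by (simp add: N_def)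
  let ?G = "four_block_mat g (0\<^sub>m n k) (0\<^sub>m k n) (1\<^sub>m k)"
  let ?H = "four_block_mat h (0\<^sub>m n k) (0\<^sub>m k n) (1\<^sub>m k)"
  let ?B = "four_block_mat N u (- w) (0\<^sub>m k k)"
  have gN: "g * N * h = t \<cdot>\<^sub>m 1\<^sub>m n - g * a * h"
  proof -
    have "g * N = t \<cdot>\<^sub>m g - g * a"
      unfolding N_def using c g by (subst mult_minus_distrib_mat[of _ n n _ n]) (auto simp: mult_smult_distrib[of _ n n _ n])
    then have "g * N * h = (t \<cdot>\<^sub>m g) * h - g * a * h"
      using c g by (simp add: minus_mult_distrib_mat[of _ n n _ _ n])
    then show ?thesis using g by (simp add: mult_smult_assoc_mat[of _ n n _ n])
  qed
  have 1: "?G * ?B = four_block_mat (g * N) (g * u) (- w) (0\<^sub>m k k)"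
    using c g N by (subst mult_four_block_mat[of _ n n _ k _ k _ _ n _ k]) auto
  have 2: "four_block_mat (g * N) (g * u) (- w) (0\<^sub>m k k) * ?H = four_block_mat (g * N * h) (g * u) (- (w * h)) (0\<^sub>m k k)"
    using c g N by (subst mult_four_block_mat[of _ n n _ k _ k _ _ n _ k]) auto
  have GH: "?G * ?H = 1\<^sub>m (n + k)"
    using g by (subst mult_four_block_mat[of _ n n _ k _ k _ _ n _ k]) auto
  have "det ?G * det ?H = 1"
    using det_mult[of ?G "n + k" ?H] g GH by simp
  have "det (?G * ?B * ?H) = det ?G * det ?B * det ?H"
    using g N by (intro det_mult3[of _ "n + k"]) auto
  also have "\<dots> = det ?B" using \<open>det ?G * det ?H = 1\<close> by (simp add: mult_ac)
  finally have "det (four_block_mat (t \<cdot>\<^sub>m 1\<^sub>m n - g * a * h) (g * u) (- (w * h)) (0\<^sub>m k k)) = det ?B"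
    unfolding 1 2 gN by simp
  then show "poly (charb n k (tconj g h T)) t = poly (charb n k T) t"
    using c g unfolding T' tconj.simps by (subst (1 2) poly_charb) (auto simp: N_def)
qed

text \<open>\<open>c w\<close> is a combination of border rows and \<open>u b\<close> one of border
  columns; unipotent block matrices subtract them.\<close>

lemma charb_ttrans:
  assumes T: "T \<in> carr n k" and b: "b \<in> carrier_mat k n" "c \<in> carrier_mat n k"
  shows "charb n k (ttrans b c T) = charb n k T"
proof (rule charb_eqI)
  fix t :: complex
  obtain a u w where T': "T = (a, u, w)" by (cases T)
  have cc: "a \<in> carrier_mat n n" "u \<in> carrier_mat n k" "w \<in> carrier_mat k n" using T by (auto simp: T')
  define N where "N = t \<cdot>\<^sub>m 1\<^sub>m n - a"
  have N: "N \<in> carrier_mat n n" using cc by (simp add: N_def)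
  let ?G = "four_block_mat (1\<^sub>m n) c (0\<^sub>m k n) (1\<^sub>m k)"
  let ?H = "four_block_mat (1\<^sub>m n) (0\<^sub>m n k) (- b) (1\<^sub>m k)"
  let ?B = "four_block_mat N u (- w) (0\<^sub>m k k)"
  have 1: "?G * ?B = four_block_mat (N - c * w) u (- w) (0\<^sub>m k k)"
    using cc b N by (subst mult_four_block_mat[of _ n n _ k _ k _ _ n _ k]) (auto simp: minus_add_uminus_mat[of _ n n])
  have 2: "four_block_mat (N - c * w) u (- w) (0\<^sub>m k k) * ?H = four_block_mat (N - c * w - u * b) u (- w) (0\<^sub>m k k)"
    using cc b N by (subst mult_four_block_mat[of _ n n _ k _ k _ _ n _ k]) (auto simp: minus_add_uminus_mat[of _ n n])
  have 3: "N - c * w - u * b = t \<cdot>\<^sub>m 1\<^sub>m n - (a + (u * b + c * w))"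
    unfolding N_def by (rule eq_matI) (use cc b in \<open>auto simp del: index_mult_mat(1)\<close>)
  have d: "det ?G = 1" "det ?H = 1"
    using b by (simp_all add: det_four_block_mat_lower_left_zero[of _ n _ k] det_four_block_mat_upper_right_zero[of _ n _ k])
  have "det (?G * ?B * ?H) = det ?G * det ?B * det ?H"
    using N by (intro det_mult3[of _ "n + k"]) auto
  then have "det (four_block_mat (t \<cdot>\<^sub>m 1\<^sub>m n - (a + (u * b + c * w))) u (- w) (0\<^sub>m k k)) = det ?B"
    unfolding 1 2 3 d by simp
  then show "poly (charb n k (ttrans b c T)) t = poly (charb n k T) t"
    using cc b unfolding T' ttrans.simps by (subst (1 2) poly_charb) (auto simp: N_def)
qed

lemma charb_tshift:
  assumes T: "T \<in> carr n k"
  shows "charb n k (tshift n r T) = pcompose (charb n k T) [:- r, 1:]"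
proof (rule charb_eqI)
  fix t :: complex
  obtain a u w where T': "T = (a, u, w)" by (cases T)
  have "t \<cdot>\<^sub>m 1\<^sub>m n - (a + r \<cdot>\<^sub>m 1\<^sub>m n) = (t - r) \<cdot>\<^sub>m 1\<^sub>m n - a"
    by (rule eq_matI) (use T in \<open>auto simp: T'\<close>)
  then show "poly (charb n k (tshift n r T)) t = poly (pcompose (charb n k T) [:- r, 1:]) t"
    using T unfolding T' tshift.simps poly_pcompose by (subst (1 2) poly_charb) auto
qed

lemma polyfam_charb [pf]: "polyfam UNIV (\<lambda>y. charb n k (Tof n k y))"
  unfolding charb_def Tof_def prod.case
  by (rule polyfam_det) (auto intro!: pf)

lemma charb_slice:
  assumes k: "k \<le> n" and M: "M \<in> carrier_mat k k" and A: "A \<in> carrier_mat (n - k) (n - k)"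
  shows "charb n k (slice n k M A) = Polynomial.smult (det M) (char_poly A)"
proof (rule charb_eqI)
  fix t :: complex
  \<comment> \<open>A translation depending on \<open>t\<close> that turns the first block of
    \<open>t - a\<close> into the identity. Then \<open>?P\<close> fixes \<open>ublk n k M\<close>,
    and the factorisation into \<open>?G\<close> and \<open>?H\<close> below works for singular
    \<open>M\<close> as well.\<close>
  define c where "c = mat n k (\<lambda>(i, d). if i = d then t - 1 else 0)"
  have c: "c \<in> carrier_mat n k" by (simp add: c_def)
  let ?P = "t \<cdot>\<^sub>m 1\<^sub>m n - (ablk n k A + (ublk n k M * 0\<^sub>m k n + c * wstd n k))"
  let ?K = "four_block_mat (1\<^sub>m k) (0\<^sub>m k (n - k)) (0\<^sub>m (n - k) k) (t \<cdot>\<^sub>m 1\<^sub>m (n - k) - A)"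
  have P: "?P = ?K"
  proof (rule eq_matI)
    fix i j assume "i < dim_row ?K" "j < dim_col ?K"
    then have ij: "i < n" "j < n" using A k by auto
    have "(c * wstd n k) $$ (i, j) = (if j < k then c $$ (i, j) else 0)"
      by (rule mult_wstd_entry[OF k c ij])
    then show "?P $$ (i, j) = ?K $$ (i, j)"
      using ij k A c by (auto simp: ablk_def c_def simp del: index_mult_mat(1))
  qed (use A k c in auto)
  have Pc: "?P \<in> carrier_mat n n" using c by (auto intro!: mult_carrier_mat[of _ _ k])
  have Pu: "?P * ublk n k M = ublk n k M"
  proof (rule eq_matI)
    fix i j assume "i < dim_row (ublk n k M)" "j < dim_col (ublk n k M)"
    then have ij: "i < n" "j < k" by auto
    have "(?P * ublk n k M) $$ (i, j) = (\<Sum>l<n. ?P $$ (i, l) * ublk n k M $$ (l, j))"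
      using ij Pc by (intro mult_mat_entry) auto
    also have "\<dots> = (\<Sum>l<n. if l = i then ublk n k M $$ (i, j) else 0)"
      unfolding P using ij k A by (intro sum.cong refl) (auto simp: ublk_def)
    finally show "(?P * ublk n k M) $$ (i, j) = ublk n k M $$ (i, j)" using ij by simp
  qed (use c in auto)
  let ?G = "four_block_mat ?P (0\<^sub>m n k) (- wstd n k) (1\<^sub>m k)"
  let ?H = "four_block_mat (1\<^sub>m n) (ublk n k M) (0\<^sub>m k n) M"
  have GH: "?G * ?H = four_block_mat ?P (ublk n k M) (- wstd n k) (0\<^sub>m k k)"
    using M Pc k Pu by (subst mult_four_block_mat[of _ n n _ k _ k _ _ n _ k])
       (auto simp: wstd_ublk[OF k M] intro!: cong_four_block_mat eq_matI simp del: index_mult_mat(1))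
  have "det ?P = det (t \<cdot>\<^sub>m 1\<^sub>m (n - k) - A)"
    unfolding P using A by (subst det_four_block_mat_lower_left_zero[of _ k _ "n - k"]) auto
  moreover have "poly (char_poly A) t = det (t \<cdot>\<^sub>m 1\<^sub>m (n - k) - A)"
  proof -
    have "- char_matrix A t = t \<cdot>\<^sub>m 1\<^sub>m (n - k) - A"
      unfolding char_matrix_def by (rule eq_matI) (use A in auto)
    then show ?thesis using char_poly_matrix[OF A, of t] by simp
  qed
  moreover have "det (?G * ?H) = det ?P * det M"
    using Pc M by (subst det_mult[of _ "n + k"])
      (auto simp: det_four_block_mat_lower_left_zero[of _ n _ k] det_four_block_mat_upper_right_zero[of _ n _ k])
  moreover have "charb n k (slice n k M A) = charb n k (ttrans (0\<^sub>m k n) c (slice n k M A))"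
    by (rule charb_ttrans[symmetric]) (auto simp: c)
  moreover have "poly (charb n k (ttrans (0\<^sub>m k n) c (slice n k M A))) t = det (four_block_mat ?P (ublk n k M) (- wstd n k) (0\<^sub>m k k))"
    unfolding slice_def ttrans.simps by (rule poly_charb) (use c in \<open>auto intro!: mult_carrier_mat[of _ _ k]\<close>)
  ultimately show "poly (charb n k (slice n k M A)) t = poly (Polynomial.smult (det M) (char_poly A)) t"
    unfolding GH by simp
qed

section \<open>The moment matrix and the leading coefficient\<close>

fun tmom :: "triple \<Rightarrow> complex mat" where
  "tmom (a, u, w) = w * u"

lemma tmom_carrier [simp]: "T \<in> carr n k \<Longrightarrow> tmom T \<in> carrier_mat k k"
  by (cases T) auto

lemma tmom_tconj:
  assumes "T \<in> carr n k" "g \<in> carrier_mat n n" "h \<in> carrier_mat n n" "h * g = 1\<^sub>m n"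
  shows "tmom (tconj g h T) = tmom T"
proof -
  obtain a u w where T': "T = (a, u, w)" by (cases T)
  have c: "u \<in> carrier_mat n k" "w \<in> carrier_mat k n" using assms by (auto simp: T')
  have "(w * h) * (g * u) = w * (h * (g * u))" using c assms by (intro assoc_mult_mat) auto
  also have "h * (g * u) = (h * g) * u" using c assms by (intro assoc_mult_mat[symmetric]) auto
  finally show ?thesis using assms c by (simp add: T')
qed

lemma tmom_move: "move n k T T' \<Longrightarrow> tmom T' = tmom T"
proof (induction rule: move.induct)
  case (move_conj T Y)
  then show ?case using tmom_tconj[of T n k "1\<^sub>m n + Y" "1\<^sub>m n - Y"] by (auto simp: one_plus_minus_Y)
next
  case (move_trans T b c)
  then show ?case by (cases T) auto
next
  case (move_shift T r)
  then show ?case by (cases T) auto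
qed

lemma tmom_slice [simp]: "k \<le> n \<Longrightarrow> M \<in> carrier_mat k k \<Longrightarrow> tmom (slice n k M A) = M"
  by (simp add: slice_def wstd_ublk)

lemma tmom_Tof: "tmom (Tof n k y) = mat k k (\<lambda>(i, j). \<Sum>l<n. y (W i l) * y (U j l))"
  by (rule eq_matI) (auto simp: Tof_def mult_mat_entry[of _ k n _ k] simp del: index_mult_mat(1))

lemma polyfun_tmom_entry [pf]: "i < k \<Longrightarrow> j < k \<Longrightarrow> polyfun UNIV (\<lambda>y. tmom (Tof n k y) $$ (i, j))"
  by (auto simp: tmom_Tof intro!: pf)

lemma polyfun_det_tmom [pf]: "polyfun UNIV (\<lambda>y. det (tmom (Tof n k y)))"
  unfolding tmom_Tof by (intro pf) auto

lemma ex_Tof_tmom: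
  assumes "k \<le> n" "M \<in> carrier_mat k k"
  obtains y where "tmom (Tof n k y) = M"
  using Tof_surj[OF slice_carrier(4)[of n k M "0\<^sub>m (n - k) (n - k)"]] tmom_slice[OF assms] by metis

lemma generic_normal_form:
  assumes k: "k < n" and T: "T \<in> carr n k" and det: "det (tmom T) \<noteq> 0"
  obtains A where "A \<in> carrier_mat (n - k) (n - k)" "moves n k T (slice n k (tmom T) A)"
proof (cases T)
  case (fields a u w)
  show ?thesis
    by (rule normal_form[OF k, of a u w]) (use that T det in \<open>auto simp: fields\<close>)
qed

text \<open>On a normal form both facts are visible. They are carried back along moves: conjugation
  and translation fix \<open>charb\<close>, and a shift substitutes \<open>t - r\<close>, which
  keeps degree and leading coefficient. Density of the triples with invertible moment matrix covers
  the rest.\<close>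

lemma charb_leading:
  assumes k: "k < n" and T: "T \<in> carr n k"
  shows "degree (charb n k T) \<le> n - k" "coeff (charb n k T) (n - k) = det (tmom T)"
proof -
  define Q where "Q T \<longleftrightarrow> degree (charb n k T) \<le> n - k \<and> coeff (charb n k T) (n - k) = det (tmom T)" for T
  have step: "Q T" if m: "move n k T T'" and Q: "Q T'" for T T'
    using m Q
  proof (cases rule: move.cases)
    case (move_conj Y)
    then have "charb n k T' = charb n k T"
      using charb_tconj[of T n k "1\<^sub>m n + Y" "1\<^sub>m n - Y"] by (auto simp: one_plus_minus_Y)
    then show ?thesis using Q tmom_move[OF m] by (simp add: Q_def)
  next
    case (move_trans b c)
    then show ?thesis using Q tmom_move[OF m] charb_ttrans[of T n k b c] by (simp add: Q_def)
  next
    case (move_shift r)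
    then have *: "charb n k T' = pcompose (charb n k T) [:- r, 1:]" using charb_tshift by simp
    have deg: "degree (charb n k T') = degree (charb n k T)" unfolding * degree_pcompose by simp
    have "coeff (charb n k T') (n - k) = coeff (charb n k T) (n - k)"
    proof (cases "degree (charb n k T) = n - k")
      case True
      then show ?thesis using lead_coeff_comp[of "[:- r, 1:]" "charb n k T"] deg * by simp
    next
      case False
      then have "degree (charb n k T) < n - k" using deg Q by (simp add: Q_def)
      then show ?thesis using deg by (simp add: coeff_eq_0)
    qed
    then show ?thesis using Q tmom_move[OF m] deg by (simp add: Q_def)
  qed
  have steps: "Q T" if "moves n k T T'" "Q T'" for T T'
    using that by (induction rule: converse_rtranclp_induct) (auto intro: step)
  have gen: "Q T" if T: "T \<in> carr n k" "det (tmom T) \<noteq> 0" for T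
  proof -
    obtain A where A: "A \<in> carrier_mat (n - k) (n - k)" "moves n k T (slice n k (tmom T) A)"
      using generic_normal_form[OF k T] .
    have "Q (slice n k (tmom T) A)"
      using charb_slice[of k n "tmom T" A] k T A degree_monic_char_poly[OF A(1)] by (simp add: Q_def)
    then show ?thesis by (rule steps[OF A(2)])
  qed
  obtain y0 where y0: "tmom (Tof n k y0) = 1\<^sub>m k" using ex_Tof_tmom[of k n "1\<^sub>m k"] k by auto
  obtain y where y: "T = Tof n k y" using Tof_surj[OF T] .
  have "coeff (charb n k T) i = 0" if i: "n - k < i" for i
    unfolding y
  proof (rule polyfun_dense[where p = "\<lambda>y. coeff (charb n k (Tof n k y)) i" and q = "\<lambda>y. det (tmom (Tof n k y))" and ?y0.0 = y0])
    show "coeff (charb n k (Tof n k y)) i = 0" if "det (tmom (Tof n k y)) \<noteq> 0" for y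
      using gen[OF Tof_carr that] i by (simp add: Q_def coeff_eq_0)
  qed (auto intro!: pf simp: y0)
  then show "degree (charb n k T) \<le> n - k" by (intro degree_le) auto
  have "coeff (charb n k (Tof n k y)) (n - k) - det (tmom (Tof n k y)) = 0"
  proof (rule polyfun_dense[where p = "\<lambda>y. coeff (charb n k (Tof n k y)) (n - k) - det (tmom (Tof n k y))" and q = "\<lambda>y. det (tmom (Tof n k y))" and ?y0.0 = y0])
    show "coeff (charb n k (Tof n k y)) (n - k) - det (tmom (Tof n k y)) = 0" if "det (tmom (Tof n k y)) \<noteq> 0" for y
      using gen[OF Tof_carr that] by (simp add: Q_def)
  qed (auto intro!: pf simp: y0)
  then show "coeff (charb n k T) (n - k) = det (tmom T)" by (simp add: y)
qed

text \<open>Numbered from the top, so that \<open>cb n k 0\<close> is the determinant of the moment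
  matrix. The subtraction is truncated, which is why the shift formulas ask for
  \<open>m \<le> n - k\<close>.\<close>

definition cb :: "nat \<Rightarrow> nat \<Rightarrow> nat \<Rightarrow> triple \<Rightarrow> complex" where
  "cb n k m T = coeff (charb n k T) (n - k - m)"

lemma cb_0: "k < n \<Longrightarrow> T \<in> carr n k \<Longrightarrow> cb n k 0 T = det (tmom T)"
  by (simp add: cb_def charb_leading)

lemma polyfun_cb [pf]: "polyfun UNIV (\<lambda>y. cb n k m (Tof n k y))"
  unfolding cb_def by (intro pf)

lemma coeff_pcompose_shift:
  fixes p :: "complex poly"
  assumes deg: "degree p \<le> l" and m: "m \<le> l"
  shows "coeff (pcompose p [:- r, 1:]) (l - m) = (\<Sum>q\<le>m. coeff p (l - (m - q)) * of_nat ((l - (m - q)) choose q) * (- r) ^ q)"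
proof -
  have "pcompose p [:- r, 1:] = (\<Sum>i\<le>l. Polynomial.smult (coeff p i) ([:- r, 1:] ^ i))"
  proof (simp only: poly_eq_poly_eq_iff[symmetric] fun_eq_iff, rule allI)
    fix t :: complex
    have "poly p (t - r) = (\<Sum>i\<le>l. coeff p i * (t - r) ^ i)"
      unfolding poly_altdef using deg by (intro sum.mono_neutral_left) (auto simp: coeff_eq_0)
    then show "poly (pcompose p [:- r, 1:]) t = poly (\<Sum>i\<le>l. Polynomial.smult (coeff p i) ([:- r, 1:] ^ i)) t"
      by (simp add: poly_pcompose poly_sum poly_power)
  qed
  then have "coeff (pcompose p [:- r, 1:]) (l - m) = (\<Sum>i\<le>l. coeff p i * coeff ([:- r, 1:] ^ i) (l - m))"
    by (simp add: coeff_sum)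
  also have "\<dots> = (\<Sum>i\<in>{l - m..l}. coeff p i * coeff ([:- r, 1:] ^ i) (l - m))"
  proof (rule sum.mono_neutral_right)
    show "\<forall>i\<in>{..l} - {l - m..l}. coeff p i * coeff ([:- r, 1:] ^ i) (l - m) = 0"
    proof
      fix i assume "i \<in> {..l} - {l - m..l}"
      then have "i < l - m" by auto
      then have "degree ([:- r, 1:] ^ i) < l - m" by (simp add: degree_power_eq)
      then show "coeff p i * coeff ([:- r, 1:] ^ i) (l - m) = 0" by (simp add: coeff_eq_0)
    qed
  qed auto
  also have "\<dots> = (\<Sum>q\<in>{0..m}. coeff p (q + (l - m)) * coeff ([:- r, 1:] ^ (q + (l - m))) (l - m))"
    using sum.shift_bounds_cl_nat_ivl[of "\<lambda>i. coeff p i * coeff ([:- r, 1:] ^ i) (l - m)" 0 "l - m" m] m by simp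
  also have "\<dots> = (\<Sum>q\<in>{0..m}. coeff p (l - (m - q)) * of_nat ((l - (m - q)) choose q) * (- r) ^ q)"
  proof (rule sum.cong[OF refl])
    fix q assume "q \<in> {0..m}"
    then have e: "l - (m - q) = q + (l - m)" using m by auto
    have "(q + (l - m)) choose (l - m) = (q + (l - m)) choose q"
      using binomial_symmetric[of q "q + (l - m)"] by simp
    then show "coeff p (q + (l - m)) * coeff ([:- r, 1:] ^ (q + (l - m))) (l - m) =
        coeff p (l - (m - q)) * of_nat ((l - (m - q)) choose q) * (- r) ^ q"
      unfolding e by (simp add: coeff_linear_poly_power)
  qed
  finally show ?thesis by (simp add: atLeast0AtMost)
qed

lemma of_nat_binomial_2_3:
  "of_nat (l choose 2) = (of_nat l * (of_nat l - 1) / 2 :: complex)"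
  "of_nat (l choose 3) = (of_nat l * (of_nat l - 1) * (of_nat l - 2) / 6 :: complex)"
  unfolding binomial_gbinomial gbinomial_prod_rev
  by (simp_all add: numeral_2_eq_2 numeral_3_eq_3 fact_numeral prod.atLeast0_lessThan_Suc)

lemma cb_tshift:
  assumes k: "k < n" and T: "T \<in> carr n k"
  defines "l \<equiv> (of_nat (n - k) :: complex)"
  shows "cb n k 0 (tshift n r T) = cb n k 0 T"
    and "1 \<le> n - k \<Longrightarrow> cb n k 1 (tshift n r T) = cb n k 1 T - l * r * cb n k 0 T"
    and "2 \<le> n - k \<Longrightarrow> cb n k 2 (tshift n r T) = cb n k 2 T - (l - 1) * r * cb n k 1 T + l * (l - 1) / 2 * r^2 * cb n k 0 T"
    and "3 \<le> n - k \<Longrightarrow> cb n k 3 (tshift n r T) = cb n k 3 T - (l - 2) * r * cb n k 2 T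
      + (l - 1) * (l - 2) / 2 * r^2 * cb n k 1 T - l * (l - 1) * (l - 2) / 6 * r^3 * cb n k 0 T"
proof -
  define N where "N = n - k"
  have *: "cb n k m (tshift n r T) = (\<Sum>q\<le>m. cb n k (m - q) T * of_nat ((N - (m - q)) choose q) * (- r) ^ q)" if "m \<le> N" for m
    unfolding cb_def charb_tshift[OF T] N_def by (rule coeff_pcompose_shift[OF charb_leading(1)[OF k T]]) (use that N_def in simp)
  have l: "of_nat N = l" by (simp add: l_def N_def)
  have l1: "of_nat (N - Suc 0) = l - 1" if "1 \<le> N" using that by (simp add: l[symmetric] of_nat_diff)
  have l2: "of_nat (N - 2) = l - 2" if "2 \<le> N" using that by (simp add: l[symmetric] of_nat_diff)
  show "cb n k 0 (tshift n r T) = cb n k 0 T" using *[of 0] by simp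
  show "cb n k 1 (tshift n r T) = cb n k 1 T - l * r * cb n k 0 T" if "1 \<le> n - k"
    using *[of 1] that by (simp add: N_def[symmetric] l algebra_simps)
  show "cb n k 2 (tshift n r T) = cb n k 2 T - (l - 1) * r * cb n k 1 T + l * (l - 1) / 2 * r^2 * cb n k 0 T" if "2 \<le> n - k"
  proof -
    have N: "2 \<le> N" "1 \<le> N" using that by (auto simp: N_def)
    have "{..2::nat} = {0, 1, 2}" by auto
    then show ?thesis using *[OF N(1)] by (simp add: of_nat_binomial_2_3 l l1[OF N(2)] algebra_simps)
  qed
  show "cb n k 3 (tshift n r T) = cb n k 3 T - (l - 2) * r * cb n k 2 T
      + (l - 1) * (l - 2) / 2 * r^2 * cb n k 1 T - l * (l - 1) * (l - 2) / 6 * r^3 * cb n k 0 T" if "3 \<le> n - k"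
  proof -
    have N: "3 \<le> N" "2 \<le> N" "1 \<le> N" using that by (auto simp: N_def)
    have "{..3::nat} = {0, 1, 2, 3}" by auto
    then show ?thesis using *[OF N(1)]
      by (simp add: of_nat_binomial_2_3 l l1[OF N(3)] l2[OF N(2)] field_simps power3_eq_cube power2_eq_square)
  qed
qed

text \<open>The seminvariants of degrees 2 and 3 of the binary form with coefficients \<open>cb n k m\<close>, and the
  quotient of their syzygy by the leading coefficient.\<close>

definition S2 :: "nat \<Rightarrow> nat \<Rightarrow> triple \<Rightarrow> complex" where
  "S2 n k T = (let l = of_nat (n - k) in 2 * l * cb n k 0 T * cb n k 2 T - (l - 1) * cb n k 1 T ^ 2)"

text \<open>Where \<open>c0 \<noteq> 0\<close>, the shift by \<open>r = c1 / (l c0)\<close> removes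
  \<open>c1\<close>. In terms of the coefficients \<open>c2'\<close> and \<open>c3'\<close> after
  this shift, \<open>S2 = 2 l c0 c2'\<close> and \<open>S3 = 3 l^2 c0^2 c3'\<close>; the constants
  are those that clear all denominators.\<close>

definition S3 :: "nat \<Rightarrow> nat \<Rightarrow> triple \<Rightarrow> complex" where
  "S3 n k T = (let l = of_nat (n - k) in 3 * l^2 * cb n k 0 T ^ 2 * cb n k 3 T
     - 3 * l * (l - 2) * cb n k 0 T * cb n k 1 T * cb n k 2 T + (l - 1) * (l - 2) * cb n k 1 T ^ 3)"

definition S6 :: "nat \<Rightarrow> nat \<Rightarrow> triple \<Rightarrow> complex" where
  "S6 n k T = (let l = of_nat (n - k); c0 = cb n k 0 T; A = 2 * l * cb n k 2 T; B = (l - 1) * cb n k 1 T ^ 2;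
      X = 3 * l^2 * c0 * cb n k 3 T - 3 * l * (l - 2) * cb n k 1 T * cb n k 2 T; Y = (l - 1) * (l - 2) * cb n k 1 T ^ 3
     in (l - 2)^2 * (c0^2 * A^3 - 3 * c0 * A^2 * B + 3 * A * B^2) + (l - 1) * (c0 * X^2 + 2 * X * Y))"

text \<open>With \<open>S2 = c0 A - B\<close> and \<open>S3 = c0 X + Y\<close> the part without
  \<open>c0\<close> is \<open>- (l - 2)^2 B^3 + (l - 1) Y^2\<close>, and the two weights are chosen
  to make it vanish. \<open>S6\<close> is what remains after division by \<open>c0\<close>.\<close>

lemma syzygy_identity:
  fixes l c0 c1 c2 c3 :: complex
  shows "(l - 2)^2 * (2 * l * c0 * c2 - (l - 1) * c1^2) ^ 3
     + (l - 1) * (3 * l^2 * c0^2 * c3 - 3 * l * (l - 2) * c0 * c1 * c2 + (l - 1) * (l - 2) * c1^3) ^ 2 =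
     c0 * ((l - 2)^2 * (c0^2 * (2 * l * c2)^3 - 3 * c0 * (2 * l * c2)^2 * ((l - 1) * c1^2) + 3 * (2 * l * c2) * ((l - 1) * c1^2)^2)
       + (l - 1) * (c0 * (3 * l^2 * c0 * c3 - 3 * l * (l - 2) * c1 * c2)^2
         + 2 * (3 * l^2 * c0 * c3 - 3 * l * (l - 2) * c1 * c2) * ((l - 1) * (l - 2) * c1^3)))"
proof -
  define A where "A = 2 * l * c2"
  define B where "B = (l - 1) * c1^2"
  define X where "X = 3 * l^2 * c0 * c3 - 3 * l * (l - 2) * c1 * c2"
  define Y where "Y = (l - 1) * (l - 2) * c1^3"
  have 1: "2 * l * c0 * c2 - (l - 1) * c1^2 = c0 * A - B" by (simp add: A_def B_def)
  have 2: "3 * l^2 * c0^2 * c3 - 3 * l * (l - 2) * c0 * c1 * c2 + (l - 1) * (l - 2) * c1^3 = c0 * X + Y"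
    by (simp add: X_def Y_def algebra_simps power2_eq_square)
  have "(l - 2)^2 * B^3 = (l - 1) * Y^2"
    by (simp add: B_def Y_def power_mult_distrib power2_eq_square power3_eq_cube mult_ac)
  moreover have "(c0 * A - B) ^ 3 = c0 * (c0^2 * A^3 - 3 * c0 * A^2 * B + 3 * A * B^2) - B^3"
    by (simp add: algebra_simps power2_eq_square power3_eq_cube)
  moreover have "(c0 * X + Y)^2 = c0 * (c0 * X^2 + 2 * X * Y) + Y^2"
    by (simp add: algebra_simps power2_eq_square)
  ultimately have "(l - 2)^2 * (c0 * A - B) ^ 3 + (l - 1) * (c0 * X + Y)^2 =
    c0 * ((l - 2)^2 * (c0^2 * A^3 - 3 * c0 * A^2 * B + 3 * A * B^2) + (l - 1) * (c0 * X^2 + 2 * X * Y))"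
    by (simp only: distrib_left right_diff_distrib) (simp add: mult_ac)
  then show ?thesis unfolding 1 2 by (simp add: A_def B_def X_def Y_def)
qed

lemma syzygy: "(of_nat (n - k) - 2)^2 * S2 n k T ^ 3 + (of_nat (n - k) - 1) * S3 n k T ^ 2 = cb n k 0 T * S6 n k T"
  unfolding S2_def S3_def S6_def Let_def by (rule syzygy_identity)

text \<open>Holds on \<open>c0 = 0\<close> as well: there the defining expression of
  \<open>S6\<close> vanishes, and division by 0 gives 0. So shift invariance of \<open>S6\<close> is
  inherited from \<open>S2\<close>, \<open>S3\<close> and \<open>c0\<close>.\<close>

lemma S6_quotient:
  "S6 n k T = ((of_nat (n - k) - 2)^2 * S2 n k T ^ 3 + (of_nat (n - k) - 1) * S3 n k T ^ 2) / cb n k 0 T"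
proof (cases "cb n k 0 T = 0")
  case True
  have "S6 n k T = 0" unfolding S6_def Let_def True by (simp add: power2_eq_square power3_eq_cube)
  then show ?thesis using True by simp
next
  case False
  then show ?thesis by (simp add: syzygy)
qed

lemma cb_tconj:
  assumes "T \<in> carr n k" "g \<in> carrier_mat n n" "h \<in> carrier_mat n n" "g * h = 1\<^sub>m n"
  shows "cb n k m (tconj g h T) = cb n k m T"
  by (simp add: cb_def charb_tconj[OF assms])

lemma cb_ttrans:
  assumes "T \<in> carr n k" "b \<in> carrier_mat k n" "c \<in> carrier_mat n k"
  shows "cb n k m (ttrans b c T) = cb n k m T"
  by (simp add: cb_def charb_ttrans[OF assms])

lemma S2_tshift:
  assumes "k < n" "2 \<le> n - k" "T \<in> carr n k"
  shows "S2 n k (tshift n r T) = S2 n k T"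
proof -
  have "1 \<le> n - k" using assms by simp
  note c = cb_tshift(1)[OF assms(1,3)] cb_tshift(2)[OF assms(1,3) this] cb_tshift(3)[OF assms(1,3,2)]
  show ?thesis unfolding S2_def Let_def c by (simp add: field_simps power2_eq_square)
qed

lemma S3_tshift:
  assumes "k < n" "3 \<le> n - k" "T \<in> carr n k"
  shows "S3 n k (tshift n r T) = S3 n k T"
proof -
  have "1 \<le> n - k" "2 \<le> n - k" using assms by auto
  note c = cb_tshift(1)[OF assms(1,3)] cb_tshift(2)[OF assms(1,3) this(1)] cb_tshift(3)[OF assms(1,3) this(2)]
    cb_tshift(4)[OF assms(1,3,2)]
  show ?thesis unfolding S3_def Let_def c by (simp add: field_simps power2_eq_square power3_eq_cube)
qed

lemma S6_tshift:
  assumes "k < n" "3 \<le> n - k" "T \<in> carr n k"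
  shows "S6 n k (tshift n r T) = S6 n k T"
  using assms S2_tshift[OF assms(1) _ assms(3)] S3_tshift[OF assms] cb_tshift(1)[OF assms(1,3)]
  by (simp add: S6_quotient)

lemma S2_invariant:
  assumes "k < n" "2 \<le> n - k"
  obtains f where "f \<in> invariants n k" "\<And>T. T \<in> carr n k \<Longrightarrow> meval f (proj n k T) = S2 n k T"
proof (rule make_invariant[of n "S2 n k" k])
  show "polyfun UNIV (\<lambda>y. S2 n k (Tof n k y))" unfolding S2_def Let_def by (intro pf)
qed (use assms S2_tshift in \<open>auto simp: S2_def cb_tconj cb_ttrans\<close>)

lemma S3_invariant:
  assumes "k < n" "3 \<le> n - k"
  obtains f where "f \<in> invariants n k" "\<And>T. T \<in> carr n k \<Longrightarrow> meval f (proj n k T) = S3 n k T"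
proof (rule make_invariant[of n "S3 n k" k])
  show "polyfun UNIV (\<lambda>y. S3 n k (Tof n k y))" unfolding S3_def Let_def by (intro pf)
qed (use assms S3_tshift in \<open>auto simp: S3_def cb_tconj cb_ttrans\<close>)

lemma S6_invariant:
  assumes "k < n" "3 \<le> n - k"
  obtains f where "f \<in> invariants n k" "\<And>T. T \<in> carr n k \<Longrightarrow> meval f (proj n k T) = S6 n k T"
proof (rule make_invariant[of n "S6 n k" k])
  show "polyfun UNIV (\<lambda>y. S6 n k (Tof n k y))" unfolding S6_def Let_def by (intro pf)
qed (use assms S6_tshift in \<open>auto simp: S6_def cb_tconj cb_ttrans\<close>)

lemma cb_0_invariant:
  assumes "k < n"
  obtains f where "f \<in> invariants n k" "\<And>T. T \<in> carr n k \<Longrightarrow> meval f (proj n k T) = cb n k 0 T"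
proof (rule make_invariant[of n "cb n k 0" k])
  show "polyfun UNIV (\<lambda>y. cb n k 0 (Tof n k y))" by (intro pf)
qed (use assms cb_tshift(1) in \<open>auto simp: cb_tconj cb_ttrans\<close>)

lemma tmom_invariant:
  assumes "0 < n" "i < k" "j < k"
  obtains f where "f \<in> invariants n k" "\<And>T. T \<in> carr n k \<Longrightarrow> meval f (proj n k T) = tmom T $$ (i, j)"
proof (rule make_invariant[of n "\<lambda>T. tmom T $$ (i, j)" k])
  show "polyfun UNIV (\<lambda>y. tmom (Tof n k y) $$ (i, j))" using assms by (intro pf)
  show "tmom (tconj g h T) $$ (i, j) = tmom T $$ (i, j)"
    if "T \<in> carr n k" "g \<in> carrier_mat n n" "h \<in> carrier_mat n n" "h * g = 1\<^sub>m n" for T g h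
    using tmom_tconj[OF that] by simp
  show "tmom (ttrans b c T) $$ (i, j) = tmom T $$ (i, j)" for T b c by (cases T) auto
  show "tmom (tshift n r T) $$ (i, j) = tmom T $$ (i, j)" for T r by (cases T) auto
qed (use assms in auto)

section \<open>The polynomial cases\<close>

lemma proj_Tof_lift: "l \<in> qbasis n k \<Longrightarrow> proj n k (Tof n k (lift n k x)) l = x l"
proof (cases l)
  case (H t)
  assume "l \<in> qbasis n k"
  then have "{t..<n - 1} = insert t {t + 1..<n - 1}" using H by auto
  then show ?thesis using \<open>l \<in> qbasis n k\<close> H by (simp add: proj_def Tof_def lift_def)
qed (auto simp: proj_def Tof_def lift_def)

text \<open>By \<open>lift\<close>, every assignment to the basis variables comes from a
  triple.\<close>

lemma invariants_eqI:
  assumes "mvars f \<subseteq> qbasis n k" "mvars g \<subseteq> qbasis n k" "\<And>T. T \<in> carr n k \<Longrightarrow> meval f (proj n k T) = meval g (proj n k T)"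
  shows "f = g"
proof (rule meval_inject)
  fix x
  have "meval f x = meval f (proj n k (Tof n k (lift n k x)))"
    by (rule meval_cong[OF assms(1)]) (simp add: proj_Tof_lift)
  also have "\<dots> = meval g (proj n k (Tof n k (lift n k x)))" by (rule assms(3)) simp
  also have "\<dots> = meval g x" by (rule meval_cong[OF assms(2)]) (simp add: proj_Tof_lift)
  finally show "meval f x = meval g x" .
qed

lemma invariants_mvars: "f \<in> invariants n k \<Longrightarrow> mvars f \<subseteq> qbasis n k"
  by (simp add: invariants_def Sq_def)

lemma ad_poly_derivative:
  assumes "mvars f \<subseteq> qbasis n k"
  shows "((\<lambda>t. meval f (\<lambda>j. x j + t * meval (brpoly n k i j) x)) has_field_derivative meval (ad_poly n k i f) x) (at 0)"
proof -
  have "((\<lambda>t. meval f (\<lambda>j. x j + t * meval (brpoly n k i j) x)) has_field_derivative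
      (\<Sum>j\<in>qbasis n k. meval (mderiv j f) (\<lambda>j. x j + 0 * meval (brpoly n k i j) x) * meval (brpoly n k i j) x)) (at 0)"
    by (rule meval_has_field_derivative[OF assms]) (auto intro!: derivative_eq_intros)
  then show ?thesis by (simp add: meval_ad_poly mult.commute)
qed

text \<open>The adjoint action of a basis element is, at each point, a directional derivative; by
  the chain rule it kills whatever is composed of invariants.\<close>

lemma invariants_msubst:
  assumes F: "\<And>l. l < m \<Longrightarrow> F l \<in> invariants n k" and P: "mvars P \<subseteq> {..<m}"
  shows "msubst P F \<in> invariants n k"
proof -
  have "polyfun (qbasis n k) (\<lambda>x. meval P (\<lambda>l. meval (F l) x))"
    by (rule polyfun_comp[OF polyfun_meval[OF P]]) (auto intro!: pf invariants_mvars F)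
  moreover have "meval (msubst P F) = (\<lambda>x. meval P (\<lambda>l. meval (F l) x))" by (rule ext) simp
  ultimately have mv: "mvars (msubst P F) \<subseteq> qbasis n k"
    by (intro polyfun_imp_mvars) metis
  have "ad_poly n k i (msubst P F) = 0" if i: "i \<in> qbasis n k" for i
  proof (rule meval_eq_0_imp)
    fix x
    let ?c = "\<lambda>t j. x j + t * meval (brpoly n k i j) x"
    have "((\<lambda>t. meval (F l) (?c t)) has_field_derivative 0) (at 0)" if "l \<in> {..<m}" for l
      using ad_poly_derivative[OF invariants_mvars[OF F[of l]], of x i] that F[of l] i by (simp add: invariants_def)
    then have "((\<lambda>t. meval P (\<lambda>l. meval (F l) (?c t))) has_field_derivative
        (\<Sum>l\<in>{..<m}. meval (mderiv l P) (\<lambda>l. meval (F l) (?c 0)) * 0)) (at 0)"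
      by (intro meval_has_field_derivative[OF P]) auto
    then have "((\<lambda>t. meval (msubst P F) (?c t)) has_field_derivative 0) (at 0)" by simp
    with ad_poly_derivative[OF mv, of x i] show "meval (ad_poly n k i (msubst P F)) x = 0"
      by (rule DERIV_unique)
  qed
  with mv show ?thesis by (simp add: invariants_def Sq_def)
qed

lemma polyfun_proj_Tof:
  assumes "mvars f \<subseteq> qbasis n k"
  shows "polyfun UNIV (\<lambda>y. meval f (proj n k (Tof n k y)))"
proof (rule polyfun_comp[OF polyfun_meval[OF assms]])
  show "polyfun UNIV (\<lambda>y. proj n k (Tof n k y) l)" if "l \<in> qbasis n k" for l
    using that by (cases l) (auto simp: proj_def Tof_def intro!: pf)
qed

lemma is_polynomial_ringI:
  fixes m :: nat
  assumes F: "\<And>l. l < m \<Longrightarrow> F l \<in> invariants n k"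
    and indep: "\<And>P. mvars P \<subseteq> {..<m} \<Longrightarrow> (\<And>T. T \<in> carr n k \<Longrightarrow> meval P (\<lambda>l. meval (F l) (proj n k T)) = 0) \<Longrightarrow> P = 0"
    and gen: "\<And>f. f \<in> invariants n k \<Longrightarrow> \<exists>p. polyfun {..<m} p \<and> (\<forall>T\<in>carr n k. meval f (proj n k T) = p (\<lambda>l. meval (F l) (proj n k T)))"
  shows "is_polynomial_ring (invariants n k)"
  unfolding is_polynomial_ring_def
proof (rule exI[of _ m], rule exI[of _ F], intro conjI allI impI)
  show "F i \<in> invariants n k" if "i < m" for i by (rule F[OF that])
  show "P = 0" if "mvars P \<subseteq> {..<m} \<and> msubst P F = 0" for P
  proof (rule indep)
    show "meval P (\<lambda>l. meval (F l) (proj n k T)) = 0" for T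
      using meval_msubst[of P F "proj n k T"] that by simp
  qed (use that in blast)
  show "invariants n k = {msubst P F |P. mvars P \<subseteq> {..<m}}"
  proof (intro equalityI subsetI)
    fix f assume f: "f \<in> invariants n k"
    obtain p where p: "polyfun {..<m} p" "\<And>T. T \<in> carr n k \<Longrightarrow> meval f (proj n k T) = p (\<lambda>l. meval (F l) (proj n k T))"
      using gen[OF f] by blast
    obtain P where P: "mvars P \<subseteq> {..<m}" "\<And>x. meval P x = p x" using p(1) by (rule polyfun_obtain) blast
    have "f = msubst P F"
    proof (rule invariants_eqI)
      show "mvars f \<subseteq> qbasis n k" by (rule invariants_mvars[OF f])
      show "mvars (msubst P F) \<subseteq> qbasis n k" by (rule invariants_mvars[OF invariants_msubst[OF F P(1)]])
    qed (simp add: P p)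
    with P(1) show "f \<in> {msubst P F |P. mvars P \<subseteq> {..<m}}" by blast
  next
    fix f assume "f \<in> {msubst P F |P. mvars P \<subseteq> {..<m}}"
    then show "f \<in> invariants n k" using invariants_msubst[of m F n k, OF F] by blast
  qed
qed

definition My :: "nat \<Rightarrow> (nat \<Rightarrow> complex) \<Rightarrow> complex mat" where
  "My k y = mat k k (\<lambda>(i, j). y (i * k + j))"

definition ofM :: "nat \<Rightarrow> complex mat \<Rightarrow> nat \<Rightarrow> complex" where
  "ofM k M l = M $$ (l div k, l mod k)"

lemma My_carrier [simp]: "My k y \<in> carrier_mat k k"
  by (simp add: My_def)

lemma index_less: "i < k \<Longrightarrow> j < k \<Longrightarrow> i * k + j < k * (k::nat)"
proof -
  assume "i < k" "j < k"
  then have "i * k + j < Suc i * k" by simp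
  also have "\<dots> \<le> k * k" using \<open>i < k\<close> by (intro mult_le_mono1) simp
  finally show ?thesis .
qed

lemma My_eqI:
  assumes "M \<in> carrier_mat k k" "\<And>l. l < k * k \<Longrightarrow> y l = ofM k M l"
  shows "My k y = M"
  using assms by (intro eq_matI) (auto simp: My_def index_less ofM_def)

lemma polyfun_My_entry [pf]: "k * k \<le> m \<Longrightarrow> i < k \<Longrightarrow> j < k \<Longrightarrow> polyfun {..<m} (\<lambda>y. My k y $$ (i, j))"
  using index_less[of i k j] by (auto simp: My_def intro!: pf)

lemma polyfun_det_My [pf]: "k * k \<le> m \<Longrightarrow> polyfun {..<m} (\<lambda>y. det (My k y))"
  unfolding My_def using index_less[of _ k] by (intro pf) (auto intro: less_le_trans)

text \<open>The shift also puts \<open>r\<close> on the first \<open>k\<close> diagonal entries; the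
  translation in \<open>std_normal_form\<close> removes it there and leaves it in the block.\<close>

lemma slice_shift:
  assumes k: "k \<le> n" and M: "M \<in> carrier_mat k k" "det M \<noteq> 0" and A: "A \<in> carrier_mat (n - k) (n - k)"
  shows "moves n k (slice n k M A) (slice n k M (A + r \<cdot>\<^sub>m 1\<^sub>m (n - k)))"
proof -
  obtain B where B: "B \<in> carrier_mat k k" "M * B = 1\<^sub>m k" "B * M = 1\<^sub>m k" using det_nonzero_inverse[OF M] .
  have "move n k (slice n k M A) (tshift n r (slice n k M A))" by (rule move_shift) simp
  moreover have "tshift n r (slice n k M A) = (ablk n k A + r \<cdot>\<^sub>m 1\<^sub>m n, ublk n k M, wstd n k)"
    by (simp add: slice_def)
  moreover have "M = mat k k (\<lambda>(i, j). ublk n k M $$ (i, j))"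
    using M k by (intro eq_matI) (auto simp: ublk_def)
  moreover have "mat (n - k) (n - k) (\<lambda>(i, j). (ablk n k A + r \<cdot>\<^sub>m 1\<^sub>m n) $$ (i + k, j + k) -
     (\<Sum>d<k. (\<Sum>c<k. ublk n k M $$ (i + k, c) * B $$ (c, d)) * (ablk n k A + r \<cdot>\<^sub>m 1\<^sub>m n) $$ (d, j + k))) = A + r \<cdot>\<^sub>m 1\<^sub>m (n - k)"
    using A by (intro eq_matI) (auto simp: ublk_def ablk_def)
  ultimately show ?thesis
    using std_normal_form[OF k, of "ablk n k A + r \<cdot>\<^sub>m 1\<^sub>m n" "ublk n k M" M B] B
    by (auto intro: converse_rtranclp_into_rtranclp)
qed

lemma sum_shift_k:
  fixes f :: "nat \<Rightarrow> complex"
  assumes "k \<le> n" "\<And>l. l < k \<Longrightarrow> f l = 0"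
  shows "(\<Sum>l<n. f l) = (\<Sum>l<n - k. f (l + k))"
proof -
  have "(\<Sum>l<n. f l) = (\<Sum>l\<in>{k..<n}. f l)"
    by (rule sum.mono_neutral_right) (use assms in auto)
  also have "\<dots> = (\<Sum>l\<in>{0..<n - k}. f (l + k))"
    using sum.shift_bounds_nat_ivl[of f 0 k "n - k"] assms(1) by simp
  finally show ?thesis by (simp add: atLeast0LessThan)
qed

lemma ablk_mult:
  assumes k: "k \<le> n" and A: "A \<in> carrier_mat (n - k) (n - k)" "B \<in> carrier_mat (n - k) (n - k)"
  shows "ablk n k A * ablk n k B = ablk n k (A * B)"
proof (rule eq_matI)
  fix i j assume "i < dim_row (ablk n k (A * B))" "j < dim_col (ablk n k (A * B))"
  then have ij: "i < n" "j < n" by auto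
  have "(ablk n k A * ablk n k B) $$ (i, j) = (\<Sum>l<n. ablk n k A $$ (i, l) * ablk n k B $$ (l, j))"
    using ij by (intro mult_mat_entry) auto
  also have "\<dots> = (\<Sum>l<n - k. ablk n k A $$ (i, l + k) * ablk n k B $$ (l + k, j))"
    using ij k by (intro sum_shift_k) (auto simp: ablk_def)
  also have "\<dots> = ablk n k (A * B) $$ (i, j)"
  proof (cases "k \<le> i \<and> k \<le> j")
    case True
    then show ?thesis using ij k A
      by (auto simp: ablk_def mult_mat_entry[of A "n - k" "n - k" B "n - k"] simp del: index_mult_mat(1) intro!: sum.cong)
  next
    case False
    then show ?thesis using ij k by (auto simp: ablk_def simp del: index_mult_mat(1) intro!: sum.neutral)
  qed
  finally show "(ablk n k A * ablk n k B) $$ (i, j) = ablk n k (A * B) $$ (i, j)" .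
qed auto

lemma smult_one_mat: "1 \<cdot>\<^sub>m A = (A :: complex mat)"
  by (rule eq_matI) auto

text \<open>A matrix supported in the lower right block annihilates \<open>u\<close> from the left
  and \<open>w\<close> from the right, so conjugation touches \<open>A\<close> alone.\<close>

lemma slice_conj:
  assumes k: "k \<le> n" and A: "A \<in> carrier_mat (n - k) (n - k)" and Y: "Y \<in> carrier_mat (n - k) (n - k)" "Y * Y = 0\<^sub>m (n - k) (n - k)"
    "\<And>i. i < n - k \<Longrightarrow> Y $$ (i, i) = 0"
  shows "moves n k (slice n k M A) (slice n k M (A + (Y * A - A * Y) - Y * A * Y))"
proof -
  let ?Y = "ablk n k Y"
  have YY: "?Y * ?Y = 0\<^sub>m n n" unfolding ablk_mult[OF k Y(1,1)] Y(2) by (rule eq_matI) (auto simp: ablk_def)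
  have diag: "?Y $$ (i, i) = 0" if "i < n" for i using that Y by (auto simp: ablk_def)
  have mv: "move n k (slice n k M A) (tconj (1\<^sub>m n + ?Y) (1\<^sub>m n - ?Y) (slice n k M A))"
    by (rule move_conj) (use YY diag in auto)
  have "tconj (1\<^sub>m n + ?Y) (1\<^sub>m n - ?Y) (slice n k M A) =
     qcurve (slice n k M A) (?Y * ablk n k A - ablk n k A * ?Y, ?Y * ublk n k M, - (wstd n k * ?Y)) (- (?Y * ablk n k A * ?Y)) 1"
    using tconj_qcurve[of "ablk n k A" "ublk n k M" "wstd n k" n k ?Y 1] by (simp add: slice_def smult_one_mat)
  also have "\<dots> = slice n k M (A + (Y * A - A * Y) - Y * A * Y)"
  proof -
    have 1: "?Y * ublk n k M = 0\<^sub>m n k"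
    proof (rule eq_matI)
      fix i j assume "i < dim_row (0\<^sub>m n k :: complex mat)" "j < dim_col (0\<^sub>m n k :: complex mat)"
      then have ij: "i < n" "j < k" by auto
      have "(?Y * ublk n k M) $$ (i, j) = (\<Sum>l<n. ?Y $$ (i, l) * ublk n k M $$ (l, j))"
        using ij by (intro mult_mat_entry) auto
      also have "\<dots> = 0" using ij by (intro sum.neutral) (auto simp: ablk_def ublk_def)
      finally show "(?Y * ublk n k M) $$ (i, j) = 0\<^sub>m n k $$ (i, j)" using ij by simp
    qed auto
    have 2: "wstd n k * ?Y = 0\<^sub>m k n"
      using k by (intro eq_matI) (auto simp: wstd_mult_entry[of k n _ n] ablk_def simp del: index_mult_mat(1))
    have 3: "?Y * ablk n k A = ablk n k (Y * A)" "ablk n k A * ?Y = ablk n k (A * Y)" "ablk n k (Y * A) * ?Y = ablk n k (Y * A * Y)"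
      using A Y k by (simp_all add: ablk_mult)
    show ?thesis unfolding slice_def qcurve_def prod.case 1 2 3
      using A Y k by (auto intro!: eq_matI simp: ablk_def simp del: index_mult_mat(1))
  qed
  finally show ?thesis using mv by auto
qed

text \<open>The block \<open>A\<close> is a single number, removed by a shift. The normal form with
  \<open>A = 0\<close> is polynomial in \<open>M\<close>, so restricting an invariant to it yields a
  polynomial in the entries of \<open>M\<close> at once, without denominators.\<close>

theorem polynomial_ring_codim_1:
  assumes k: "1 \<le> k" "n = k + 1"
  shows "is_polynomial_ring (invariants n k)"
proof -
  have ex: "\<exists>f. f \<in> invariants n k \<and> (\<forall>T\<in>carr n k. meval f (proj n k T) = ofM k (tmom T) l)" if "l < k * k" for l
  proof -
    have "l div k < k" "l mod k < k" using that k by (auto simp: less_mult_imp_div_less)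
    then show ?thesis
      unfolding ofM_def by (rule tmom_invariant[of n, rotated]) (use k in auto)
  qed
  define F where "F l = (SOME f. f \<in> invariants n k \<and> (\<forall>T\<in>carr n k. meval f (proj n k T) = ofM k (tmom T) l))" for l
  have F: "F l \<in> invariants n k" "\<And>T. T \<in> carr n k \<Longrightarrow> meval (F l) (proj n k T) = ofM k (tmom T) l" if "l < k * k" for l
    using someI_ex[OF ex[OF that]] by (auto simp: F_def)
  show ?thesis
  proof (rule is_polynomial_ringI[of "k * k" F])
    show "P = 0" if P: "mvars P \<subseteq> {..<k * k}" "\<And>T. T \<in> carr n k \<Longrightarrow> meval P (\<lambda>l. meval (F l) (proj n k T)) = 0" for P
    proof (rule meval_eq_0_imp)
      fix y
      let ?T = "slice n k (My k y) (0\<^sub>m 1 1)"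
      have "meval P y = meval P (\<lambda>l. meval (F l) (proj n k ?T))"
      proof (rule meval_cong[OF P(1)])
        fix l assume l: "l \<in> {..<k * k}"
        then have "l div k < k" "l mod k < k" using k by (auto simp: less_mult_imp_div_less)
        then show "y l = meval (F l) (proj n k ?T)"
          using l k F(2)[of l ?T] by (simp add: ofM_def) (simp add: My_def)
      qed
      also have "\<dots> = 0" by (rule P(2)) simp
      finally show "meval P y = 0" .
    qed
    fix f assume f: "f \<in> invariants n k"
    define p where "p y = meval f (proj n k (slice n k (My k y) (0\<^sub>m 1 1)))" for y
    have "polyfun {..<k * k} p"
      unfolding p_def
    proof (rule polyfun_comp[OF polyfun_meval[OF invariants_mvars[OF f]]])
      show "polyfun {..<k * k} (\<lambda>y. proj n k (slice n k (My k y) (0\<^sub>m 1 1)) v)" if "v \<in> qbasis n k" for v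
        using that by (cases v) (auto simp: proj_def slice_def ablk_def ublk_def wstd_def intro!: pf)
    qed
    moreover have "meval f (proj n k T) = p (\<lambda>l. meval (F l) (proj n k T))" if T: "T \<in> carr n k" for T
    proof -
      have pF: "p (\<lambda>l. meval (F l) (proj n k T)) = meval f (proj n k (slice n k (tmom T) (0\<^sub>m 1 1)))" if "T \<in> carr n k" for T
        unfolding p_def using that by (subst My_eqI[of "tmom T"]) (auto simp: F)
      obtain y where y: "T = Tof n k y" using Tof_surj[OF T] .
      obtain y0 where y0: "tmom (Tof n k y0) = 1\<^sub>m k" using ex_Tof_tmom[of k n "1\<^sub>m k"] k by auto
      have "meval f (proj n k (Tof n k y)) - p (\<lambda>l. meval (F l) (proj n k (Tof n k y))) = 0"
      proof (rule polyfun_dense[where p = "\<lambda>y. meval f (proj n k (Tof n k y)) - p (\<lambda>l. meval (F l) (proj n k (Tof n k y)))"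
            and q = "\<lambda>y. det (tmom (Tof n k y))" and ?y0.0 = y0])
        show "polyfun UNIV (\<lambda>y. meval f (proj n k (Tof n k y)) - p (\<lambda>l. meval (F l) (proj n k (Tof n k y))))"
          by (intro pf polyfun_proj_Tof invariants_mvars f polyfun_comp[OF \<open>polyfun {..<k * k} p\<close>] F) auto
        show "meval f (proj n k (Tof n k y)) - p (\<lambda>l. meval (F l) (proj n k (Tof n k y))) = 0"
          if det: "det (tmom (Tof n k y)) \<noteq> 0" for y
        proof -
          let ?M = "tmom (Tof n k y)"
          obtain A where A: "A \<in> carrier_mat (n - k) (n - k)" "moves n k (Tof n k y) (slice n k ?M A)"
            using generic_normal_form[OF _ Tof_carr det] k by auto
          have "A + (- A $$ (0, 0)) \<cdot>\<^sub>m 1\<^sub>m (n - k) = 0\<^sub>m 1 1"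
            using A k by (intro eq_matI) auto
          then have "moves n k (slice n k ?M A) (slice n k ?M (0\<^sub>m 1 1))"
            using slice_shift[of k n ?M A "- A $$ (0, 0)"] tmom_carrier[OF Tof_carr[of n k y]] k det A by simp
          with A(2) have "meval f (proj n k (slice n k ?M (0\<^sub>m 1 1))) = meval f (proj n k (Tof n k y))"
            using invariant_moves[OF _ f] by (metis rtranclp_trans)
          then show ?thesis by (simp add: pF)
        qed
      qed (auto intro!: pf simp: y0)
      then show ?thesis by (simp add: y)
    qed
    ultimately show "\<exists>p. polyfun {..<k * k} p \<and> (\<forall>T\<in>carr n k. meval f (proj n k T) = p (\<lambda>l. meval (F l) (proj n k T)))"
      by blast
  qed (use F in auto)
qed

lemma det_2x2:
  fixes A :: "'a :: comm_ring_1 mat"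
  assumes "A \<in> carrier_mat 2 2"
  shows "det A = A $$ (0, 0) * A $$ (1, 1) - A $$ (0, 1) * A $$ (1, 0)"
proof -
  have d1: "det (mat (Suc 0) (Suc 0) f) = f (0, 0)" for f :: "nat \<times> nat \<Rightarrow> 'a"
    by (subst det_single) auto
  have "det A = (\<Sum>j<2. A $$ (0, j) * cofactor A 0 j)"
    using laplace_expansion_row[OF assms, of 0] by simp
  also have "\<dots> = A $$ (0, 0) * cofactor A 0 0 + A $$ (0, 1) * cofactor A 0 1"
    by (simp add: numeral_2_eq_2)
  also have "\<dots> = A $$ (0, 0) * A $$ (1, 1) - A $$ (0, 1) * A $$ (1, 0)"
    using assms by (simp add: cofactor_def d1 mat_delete_def)
  finally show ?thesis .
qed

lemma char_poly_2x2:
  fixes A :: "complex mat"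
  assumes A: "A \<in> carrier_mat 2 2"
  shows "char_poly A = [:A $$ (0, 0) * A $$ (1, 1) - A $$ (0, 1) * A $$ (1, 0), - (A $$ (0, 0) + A $$ (1, 1)), 1:]"
proof -
  have "det (char_poly_matrix A) = char_poly_matrix A $$ (0, 0) * char_poly_matrix A $$ (1, 1) - char_poly_matrix A $$ (0, 1) * char_poly_matrix A $$ (1, 0)"
    using A by (intro det_2x2) simp
  then show ?thesis using A by (simp add: char_poly_def char_poly_matrix_def)
qed

definition disc2 :: "complex mat \<Rightarrow> complex" where
  "disc2 A = (A $$ (0, 0) - A $$ (1, 1))^2 + 4 * A $$ (0, 1) * A $$ (1, 0)"

lemma S2_slice:
  assumes n: "n = k + 2" and M: "M \<in> carrier_mat k k" and A: "A \<in> carrier_mat 2 2"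
  shows "S2 n k (slice n k M A) = - (det M ^ 2 * disc2 A)"
proof -
  have "charb n k (slice n k M A) = Polynomial.smult (det M) (char_poly A)"
    by (rule charb_slice) (use n M A in auto)
  then show ?thesis
    by (simp add: S2_def cb_def n char_poly_2x2[OF A] disc2_def algebra_simps power2_eq_square numeral_2_eq_2)
qed

text \<open>The companion matrix of \<open>t^2 - h\<close>. It is polynomial in \<open>h\<close> and
  remains non-scalar at \<open>h = 0\<close>, whereas a diagonal form would involve a square root
  and degenerate there.\<close>

definition comp2 :: "complex \<Rightarrow> complex mat" where
  "comp2 h = mat 2 2 (\<lambda>(i, j). if i = 0 \<and> j = 1 then h else if i = 1 \<and> j = 0 then 1 else 0)"

lemma comp2_carrier [simp]: "comp2 h \<in> carrier_mat 2 2"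
  by (simp add: comp2_def)

lemma disc2_comp2: "disc2 (comp2 h) = 4 * h"
  by (simp add: disc2_def comp2_def)

definition m2 :: "complex \<Rightarrow> complex \<Rightarrow> complex \<Rightarrow> complex \<Rightarrow> complex mat" where
  "m2 p q c r = mat 2 2 (\<lambda>(i, j). if i = 0 then (if j = 0 then p else q) else (if j = 0 then c else r))"

lemma m2_carrier [simp]: "m2 p q c r \<in> carrier_mat 2 2"
  by (simp add: m2_def)

lemma m2_entries: "A \<in> carrier_mat 2 2 \<Longrightarrow> A = m2 (A $$ (0, 0)) (A $$ (0, 1)) (A $$ (1, 0)) (A $$ (1, 1))"
  by (intro eq_matI) (auto simp: m2_def less_2_cases_iff)

lemma m2_ops:
  "m2 p q c r * m2 p' q' c' r' = m2 (p * p' + q * c') (p * q' + q * r') (c * p' + r * c') (c * q' + r * r')"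
  "m2 p q c r + m2 p' q' c' r' = m2 (p + p') (q + q') (c + c') (r + r')"
  "m2 p q c r - m2 p' q' c' r' = m2 (p - p') (q - q') (c - c') (r - r')"
  "s \<cdot>\<^sub>m 1\<^sub>m 2 = m2 s 0 0 s" "0\<^sub>m 2 2 = m2 0 0 0 0" "comp2 h = m2 0 h 1 0"
proof -
  show "m2 p q c r * m2 p' q' c' r' = m2 (p * p' + q * c') (p * q' + q * r') (c * p' + r * c') (c * q' + r * r')"
    by (rule eq_matI) (auto simp: m2_def scalar_prod_def numeral_2_eq_2 less_Suc_eq)
qed (rule eq_matI; auto simp: m2_def comp2_def less_2_cases_iff)+

lemma slice_conj_2:
  assumes n: "n = k + 2"
  shows "moves n k (slice n k M (m2 p q c r)) (slice n k M (m2 (p - t * q) q (c + t * (p - r) - t^2 * q) (r + t * q)))"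
    and "moves n k (slice n k M (m2 p q c r)) (slice n k M (m2 (p + t * c) (q + t * (r - p) - t^2 * c) c (r - t * c)))"
proof -
  have 1: "moves n k (slice n k M (m2 p q c r)) (slice n k M (m2 p q c r + (m2 0 0 t 0 * m2 p q c r - m2 p q c r * m2 0 0 t 0) - m2 0 0 t 0 * m2 p q c r * m2 0 0 t 0))"
    by (rule slice_conj) (use n in \<open>auto simp: m2_ops, auto simp: m2_def less_2_cases_iff\<close>)
  then show "moves n k (slice n k M (m2 p q c r)) (slice n k M (m2 (p - t * q) q (c + t * (p - r) - t^2 * q) (r + t * q)))"
    by (simp add: m2_ops algebra_simps power2_eq_square)
  have 1: "moves n k (slice n k M (m2 p q c r)) (slice n k M (m2 p q c r + (m2 0 t 0 0 * m2 p q c r - m2 p q c r * m2 0 t 0 0) - m2 0 t 0 0 * m2 p q c r * m2 0 t 0 0))"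
    by (rule slice_conj) (use n in \<open>auto simp: m2_ops, auto simp: m2_def less_2_cases_iff\<close>)
  then show "moves n k (slice n k M (m2 p q c r)) (slice n k M (m2 (p + t * c) (q + t * (r - p) - t^2 * c) c (r - t * c)))"
    by (simp add: m2_ops algebra_simps power2_eq_square)
qed

lemma slice_comp2:
  assumes n: "n = k + 2" and M: "M \<in> carrier_mat k k" "det M \<noteq> 0" and A: "A \<in> carrier_mat 2 2" "disc2 A \<noteq> 0"
  obtains h where "moves n k (slice n k M A) (slice n k M (comp2 h))"
proof -
  obtain p q c r where A': "A = m2 p q c r" using m2_entries[OF A(1)] by blast
  have disc: "(p - r)^2 + 4 * q * c \<noteq> 0" using A(2) by (simp add: A' disc2_def m2_def)
  \<comment> \<open>Conjugation by a lower transvection replaces the lower left entry by this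
    quadratic in \<open>t\<close>, which is to become 1. If \<open>q = 0\<close> it is linear, with
    nonzero slope by \<open>disc\<close>.\<close>
  obtain t where t: "c + t * (p - r) - t^2 * q = 1"
  proof (cases "q = 0")
    case True
    then have "p \<noteq> r" using disc by auto
    then show ?thesis using that[of "(1 - c) / (p - r)"] True by simp
  next
    case False
    define z where "z = csqrt ((p - r)^2 - 4 * q * (1 - c))"
    have z: "z^2 = (p - r)^2 - 4 * q * (1 - c)" by (simp add: z_def)
    define t where "t = ((p - r) + z) / (2 * q)"
    have "2 * q * t = (p - r) + z" using False by (simp add: t_def)
    then have "(2 * q * t - (p - r))^2 = (p - r)^2 - 4 * q * (1 - c)" using z by simp
    then have "4 * q * (c + t * (p - r) - t^2 * q - 1) = 0"
      by (simp add: power2_eq_square algebra_simps)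
    then show ?thesis using that[of t] False by simp
  qed
  define p' r' where "p' = p - t * q" and "r' = r + t * q"
  \<comment> \<open>An upper transvection with this parameter makes the two diagonal entries equal;
    a shift then makes them 0.\<close>
  define s where "s = (r' - p') / 2"
  have 1: "moves n k (slice n k M A) (slice n k M (m2 p' q 1 r'))"
    using slice_conj_2(1)[OF n, of M p q c r t] by (simp add: A' t p'_def r'_def)
  have 2: "moves n k (slice n k M (m2 p' q 1 r')) (slice n k M (m2 (p' + s) (q + s * (r' - p') - s^2) 1 (r' - s)))"
    using slice_conj_2(2)[OF n, of M p' q 1 r' s] by simp
  have eq: "r' - s = p' + s" by (simp add: s_def field_simps)
  have 3: "moves n k (slice n k M (m2 (p' + s) (q + s * (r' - p') - s^2) 1 (r' - s))) (slice n k M (comp2 (q + s * (r' - p') - s^2)))"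
    using slice_shift[of k n M "m2 (p' + s) (q + s * (r' - p') - s^2) 1 (r' - s)" "- (p' + s)"] n M by (simp add: m2_ops eq)
  show ?thesis using that 1 2 3 by (meson rtranclp_trans)
qed

lemma inverse_corner:
  fixes M :: "complex mat"
  assumes k: "0 < k" and M: "M \<in> carrier_mat k k" and B: "B \<in> carrier_mat k k" "M * B = 1\<^sub>m k" "B * M = 1\<^sub>m k"
  shows "det M \<noteq> 0" "B $$ (k - 1, k - 1) = det (mat (k - 1) (k - 1) (\<lambda>(i, j). M $$ (i, j))) / det M"
proof -
  have "det M * det B = 1" using det_mult[OF M B(1)] B(2) by simp
  then show nz: "det M \<noteq> 0" by auto
  have adj: "adj_mat M \<in> carrier_mat k k" "M * adj_mat M = det M \<cdot>\<^sub>m 1\<^sub>m k" using adj_mat[OF M] by auto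
  have "adj_mat M = (B * M) * adj_mat M" using B adj by simp
  also have "\<dots> = B * (M * adj_mat M)" using B M adj by (intro assoc_mult_mat) auto
  also have "\<dots> = det M \<cdot>\<^sub>m B" unfolding adj(2) using B by (simp add: mult_smult_distrib[of _ k k _ k])
  finally have "adj_mat M $$ (k - 1, k - 1) = det M * B $$ (k - 1, k - 1)" using B k by simp
  moreover have "adj_mat M $$ (k - 1, k - 1) = det (mat (k - 1) (k - 1) (\<lambda>(i, j). M $$ (i, j)))"
  proof -
    have "mat_delete M (k - 1) (k - 1) = mat (k - 1) (k - 1) (\<lambda>(i, j). M $$ (i, j))"
      using M by (intro eq_matI) (auto simp: mat_delete_def)
    then show ?thesis using M k by (simp add: adj_mat_def cofactor_def)
  qed
  ultimately show "B $$ (k - 1, k - 1) = det (mat (k - 1) (k - 1) (\<lambda>(i, j). M $$ (i, j))) / det M"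
    using nz by (simp add: field_simps)
qed

lemma S2_moves:
  assumes "k < n" "2 \<le> n - k" "moves n k T T'" "T \<in> carr n k"
  shows "S2 n k T' = S2 n k T"
  using S2_invariant[OF assms(1,2)] invariant_moves[OF assms(3)] moves_carr[OF assms(3,4)] assms(4) by metis

text \<open>The value of \<open>h\<close> is read off from the invariant \<open>S2\<close> instead
  of tracking the conjugations: the block \<open>e11\<close> has discriminant \<open>x^2\<close>,
  the companion matrix has \<open>4 h\<close>, and \<open>x = - s D / det M\<close> by Cramer's
  rule.\<close>

lemma sect_comp2:
  assumes k: "1 \<le> k" "n = k + 2" and f: "f \<in> invariants n k" and M: "M \<in> carrier_mat k k" "det M \<noteq> 0"
    and D: "D = det (mat (k - 1) (k - 1) (\<lambda>(i, j). M $$ (i, j)))" "D \<noteq> 0" and s: "s \<noteq> 0"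
  shows "meval f (proj n k (sect n k M s)) = meval f (proj n k (slice n k M (comp2 ((s * D / (2 * det M))^2))))"
proof -
  obtain B where B: "B \<in> carrier_mat k k" "M * B = 1\<^sub>m k" "B * M = 1\<^sub>m k" using det_nonzero_inverse[OF M] .
  let ?x = "- (s * B $$ (k - 1, k - 1))"
  have Bx: "?x = - (s * D / det M)" using inverse_corner(2)[OF _ M(1) B] k D by simp
  have x: "?x \<noteq> 0" unfolding Bx using s D M by simp
  have 1: "moves n k (sect n k M s) (slice n k M (e11 2 ?x))" using sect_moves[OF _ _ M(1) B, of n s] k by simp
  have ec: "e11 2 ?x \<in> carrier_mat 2 2" by (simp add: e11_def)
  have disc: "disc2 (e11 2 ?x) = ?x^2" by (simp add: disc2_def e11_def)
  obtain h where h: "moves n k (slice n k M (e11 2 ?x)) (slice n k M (comp2 h))"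
    using slice_comp2[OF k(2) M ec] disc x by (metis power_not_zero)
  have "S2 n k (slice n k M (comp2 h)) = S2 n k (slice n k M (e11 2 ?x))"
    by (rule S2_moves[OF _ _ h]) (use k in auto)
  then have "det M ^ 2 * (4 * h) = det M ^ 2 * ?x^2"
    unfolding S2_slice[OF k(2) M(1) ec] S2_slice[OF k(2) M(1) comp2_carrier] disc disc2_comp2 by simp
  then have "h = (s * D / (2 * det M))^2"
    unfolding Bx using M by (simp add: field_simps power2_eq_square)
  then show ?thesis using invariant_moves[OF 1 f] invariant_moves[OF h f] by simp
qed

lemma coeff_even_substitution:
  fixes g p :: "complex poly"
  assumes "\<And>s. s \<noteq> 0 \<Longrightarrow> poly g s = poly p (c * s^2)"
  shows "coeff g (2 * i) = coeff p i * c ^ i"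
proof -
  define Hp where "Hp = (\<Sum>i\<le>degree p. monom (coeff p i * c ^ i) (2 * i))"
  have "poly Hp s = poly p (c * s^2)" for s
    unfolding Hp_def poly_sum poly_monom poly_altdef[of p] by (intro sum.cong refl) (simp add: power_mult_distrib power_mult[symmetric] mult_ac)
  then have *: "poly (g - Hp) s = 0" if "s \<noteq> 0" for s using assms[OF that] by simp
  have "poly (g - Hp) s = 0" for s
  proof (rule pcurve_dense[of "poly (g - Hp)" "{0}"])
    show "pcurve (poly (g - Hp))" unfolding pcurve_def by blast
  qed (use * in auto)
  then have "g = Hp" using poly_all_0_iff_0[of "g - Hp"] by auto
  then have "coeff g (2 * i) = (\<Sum>j\<le>degree p. if j = i then coeff p i * c ^ i else 0)"
    unfolding Hp_def by (auto simp: coeff_sum intro!: sum.cong)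
  also have "\<dots> = coeff p i * c ^ i" by (auto simp: coeff_eq_0)
  finally show ?thesis .
qed

lemma polyfam_fun_upd:
  assumes "polyfam (V - {v}) G"
  shows "G (x(v := t)) = G x"
  by (rule poly_eqI, rule polyfun_cong[OF polyfam_coeff[OF assms]]) auto

text \<open>On normal forms an invariant is a polynomial \<open>Q\<close> in \<open>M\<close> and
  \<open>h\<close>, and \<open>h = - S2 / (4 det M^2)\<close>, so the coefficient of
  \<open>h^i\<close> has to be divisible by \<open>det M ^ (2 i)\<close>. The section provides this:
  there \<open>h\<close> is \<open>(s D / (2 det M))^2\<close>, while the value is a polynomial in
  \<open>M\<close> and \<open>s\<close>.\<close>

theorem polynomial_ring_codim_2:
  assumes k: "1 \<le> k" "n = k + 2"
  shows "is_polynomial_ring (invariants n k)"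
proof -
  \<comment> \<open>The variables below \<open>k * k\<close> are the entries of \<open>M\<close>,
    row by row. The additional variable carries \<open>h\<close>, \<open>s\<close> or the value of
    \<open>S2\<close>, depending on the function.\<close>
  let ?v = "k * k"
  let ?V = "{..<k * k + 1}"
  have kn: "k < n" "2 \<le> n - k" using k by auto
  have VV: "?V - {?v} = {..<k * k}" by auto
  have ex: "\<exists>f. f \<in> invariants n k \<and> (\<forall>T\<in>carr n k. meval f (proj n k T) = (if l < k * k then ofM k (tmom T) l else S2 n k T))"
    if "l < k * k + 1" for l
  proof (cases "l < k * k")
    case True
    have "l div k < k" "l mod k < k" using True k by (auto simp: less_mult_imp_div_less)
    then show ?thesis
      unfolding ofM_def by (rule tmom_invariant[of n, rotated]) (use k True in auto)
  next
    case False
    show ?thesis by (rule S2_invariant[OF kn]) (use False in auto)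
  qed
  define F where "F l = (SOME f. f \<in> invariants n k \<and> (\<forall>T\<in>carr n k. meval f (proj n k T) = (if l < k * k then ofM k (tmom T) l else S2 n k T)))" for l
  have F: "F l \<in> invariants n k" "\<And>T. T \<in> carr n k \<Longrightarrow> meval (F l) (proj n k T) = (if l < k * k then ofM k (tmom T) l else S2 n k T)" if "l < k * k + 1" for l
    using someI_ex[OF ex[OF that]] by (auto simp: F_def)
  define \<Delta> where "\<Delta> y = det (My k y)" for y
  define D where "D y = det (mat (k - 1) (k - 1) (\<lambda>(i, j). y (i * k + j)) :: complex mat)" for y
  have \<Delta>p: "polyfun {..<k * k} \<Delta>" unfolding \<Delta>_def by (intro pf) simp
  have idx: "i * k + j < k * k" if "i < k - 1" "j < k - 1" for i j using index_less[of i k j] that by simp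
  have Dp: "polyfun {..<k * k} D" unfolding D_def by (intro pf) (use idx in auto)
  define y0 :: "nat \<Rightarrow> complex" where "y0 = ofM k (1\<^sub>m k)"
  have My0: "My k y0 = 1\<^sub>m k" by (rule My_eqI) (auto simp: y0_def)
  have \<Delta>0: "\<Delta> y0 = 1" by (simp add: \<Delta>_def My0)
  have "mat (k - 1) (k - 1) (\<lambda>(i, j). y0 (i * k + j)) = 1\<^sub>m (k - 1)"
  proof (rule eq_matI)
    fix i j assume "i < dim_row (1\<^sub>m (k - 1) :: complex mat)" "j < dim_col (1\<^sub>m (k - 1) :: complex mat)"
    then have ij: "i < k" "j < k" "i < k - 1" "j < k - 1" by auto
    then have "y0 (i * k + j) = My k y0 $$ (i, j)" by (simp add: My_def)
    then show "mat (k - 1) (k - 1) (\<lambda>(i, j). y0 (i * k + j)) $$ (i, j) = 1\<^sub>m (k - 1) $$ (i, j)"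
      unfolding My0 using ij by simp
  qed auto
  then have D0: "D y0 = 1" by (simp add: D_def)
  have nzd: "nzd {..<k * k} \<Delta> D"
  proof -
    have inj: "a = c \<and> b = d" if "a < k" "b < k" "c < k" "d < k" "a * k + b = c * k + d" for a b c d
    proof -
      have "(a * k + b) div k = a" "(a * k + b) mod k = b" using that(2) by simp_all
      moreover have "(c * k + d) div k = c" "(c * k + d) mod k = d" using that(4) by simp_all
      ultimately show ?thesis using that(5) by metis
    qed
    have "nzd {..<k * k} (\<lambda>x. det (mat (Suc (k - 1)) (Suc (k - 1)) (\<lambda>(a, b). x (a * k + b)))) (\<lambda>x. det (mat (k - 1) (k - 1) (\<lambda>(a, b). x (a * k + b))))"
      by (rule leading_minors_coprime[where e = "\<lambda>a b. a * k + b" and k = k]) (use inj index_less k in auto)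
    then show ?thesis using k by (simp add: \<Delta>_def[abs_def] D_def[abs_def] My_def)
  qed
  show ?thesis
  proof (rule is_polynomial_ringI[of "k * k + 1" F])
    show "P = 0" if P: "mvars P \<subseteq> ?V" "\<And>T. T \<in> carr n k \<Longrightarrow> meval P (\<lambda>l. meval (F l) (proj n k T)) = 0" for P
    proof (rule meval_eq_0_imp)
      fix y
      show "meval P y = 0"
      proof (rule polyfun_dense[where p = "meval P" and q = \<Delta> and ?y0.0 = y0 and V = ?V])
        show "polyfun ?V \<Delta>" using \<Delta>p by (rule polyfun_mono) auto
        fix y assume y: "\<Delta> y \<noteq> 0"
        let ?T = "slice n k (My k y) (comp2 (- (y ?v) / (4 * \<Delta> y ^ 2)))"
        have S: "S2 n k ?T = y ?v" using k y by (simp add: S2_slice disc2_comp2 \<Delta>_def field_simps)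
        have "meval P y = meval P (\<lambda>l. meval (F l) (proj n k ?T))"
        proof (rule meval_cong[OF P(1)])
          fix l assume l: "l \<in> ?V"
          show "y l = meval (F l) (proj n k ?T)"
          proof (cases "l < k * k")
            case True
            then have "l div k < k" "l mod k < k" using k by (auto simp: less_mult_imp_div_less)
            then show ?thesis using True l k F(2)[of l ?T] by (simp add: ofM_def) (simp add: My_def)
          next
            case False
            then have "l = ?v" using l by simp
            then show ?thesis using F(2)[of ?v ?T] S by simp
          qed
        qed
        also have "\<dots> = 0" by (rule P(2)) simp
        finally show "meval P y = 0" .
      qed (use P \<Delta>0 in \<open>auto intro!: pf\<close>)
    qed
    fix f assume f: "f \<in> invariants n k"
    note fm = polyfun_meval[OF invariants_mvars[OF f]]
    define Q where "Q y = meval f (proj n k (slice n k (My k y) (comp2 (y ?v))))" for y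
    define G where "G y = meval f (proj n k (sect n k (My k y) (y ?v)))" for y
    have "polyfun ?V Q" unfolding Q_def
    proof (rule polyfun_comp[OF fm])
      show "polyfun ?V (\<lambda>y. proj n k (slice n k (My k y) (comp2 (y ?v))) x)" if "x \<in> qbasis n k" for x
        using that k by (cases x) (auto simp: proj_def slice_def ablk_def ublk_def wstd_def comp2_def intro!: pf)
    qed
    then obtain Qp where Qp: "polyfam {..<k * k} Qp" "\<And>y. Q y = poly (Qp y) (y ?v)"
      using polyfun_expand[of ?V Q ?v] unfolding VV by blast
    have "polyfun ?V G" unfolding G_def
    proof (rule polyfun_comp[OF fm])
      show "polyfun ?V (\<lambda>y. proj n k (sect n k (My k y) (y ?v)) x)" if "x \<in> qbasis n k" for x
        using that k by (cases x) (auto simp: proj_def sect_def wstd_def intro!: pf)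
    qed
    then obtain Gp where Gp: "polyfam {..<k * k} Gp" "\<And>y. G y = poly (Gp y) (y ?v)"
      using polyfun_expand[of ?V G ?v] unfolding VV by blast
    have My_upd: "My k (y(?v := t)) = My k y" for y t
      by (rule eq_matI) (auto simp: My_def dest: index_less)
    have Qt: "poly (Qp y) t = meval f (proj n k (slice n k (My k y) (comp2 t)))" for y t
      using Qp(2)[of "y(?v := t)"] polyfam_fun_upd[of ?V ?v Qp y t, unfolded VV, OF Qp(1)] by (simp add: Q_def My_upd)
    have Gt: "poly (Gp y) t = meval f (proj n k (sect n k (My k y) t))" for y t
      using Gp(2)[of "y(?v := t)"] polyfam_fun_upd[of ?V ?v Gp y t, unfolded VV, OF Gp(1)] by (simp add: G_def My_upd)
    \<comment> \<open>The coefficients of \<open>s^(2 i)\<close> in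
      \<open>Gp(s) = Qp((s D / (2 \<Delta>))^2)\<close>, cleared of denominators; the factor
      \<open>4 ^ i\<close> stems from the 2.\<close>
    have coeffs: "4 ^ i * coeff (Gp y) (2 * i) * \<Delta> y ^ (2 * i) = D y ^ (2 * i) * coeff (Qp y) i" if "\<Delta> y \<noteq> 0" "D y \<noteq> 0" for i y
    proof -
      have "coeff (Gp y) (2 * i) = coeff (Qp y) i * ((D y / (2 * \<Delta> y))^2) ^ i"
      proof (rule coeff_even_substitution)
        fix s :: complex assume s: "s \<noteq> 0"
        have Dy: "D y = det (mat (k - 1) (k - 1) (\<lambda>(i, j). My k y $$ (i, j)))"
          unfolding D_def by (intro arg_cong[of _ _ det] eq_matI) (auto simp: My_def)
        show "poly (Gp y) s = poly (Qp y) ((D y / (2 * \<Delta> y))^2 * s^2)"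
          unfolding Qt Gt using sect_comp2[OF k f My_carrier _ Dy that(2) s] that(1)
          by (simp add: \<Delta>_def power_mult_distrib power_divide mult_ac)
      qed
      then show ?thesis using that
        by (simp add: power_mult[symmetric] power_divide power_mult_distrib field_simps)
    qed
    have coeffs': "4 ^ i * coeff (Gp y) (2 * i) * \<Delta> y ^ (2 * i) - D y ^ (2 * i) * coeff (Qp y) i = 0" for i y
    proof (rule polyfun_dense[where p = "\<lambda>y. 4 ^ i * coeff (Gp y) (2 * i) * \<Delta> y ^ (2 * i) - D y ^ (2 * i) * coeff (Qp y) i"
          and q = "\<lambda>y. \<Delta> y * D y" and ?y0.0 = y0 and V = "{..<k * k}"])
      show "4 ^ i * coeff (Gp y) (2 * i) * \<Delta> y ^ (2 * i) - D y ^ (2 * i) * coeff (Qp y) i = 0" if "\<Delta> y * D y \<noteq> 0" for y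
        using coeffs[of y i] that by simp
    qed (use \<Delta>0 D0 in \<open>auto intro!: pf \<Delta>p Dp Gp Qp\<close>)
    have "\<exists>r. polyfun {..<k * k} r \<and> (\<forall>y. coeff (Qp y) i = \<Delta> y ^ (2 * i) * r y)" for i
    proof -
      have "dvdp {..<k * k} (\<lambda>y. \<Delta> y ^ (2 * i)) (\<lambda>y. D y ^ (2 * i) * coeff (Qp y) i)"
        unfolding dvdp_def
      proof (intro exI conjI allI)
        show "polyfun {..<k * k} (\<lambda>y. 4 ^ i * coeff (Gp y) (2 * i))" by (intro pf Gp)
        show "D y ^ (2 * i) * coeff (Qp y) i = \<Delta> y ^ (2 * i) * (4 ^ i * coeff (Gp y) (2 * i))" for y
          using coeffs'[of i y] by (simp add: mult_ac)
      qed
      \<comment> \<open>Coprimality of \<open>\<Delta>\<close> and \<open>D\<close> is spent here: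
        the powers of \<open>D\<close> cancel.\<close>
      then have "dvdp {..<k * k} (\<lambda>y. \<Delta> y ^ (2 * i)) (\<lambda>y. coeff (Qp y) i)"
        by (rule dvdp_power_cancel[OF \<Delta>p _ Dp nzd, of y0, rotated 2]) (use \<Delta>0 in \<open>auto intro!: pf Qp\<close>)
      then show ?thesis by (simp add: dvdp_def)
    qed
    then obtain r where r: "\<And>i. polyfun {..<k * k} (r i)" "\<And>i y. coeff (Qp y) i = \<Delta> y ^ (2 * i) * r i y"
      by metis
    obtain d where d: "\<And>y. degree (Qp y) \<le> d" using Qp(1) by (auto simp: polyfam_def)
    \<comment> \<open>The substitution \<open>h = - S2 / (4 \<Delta>^2)\<close>, with
      \<open>\<Delta> ^ (2 i)\<close> cancelled against the denominator.\<close>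
    define R where "R y = (\<Sum>i\<le>d. r i y * (- (y ?v) / 4) ^ i)" for y
    have Rp: "polyfun ?V R"
      unfolding R_def by (intro pf polyfun_mono[OF r(1)]) auto
    have RF: "R (\<lambda>l. meval (F l) (proj n k T)) = meval f (proj n k T)" if T: "T \<in> carr n k" "det (tmom T) \<noteq> 0" "S2 n k T \<noteq> 0" for T
    proof -
      define y where "y l = meval (F l) (proj n k T)" for l
      have My: "My k y = tmom T" using T by (intro My_eqI) (auto simp: y_def F)
      have yv: "y ?v = S2 n k T" using T by (simp add: y_def F)
      obtain A where A: "A \<in> carrier_mat (n - k) (n - k)" "moves n k T (slice n k (tmom T) A)"
        using generic_normal_form[OF kn(1) T(1,2)] .
      have A2: "A \<in> carrier_mat 2 2" using A k by simp
      have "S2 n k (slice n k (tmom T) A) \<noteq> 0" using S2_moves[OF kn A(2) T(1)] T by simp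
      then have "disc2 A \<noteq> 0" using S2_slice[OF k(2) tmom_carrier[OF T(1)] A2] by auto
      then obtain h where h: "moves n k (slice n k (tmom T) A) (slice n k (tmom T) (comp2 h))"
        using slice_comp2[OF k(2) tmom_carrier[OF T(1)] T(2) A2] by blast
      have mh: "moves n k T (slice n k (tmom T) (comp2 h))" using A(2) h by (rule rtranclp_trans)
      have S: "S2 n k T = - (\<Delta> y ^ 2 * (4 * h))"
        using S2_moves[OF kn mh T(1)] S2_slice[OF k(2) tmom_carrier[OF T(1)] comp2_carrier] by (simp add: disc2_comp2 \<Delta>_def My)
      have "meval f (proj n k T) = poly (Qp y) h" using invariant_moves[OF mh f] by (simp add: Qt My)
      also have "\<dots> = (\<Sum>i\<le>d. coeff (Qp y) i * h ^ i)"
        unfolding poly_altdef by (intro sum.mono_neutral_left) (use d in \<open>auto simp: coeff_eq_0\<close>)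
      also have "\<dots> = R y"
        unfolding R_def yv S r(2) by (intro sum.cong refl) (simp add: power_mult[symmetric] power_mult_distrib mult_ac)
      finally show ?thesis by (simp add: y_def[abs_def])
    qed
    have "meval f (proj n k T) = R (\<lambda>l. meval (F l) (proj n k T))" if T: "T \<in> carr n k" for T
    proof -
      obtain y where y: "T = Tof n k y" using Tof_surj[OF T] .
      obtain z where z: "slice n k (1\<^sub>m k) (comp2 1) = Tof n k z" using Tof_surj[OF slice_carrier(4)] .
      have z1: "tmom (Tof n k z) = 1\<^sub>m k" unfolding z[symmetric] using k by simp
      have z2: "S2 n k (Tof n k z) \<noteq> 0" unfolding z[symmetric] using k by (simp add: S2_slice disc2_comp2)
      have "meval f (proj n k (Tof n k y)) - R (\<lambda>l. meval (F l) (proj n k (Tof n k y))) = 0"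
      proof (rule polyfun_dense[where p = "\<lambda>y. meval f (proj n k (Tof n k y)) - R (\<lambda>l. meval (F l) (proj n k (Tof n k y)))"
            and q = "\<lambda>y. det (tmom (Tof n k y)) * S2 n k (Tof n k y)" and ?y0.0 = z])
        show "polyfun UNIV (\<lambda>y. meval f (proj n k (Tof n k y)) - R (\<lambda>l. meval (F l) (proj n k (Tof n k y))))"
          by (intro pf polyfun_proj_Tof invariants_mvars f polyfun_comp[OF Rp] F) auto
        show "polyfun UNIV (\<lambda>y. det (tmom (Tof n k y)) * S2 n k (Tof n k y))"
          unfolding S2_def Let_def by (intro pf)
        show "meval f (proj n k (Tof n k y)) - R (\<lambda>l. meval (F l) (proj n k (Tof n k y))) = 0"
          if "det (tmom (Tof n k y)) * S2 n k (Tof n k y) \<noteq> 0" for y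
          using RF[OF Tof_carr] that by simp
      qed (use z1 z2 in auto)
      then show ?thesis by (simp add: y)
    qed
    with Rp show "\<exists>p. polyfun ?V p \<and> (\<forall>T\<in>carr n k. meval f (proj n k T) = p (\<lambda>l. meval (F l) (proj n k T)))"
      by blast
  qed (use F in auto)
qed

section \<open>The non-polynomial cases\<close>

lemma char_poly_e11:
  assumes "0 < l"
  shows "char_poly (e11 l x) = monom 1 (l - 1) * [:- x, 1:]"
proof -
  obtain l' where l: "l = Suc l'" using assms by (cases l) auto
  have e: "e11 l x \<in> carrier_mat l l" "upper_triangular (e11 l x)" by (auto simp: e11_def upper_triangular_def)
  have "diag_mat (e11 l x) = x # replicate l' 0"
    unfolding diag_mat_def l by (intro nth_equalityI) (auto simp: e11_def nth_Cons simp del: upt_Suc split: nat.splits)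
  then show ?thesis
    using char_poly_upper_triangular[OF e] by (simp add: l monom_altdef mult.commute)
qed

lemma cb_slice_e11:
  assumes k: "k + 3 \<le> n" and M: "M \<in> carrier_mat k k"
  shows "cb n k 0 (slice n k M (e11 (n - k) x)) = det M" "cb n k 1 (slice n k M (e11 (n - k) x)) = - (det M * x)"
    "cb n k 2 (slice n k M (e11 (n - k) x)) = 0" "cb n k 3 (slice n k M (e11 (n - k) x)) = 0"
proof -
  have "e11 (n - k) x \<in> carrier_mat (n - k) (n - k)" by (simp add: e11_def)
  then have ch: "charb n k (slice n k M (e11 (n - k) x)) = Polynomial.smult (det M) (monom 1 (n - k - 1) * [:- x, 1:])"
    using charb_slice[of k n M] k M by (simp add: char_poly_e11)
  obtain d where d: "n - k = d + 3" using k that[of "n - k - 3"] by auto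
  show "cb n k 0 (slice n k M (e11 (n - k) x)) = det M" "cb n k 1 (slice n k M (e11 (n - k) x)) = - (det M * x)"
    "cb n k 2 (slice n k M (e11 (n - k) x)) = 0" "cb n k 3 (slice n k M (e11 (n - k) x)) = 0"
    unfolding cb_def d ch[unfolded d] by (simp_all add: coeff_monom_mult numeral_3_eq_3 numeral_2_eq_2 coeff_pCons split: nat.splits)
qed

definition unit_mat :: "nat \<Rightarrow> nat \<Rightarrow> nat \<Rightarrow> complex mat" where
  "unit_mat l i j = mat l l (\<lambda>(p, q). if p = i \<and> q = j then 1 else 0)"

lemma unit_mat_carrier [simp]: "unit_mat l i j \<in> carrier_mat l l"
  by (simp add: unit_mat_def)

lemma unit_mat_mult:
  assumes "i < l" "j < l" "p < l" "q < l"
  shows "unit_mat l i j * unit_mat l p q = (if j = p then unit_mat l i q else 0\<^sub>m l l)"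
proof (rule eq_matI)
  fix x y assume "x < dim_row (if j = p then unit_mat l i q else 0\<^sub>m l l)" "y < dim_col (if j = p then unit_mat l i q else 0\<^sub>m l l)"
  then have xy: "x < l" "y < l" by (auto simp: unit_mat_def split: if_splits)
  have "(unit_mat l i j * unit_mat l p q) $$ (x, y) = (\<Sum>z<l. unit_mat l i j $$ (x, z) * unit_mat l p q $$ (z, y))"
    using xy by (intro mult_mat_entry) auto
  also have "\<dots> = (\<Sum>z<l. if z = j then (if x = i \<and> y = q \<and> j = p then 1 else 0) else 0)"
    using xy by (intro sum.cong refl) (auto simp: unit_mat_def)
  finally show "(unit_mat l i j * unit_mat l p q) $$ (x, y) = (if j = p then unit_mat l i q else 0\<^sub>m l l) $$ (x, y)"
    using xy assms by (auto simp: unit_mat_def)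
qed (auto simp: unit_mat_def)

text \<open>An invariant has no term that is linear in the block \<open>A\<close> of a normal form, because
  \<open>sl\<^sub>l\<close> has no linear invariants.\<close>

lemma slice_linear_part:
  assumes k: "k < n" and f: "f \<in> invariants n k" and M: "M \<in> carrier_mat k k" "det M \<noteq> 0"
  shows "((\<lambda>x. meval f (proj n k (slice n k M (e11 (n - k) x)))) has_field_derivative 0) (at 0)"
proof -
  define l where "l = n - k"
  have l: "0 < l" using k by (simp add: l_def)
  define L where "L Z = (\<Sum>v\<in>qbasis n k. meval (mderiv v f) (proj n k (slice n k M (0\<^sub>m l l))) * tproj (ablk n k Z, 0\<^sub>m n k, 0\<^sub>m k n) v)" for Z
  have der: "((\<lambda>x. meval f (proj n k (slice n k M (x \<cdot>\<^sub>m Z)))) has_field_derivative L Z) (at 0)" if Z: "Z \<in> carrier_mat l l" for Z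
  proof -
    have co: "proj n k (slice n k M (x \<cdot>\<^sub>m Z)) v = proj n k (slice n k M (0\<^sub>m l l)) v + x * tproj (ablk n k Z, 0\<^sub>m n k, 0\<^sub>m k n) v"
      if "v \<in> qbasis n k" for x v
      using that Z by (cases v) (auto simp: proj_def slice_def ablk_def l_def algebra_simps)
    have "((\<lambda>x. meval f (proj n k (slice n k M (x \<cdot>\<^sub>m Z)))) has_field_derivative
       (\<Sum>v\<in>qbasis n k. meval (mderiv v f) (proj n k (slice n k M (0 \<cdot>\<^sub>m Z))) * tproj (ablk n k Z, 0\<^sub>m n k, 0\<^sub>m k n) v)) (at 0)"
      by (rule meval_has_field_derivative[OF invariants_mvars[OF f]]) (auto simp: co intro!: derivative_eq_intros)
    moreover have "0 \<cdot>\<^sub>m Z = 0\<^sub>m l l" using Z by (intro eq_matI) auto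
    ultimately show ?thesis by (simp add: L_def)
  qed
  have Leq: "L Z = L Z'" if "Z \<in> carrier_mat l l" "Z' \<in> carrier_mat l l" "\<And>x. moves n k (slice n k M (x \<cdot>\<^sub>m Z)) (slice n k M (x \<cdot>\<^sub>m Z'))" for Z Z'
    using DERIV_unique[OF der[OF that(1)]] der[OF that(2)] invariant_moves[OF that(3) f] by simp
  have Lin: "L (a \<cdot>\<^sub>m Z + b \<cdot>\<^sub>m Z') = a * L Z + b * L Z'" if Z: "Z \<in> carrier_mat l l" "Z' \<in> carrier_mat l l" for a b Z Z'
  proof -
    have "tproj (ablk n k (a \<cdot>\<^sub>m Z + b \<cdot>\<^sub>m Z'), 0\<^sub>m n k, 0\<^sub>m k n) v = a * tproj (ablk n k Z, 0\<^sub>m n k, 0\<^sub>m k n) v + b * tproj (ablk n k Z', 0\<^sub>m n k, 0\<^sub>m k n) v"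
      if "v \<in> qbasis n k" for v
      using that Z by (cases v) (auto simp: ablk_def l_def algebra_simps)
    then show ?thesis unfolding L_def sum_distrib_left sum.distrib[symmetric]
      by (intro sum.cong refl) (simp add: algebra_simps)
  qed
  have diag: "L (unit_mat l i i) = L (unit_mat l 0 0)" if i: "i < l" for i
  proof (cases "i = 0")
    case False
    let ?Z = "unit_mat l 0 i"
    \<comment> \<open>Conjugating the matrix unit \<open>E_0i\<close> by \<open>1 + t E_i0\<close>
      adds \<open>t (E_ii - E_00) - t^2 E_i0\<close>. Invariance holds for all \<open>t\<close>, and
      the values 1 and -1 separate the odd part from the even one.\<close>
    have *: "t * (L (unit_mat l i i) - L (unit_mat l 0 0)) = t^2 * L (unit_mat l i 0)" for t
    proof -
      let ?Y = "t \<cdot>\<^sub>m unit_mat l i 0"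
      let ?Z' = "?Z + (t \<cdot>\<^sub>m unit_mat l i i - t \<cdot>\<^sub>m unit_mat l 0 0) - (t * t) \<cdot>\<^sub>m unit_mat l i 0"
      have Y: "?Y \<in> carrier_mat l l" by simp
      have YY: "?Y * ?Y = 0\<^sub>m l l" using False i l
        by (simp add: mult_smult_distrib[of _ l l _ l] mult_smult_assoc_mat[of _ l l _ l] unit_mat_mult)
      have "L ?Z = L ?Z'"
      proof (rule Leq)
        fix x
        have YZ: "?Y * (x \<cdot>\<^sub>m ?Z) = (x * t) \<cdot>\<^sub>m unit_mat l i i" "(x \<cdot>\<^sub>m ?Z) * ?Y = (x * t) \<cdot>\<^sub>m unit_mat l 0 0"
          using i l by (simp_all add: mult_smult_distrib[of _ l l _ l] mult_smult_assoc_mat[of _ l l _ l] unit_mat_mult smult_smult_mat mult.commute)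
        have YZY: "?Y * (x \<cdot>\<^sub>m ?Z) * ?Y = (x * (t * t)) \<cdot>\<^sub>m unit_mat l i 0"
          unfolding YZ using i l
          by (simp add: mult_smult_distrib[of _ l l _ l] mult_smult_assoc_mat[of _ l l _ l] unit_mat_mult smult_smult_mat mult_ac)
        have eq: "x \<cdot>\<^sub>m ?Z + (?Y * (x \<cdot>\<^sub>m ?Z) - (x \<cdot>\<^sub>m ?Z) * ?Y) - ?Y * (x \<cdot>\<^sub>m ?Z) * ?Y = x \<cdot>\<^sub>m ?Z'"
          unfolding YZY unfolding YZ by (rule eq_matI) (auto simp: unit_mat_def algebra_simps)
        have "moves n k (slice n k M (x \<cdot>\<^sub>m ?Z)) (slice n k M (x \<cdot>\<^sub>m ?Z + (?Y * (x \<cdot>\<^sub>m ?Z) - (x \<cdot>\<^sub>m ?Z) * ?Y) - ?Y * (x \<cdot>\<^sub>m ?Z) * ?Y))"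
          by (rule slice_conj) (use k False YY in \<open>auto simp: l_def[symmetric], auto simp: unit_mat_def\<close>)
        then show "moves n k (slice n k M (x \<cdot>\<^sub>m ?Z)) (slice n k M (x \<cdot>\<^sub>m ?Z'))" unfolding eq .
      qed auto
      also have "?Z' = 1 \<cdot>\<^sub>m (1 \<cdot>\<^sub>m ?Z + t \<cdot>\<^sub>m unit_mat l i i) + 1 \<cdot>\<^sub>m ((- t) \<cdot>\<^sub>m unit_mat l 0 0 + (- (t * t)) \<cdot>\<^sub>m unit_mat l i 0)"
        by (rule eq_matI) (auto simp: unit_mat_def)
      also have "L \<dots> = L ?Z + t * L (unit_mat l i i) - t * L (unit_mat l 0 0) - t * t * L (unit_mat l i 0)"
        by (simp add: Lin)
      finally show ?thesis by (simp add: algebra_simps power2_eq_square)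
    qed
    from *[of 1] *[of "- 1"] have "2 * (L (unit_mat l i i) - L (unit_mat l 0 0)) = 0" by simp
    then show ?thesis by simp
  qed simp
  \<comment> \<open>A multiple of the identity is a shift away from 0.\<close>
  have L1: "L (1\<^sub>m l) = 0"
  proof -
    have "L (1\<^sub>m l) = L (0\<^sub>m l l)"
    proof (rule Leq[symmetric])
      fix x :: complex
      have "x \<cdot>\<^sub>m 0\<^sub>m l l + x \<cdot>\<^sub>m 1\<^sub>m l = x \<cdot>\<^sub>m 1\<^sub>m l" by (rule eq_matI) auto
      then show "moves n k (slice n k M (x \<cdot>\<^sub>m 0\<^sub>m l l)) (slice n k M (x \<cdot>\<^sub>m 1\<^sub>m l))"
        using slice_shift[of k n M "x \<cdot>\<^sub>m 0\<^sub>m l l" x] k M by (simp add: l_def)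
    qed auto
    moreover have "0\<^sub>m l l = 0 \<cdot>\<^sub>m 1\<^sub>m l + 0 \<cdot>\<^sub>m (1\<^sub>m l :: complex mat)" by (rule eq_matI) auto
    then have "L (0\<^sub>m l l) = 0" using Lin[of "1\<^sub>m l" "1\<^sub>m l" 0 0] by simp
    ultimately show ?thesis by simp
  qed
  define E where "E m = mat l l (\<lambda>(p, q). if p = q \<and> p < m then 1 else (0 :: complex))" for m
  have "L (E m) = of_nat m * L (unit_mat l 0 0)" if "m \<le> l" for m
    using that
  proof (induction m)
    case 0
    have "E 0 = 0 \<cdot>\<^sub>m 1\<^sub>m l + 0 \<cdot>\<^sub>m 1\<^sub>m l" unfolding E_def by (rule eq_matI) auto
    then show ?case using Lin[of "1\<^sub>m l" "1\<^sub>m l" 0 0] by simp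
  next
    case (Suc m)
    have "E (Suc m) = 1 \<cdot>\<^sub>m E m + 1 \<cdot>\<^sub>m unit_mat l m m" unfolding E_def unit_mat_def by (rule eq_matI) auto
    then have "L (E (Suc m)) = L (E m) + L (unit_mat l m m)" using Lin[of "E m" "unit_mat l m m" 1 1] by (simp add: E_def)
    then show ?case using Suc diag[of m] by (simp add: algebra_simps)
  qed
  \<comment> \<open>All diagonal units have the same value under \<open>L\<close> and sum up to the
    identity, so \<open>l\<close> times this value is 0.\<close>
  from this[of l] have "L (E l) = of_nat l * L (unit_mat l 0 0)" by simp
  moreover have "E l = 1\<^sub>m l" unfolding E_def by (rule eq_matI) auto
  ultimately have "L (unit_mat l 0 0) = 0" using L1 l by simp
  moreover have "x \<cdot>\<^sub>m unit_mat l 0 0 = e11 l x" for x unfolding unit_mat_def e11_def by (rule eq_matI) auto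
  ultimately show ?thesis using der[OF unit_mat_carrier, of 0 0] by (simp add: l_def)
qed

section \<open>The curve at a singular moment matrix\<close>

definition Mdel :: "nat \<Rightarrow> complex \<Rightarrow> complex mat" where
  "Mdel k \<delta> = mat k k (\<lambda>(i, j). if i = j then (if i = k - 1 then \<delta> else 1) else 0)"

lemma Mdel_carrier [simp]: "Mdel k \<delta> \<in> carrier_mat k k"
  by (simp add: Mdel_def)

lemma Mdel_mult: "0 < k \<Longrightarrow> Mdel k \<delta> * Mdel k \<epsilon> = Mdel k (\<delta> * \<epsilon>)"
proof (rule eq_matI)
  fix i j assume "i < dim_row (Mdel k (\<delta> * \<epsilon>))" "j < dim_col (Mdel k (\<delta> * \<epsilon>))"
  then have ij: "i < k" "j < k" by (auto simp: Mdel_def)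
  have "(Mdel k \<delta> * Mdel k \<epsilon>) $$ (i, j) = (\<Sum>l<k. Mdel k \<delta> $$ (i, l) * Mdel k \<epsilon> $$ (l, j))"
    using ij by (intro mult_mat_entry) auto
  also have "\<dots> = (\<Sum>l<k. if l = i then Mdel k (\<delta> * \<epsilon>) $$ (i, j) else 0)"
    using ij by (intro sum.cong refl) (auto simp: Mdel_def)
  finally show "(Mdel k \<delta> * Mdel k \<epsilon>) $$ (i, j) = Mdel k (\<delta> * \<epsilon>) $$ (i, j)" using ij by simp
qed (auto simp: Mdel_def)

lemma det_Mdel: "0 < k \<Longrightarrow> det (Mdel k \<delta>) = \<delta>"
proof -
  assume k: "0 < k"
  then obtain k' where k': "k = Suc k'" by (cases k) auto
  have "det (Mdel k \<delta>) = prod_list (diag_mat (Mdel k \<delta>))"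
    by (rule det_upper_triangular[of _ k]) (auto simp: Mdel_def upper_triangular_def)
  also have "diag_mat (Mdel k \<delta>) = replicate k' 1 @ [\<delta>]"
    unfolding diag_mat_def k' by (intro nth_equalityI) (auto simp: Mdel_def nth_append simp del: upt_Suc)
  finally show ?thesis by simp
qed

lemma Mdel_1: "Mdel k 1 = 1\<^sub>m k"
  by (rule eq_matI) (auto simp: Mdel_def)

text \<open>\<open>Mdel k \<delta>\<close> has the inverse \<open>Mdel k (1 / \<delta>)\<close>, so
  for fixed \<open>s \<noteq> 0\<close> the block blows up as \<open>\<delta>\<close> tends to 0,
  while the section stays polynomial in \<open>\<delta>\<close>.\<close>

lemma sect_Mdel_moves:
  assumes k: "0 < k" "k < n" and \<delta>: "\<delta> \<noteq> 0"
  shows "moves n k (sect n k (Mdel k \<delta>) s) (slice n k (Mdel k \<delta>) (e11 (n - k) (- (s / \<delta>))))"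
proof -
  have "Mdel k \<delta> * Mdel k (1 / \<delta>) = 1\<^sub>m k" "Mdel k (1 / \<delta>) * Mdel k \<delta> = 1\<^sub>m k"
    using k \<delta> by (simp_all add: Mdel_mult Mdel_1)
  from sect_moves[OF k Mdel_carrier Mdel_carrier this, of s] show ?thesis
    using k by (simp add: Mdel_def)
qed

text \<open>In a product the coefficient of \<open>s^3\<close> is
  \<open>a0 b3 + a1 b2 + a2 b1 + a3 b0\<close>; vanishing linear coefficients leave the Leibniz
  rule. So reading off the coefficients of \<open>s^0\<close> and \<open>s^3\<close> agrees to first
  order with moving along the line
  \<open>e \<mapsto> coeff (g i) 0 + e * coeff (g i) 3\<close>.\<close>

lemma arc_derivation:
  fixes P :: "nat mpoly"
  assumes P: "mvars P \<subseteq> {..<m}" and g: "\<And>i. i < m \<Longrightarrow> coeff (g i) 1 = (0::complex)"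
  shows "\<exists>A B. (\<forall>s. poly A s = meval P (\<lambda>i. poly (g i) s)) \<and> (\<forall>e. poly B e = meval P (\<lambda>i. coeff (g i) 0 + e * coeff (g i) 3))
     \<and> coeff A 0 = coeff B 0 \<and> coeff A 1 = 0 \<and> coeff A 3 = coeff B 1"
  using P
proof (induction rule: mpoly_induct)
  case (const c)
  show ?case by (rule exI[of _ "[:c:]"], rule exI[of _ "[:c:]"]) (auto simp: coeff_pCons numeral_3_eq_3)
next
  case (var v)
  then show ?case
    by (intro exI[of _ "g v"] exI[of _ "[:coeff (g v) 0, coeff (g v) 3:]"]) (auto simp: g[simplified])
next
  case (add p q)
  then obtain A B A' B' where "\<forall>s. poly A s = meval p (\<lambda>i. poly (g i) s)" "\<forall>e. poly B e = meval p (\<lambda>i. coeff (g i) 0 + e * coeff (g i) 3)"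
     "coeff A 0 = coeff B 0" "coeff A 1 = 0" "coeff A 3 = coeff B 1"
     "\<forall>s. poly A' s = meval q (\<lambda>i. poly (g i) s)" "\<forall>e. poly B' e = meval q (\<lambda>i. coeff (g i) 0 + e * coeff (g i) 3)"
     "coeff A' 0 = coeff B' 0" "coeff A' 1 = 0" "coeff A' 3 = coeff B' 1" by metis
  then show ?case by (intro exI[of _ "A + A'"] exI[of _ "B + B'"]) auto
next
  case (mult p q)
  then obtain A B A' B' where AB: "\<forall>s. poly A s = meval p (\<lambda>i. poly (g i) s)" "\<forall>e. poly B e = meval p (\<lambda>i. coeff (g i) 0 + e * coeff (g i) 3)"
     "coeff A 0 = coeff B 0" "coeff A 1 = 0" "coeff A 3 = coeff B 1"
     "\<forall>s. poly A' s = meval q (\<lambda>i. poly (g i) s)" "\<forall>e. poly B' e = meval q (\<lambda>i. coeff (g i) 0 + e * coeff (g i) 3)"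
     "coeff A' 0 = coeff B' 0" "coeff A' 1 = 0" "coeff A' 3 = coeff B' 1" by metis
  have "{..3::nat} = {0, 1, 2, 3}" "{..1::nat} = {0, 1}" by auto
  then have "coeff (A * A') 0 = coeff (B * B') 0" "coeff (A * A') 1 = 0" "coeff (A * A') 3 = coeff (B * B') 1"
    using AB by (auto simp: coeff_mult)
  then show ?case using AB by (intro exI[of _ "A * A'"] exI[of _ "B * B'"]) auto
qed

text \<open>For \<open>\<delta> \<noteq> 0\<close> the section has \<open>c0 = \<delta>\<close>,
  \<open>c1 = s\<close> and \<open>c2 = c3 = 0\<close>, so \<open>S3 = (l - 1) (l - 2) s^3\<close>
  does not depend on \<open>\<delta>\<close>. Values at \<open>\<delta> = 0\<close>, where
  \<open>c0\<close> vanishes along the whole curve, are obtained by polynomial continuation in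
  \<open>\<delta>\<close>.\<close>

theorem not_polynomial_ring:
  assumes k: "1 \<le> k" "k + 3 \<le> n"
  shows "\<not> is_polynomial_ring (invariants n k)"
proof
  assume "is_polynomial_ring (invariants n k)"
  then obtain m F where F: "\<And>i. i < m \<Longrightarrow> F i \<in> invariants n k"
    and indep: "\<And>P. mvars P \<subseteq> {..<m} \<Longrightarrow> msubst P F = 0 \<Longrightarrow> P = 0"
    and gen: "invariants n k = {msubst P F |P. mvars P \<subseteq> {..<m}}"
    unfolding is_polynomial_ring_def by blast
  have kn: "k < n" "0 < k" "2 \<le> n - k" "3 \<le> n - k" using k by auto
  define \<sigma> where "\<sigma> \<delta> s = sect n k (Mdel k \<delta>) s" for \<delta> s
  define l where "l = (of_nat (n - k) :: complex)"
  have l: "l - 1 \<noteq> 0" "l - 2 \<noteq> 0"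
  proof -
    have "l \<noteq> of_nat 1" "l \<noteq> of_nat 2" unfolding l_def of_nat_eq_iff using kn by auto
    then show "l - 1 \<noteq> 0" "l - 2 \<noteq> 0" by auto
  qed
  have \<sigma>c: "\<sigma> \<delta> s \<in> carr n k" for \<delta> s by (simp add: \<sigma>_def)
  have two_var: "polyfun {..<2::nat} (\<lambda>y. meval f (proj n k (\<sigma> (y 0) (y 1))))" if f: "f \<in> invariants n k" for f
    unfolding \<sigma>_def
  proof (rule polyfun_comp[OF polyfun_meval[OF invariants_mvars[OF f]]])
    show "polyfun {..<2::nat} (\<lambda>y. proj n k (sect n k (Mdel k (y 0)) (y 1)) x)" if "x \<in> qbasis n k" for x
      using that by (cases x) (auto simp: proj_def sect_def wstd_def Mdel_def intro!: pf)
  qed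
  have curve: "\<exists>p. (\<forall>s. poly p s = meval f (proj n k (\<sigma> 0 s))) \<and> coeff p 1 = 0" if f: "f \<in> invariants n k" for f
  proof -
    let ?G = "\<lambda>y. meval f (proj n k (\<sigma> (y 0) (y 1)))"
    obtain Gp where Gp: "polyfam ({..<2::nat} - {1}) Gp" "\<And>y. ?G y = poly (Gp y) (y 1)"
      using polyfun_expand[OF two_var[OF f], of 1] by blast
    have Gt: "poly (Gp y) s = meval f (proj n k (\<sigma> (y 0) s))" for y s
      using Gp(2)[of "y(1 := s)"] polyfam_fun_upd[OF Gp(1), of y s] by simp
    \<comment> \<open>For \<open>\<delta> \<noteq> 0\<close> the curve can be moved into normal
      forms, where \<open>slice_linear_part\<close> applies; the coefficient is polynomial in
      \<open>\<delta>\<close>, so it vanishes at 0 too.\<close>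
    have "coeff (Gp (\<lambda>_. 0)) 1 = 0"
    proof (rule polyfun_dense[where p = "\<lambda>y. coeff (Gp y) 1" and q = "\<lambda>y. y 0" and ?y0.0 = "\<lambda>_. 1" and V = "{..<2::nat}"])
      show "polyfun {..<2::nat} (\<lambda>y. coeff (Gp y) 1)" by (rule polyfun_mono[OF polyfam_coeff[OF Gp(1)]]) auto
      show "coeff (Gp y) 1 = 0" if y: "y 0 \<noteq> 0" for y
      proof (rule pcurve_coeff_1_eq_0)
        have "poly (Gp y) = (\<lambda>s. meval f (proj n k (slice n k (Mdel k (y 0)) (e11 (n - k) (- (s / y 0))))))"
          using invariant_moves[OF sect_Mdel_moves[OF kn(2,1) y] f] by (auto simp: Gt \<sigma>_def)
        moreover have "((\<lambda>x. meval f (proj n k (slice n k (Mdel k (y 0)) (e11 (n - k) x)))) has_field_derivative 0) (at (- (0 / y 0)))"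
          using slice_linear_part[OF kn(1) f Mdel_carrier[of k "y 0"]] det_Mdel kn y by simp
        then have "((\<lambda>s. meval f (proj n k (slice n k (Mdel k (y 0)) (e11 (n - k) (- (s / y 0)))))) has_field_derivative 0 * (- (1 / y 0))) (at 0)"
          by (rule DERIV_chain2) (auto intro!: derivative_eq_intros simp: y)
        ultimately show "(poly (Gp y) has_field_derivative 0) (at 0)" by simp
      qed
    qed (auto intro!: pf)
    then show ?thesis using Gt[of "\<lambda>_. 0"] by blast
  qed
  obtain g where g: "\<And>i. i < m \<Longrightarrow> (\<forall>s. poly (g i) s = meval (F i) (proj n k (\<sigma> 0 s))) \<and> coeff (g i) 1 = 0"
    using curve[OF F] by metis
  have arc: "\<exists>A B. (\<forall>s. poly A s = meval P (\<lambda>i. poly (g i) s)) \<and> (\<forall>e. poly B e = meval P (\<lambda>i. coeff (g i) 0 + e * coeff (g i) 3))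
     \<and> coeff A 0 = coeff B 0 \<and> coeff A 1 = 0 \<and> coeff A 3 = coeff B 1" if P: "mvars P \<subseteq> {..<m}" for P
    using arc_derivation[OF P, of g] g by blast
  have val: "meval P (\<lambda>i. poly (g i) s) = meval (msubst P F) (proj n k (\<sigma> 0 s))" if P: "mvars P \<subseteq> {..<m}" for P s
    using meval_cong[OF P, of "\<lambda>i. poly (g i) s" "\<lambda>i. meval (F i) (proj n k (\<sigma> 0 s))"] g by simp
  have limit: "meval f (proj n k (\<sigma> 0 s)) = c" if f: "f \<in> invariants n k" and c: "\<And>\<delta>. \<delta> \<noteq> 0 \<Longrightarrow> meval f (proj n k (\<sigma> \<delta> s)) = c" for f c s
  proof -
    have "pcurve (\<lambda>\<delta>. meval f (proj n k (\<sigma> ((\<lambda>i. if i = 0 then \<delta> else s) (0::nat)) ((\<lambda>i. if i = 0 then \<delta> else s) (1::nat)))))"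
      by (rule pcurve_comp[OF two_var[OF f], of "\<lambda>\<delta> i. if i = 0 then \<delta> else s"]) (intro pf)
    then have "pcurve (\<lambda>\<delta>. meval f (proj n k (\<sigma> \<delta> s)) - c)" by (auto intro!: pf)
    from pcurve_dense[OF this, of "{0}" 0] c show ?thesis by simp
  qed
  have sl: "meval f (proj n k (\<sigma> \<delta> s)) = \<Phi> (slice n k (Mdel k \<delta>) (e11 (n - k) (- (s / \<delta>))))"
    if f: "f \<in> invariants n k" "\<And>T. T \<in> carr n k \<Longrightarrow> meval f (proj n k T) = \<Phi> T" and "\<delta> \<noteq> 0" for f \<Phi> \<delta> s
    using invariant_moves[OF sect_Mdel_moves[OF kn(2,1) that(3), of s] f(1)] f(2) by (simp add: \<sigma>_def)
  note cbs = cb_slice_e11[OF k(2) Mdel_carrier] cb_slice_e11(2)[OF k(2) Mdel_carrier, unfolded One_nat_def]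
  obtain f0 where f0: "f0 \<in> invariants n k" "\<And>T. T \<in> carr n k \<Longrightarrow> meval f0 (proj n k T) = cb n k 0 T"
    using cb_0_invariant[OF kn(1)] by blast
  obtain f2 where f2: "f2 \<in> invariants n k" "\<And>T. T \<in> carr n k \<Longrightarrow> meval f2 (proj n k T) = S2 n k T"
    using S2_invariant[OF kn(1,3)] by blast
  obtain f3 where f3: "f3 \<in> invariants n k" "\<And>T. T \<in> carr n k \<Longrightarrow> meval f3 (proj n k T) = S3 n k T"
    using S3_invariant[OF kn(1,4)] by blast
  obtain f6 where f6: "f6 \<in> invariants n k" "\<And>T. T \<in> carr n k \<Longrightarrow> meval f6 (proj n k T) = S6 n k T"
    using S6_invariant[OF kn(1,4)] by blast
  have v0: "meval f0 (proj n k (\<sigma> 0 s)) = 0" for s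
  proof -
    have "tmom (\<sigma> 0 s) = Mdel k 0"
      unfolding \<sigma>_def sect_def tmom.simps using kn
      by (intro eq_matI) (auto simp: wstd_mult_entry[of k n _ k] Mdel_def simp del: index_mult_mat(1))
    then show ?thesis using f0(2)[OF \<sigma>c] cb_0[OF kn(1) \<sigma>c] det_Mdel[OF kn(2)] by simp
  qed
  have v2: "meval f2 (proj n k (\<sigma> 0 0)) = 0"
    by (rule limit[OF f2(1)]) (use sl[OF f2, of _ 0] in \<open>simp add: S2_def cbs\<close>)
  have v3: "meval f3 (proj n k (\<sigma> 0 s)) = (l - 1) * (l - 2) * s^3" for s
    by (rule limit[OF f3(1)]) (use sl[OF f3, of _ s] kn in \<open>simp add: S3_def cbs det_Mdel l_def[symmetric] Let_def\<close>)
  have v6: "meval f6 (proj n k (\<sigma> 0 0)) = 0"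
    by (rule limit[OF f6(1)]) (use sl[OF f6, of _ 0] in \<open>simp add: S6_def cbs Let_def\<close>)
  obtain P0 P2 P3 P6 where P: "mvars P0 \<subseteq> {..<m}" "mvars P2 \<subseteq> {..<m}" "mvars P3 \<subseteq> {..<m}" "mvars P6 \<subseteq> {..<m}"
    and fP: "f0 = msubst P0 F" "f2 = msubst P2 F" "f3 = msubst P3 F" "f6 = msubst P6 F"
    using f0(1) f2(1) f3(1) f6(1) unfolding gen by blast
  \<comment> \<open>The syzygy as a relation between the generators. Independence makes it the zero
    polynomial, so it may be evaluated at points of affine space that need not come from a triple,
    such as those of the line in \<open>arc_derivation\<close>.\<close>
  define Z where "Z = mconst ((l - 2)^2) * P2^3 + mconst (l - 1) * P3^2 - P0 * P6"
  have Zm: "mvars Z \<subseteq> {..<m}"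
  proof (rule polyfun_imp_mvars)
    have "meval Z = (\<lambda>x. (l - 2)^2 * meval P2 x ^ 3 + (l - 1) * meval P3 x ^ 2 - meval P0 x * meval P6 x)"
      by (rule ext) (simp add: Z_def)
    then show "polyfun {..<m} (meval Z)" using P by (auto intro!: pf)
  qed
  have "msubst Z F = 0"
  proof (rule invariants_eqI)
    show "mvars (msubst Z F) \<subseteq> qbasis n k" by (rule invariants_mvars[OF invariants_msubst[OF F Zm]])
    show "meval (msubst Z F) (proj n k T) = meval 0 (proj n k T)" if T: "T \<in> carr n k" for T
    proof -
      have "meval (msubst Z F) (proj n k T) = (l - 2)^2 * S2 n k T ^ 3 + (l - 1) * S3 n k T ^ 2 - cb n k 0 T * S6 n k T"
        using f0(2)[OF T] f2(2)[OF T] f3(2)[OF T] f6(2)[OF T] unfolding fP meval_msubst Z_def by simp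
      then show ?thesis using syzygy[of n k T] by (simp add: l_def)
    qed
  qed (simp add: mvars_def)
  then have Z0: "Z = 0" by (rule indep[OF Zm])
  obtain A0 B0 where AB0: "\<And>s. poly A0 s = meval P0 (\<lambda>i. poly (g i) s)" "\<And>e. poly B0 e = meval P0 (\<lambda>i. coeff (g i) 0 + e * coeff (g i) 3)"
     "coeff A0 0 = coeff B0 0" "coeff A0 3 = coeff B0 1" using arc[OF P(1)] by blast
  obtain A2 B2 where AB2: "\<And>s. poly A2 s = meval P2 (\<lambda>i. poly (g i) s)" "\<And>e. poly B2 e = meval P2 (\<lambda>i. coeff (g i) 0 + e * coeff (g i) 3)"
     "coeff A2 0 = coeff B2 0" using arc[OF P(2)] by blast
  obtain A3 B3 where AB3: "\<And>s. poly A3 s = meval P3 (\<lambda>i. poly (g i) s)" "\<And>e. poly B3 e = meval P3 (\<lambda>i. coeff (g i) 0 + e * coeff (g i) 3)"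
     "coeff A3 0 = coeff B3 0" "coeff A3 3 = coeff B3 1" using arc[OF P(3)] by blast
  obtain A6 B6 where AB6: "\<And>s. poly A6 s = meval P6 (\<lambda>i. poly (g i) s)" "\<And>e. poly B6 e = meval P6 (\<lambda>i. coeff (g i) 0 + e * coeff (g i) 3)"
     "coeff A6 0 = coeff B6 0" using arc[OF P(4)] by blast
  have "poly A0 s = 0" for s unfolding AB0(1) val[OF P(1)] fP(1)[symmetric] by (rule v0)
  then have "A0 = 0" using poly_all_0_iff_0[of A0] by blast
  then have B0: "coeff B0 0 = 0" "coeff B0 1 = 0" using AB0(3,4) by auto
  have "poly A3 s = poly (monom ((l - 1) * (l - 2)) 3) s" for s
    unfolding AB3(1) val[OF P(3)] fP(3)[symmetric] v3 by (simp add: poly_monom)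
  then have "A3 = monom ((l - 1) * (l - 2)) 3" by (simp add: poly_eq_poly_eq_iff[symmetric] fun_eq_iff)
  then have B3: "coeff B3 0 = 0" "coeff B3 1 = (l - 1) * (l - 2)" using AB3(3,4) by auto
  have B2: "coeff B2 0 = 0" using AB2(3) AB2(1)[of 0] val[OF P(2), of 0] v2 fP(2) by (simp add: poly_0_coeff_0)
  have B6: "coeff B6 0 = 0" using AB6(3) AB6(1)[of 0] val[OF P(4), of 0] v6 fP(4) by (simp add: poly_0_coeff_0)
  have "poly (Polynomial.smult ((l - 2)^2) (B2^3) + Polynomial.smult (l - 1) (B3^2) - B0 * B6) e = meval Z (\<lambda>i. coeff (g i) 0 + e * coeff (g i) 3)" for e
    by (simp add: Z_def AB0 AB2 AB3 AB6)
  then have "Polynomial.smult ((l - 2)^2) (B2^3) + Polynomial.smult (l - 1) (B3^2) - B0 * B6 = 0"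
    using poly_all_0_iff_0 unfolding Z0 by fastforce
  \<comment> \<open>In powers of \<open>e\<close>, \<open>B2 ^ 3\<close> has order at least 3, and
    so has \<open>B0 * B6\<close>, with \<open>B0\<close> of order at least 2 and \<open>B6\<close>
    of order at least 1. Only \<open>B3 ^ 2\<close> contributes to \<open>e^2\<close>.\<close>
  then have "coeff (Polynomial.smult ((l - 2)^2) (B2^3) + Polynomial.smult (l - 1) (B3^2) - B0 * B6) 2 = 0" by simp
  moreover have "{..2::nat} = {0, 1, 2}" "{..1::nat} = {0, 1}" by auto
  ultimately have "(l - 1) * ((l - 1) * (l - 2))^2 = 0"
    using B0 B2 B3 B6 by (simp add: coeff_mult power2_eq_square power3_eq_cube)
  then show False using l by simp
qed

section \<open>Pfaffians and the rank of a skew form\<close>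

text \<open>The Pfaffian without its normalisation: for a skew matrix each perfect matching is
  counted \<open>2 ^ r * fact r\<close> times.\<close>

definition PF :: "(nat \<Rightarrow> nat \<Rightarrow> complex) \<Rightarrow> nat \<Rightarrow> complex" where
  "PF m r = (\<Sum>\<sigma>\<in>{\<sigma>. \<sigma> permutes {..<2*r}}. of_int (sign \<sigma>) * (\<Prod>i<r. m (\<sigma> (2*i)) (\<sigma> (2*i+1))))"

lemma meval_pfaff: "meval (pfaff M r) x = 1 / (2 ^ r * fact r) * PF (\<lambda>a b. meval (M a b) x) r"
  by (simp add: pfaff_def PF_def)

text \<open>Exchanging the two equal indices is a sign-reversing bijection of the terms.\<close>

lemma PF_equal_rows:
  assumes pq: "p < 2 * r" "q < 2 * r" "p \<noteq> q" and rows: "\<And>b. m p b = m q b" and cols: "\<And>b. m b p = m b q"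
  shows "PF m r = 0"
proof -
  let ?S = "{\<sigma>. \<sigma> permutes {..<2*r}}" and ?\<tau> = "transpose p q"
  let ?t = "\<lambda>\<sigma>. of_int (sign \<sigma>) * (\<Prod>i<r. m (\<sigma> (2*i)) (\<sigma> (2*i+1)))"
  have tau: "?\<tau> permutes {..<2*r}" using pq by (intro permutes_swap_id) auto
  have m\<tau>: "m (?\<tau> a) (?\<tau> b) = m a b" for a b
  proof -
    have "m (?\<tau> a) (?\<tau> b) = m a (?\<tau> b)" by (simp add: transpose_def rows)
    also have "\<dots> = m a b" by (simp add: transpose_def cols)
    finally show ?thesis .
  qed
  have bij: "bij_betw (\<lambda>\<sigma>. ?\<tau> \<circ> \<sigma>) ?S ?S"
  proof (rule bij_betwI[of _ _ _ "\<lambda>\<sigma>. ?\<tau> \<circ> \<sigma>"])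
    show "(\<lambda>\<sigma>. ?\<tau> \<circ> \<sigma>) \<in> ?S \<rightarrow> ?S" using permutes_compose[OF _ tau] by blast
    then show "(\<lambda>\<sigma>. ?\<tau> \<circ> \<sigma>) \<in> ?S \<rightarrow> ?S" .
    show "?\<tau> \<circ> (?\<tau> \<circ> \<sigma>) = \<sigma>" for \<sigma> :: "nat \<Rightarrow> nat" by (rule ext) simp
    then show "?\<tau> \<circ> (?\<tau> \<circ> \<sigma>) = \<sigma>" for \<sigma> :: "nat \<Rightarrow> nat" .
  qed
  have "PF m r = (\<Sum>\<sigma>\<in>?S. ?t (?\<tau> \<circ> \<sigma>))"
    unfolding PF_def by (rule sum.reindex_bij_betw[OF bij, symmetric])
  also have "\<dots> = (\<Sum>\<sigma>\<in>?S. - ?t \<sigma>)"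
  proof (rule sum.cong[OF refl])
    fix \<sigma> assume "\<sigma> \<in> ?S"
    then have "permutation \<sigma>" using permutation_permutes by auto
    then have "sign (?\<tau> \<circ> \<sigma>) = - sign \<sigma>"
      using pq by (simp add: sign_compose permutation_swap_id sign_swap_id)
    then show "?t (?\<tau> \<circ> \<sigma>) = - ?t \<sigma>" by (simp add: m\<tau>)
  qed
  also have "\<dots> = - PF m r" by (simp add: PF_def sum_negf)
  finally show ?thesis by simp
qed

lemma perm_slot:
  assumes "\<sigma> permutes {..<2*r}" "p < 2 * (r::nat)"
  obtains i where "i < r" "\<sigma> (2*i) = p \<or> \<sigma> (2*i+1) = p" "\<And>j. j \<noteq> i \<Longrightarrow> \<sigma> (2*j) \<noteq> p \<and> \<sigma> (2*j+1) \<noteq> p"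
    "\<sigma> (2*i) \<noteq> \<sigma> (2*i+1)"
proof -
  obtain c where c: "\<sigma> c = p" using permutes_surj[OF assms(1)] by (metis surjD)
  have inj: "inj \<sigma>" by (rule permutes_inj[OF assms(1)])
  have "c < 2 * r" using permutes_in_image[OF assms(1), of c] c assms(2) by auto
  then have i: "c div 2 < r" by auto
  have c2: "2 * (c div 2) = c \<or> 2 * (c div 2) + 1 = c" by presburger
  show ?thesis
  proof (rule that[OF i])
    show "\<sigma> (2 * (c div 2)) = p \<or> \<sigma> (2 * (c div 2) + 1) = p" using c2 c by auto
    show "\<sigma> (2 * j) \<noteq> p \<and> \<sigma> (2 * j + 1) \<noteq> p" if "j \<noteq> c div 2" for j
    proof -
      have "2 * j \<noteq> c" "2 * j + 1 \<noteq> c" using that by auto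
      then show ?thesis using inj c by (metis injD)
    qed
    show "\<sigma> (2 * (c div 2)) \<noteq> \<sigma> (2 * (c div 2) + 1)" using inj by (metis injD n_not_Suc_n Suc_eq_plus1)
  qed
qed

definition bil :: "'v set \<Rightarrow> ('v \<Rightarrow> 'v \<Rightarrow> complex) \<Rightarrow> ('v \<Rightarrow> complex) \<Rightarrow> ('v \<Rightarrow> complex) \<Rightarrow> complex" where
  "bil B om x y = (\<Sum>i\<in>B. \<Sum>j\<in>B. x i * y j * om i j)"

definition uvec :: "'v \<Rightarrow> 'v \<Rightarrow> complex" where
  "uvec j = (\<lambda>i. if i = j then 1 else 0)"

lemma bil_uvec_left: "finite B \<Longrightarrow> j \<in> B \<Longrightarrow> bil B om (uvec j) y = (\<Sum>i\<in>B. y i * om j i)"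
proof -
  assume "finite B" "j \<in> B"
  have "bil B om (uvec j) y = (\<Sum>i\<in>B. if i = j then (\<Sum>l\<in>B. y l * om j l) else 0)"
    unfolding bil_def by (intro sum.cong refl) (auto simp: uvec_def)
  then show ?thesis using \<open>finite B\<close> \<open>j \<in> B\<close> by simp
qed

lemma bil_uvec_right: "finite B \<Longrightarrow> j \<in> B \<Longrightarrow> bil B om x (uvec j) = (\<Sum>i\<in>B. x i * om i j)"
proof -
  assume "finite B" "j \<in> B"
  have "bil B om x (uvec j) = (\<Sum>i\<in>B. \<Sum>l\<in>B. if l = j then x i * om i j else 0)"
    unfolding bil_def by (intro sum.cong refl) (auto simp: uvec_def)
  then show ?thesis using \<open>finite B\<close> \<open>j \<in> B\<close> by simp
qed

lemma bil_uvec: "finite B \<Longrightarrow> i \<in> B \<Longrightarrow> j \<in> B \<Longrightarrow> bil B om (uvec i) (uvec j) = om i j"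
  by (simp add: bil_uvec_left) (simp add: uvec_def if_distrib[of "\<lambda>z. z * _"] cong: if_cong)

lemma bil_expand_left: "finite B \<Longrightarrow> bil B om x y = (\<Sum>j\<in>B. x j * bil B om (uvec j) y)"
proof -
  assume B: "finite B"
  have "(\<Sum>j\<in>B. x j * bil B om (uvec j) y) = (\<Sum>j\<in>B. x j * (\<Sum>i\<in>B. y i * om j i))"
    by (intro sum.cong refl) (simp add: bil_uvec_left B)
  then show ?thesis by (simp add: bil_def sum_distrib_left mult.assoc)
qed

lemma bil_expand_right: "finite B \<Longrightarrow> bil B om x y = (\<Sum>j\<in>B. y j * bil B om x (uvec j))"
proof -
  assume B: "finite B"
  have "(\<Sum>j\<in>B. y j * bil B om x (uvec j)) = (\<Sum>j\<in>B. \<Sum>i\<in>B. x i * y j * om i j)"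
    by (intro sum.cong refl) (simp add: bil_uvec_right B sum_distrib_left mult_ac)
  also have "\<dots> = bil B om x y" unfolding bil_def by (rule sum.swap)
  finally show ?thesis by simp
qed

text \<open>Each permutation puts \<open>p\<close> into exactly one of the pairs, so every term, and
  with it the sum, is linear in the vector \<open>v p\<close>.\<close>

lemma PF_expand:
  assumes B: "finite B" and p: "p < 2 * r"
  shows "PF (\<lambda>a b. bil B om (v a) (v b)) r = (\<Sum>j\<in>B. v p j * PF (\<lambda>a b. bil B om ((v(p := uvec j)) a) ((v(p := uvec j)) b)) r)"
proof -
  let ?S = "{\<sigma>. \<sigma> permutes {..<2*r}}"
  have slot: "(\<Prod>i<r. bil B om (v (\<sigma> (2*i))) (v (\<sigma> (2*i+1)))) =
      (\<Sum>j\<in>B. v p j * (\<Prod>i<r. bil B om ((v(p := uvec j)) (\<sigma> (2*i))) ((v(p := uvec j)) (\<sigma> (2*i+1)))))" if \<sigma>: "\<sigma> \<in> ?S" for \<sigma>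
  proof -
    obtain i0 where i0: "i0 < r" "\<sigma> (2*i0) = p \<or> \<sigma> (2*i0+1) = p" "\<And>j. j \<noteq> i0 \<Longrightarrow> \<sigma> (2*j) \<noteq> p \<and> \<sigma> (2*j+1) \<noteq> p"
      "\<sigma> (2*i0) \<noteq> \<sigma> (2*i0+1)" using perm_slot[of \<sigma> r p] \<sigma> p by blast
    have split: "(\<Prod>i<r. g i) = g i0 * (\<Prod>i\<in>{..<r} - {i0}. g i)" for g :: "nat \<Rightarrow> complex"
      using i0(1) by (intro prod.remove) auto
    have rest: "(\<Prod>i\<in>{..<r} - {i0}. bil B om ((v(p := uvec j)) (\<sigma> (2*i))) ((v(p := uvec j)) (\<sigma> (2*i+1)))) =
        (\<Prod>i\<in>{..<r} - {i0}. bil B om (v (\<sigma> (2*i))) (v (\<sigma> (2*i+1))))" for j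
      using i0(3) by (intro prod.cong) auto
    have first: "bil B om (v (\<sigma> (2*i0))) (v (\<sigma> (2*i0+1))) =
        (\<Sum>j\<in>B. v p j * bil B om ((v(p := uvec j)) (\<sigma> (2*i0))) ((v(p := uvec j)) (\<sigma> (2*i0+1))))"
      using i0(2)
    proof
      assume "\<sigma> (2*i0) = p"
      then show ?thesis using i0(4) bil_expand_left[OF B, of om "v p" "v (\<sigma> (2*i0+1))"] by auto
    next
      assume "\<sigma> (2*i0+1) = p"
      then show ?thesis using i0(4) bil_expand_right[OF B, of om "v (\<sigma> (2*i0))" "v p"] by auto
    qed
    show ?thesis unfolding split rest first by (simp add: sum_distrib_right mult.assoc)
  qed
  have "PF (\<lambda>a b. bil B om (v a) (v b)) r = (\<Sum>\<sigma>\<in>?S. \<Sum>j\<in>B. v p j * (of_int (sign \<sigma>) *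
      (\<Prod>i<r. bil B om ((v(p := uvec j)) (\<sigma> (2*i))) ((v(p := uvec j)) (\<sigma> (2*i+1))))))"
    unfolding PF_def
    by (intro sum.cong refl, subst slot, assumption) (simp only: sum_distrib_left mult.left_commute)
  also have "\<dots> = (\<Sum>j\<in>B. v p j * PF (\<lambda>a b. bil B om ((v(p := uvec j)) a) ((v(p := uvec j)) b)) r)"
    unfolding PF_def sum_distrib_left by (rule sum.swap)
  finally show ?thesis .
qed

text \<open>The vectors are replaced by basis vectors one by one, each time keeping a nonzero
  summand of the expansion. A repeated basis vector would make the Pfaffian vanish.\<close>

lemma PF_nonzero_basis:
  assumes B: "finite B" and nz: "PF (\<lambda>a b. bil B om (v a) (v b)) r \<noteq> 0"
  obtains xs where "distinct xs" "set xs \<subseteq> B" "length xs = 2 * r" "PF (\<lambda>a b. om (xs ! a) (xs ! b)) r \<noteq> 0"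
proof -
  have "\<exists>w x. (\<forall>a<t. w a = uvec (x a) \<and> x a \<in> B) \<and> PF (\<lambda>a b. bil B om (w a) (w b)) r \<noteq> 0" if "t \<le> 2 * r" for t
    using that
  proof (induction t)
    case 0
    then show ?case using nz by auto
  next
    case (Suc t)
    then obtain w x where w: "\<forall>a<t. w a = uvec (x a) \<and> x a \<in> B" "PF (\<lambda>a b. bil B om (w a) (w b)) r \<noteq> 0" by auto
    have "\<exists>j\<in>B. PF (\<lambda>a b. bil B om ((w(t := uvec j)) a) ((w(t := uvec j)) b)) r \<noteq> 0"
    proof (rule ccontr)
      assume "\<not> ?thesis"
      then have "PF (\<lambda>a b. bil B om (w a) (w b)) r = 0"
        using PF_expand[OF B, of t r om w] Suc.prems by (auto intro: sum.neutral)
      then show False using w by simp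
    qed
    then obtain j where "j \<in> B" "PF (\<lambda>a b. bil B om ((w(t := uvec j)) a) ((w(t := uvec j)) b)) r \<noteq> 0" by blast
    then show ?case using w(1) by (intro exI[of _ "w(t := uvec j)"] exI[of _ "x(t := j)"]) (auto simp: less_Suc_eq)
  qed
  from this[of "2 * r"] obtain w x where w: "\<And>a. a < 2 * r \<Longrightarrow> w a = uvec (x a) \<and> x a \<in> B" "PF (\<lambda>a b. bil B om (w a) (w b)) r \<noteq> 0" by auto
  have eq: "PF (\<lambda>a b. bil B om (w a) (w b)) r = PF (\<lambda>a b. om (x a) (x b)) r"
    unfolding PF_def
  proof (intro sum.cong refl arg_cong2[of _ _ _ _ "(*)"] prod.cong)
    fix \<sigma> i assume "\<sigma> \<in> {\<sigma>. \<sigma> permutes {..<2*r}}" "i \<in> {..<r}"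
    then have "\<sigma> (2*i) < 2*r" "\<sigma> (2*i+1) < 2*r" using permutes_in_image[of \<sigma> "{..<2*r}"] by auto
    then show "bil B om (w (\<sigma> (2*i))) (w (\<sigma> (2*i+1))) = om (x (\<sigma> (2*i))) (x (\<sigma> (2*i+1)))"
      using w(1) by (simp add: bil_uvec B)
  qed
  have inj: "x a \<noteq> x b" if "a < 2 * r" "b < 2 * r" "a \<noteq> b" for a b
  proof
    assume "x a = x b"
    then have "PF (\<lambda>a b. om (x a) (x b)) r = 0" by (intro PF_equal_rows[OF that]) auto
    then show False using w(2) eq by simp
  qed
  let ?xs = "map x [0..<2*r]"
  have "PF (\<lambda>a b. om (?xs ! a) (?xs ! b)) r = PF (\<lambda>a b. om (x a) (x b)) r"
    unfolding PF_def
  proof (intro sum.cong refl arg_cong2[of _ _ _ _ "(*)"] prod.cong)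
    fix \<sigma> i assume "\<sigma> \<in> {\<sigma>. \<sigma> permutes {..<2*r}}" "i \<in> {..<r}"
    then have "\<sigma> (2*i) < 2*r" "\<sigma> (2*i+1) < 2*r" using permutes_in_image[of \<sigma> "{..<2*r}"] by auto
    then show "om (?xs ! \<sigma> (2*i)) (?xs ! \<sigma> (2*i+1)) = om (x (\<sigma> (2*i))) (x (\<sigma> (2*i+1)))" by simp
  qed
  moreover have "distinct ?xs" unfolding distinct_map inj_on_def using inj by (metis atLeastLessThan_iff set_upt distinct_upt)
  moreover have "set ?xs \<subseteq> B" using w by auto
  ultimately show ?thesis using that[of ?xs] w(2) eq by simp
qed

definition Jm :: "nat \<Rightarrow> nat \<Rightarrow> complex" where
  "Jm a b = (if even a \<and> b = a + 1 then 1 else if even b \<and> a = b + 1 then -1 else 0)"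

lemma Jm_skew: "Jm b a = - Jm a b"
  by (auto simp: Jm_def)

text \<open>A nonzero term matches the indices in the standard pairs. Exchanging two pairs is an
  even permutation, and a swap inside a pair changes the sign of the permutation and of one entry;
  so every such term equals that of the identity.\<close>

lemma Jm_term:
  "\<sigma> permutes {..<2*r} \<Longrightarrow> (\<And>i. i < r \<Longrightarrow> Jm (\<sigma> (2*i)) (\<sigma> (2*i+1)) \<noteq> 0) \<Longrightarrow>
    of_int (sign \<sigma>) * (\<Prod>i<r. Jm (\<sigma> (2*i)) (\<sigma> (2*i+1))) = 1"
proof (induction r arbitrary: \<sigma>)
  case 0
  then have "\<sigma> = id" by (simp add: permutes_empty)
  then show ?case by simp
next
  case (Suc r)
  let ?n = "2 * Suc r"
  define X where "X \<sigma> = of_int (sign \<sigma>) * (\<Prod>i<Suc r. Jm (\<sigma> (2*i)) (\<sigma> (2*i+1)))" for \<sigma>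
  have A: "X \<sigma> = 1" if \<sigma>: "\<sigma> permutes {..<?n}" "\<And>i. i < Suc r \<Longrightarrow> Jm (\<sigma> (2*i)) (\<sigma> (2*i+1)) \<noteq> 0" and fix_top: "\<sigma> (2*r) = 2*r" "\<sigma> (2*r+1) = 2*r+1" for \<sigma>
  proof -
    have "\<sigma> permutes {..<2*r}"
    proof (rule permutes_superset[OF \<sigma>(1)])
      show "\<sigma> x = x" if "x \<in> {..<?n} - {..<2*r}" for x
      proof -
        have "x = 2*r \<or> x = 2*r+1" using that by auto
        then show ?thesis using fix_top by auto
      qed
    qed
    from Suc.IH[OF this] \<sigma>(2) have "of_int (sign \<sigma>) * (\<Prod>i<r. Jm (\<sigma> (2*i)) (\<sigma> (2*i+1))) = 1" by auto
    then show ?thesis unfolding X_def using fix_top by (simp add: Jm_def mult.assoc[symmetric])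
  qed
  \<comment> \<open>The top pair sits in slot \<open>i0\<close> in the right order; exchanging this
    slot with the last one is a product of two transpositions.\<close>
  have Bp: "X \<sigma> = 1" if \<sigma>: "\<sigma> permutes {..<?n}" "\<And>i. i < Suc r \<Longrightarrow> Jm (\<sigma> (2*i)) (\<sigma> (2*i+1)) \<noteq> 0"
    and i0: "i0 < Suc r" "\<sigma> (2*i0) = 2*r" "\<sigma> (2*i0+1) = 2*r+1" for \<sigma> i0
  proof (cases "i0 = r")
    case True
    then show ?thesis using A[OF \<sigma>] i0 by simp
  next
    case False
    let ?\<tau> = "transpose (2*i0) (2*r) \<circ> transpose (2*i0+1) (2*r+1)"
    have t\<tau>: "?\<tau> permutes {..<?n}" using i0 by (intro permutes_compose permutes_swap_id) auto
    have perm: "\<sigma> \<circ> ?\<tau> permutes {..<?n}" by (rule permutes_compose[OF t\<tau> \<sigma>(1)])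
    have s\<tau>: "sign ?\<tau> = 1" using False by (simp add: sign_compose permutation_swap_id sign_swap_id)
    have sgn: "sign (\<sigma> \<circ> ?\<tau>) = sign \<sigma>"
      using sign_compose[of \<sigma> ?\<tau>] s\<tau> permutation_permutes \<sigma>(1) t\<tau> by fastforce
    define \<pi> where "\<pi> = transpose i0 r"
    have ev: "?\<tau> (2*i) = 2 * \<pi> i" "?\<tau> (2*i+1) = 2 * \<pi> i + 1" for i
      using False by (auto simp: \<pi>_def transpose_def)
    have "(\<Prod>i<Suc r. Jm (\<sigma> (2 * \<pi> i)) (\<sigma> (2 * \<pi> i + 1))) = (\<Prod>i<Suc r. Jm (\<sigma> (2*i)) (\<sigma> (2*i+1)))"
      by (rule prod.permute[symmetric, where p = \<pi>, unfolded comp_def]) (use i0 in \<open>auto simp: \<pi>_def intro: permutes_swap_id\<close>)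
    then have "X (\<sigma> \<circ> ?\<tau>) = X \<sigma>" unfolding X_def sgn by (simp only: comp_def ev[unfolded comp_def])
    moreover have "X (\<sigma> \<circ> ?\<tau>) = 1"
    proof (rule A[OF perm])
      show "Jm ((\<sigma> \<circ> ?\<tau>) (2*i)) ((\<sigma> \<circ> ?\<tau>) (2*i+1)) \<noteq> 0" if "i < Suc r" for i
      proof -
        have "\<pi> i < Suc r" using that i0 by (auto simp: \<pi>_def transpose_def)
        then show ?thesis using \<sigma>(2)[of "\<pi> i"] by (simp only: comp_def ev[unfolded comp_def]) simp
      qed
      show "(\<sigma> \<circ> ?\<tau>) (2*r) = 2*r" "(\<sigma> \<circ> ?\<tau>) (2*r+1) = 2*r+1"
        using i0 ev[of r] by (simp_all only: comp_def ev[unfolded comp_def]) (simp_all add: \<pi>_def)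
    qed
    ultimately show ?thesis by simp
  qed
  have "\<exists>i0<Suc r. (\<sigma> (2*i0) = 2*r \<and> \<sigma> (2*i0+1) = 2*r+1) \<or> (\<sigma> (2*i0) = 2*r+1 \<and> \<sigma> (2*i0+1) = 2*r)"
  proof -
    obtain i0 where i0: "i0 < Suc r" "\<sigma> (2*i0) = 2*r \<or> \<sigma> (2*i0+1) = 2*r"
      by (rule perm_slot[OF Suc.prems(1), of "2*r"]) auto
    have "Jm (\<sigma> (2*i0)) (\<sigma> (2*i0+1)) \<noteq> 0" by (rule Suc.prems(2)[OF i0(1)])
    then show ?thesis using i0 by (intro exI[of _ i0]) (auto simp: Jm_def split: if_splits)
  qed
  then obtain i0 where i0: "i0 < Suc r" "(\<sigma> (2*i0) = 2*r \<and> \<sigma> (2*i0+1) = 2*r+1) \<or> (\<sigma> (2*i0) = 2*r+1 \<and> \<sigma> (2*i0+1) = 2*r)" by blast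
  have "X \<sigma> = 1"
  proof (cases "\<sigma> (2*i0) = 2*r")
    case True
    then show ?thesis using Bp[OF Suc.prems i0(1)] i0(2) by auto
  next
    case False
    \<comment> \<open>The top pair is reversed: one transposition repairs it, and its sign is
      compensated by the skew entry.\<close>
    let ?\<tau> = "transpose (2*i0) (2*i0+1)"
    have t\<tau>: "?\<tau> permutes {..<?n}" using i0 by (intro permutes_swap_id) auto
    have perm: "\<sigma> \<circ> ?\<tau> permutes {..<?n}" by (rule permutes_compose[OF t\<tau> Suc.prems(1)])
    have "sign ?\<tau> = -1" by (simp add: sign_swap_id)
    then have sgn: "sign (\<sigma> \<circ> ?\<tau>) = - sign \<sigma>"
      using sign_compose[of \<sigma> ?\<tau>] permutation_permutes Suc.prems(1) t\<tau> by fastforce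
    have ev: "?\<tau> (2*i) = (if i = i0 then 2*i0+1 else 2*i)" "?\<tau> (2*i+1) = (if i = i0 then 2*i0 else 2*i+1)" for i
      by (auto simp: transpose_def)
    have f: "Jm ((\<sigma> \<circ> ?\<tau>) (2*i)) ((\<sigma> \<circ> ?\<tau>) (2*i+1)) = (if i = i0 then -1 else 1) * Jm (\<sigma> (2*i)) (\<sigma> (2*i+1))" for i
      unfolding comp_def ev using Jm_skew[of "\<sigma> (2*i0)" "\<sigma> (2*i0+1)"] by simp
    have "(\<Prod>i<Suc r. (if i = i0 then -1 else 1 :: complex)) = -1" using i0(1) by (simp add: prod.delta del: prod.lessThan_Suc)
    then have "X (\<sigma> \<circ> ?\<tau>) = X \<sigma>" unfolding X_def sgn f prod.distrib by simp
    moreover have "X (\<sigma> \<circ> ?\<tau>) = 1"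
    proof (rule Bp[OF perm _ i0(1)])
      show "Jm ((\<sigma> \<circ> ?\<tau>) (2*i)) ((\<sigma> \<circ> ?\<tau>) (2*i+1)) \<noteq> 0" if "i < Suc r" for i
        unfolding f using Suc.prems(2)[OF that] by simp
      show "(\<sigma> \<circ> ?\<tau>) (2*i0) = 2*r" "(\<sigma> \<circ> ?\<tau>) (2*i0+1) = 2*r+1"
        using False i0(2) by (simp_all add: comp_def ev)
    qed
    ultimately show ?thesis by simp
  qed
  then show ?case unfolding X_def .
qed

text \<open>All nonzero terms equal 1, so nothing cancels and the sum counts them; the identity is
  one of them.\<close>

lemma PF_Jm_nonzero: "PF Jm r \<noteq> 0"
proof -
  let ?S = "{\<sigma>. \<sigma> permutes {..<2*r}}"
  let ?t = "\<lambda>\<sigma>. of_int (sign \<sigma>) * (\<Prod>i<r. Jm (\<sigma> (2*i)) (\<sigma> (2*i+1)))"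
  have t01: "?t \<sigma> = of_bool (\<forall>i<r. Jm (\<sigma> (2*i)) (\<sigma> (2*i+1)) \<noteq> 0)" if "\<sigma> \<in> ?S" for \<sigma>
  proof (cases "\<forall>i<r. Jm (\<sigma> (2*i)) (\<sigma> (2*i+1)) \<noteq> 0")
    case True
    then show ?thesis using Jm_term[of \<sigma> r] that by auto
  next
    case False
    then have "(\<Prod>i<r. Jm (\<sigma> (2*i)) (\<sigma> (2*i+1))) = 0" by (auto simp: prod_zero_iff)
    then have "?t \<sigma> = 0" by (simp only: mult_zero_right)
    then show ?thesis using False by (simp only: of_bool_def if_False)
  qed
  have fin: "finite ?S" by (simp add: finite_permutations)
  have "PF Jm r = (\<Sum>\<sigma>\<in>?S. of_bool (\<forall>i<r. Jm (\<sigma> (2*i)) (\<sigma> (2*i+1)) \<noteq> 0))"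
    unfolding PF_def by (rule sum.cong[OF refl t01])
  also have "\<dots> = of_nat (card {\<sigma>\<in>?S. \<forall>i<r. Jm (\<sigma> (2*i)) (\<sigma> (2*i+1)) \<noteq> 0})"
    using fin by (simp add: sum.If_cases of_bool_def Int_def conj_commute)
  finally have eq: "PF Jm r = of_nat (card {\<sigma>\<in>?S. \<forall>i<r. Jm (\<sigma> (2*i)) (\<sigma> (2*i+1)) \<noteq> 0})" .
  have "id \<in> {\<sigma>\<in>?S. \<forall>i<r. Jm (\<sigma> (2*i)) (\<sigma> (2*i+1)) \<noteq> 0}" by (auto simp: permutes_id Jm_def)
  then have "{\<sigma>\<in>?S. \<forall>i<r. Jm (\<sigma> (2*i)) (\<sigma> (2*i+1)) \<noteq> 0} \<noteq> {}" by blast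
  moreover have "finite {\<sigma>\<in>?S. \<forall>i<r. Jm (\<sigma> (2*i)) (\<sigma> (2*i+1)) \<noteq> 0}" by (rule finite_subset[OF _ fin]) blast
  ultimately have "card {\<sigma>\<in>?S. \<forall>i<r. Jm (\<sigma> (2*i)) (\<sigma> (2*i+1)) \<noteq> 0} > 0" by (simp only: card_gt_0_iff) simp
  then show ?thesis unfolding eq by simp
qed

section \<open>Dimension counts in spaces of coordinate vectors\<close>

interpretation fvs: vector_space "\<lambda>(c::complex) (f :: 'v \<Rightarrow> complex) v. c * f v"
  by unfold_locales (auto simp: fun_eq_iff algebra_simps)

lemma cdim_eq: "cdim S = fvs.dim S"
  by (simp add: cdim_def)

lemma sum_fun_apply: "(\<Sum>i\<in>I. f i) x = (\<Sum>i\<in>I. f i x :: complex)"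
  by (induction I rule: infinite_finite_induct) auto

lemma uvec_inj: "uvec i = uvec j \<Longrightarrow> i = j"
  unfolding uvec_def fun_eq_iff by (metis zero_neq_one)

lemma independent_uvec:
  assumes "finite J"
  shows "fvs.independent (uvec ` J)"
proof (rule fvs.independent_if_scalars_zero)
  fix f :: "('a \<Rightarrow> complex) \<Rightarrow> complex" and x
  assume s: "(\<Sum>x\<in>uvec ` J. (\<lambda>v. f x * x v)) = 0" and x: "x \<in> uvec ` J"
  obtain j where j: "j \<in> J" "x = uvec j" using x by blast
  have "0 = (\<Sum>x\<in>uvec ` J. (\<lambda>v. f x * x v)) j" unfolding s by simp
  also have "\<dots> = (\<Sum>i\<in>J. f (uvec i) * uvec i j)"
    by (subst sum.reindex) (auto simp: inj_on_def dest: uvec_inj simp: sum_fun_apply)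
  also have "\<dots> = (\<Sum>i\<in>J. if i = j then f (uvec j) else 0)" by (intro sum.cong) (auto simp: uvec_def)
  finally show "f x = 0" using j assms by simp
qed (use assms in auto)

lemma span_uvec:
  assumes "finite J" "\<And>j. j \<notin> J \<Longrightarrow> x j = 0"
  shows "x \<in> fvs.span (uvec ` J)"
proof -
  have "x = (\<Sum>j\<in>J. (\<lambda>v. x j * uvec j v))"
  proof
    fix i
    have "(\<Sum>j\<in>J. (\<lambda>v. x j * uvec j v)) i = (\<Sum>j\<in>J. if j = i then x i else 0)"
      by (auto simp: sum_fun_apply uvec_def intro!: sum.cong)
    then show "x i = (\<Sum>j\<in>J. (\<lambda>v. x j * uvec j v)) i" using assms by simp
  qed
  moreover have "(\<Sum>j\<in>J. (\<lambda>v. x j * uvec j v)) \<in> fvs.span (uvec ` J)"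
    by (intro fvs.span_sum fvs.span_scale fvs.span_base) auto
  ultimately show ?thesis by simp
qed

lemma fdim_le_card:
  fixes \<phi> :: "('v \<Rightarrow> complex) \<Rightarrow> ('w \<Rightarrow> complex)"
  assumes add: "\<And>x y. \<phi> (x + y) = \<phi> x + \<phi> y" and scale: "\<And>c x. \<phi> (\<lambda>v. c * x v) = (\<lambda>w. c * \<phi> x w)"
    and R: "fvs.subspace R" and inj: "\<And>x. x \<in> R \<Longrightarrow> \<phi> x = 0 \<Longrightarrow> x = 0"
    and supp: "\<And>x j. x \<in> R \<Longrightarrow> j \<notin> J \<Longrightarrow> \<phi> x j = 0" and J: "finite J"
  shows "fvs.dim R \<le> card J"
proof -
  interpret mh: module_hom "\<lambda>(c::complex) (f :: 'v \<Rightarrow> complex) v. c * f v" "\<lambda>(c::complex) (f :: 'w \<Rightarrow> complex) v. c * f v" \<phi>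
    by unfold_locales (auto simp: add scale)
  obtain Bs where Bs: "Bs \<subseteq> R" "fvs.independent Bs" "R \<subseteq> fvs.span Bs" "card Bs = fvs.dim R"
    using fvs.basis_exists[of R] by blast
  have sp: "fvs.span Bs \<subseteq> R" by (rule fvs.span_minimal[OF Bs(1) R])
  have inj': "inj_on \<phi> (fvs.span Bs)"
  proof (rule inj_onI)
    fix x y assume xy: "x \<in> fvs.span Bs" "y \<in> fvs.span Bs" "\<phi> x = \<phi> y"
    then have "x - y \<in> R" using fvs.subspace_diff[OF R] sp by blast
    moreover have "\<phi> (x - y) = 0" using xy mh.diff by simp
    ultimately show "x = y" using inj by fastforce
  qed
  have "fvs.independent (\<phi> ` Bs)" by (rule mh.independent_injective_image[OF Bs(2) inj'])
  moreover have "\<phi> ` Bs \<subseteq> fvs.span (uvec ` J)"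
    using Bs(1) supp J by (auto intro!: span_uvec)
  ultimately have "card (\<phi> ` Bs) \<le> card (uvec ` J)"
    using fvs.independent_span_bound[of "uvec ` J" "\<phi> ` Bs"] J by auto
  moreover have "card (\<phi> ` Bs) = card Bs"
    by (rule card_image, rule inj_on_subset[OF inj']) (simp add: fvs.span_superset)
  ultimately show ?thesis using card_image_le[OF J, of uvec] Bs(4) by simp
qed

lemma card_le_fdim:
  fixes \<phi> :: "('w \<Rightarrow> complex) \<Rightarrow> ('v \<Rightarrow> complex)"
  assumes add: "\<And>x y. \<phi> (x + y) = \<phi> x + \<phi> y" and scale: "\<And>c x. \<phi> (\<lambda>v. c * x v) = (\<lambda>w. c * \<phi> x w)"
    and inj: "\<And>x. (\<And>j. j \<notin> J \<Longrightarrow> x j = 0) \<Longrightarrow> \<phi> x = 0 \<Longrightarrow> x = 0"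
    and im: "\<And>j. j \<in> J \<Longrightarrow> \<phi> (uvec j) \<in> R" and J: "finite J"
    and B: "finite B" "\<And>x j. x \<in> R \<Longrightarrow> j \<notin> B \<Longrightarrow> x j = 0"
  shows "card J \<le> fvs.dim R"
proof -
  interpret mh: module_hom "\<lambda>(c::complex) (f :: 'w \<Rightarrow> complex) v. c * f v" "\<lambda>(c::complex) (f :: 'v \<Rightarrow> complex) v. c * f v" \<phi>
    by unfold_locales (auto simp: add scale)
  obtain Bs where Bs: "Bs \<subseteq> R" "fvs.independent Bs" "R \<subseteq> fvs.span Bs" "card Bs = fvs.dim R"
    using fvs.basis_exists[of R] by blast
  have "Bs \<subseteq> fvs.span (uvec ` B)" using Bs(1) B by (auto intro!: span_uvec)
  then have fin: "finite Bs" using fvs.independent_span_bound[of "uvec ` B" Bs] B Bs(2) by auto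
  have supp: "x j = 0" if "x \<in> fvs.span (uvec ` J)" "j \<notin> J" for x j
  proof -
    have "fvs.subspace {x. x j = 0}" by (rule fvs.subspaceI) auto
    then have "fvs.span (uvec ` J) \<subseteq> {x. x j = 0}"
      by (rule fvs.span_minimal[rotated]) (use that(2) in \<open>auto simp: uvec_def\<close>)
    then show ?thesis using that by blast
  qed
  have inj': "inj_on \<phi> (fvs.span (uvec ` J))"
  proof (rule inj_onI)
    fix x y assume xy: "x \<in> fvs.span (uvec ` J)" "y \<in> fvs.span (uvec ` J)" "\<phi> x = \<phi> y"
    then have "x - y \<in> fvs.span (uvec ` J)" by (intro fvs.span_diff)
    moreover have "\<phi> (x - y) = 0" using xy mh.diff by simp
    ultimately have "x - y = 0" using inj[of "x - y"] supp by blast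
    then show "x = y" by simp
  qed
  have "fvs.independent (\<phi> ` uvec ` J)" by (rule mh.independent_injective_image[OF independent_uvec[OF J] inj'])
  moreover have "\<phi> ` uvec ` J \<subseteq> fvs.span Bs" using im Bs(3) by blast
  ultimately have "card (\<phi> ` uvec ` J) \<le> card Bs"
    using fvs.independent_span_bound[OF fin] by blast
  moreover have "card (\<phi> ` uvec ` J) = card (uvec ` J :: ('w \<Rightarrow> complex) set)"
    by (rule card_image, rule inj_on_subset[OF inj']) (simp add: fvs.span_superset)
  moreover have "card (uvec ` J :: ('w \<Rightarrow> complex) set) = card J"
    by (rule card_image) (auto simp: inj_on_def dest: uvec_inj)
  ultimately show ?thesis using Bs(4) by simp
qed

section \<open>The radical of a skew form and its rank\<close>

definition rad :: "'v set \<Rightarrow> ('v \<Rightarrow> 'v \<Rightarrow> complex) \<Rightarrow> ('v \<Rightarrow> complex) set" where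
  "rad B om = {x. (\<forall>j. j \<notin> B \<longrightarrow> x j = 0) \<and> (\<forall>i\<in>B. (\<Sum>j\<in>B. x j * om j i) = 0)}"

lemma subspace_rad: "fvs.subspace (rad B om)"
proof (rule fvs.subspaceI)
  show "x + y \<in> rad B om" if "x \<in> rad B om" "y \<in> rad B om" for x y
    using that by (auto simp: rad_def distrib_right sum.distrib)
  show "(\<lambda>v. c * x v) \<in> rad B om" if "x \<in> rad B om" for c x
  proof -
    have "(\<Sum>j\<in>B. c * x j * om j i) = c * (\<Sum>j\<in>B. x j * om j i)" for i
      by (simp only: sum_distrib_left mult.assoc)
    then show ?thesis using that by (auto simp: rad_def)
  qed
qed (auto simp: rad_def)

lemma rad_bil:
  assumes "finite B" "x \<in> rad B om"
  shows "bil B om x y = 0"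
  unfolding bil_expand_right[OF assms(1), of om x y]
  by (rule sum.neutral) (use assms in \<open>auto simp: bil_uvec_right rad_def\<close>)

lemma bil_skew:
  assumes skew: "\<And>i j. i \<in> B \<Longrightarrow> j \<in> B \<Longrightarrow> om j i = - om i j"
  shows "bil B om y x = - bil B om x y"
proof -
  have "bil B om y x = (\<Sum>j\<in>B. \<Sum>i\<in>B. y i * x j * om i j)" unfolding bil_def by (rule sum.swap)
  also have "\<dots> = (\<Sum>j\<in>B. \<Sum>i\<in>B. - (x j * y i * om j i))" 
  proof (intro sum.cong refl)
    fix j i assume "j \<in> B" "i \<in> B"
    then have "om j i = - om i j" by (intro skew)
    then show "y i * x j * om i j = - (x j * y i * om j i)" by (simp only: mult_minus_right minus_minus mult.commute[of "y i"])
  qed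
  finally show ?thesis by (simp add: bil_def sum_negf)
qed

text \<open>A nonzero Pfaffian on \<open>xs\<close> makes the form nondegenerate on these indices,
  so a vector of the radical supported on \<open>xs\<close> vanishes. The coordinates outside
  \<open>xs\<close> therefore determine a vector of the radical.\<close>

lemma PF_rad_dim:
  assumes B: "finite B" and skew: "\<And>i j. i \<in> B \<Longrightarrow> j \<in> B \<Longrightarrow> om j i = - om i j"
    and xs: "distinct xs" "set xs \<subseteq> B" "length xs = 2 * r" and nz: "PF (\<lambda>a b. om (xs ! a) (xs ! b)) r \<noteq> 0"
  shows "2 * r + fvs.dim (rad B om) \<le> card B"
proof -
  define J where "J = B - set xs"
  have "fvs.dim (rad B om) \<le> card J"
  proof (rule fdim_le_card[where \<phi> = "\<lambda>x j. if j \<in> J then x j else 0"])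
    fix x assume x: "x \<in> rad B om" "(\<lambda>j. if j \<in> J then x j else 0) = 0"
    then have xJ: "x j = 0" if "j \<in> J" for j using that fun_cong[OF x(2), of j] by simp
    have x0: "x j = 0" if "j \<notin> set xs" for j using x(1) xJ that by (auto simp: rad_def J_def)
    show "x = 0"
    proof (rule ccontr)
      assume "x \<noteq> 0"
      then obtain j where "x j \<noteq> 0" by (auto simp: fun_eq_iff)
      then obtain p where p: "p < 2 * r" "x (xs ! p) \<noteq> 0" using x0 xs(3) by (metis in_set_conv_nth)
      define v where "v a = uvec (xs ! a)" for a
      \<comment> \<open>Putting a vector of the radical in place of the \<open>p\<close>-th basis
        vector kills the Pfaffian. Expanding that vector gives its coordinate at
        \<open>xs ! p\<close> times the original Pfaffian, all other terms having a repeated index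
        or a zero coordinate.\<close>
      define v' where "v' = v(p := x)"
      have xsB: "xs ! a \<in> B" if "a < 2 * r" for a using that xs by (metis nth_mem subsetD)
      have "PF (\<lambda>a b. bil B om (v' a) (v' b)) r = 0"
        unfolding PF_def
      proof (rule sum.neutral, intro ballI)
        fix \<sigma> assume "\<sigma> \<in> {\<sigma>. \<sigma> permutes {..<2*r}}"
        then obtain i where i: "i < r" "\<sigma> (2*i) = p \<or> \<sigma> (2*i+1) = p" using perm_slot[of \<sigma> r p] p by blast
        have l: "bil B om x y = 0" for y by (rule rad_bil[OF B x(1)])
        have "bil B om y x = - bil B om x y" for y by (rule bil_skew) (rule skew)
        then have "bil B om y x = 0" for y unfolding l by simp
        with l have "bil B om (v' (\<sigma> (2*i))) (v' (\<sigma> (2*i+1))) = 0" using i(2) by (auto simp: v'_def)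
        then have "(\<Prod>i<r. bil B om (v' (\<sigma> (2*i))) (v' (\<sigma> (2*i+1)))) = 0" using i(1) by (intro prod_zero) auto
        then show "of_int (sign \<sigma>) * (\<Prod>i<r. bil B om (v' (\<sigma> (2*i))) (v' (\<sigma> (2*i+1)))) = 0" by simp
      qed
      moreover have "PF (\<lambda>a b. bil B om (v' a) (v' b)) r = (\<Sum>j\<in>B. if j = xs ! p then x (xs ! p) * PF (\<lambda>a b. bil B om (v a) (v b)) r else 0)"
        unfolding PF_expand[OF B p(1), of om v']
      proof (intro sum.cong refl)
        fix j assume j: "j \<in> B"
        have up: "v'(p := uvec j) = v(p := uvec j)" by (simp add: v'_def)
        show "v' p j * PF (\<lambda>a b. bil B om ((v'(p := uvec j)) a) ((v'(p := uvec j)) b)) r =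
          (if j = xs ! p then x (xs ! p) * PF (\<lambda>a b. bil B om (v a) (v b)) r else 0)"
        proof (cases "j = xs ! p")
          case True
          then have "v(p := uvec j) = v" by (auto simp: v_def)
          then show ?thesis unfolding up using True by (simp add: v'_def)
        next
          case False
          show ?thesis
          proof (cases "j \<in> set xs")
            case True
            then obtain q where q: "q < 2 * r" "j = xs ! q" using xs(3) by (metis in_set_conv_nth)
            then have "q \<noteq> p" using False by auto
            then have "PF (\<lambda>a b. bil B om ((v(p := uvec j)) a) ((v(p := uvec j)) b)) r = 0"
              by (intro PF_equal_rows[OF q(1) p(1)]) (auto simp: v_def q(2))
            then show ?thesis unfolding up using False by (simp only: mult_zero_right if_False)
          next
            case False
            then show ?thesis using x0[of j] p xs by (auto simp: v'_def)
          qed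
        qed
      qed
      moreover have "\<dots> = x (xs ! p) * PF (\<lambda>a b. bil B om (v a) (v b)) r" using B xsB[OF p(1)] by simp
      moreover have "PF (\<lambda>a b. bil B om (v a) (v b)) r = PF (\<lambda>a b. om (xs ! a) (xs ! b)) r"
        unfolding PF_def
      proof (intro sum.cong refl arg_cong2[of _ _ _ _ "(*)"] prod.cong)
        fix \<sigma> i assume "\<sigma> \<in> {\<sigma>. \<sigma> permutes {..<2*r}}" "i \<in> {..<r}"
        then have "\<sigma> (2*i) < 2*r" "\<sigma> (2*i+1) < 2*r" using permutes_in_image[of \<sigma> "{..<2*r}"] by auto
        then show "bil B om (v (\<sigma> (2*i))) (v (\<sigma> (2*i+1))) = om (xs ! \<sigma> (2*i)) (xs ! \<sigma> (2*i+1))"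
          using xsB by (simp add: v_def bil_uvec B)
      qed
      ultimately show False using nz p(2) by simp
    qed
  qed (use B in \<open>auto simp: J_def subspace_rad fun_eq_iff\<close>)
  moreover have "card J + 2 * r = card B"
  proof -
    have "card (set xs) = 2 * r" using distinct_card[OF xs(1)] xs(3) by simp
    moreover have "card (set xs) \<le> card B" by (rule card_mono[OF B xs(2)])
    ultimately show ?thesis using card_Diff_subset[OF _ xs(2)] by (simp add: J_def)
  qed
  ultimately show ?thesis by simp
qed

lemma bil_lin_left:
  "bil B om (\<lambda>j. x j - (\<Sum>i\<in>I. \<alpha> i * y i j - \<beta> i * z i j)) w =
     bil B om x w - (\<Sum>i\<in>I. \<alpha> i * bil B om (y i) w - \<beta> i * bil B om (z i) w)"
proof -
  have "bil B om (\<lambda>j. x j - (\<Sum>i\<in>I. \<alpha> i * y i j - \<beta> i * z i j)) w =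
     bil B om x w - (\<Sum>j\<in>B. \<Sum>l\<in>B. \<Sum>i\<in>I. \<alpha> i * (y i j * w l * om j l) - \<beta> i * (z i j * w l * om j l))"
    unfolding bil_def sum_subtractf[symmetric]
    by (intro sum.cong refl) (simp add: left_diff_distrib sum_distrib_right mult.assoc)
  also have "(\<Sum>j\<in>B. \<Sum>l\<in>B. \<Sum>i\<in>I. \<alpha> i * (y i j * w l * om j l) - \<beta> i * (z i j * w l * om j l)) =
     (\<Sum>i\<in>I. \<Sum>j\<in>B. \<Sum>l\<in>B. \<alpha> i * (y i j * w l * om j l) - \<beta> i * (z i j * w l * om j l))"
    by (rule sum3_cyc[symmetric])
  also have "\<dots> = (\<Sum>i\<in>I. \<alpha> i * bil B om (y i) w - \<beta> i * bil B om (z i) w)"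
    unfolding bil_def by (simp add: sum_subtractf sum_distrib_left)
  finally show ?thesis .
qed

lemma bil_scale_left: "bil B om (\<lambda>j. c * x j) w = c * bil B om x w"
  unfolding bil_def by (simp add: sum_distrib_left mult.assoc)

lemma Jm_sum:
  assumes "b < 2 * r"
  shows "(\<Sum>i<r. g (2*i+1) * Jm (2*i) b - g (2*i) * Jm (2*i+1) b) = (g b :: complex)"
proof -
  have b2: "b = 2 * (b div 2) \<or> b = 2 * (b div 2) + 1" by presburger
  have "(\<Sum>i<r. g (2*i+1) * Jm (2*i) b - g (2*i) * Jm (2*i+1) b) = (\<Sum>i<r. if i = b div 2 then g b else 0)"
  proof (intro sum.cong refl)
    fix i
    show "g (2*i+1) * Jm (2*i) b - g (2*i) * Jm (2*i+1) b = (if i = b div 2 then g b else 0)"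
    proof (cases "i = b div 2")
      case True
      from b2 show ?thesis
      proof
        assume "b = 2 * (b div 2)"
        then have "b = 2 * i" using True by simp
        then show ?thesis by (simp add: Jm_def)
      next
        assume "b = 2 * (b div 2) + 1"
        then have "b = 2 * i + 1" using True by simp
        then show ?thesis by (simp add: Jm_def)
      qed
    next
      case False
      then have "Jm (2*i) b = 0" "Jm (2*i+1) b = 0" by (auto simp: Jm_def)
      then show ?thesis using False by simp
    qed
  qed
  then show ?thesis using assms by simp
qed

text \<open>Symplectic Gram-Schmidt. A maximal family of hyperbolic pairs has the Pfaffian of the
  standard form, and together with the radical it spans everything, which turns the bound of
  \<open>PF_rad_dim\<close> into an equality.\<close>

lemma rank_PF:
  assumes B: "finite B" and skew: "\<And>i j. i \<in> B \<Longrightarrow> j \<in> B \<Longrightarrow> om j i = - om i j"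
  obtains r xs where "distinct xs" "set xs \<subseteq> B" "length xs = 2 * r" "PF (\<lambda>a b. om (xs ! a) (xs ! b)) r \<noteq> 0"
    "card B = 2 * r + fvs.dim (rad B om)"
proof -
  define Hy where "Hy r v \<longleftrightarrow> (\<forall>a<2*r. \<forall>b<2*r. bil B om (v a) (v b) = Jm a b)" for r :: nat and v
  have Hy_PF: "\<exists>xs. distinct xs \<and> set xs \<subseteq> B \<and> length xs = 2 * r \<and> PF (\<lambda>a b. om (xs ! a) (xs ! b)) r \<noteq> 0" if "Hy r v" for r v
  proof -
    have "PF (\<lambda>a b. bil B om (v a) (v b)) r = PF Jm r"
      unfolding PF_def
    proof (intro sum.cong refl arg_cong2[of _ _ _ _ "(*)"] prod.cong)
      fix \<sigma> i assume "\<sigma> \<in> {\<sigma>. \<sigma> permutes {..<2*r}}" "i \<in> {..<r}"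
      then have "\<sigma> (2*i) < 2*r" "\<sigma> (2*i+1) < 2*r" using permutes_in_image[of \<sigma> "{..<2*r}"] by auto
      then show "bil B om (v (\<sigma> (2*i))) (v (\<sigma> (2*i+1))) = Jm (\<sigma> (2*i)) (\<sigma> (2*i+1))"
        using that by (simp add: Hy_def)
    qed
    then have "PF (\<lambda>a b. bil B om (v a) (v b)) r \<noteq> 0" using PF_Jm_nonzero by simp
    from PF_nonzero_basis[OF B this] show ?thesis by metis
  qed
  have bound: "2 * r \<le> card B" if "Hy r v" for r v
    using Hy_PF[OF that] card_mono[OF B] distinct_card by metis
  have "\<exists>r. (\<exists>v. Hy r v) \<and> \<not> (\<exists>v. Hy (Suc r) v)"
  proof (rule ccontr)
    assume "\<not> ?thesis"
    then have step: "\<exists>v. Hy (Suc r) v" if "\<exists>v. Hy r v" for r using that by blast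
    have "\<exists>v. Hy r v" for r
    proof (induction r)
      case 0
      show ?case by (simp add: Hy_def)
    qed (rule step)
    then obtain v where "Hy (Suc (card B)) v" by blast
    from bound[OF this] show False by simp
  qed
  then obtain r v where v: "Hy r v" and max: "\<And>v. \<not> Hy (Suc r) v" by blast
  \<comment> \<open>The projection to the orthogonal complement of the hyperbolic pairs.\<close>
  define pr where "pr x = (\<lambda>j. x j - (\<Sum>i<r. bil B om x (v (2*i+1)) * v (2*i) j - bil B om x (v (2*i)) * v (2*i+1) j))" for x
  have pr: "bil B om (pr x) w = bil B om x w - (\<Sum>i<r. bil B om x (v (2*i+1)) * bil B om (v (2*i)) w - bil B om x (v (2*i)) * bil B om (v (2*i+1)) w)" for x w
    unfolding pr_def by (rule bil_lin_left)
  have prv: "bil B om (pr x) (v b) = 0" if b: "b < 2 * r" for x b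
  proof -
    have "(\<Sum>i<r. bil B om x (v (2*i+1)) * bil B om (v (2*i)) (v b) - bil B om x (v (2*i)) * bil B om (v (2*i+1)) (v b)) =
      (\<Sum>i<r. bil B om x (v (2*i+1)) * Jm (2*i) b - bil B om x (v (2*i)) * Jm (2*i+1) b)"
      using v b by (intro sum.cong refl) (auto simp: Hy_def)
    also have "\<dots> = bil B om x (v b)" by (rule Jm_sum[OF b])
    finally show ?thesis unfolding pr by simp
  qed
  have sk: "bil B om y x = - bil B om x y" for x y by (rule bil_skew) (rule skew)
  \<comment> \<open>Otherwise \<open>pr x\<close> together with \<open>pr y\<close> scaled by
    \<open>1 / c\<close> is one more hyperbolic pair, against maximality.\<close>
  have pr0: "bil B om (pr x) y = 0" for x y
  proof (rule ccontr)
    assume nz: "bil B om (pr x) y \<noteq> 0"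
    define c where "c = bil B om (pr x) y"
    have vpr: "bil B om (v b) (pr x) = 0" if "b < 2 * r" for b x using prv[OF that, of x] sk[of "v b" "pr x"] by (simp only: neg_equal_0_iff_equal)
    have "bil B om (pr y) (pr x) = bil B om y (pr x)"
    proof -
      have "(\<Sum>i<r. bil B om y (v (2*i+1)) * bil B om (v (2*i)) (pr x) - bil B om y (v (2*i)) * bil B om (v (2*i+1)) (pr x)) = 0"
        by (rule sum.neutral) (auto simp: vpr)
      then show ?thesis unfolding pr[of y "pr x"] by simp
    qed
    then have pp: "bil B om (pr y) (pr x) = - c" using sk[of "pr x" y] by (simp add: c_def)
    define z where "z = (\<lambda>j. (1 / c) * pr y j)"
    have zl: "bil B om z w = bil B om (pr y) w / c" for w unfolding z_def bil_scale_left by simp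
    have c0: "c \<noteq> 0" using nz by (simp add: c_def)
    define v' where "v' = v(2*r := pr x, 2*r+1 := z)"
    have self: "bil B om w w = 0" for w using sk[of w w] by simp
    have zx: "bil B om z (pr x) = -1" using zl pp c0 by simp
    have xz: "bil B om (pr x) z = 1" using sk[of "pr x" z] zx by simp
    have zv: "bil B om z (v b) = 0" "bil B om (v b) z = 0" if "b < 2 * r" for b
      using zl prv[OF that] sk[of "v b" z] by simp_all
    have J0: "Jm a (2*r) = 0" "Jm (2*r) a = 0" if "a < 2 * r" for a
    proof -
      have "even a \<Longrightarrow> 2 * r \<noteq> a + 1" by presburger
      then show "Jm a (2*r) = 0" using that by (auto simp: Jm_def)
      then show "Jm (2*r) a = 0" using Jm_skew[of "2*r" a] by simp
    qed
    have "Hy (Suc r) v'"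
      unfolding Hy_def
    proof (intro allI impI)
      fix a b assume "a < 2 * Suc r" "b < 2 * Suc r"
      then have a: "a < 2*r \<or> a = 2*r \<or> a = 2*r+1" and b: "b < 2*r \<or> b = 2*r \<or> b = 2*r+1" by auto
      show "bil B om (v' a) (v' b) = Jm a b"
        using a
      proof (elim disjE)
        assume a: "a < 2*r"
        then show ?thesis using b
        proof (elim disjE)
          assume "b < 2*r" then show ?thesis using a v by (simp add: v'_def Hy_def)
        next
          assume "b = 2*r" then show ?thesis using a vpr J0 by (simp add: v'_def)
        next
          assume "b = 2*r+1" then show ?thesis using a zv by (auto simp: v'_def Jm_def)
        qed
      next
        assume a: "a = 2*r"
        then show ?thesis using b
        proof (elim disjE)
          assume "b < 2*r" then show ?thesis using a prv J0 by (simp add: v'_def)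
        next
          assume "b = 2*r" then show ?thesis using a self by (auto simp: v'_def Jm_def)
        next
          assume "b = 2*r+1" then show ?thesis using a xz by (auto simp: v'_def Jm_def)
        qed
      next
        assume a: "a = 2*r+1"
        then show ?thesis using b
        proof (elim disjE)
          assume "b < 2*r" then show ?thesis using a zv by (auto simp: v'_def Jm_def)
        next
          assume "b = 2*r" then show ?thesis using a zx by (auto simp: v'_def Jm_def)
        next
          assume "b = 2*r+1" then show ?thesis using a self by (auto simp: v'_def Jm_def)
        qed
      qed
    qed
    then show False using max by blast
  qed
  obtain xs where xs: "distinct xs" "set xs \<subseteq> B" "length xs = 2 * r" "PF (\<lambda>a b. om (xs ! a) (xs ! b)) r \<noteq> 0"
    using Hy_PF[OF v] by blast
  have upper: "2 * r + fvs.dim (rad B om) \<le> card B" by (rule PF_rad_dim[OF B skew xs])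
  obtain Br where Br: "Br \<subseteq> rad B om" "fvs.independent Br" "rad B om \<subseteq> fvs.span Br" "card Br = fvs.dim (rad B om)"
    using fvs.basis_exists[of "rad B om"] by blast
  have "Br \<subseteq> fvs.span (uvec ` B)" using Br(1) B by (auto intro!: span_uvec simp: rad_def)
  then have fin: "finite Br" using fvs.independent_span_bound[of "uvec ` B" Br] B Br(2) by auto
  \<comment> \<open>\<open>bil\<close> sees only the coordinates in \<open>B\<close>, while vectors
    of \<open>rad\<close> vanish outside it; cutting off the other coordinates reconciles the
    two.\<close>
  define res where "res x = (\<lambda>j. if j \<in> B then x j else 0)" for x :: "'a \<Rightarrow> complex"
  let ?S = "Br \<union> (\<lambda>a. res (v a)) ` {..<2*r}"
  have "uvec ` B \<subseteq> fvs.span ?S"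
  proof
    fix x assume "x \<in> uvec ` B"
    then obtain j where j: "j \<in> B" "x = uvec j" by blast
    have "res (pr x) \<in> rad B om"
    proof -
      have "(\<Sum>l\<in>B. res (pr x) l * om l i) = 0" if "i \<in> B" for i
      proof -
        have "(\<Sum>l\<in>B. res (pr x) l * om l i) = bil B om (pr x) (uvec i)"
          using that B by (auto simp: bil_uvec_right res_def intro!: sum.cong)
        then show ?thesis by (simp add: pr0)
      qed
      then show ?thesis by (auto simp: rad_def res_def)
    qed
    then have 1: "res (pr x) \<in> fvs.span ?S" using Br(3) fvs.span_mono[of Br ?S] by blast
    have 2: "(\<Sum>i<r. (\<lambda>j. bil B om x (v (2*i+1)) * res (v (2*i)) j) - (\<lambda>j. bil B om x (v (2*i)) * res (v (2*i+1)) j)) \<in> fvs.span ?S"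
      by (intro fvs.span_sum fvs.span_diff fvs.span_scale fvs.span_base) auto
    have "x = res (pr x) + (\<Sum>i<r. (\<lambda>j. bil B om x (v (2*i+1)) * res (v (2*i)) j) - (\<lambda>j. bil B om x (v (2*i)) * res (v (2*i+1)) j))"
    proof
      fix i
      show "x i = (res (pr x) + (\<Sum>i<r. (\<lambda>j. bil B om x (v (2*i+1)) * res (v (2*i)) j) - (\<lambda>j. bil B om x (v (2*i)) * res (v (2*i+1)) j))) i"
        using j by (auto simp: res_def pr_def sum_fun_apply uvec_def)
    qed
    then show "x \<in> fvs.span ?S" using fvs.span_add[OF 1 2] by metis
  qed
  then have "card (uvec ` B :: ('a \<Rightarrow> complex) set) \<le> card ?S"
    using fvs.independent_span_bound[of ?S "uvec ` B"] independent_uvec[OF B] fin by simp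
  moreover have "card (uvec ` B :: ('a \<Rightarrow> complex) set) = card B"
    by (rule card_image) (auto simp: inj_on_def dest: uvec_inj)
  moreover have "card ?S \<le> card Br + 2 * r"
    using card_Un_le[of Br "(\<lambda>a. res (v a)) ` {..<2*r}"] card_image_le[of "{..<2*r}" "\<lambda>a. res (v a)"] by simp
  ultimately have "card B = 2 * r + fvs.dim (rad B om)" using upper Br(4) by linarith
  then show ?thesis using that xs by blast
qed

section \<open>Stabilisers\<close>

definition brm :: "nat \<Rightarrow> nat \<Rightarrow> (qidx \<Rightarrow> complex) \<Rightarrow> qidx \<Rightarrow> qidx \<Rightarrow> complex" where
  "brm n k \<gamma> i j = meval (brpoly n k i j) \<gamma>"

lemma stab_rad: "stab n k \<gamma> = rad (qbasis n k) (brm n k \<gamma>)"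
  by (simp add: stab_def rad_def brm_def)

lemma coord_qbr_skew: "coord l (qbr n a b) = - coord l (qbr n b a)"
proof -
  obtain X Y Z X' Y' Z' where *: "a = (X, Y, Z)" "b = (X', Y', Z')" by (metis prod_cases3)
  show ?thesis by (cases l) (auto simp: * qbr_def sum_negf[symmetric] intro!: sum.cong)
qed

lemma brm_skew: "brm n k \<gamma> j i = - brm n k \<gamma> i j"
proof -
  have "brm n k \<gamma> j i = (\<Sum>l\<in>qbasis n k. coord l (qbr n (belt j) (belt i)) * \<gamma> l)" by (simp add: brm_def brpoly_def)
  also have "\<dots> = (\<Sum>l\<in>qbasis n k. - (coord l (qbr n (belt i) (belt j)) * \<gamma> l))"
    by (rule sum.cong[OF refl], subst coord_qbr_skew) simp
  also have "\<dots> = - brm n k \<gamma> i j" by (simp add: brm_def brpoly_def sum_negf)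
  finally show ?thesis .
qed

lemma brm_cong: "(\<And>l. l \<in> qbasis n k \<Longrightarrow> \<gamma> l = \<gamma>' l) \<Longrightarrow> brm n k \<gamma> i j = brm n k \<gamma>' i j"
  by (simp add: brm_def brpoly_def)

text \<open>The equation for \<open>a\<close> holds up to a scalar \<open>r\<close>, since
  \<open>a\<close> represents a functional on traceless matrices only.\<close>

definition stabm :: "nat \<Rightarrow> nat \<Rightarrow> triple \<Rightarrow> triple set" where
  "stabm n k T = (case T of (a, u, w) \<Rightarrow> {(Y, b, c). Y \<in> carrier_mat n n \<and> b \<in> carrier_mat k n \<and> c \<in> carrier_mat n k \<and>
     (\<Sum>i<n. Y $$ (i, i)) = 0 \<and> Y * u = 0\<^sub>m n k \<and> w * Y = 0\<^sub>m k n \<and>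
     (\<exists>r. Y * a - a * Y + (u * b + c * w) = r \<cdot>\<^sub>m 1\<^sub>m n)})"

lemma Yof_trace: "(\<Sum>i<n. Yof n x $$ (i, i)) = 0"
proof (cases n)
  case (Suc m)
  have "(\<Sum>i<n. Yof n x $$ (i, i)) = (\<Sum>i<n. if i + 1 < n then x (H i) else 0) - (\<Sum>i<n. if 0 < i then x (H (i - 1)) else 0)"
    unfolding sum_subtractf[symmetric] by (intro sum.cong refl) (auto simp: Yof_def)
  also have "(\<Sum>i<n. if i + 1 < n then x (H i) else 0) = (\<Sum>i<m. x (H i))" by (simp add: Suc)
  also have "(\<Sum>i<n. if 0 < i then x (H (i - 1)) else 0) = (\<Sum>i<m. x (H i))"
    unfolding Suc by (subst sum.lessThan_Suc_shift) simp
  finally show ?thesis by simp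
qed simp

lemma stab_stabm:
  assumes T: "T \<in> carr n k" and n: "0 < n" and x: "x \<in> stab n k (proj n k T)"
  shows "(Yof n x, bof n k x, cof n k x) \<in> stabm n k T"
proof -
  obtain a u w where T': "T = (a, u, w)" by (cases T)
  have c: "a \<in> carrier_mat n n" "u \<in> carrier_mat n k" "w \<in> carrier_mat k n" using T by (auto simp: T')
  let ?Y = "Yof n x" and ?b = "bof n k x" and ?c = "cof n k x"
  define P where "P = ?Y * a - a * ?Y + (u * ?b + ?c * w)"
  have P: "P \<in> carrier_mat n n" using c unfolding P_def by (intro add_carrier_mat mult_carrier_mat[of _ n k]) (auto simp: Yof_carrier)
  have z: "tproj (P, ?Y * u, - (w * ?Y)) j = 0" if "j \<in> qbasis n k" for j
  proof -
    have "(\<Sum>i\<in>qbasis n k. x i * meval (brpoly n k i j) (proj n k T)) = 0" using x that by (auto simp: stab_def)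
    then show ?thesis using br_dact[OF T that, of x] by (simp add: T' P_def)
  qed
  have "?Y * u = 0\<^sub>m n k"
  proof (rule eq_matI)
    fix i d assume "i < dim_row (0\<^sub>m n k :: complex mat)" "d < dim_col (0\<^sub>m n k :: complex mat)"
    then show "(?Y * u) $$ (i, d) = 0\<^sub>m n k $$ (i, d)" using z[of "U d i"] by (simp del: index_mult_mat(1))
  qed (use c in \<open>auto simp: Yof_def\<close>)
  moreover have "w * ?Y = 0\<^sub>m k n"
  proof (rule eq_matI)
    fix d i assume di: "d < dim_row (0\<^sub>m k n :: complex mat)" "i < dim_col (0\<^sub>m k n :: complex mat)"
    have "d < dim_row (w * ?Y)" "i < dim_col (w * ?Y)" using c di by (auto simp: Yof_def)
    then show "(w * ?Y) $$ (d, i) = 0\<^sub>m k n $$ (d, i)" using z[of "W d i"] di by (simp del: index_mult_mat)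
  qed (use c in \<open>auto simp: Yof_def\<close>)
  moreover have "\<exists>r. P = r \<cdot>\<^sub>m 1\<^sub>m n"
  proof (rule exI[of _ "P $$ (0, 0)"])
    show "P = P $$ (0, 0) \<cdot>\<^sub>m 1\<^sub>m n"
  proof (rule eq_matI)
    have diag: "P $$ (i, i) = P $$ (0, 0)" if "i < n" for i
      using that
    proof (induction i)
      case (Suc i)
      then have "P $$ (i, i) - P $$ (i + 1, i + 1) = 0" using z[of "H i"] by simp
      then show ?case using Suc by simp
    qed simp
    fix i j assume "i < dim_row (P $$ (0, 0) \<cdot>\<^sub>m 1\<^sub>m n)" "j < dim_col (P $$ (0, 0) \<cdot>\<^sub>m 1\<^sub>m n)"
    then have ij: "i < n" "j < n" by auto
    show "P $$ (i, j) = (P $$ (0, 0) \<cdot>\<^sub>m 1\<^sub>m n) $$ (i, j)"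
    proof (cases "i = j")
      case True
      then show ?thesis using ij diag[OF ij(1)] by simp
    next
      case False
      then show ?thesis using ij z[of "E i j"] by simp
    qed
  qed (use P in auto)
  qed
  ultimately show ?thesis unfolding P_def by (simp add: T' stabm_def Yof_trace)
qed

lemma trace_mult_comm:
  fixes A B :: "complex mat"
  assumes "A \<in> carrier_mat n m" "B \<in> carrier_mat m n"
  shows "(\<Sum>i<n. (A * B) $$ (i, i)) = (\<Sum>i<m. (B * A) $$ (i, i))"
proof -
  have "(\<Sum>i<n. (A * B) $$ (i, i)) = (\<Sum>i<n. \<Sum>l<m. A $$ (i, l) * B $$ (l, i))"
    using assms by (intro sum.cong refl mult_mat_entry) auto
  also have "\<dots> = (\<Sum>l<m. \<Sum>i<n. B $$ (l, i) * A $$ (i, l))" by (subst sum.swap) (simp add: mult.commute)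
  also have "\<dots> = (\<Sum>l<m. (B * A) $$ (l, l))"
    using assms by (intro sum.cong refl mult_mat_entry[symmetric]) auto
  finally show ?thesis .
qed

section \<open>Upper bounds for stabilisers\<close>

definition tcarr :: "nat \<Rightarrow> nat \<Rightarrow> triple set" where
  "tcarr n k = carrier_mat n n \<times> carrier_mat k n \<times> carrier_mat n k"

text \<open>\<open>small n k d T\<close> bounds the dimension of the stabiliser of \<open>T\<close> by \<open>d\<close> through an injective linear
  map into \<open>\<complex>\<^sup>d\<close>, a formulation that is easily transported along moves.\<close>

definition small_via :: "nat \<Rightarrow> nat \<Rightarrow> nat \<Rightarrow> triple \<Rightarrow> (complex mat \<Rightarrow> complex mat \<Rightarrow> complex mat \<Rightarrow> nat \<Rightarrow> complex) \<Rightarrow> bool" where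
  "small_via n k d T \<phi> \<longleftrightarrow>
     (\<forall>Y b c Y' b' c'. (Y, b, c) \<in> tcarr n k \<longrightarrow> (Y', b', c') \<in> tcarr n k \<longrightarrow>
        \<phi> (Y + Y') (b + b') (c + c') = (\<lambda>l. \<phi> Y b c l + \<phi> Y' b' c' l)) \<and>
     (\<forall>Y b c s. (Y, b, c) \<in> tcarr n k \<longrightarrow> \<phi> (s \<cdot>\<^sub>m Y) (s \<cdot>\<^sub>m b) (s \<cdot>\<^sub>m c) = (\<lambda>l. s * \<phi> Y b c l)) \<and>
     (\<forall>Y b c l. d \<le> l \<longrightarrow> \<phi> Y b c l = 0) \<and>
     (\<forall>Y b c. (Y, b, c) \<in> stabm n k T \<longrightarrow> (\<forall>l. \<phi> Y b c l = 0) \<longrightarrow> Y = 0\<^sub>m n n \<and> b = 0\<^sub>m k n \<and> c = 0\<^sub>m n k)"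

definition small :: "nat \<Rightarrow> nat \<Rightarrow> nat \<Rightarrow> triple \<Rightarrow> bool" where
  "small n k d T \<longleftrightarrow> (\<exists>\<phi>. small_via n k d T \<phi>)"

text \<open>A linear injection of the stabiliser of \<open>T\<close> into that of \<open>T'\<close>
  pulls the bounding map back. \<open>F2\<close> and \<open>F3\<close> may depend on
  \<open>Y\<close>, as the adjoint action of a translation mixes it in.\<close>

lemma small_transport:
  assumes sm: "small n k d T'"
    and lin: "\<And>Y b c Y' b' c'. (Y, b, c) \<in> tcarr n k \<Longrightarrow> (Y', b', c') \<in> tcarr n k \<Longrightarrow>
        F1 (Y + Y') = F1 Y + F1 Y' \<and> F2 (Y + Y') (b + b') = F2 Y b + F2 Y' b' \<and> F3 (Y + Y') (c + c') = F3 Y c + F3 Y' c'"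
    and scl: "\<And>Y b c s. (Y, b, c) \<in> tcarr n k \<Longrightarrow> F1 (s \<cdot>\<^sub>m Y) = s \<cdot>\<^sub>m F1 Y \<and> F2 (s \<cdot>\<^sub>m Y) (s \<cdot>\<^sub>m b) = s \<cdot>\<^sub>m F2 Y b \<and> F3 (s \<cdot>\<^sub>m Y) (s \<cdot>\<^sub>m c) = s \<cdot>\<^sub>m F3 Y c"
    and car: "\<And>Y b c. (Y, b, c) \<in> tcarr n k \<Longrightarrow> (F1 Y, F2 Y b, F3 Y c) \<in> tcarr n k"
    and st: "\<And>Y b c. (Y, b, c) \<in> stabm n k T \<Longrightarrow> (F1 Y, F2 Y b, F3 Y c) \<in> stabm n k T'"
    and inj: "\<And>Y b c. (Y, b, c) \<in> tcarr n k \<Longrightarrow> F1 Y = 0\<^sub>m n n \<Longrightarrow> F2 Y b = 0\<^sub>m k n \<Longrightarrow> F3 Y c = 0\<^sub>m n k \<Longrightarrow> Y = 0\<^sub>m n n \<and> b = 0\<^sub>m k n \<and> c = 0\<^sub>m n k"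
  shows "small n k d T"
proof -
  obtain \<phi> where \<phi>: "small_via n k d T' \<phi>" using sm by (auto simp: small_def)
  note 1 = \<phi>[unfolded small_via_def, THEN conjunct1, rule_format]
  note 2 = \<phi>[unfolded small_via_def, THEN conjunct2, THEN conjunct1, rule_format]
  note 3 = \<phi>[unfolded small_via_def, THEN conjunct2, THEN conjunct2, THEN conjunct1, rule_format]
  note 4 = \<phi>[unfolded small_via_def, THEN conjunct2, THEN conjunct2, THEN conjunct2, rule_format]
  have tc: "Z \<in> tcarr n k" if "Z \<in> stabm n k T" for Z using that by (cases T) (auto simp: stabm_def tcarr_def)
  have "small_via n k d T (\<lambda>Y b c. \<phi> (F1 Y) (F2 Y b) (F3 Y c))" unfolding small_via_def
  proof (intro conjI allI impI)
    fix Y b c Y' b' c' assume Z: "(Y, b, c) \<in> tcarr n k" "(Y', b', c') \<in> tcarr n k"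
    show "\<phi> (F1 (Y + Y')) (F2 (Y + Y') (b + b')) (F3 (Y + Y') (c + c')) =
       (\<lambda>l. \<phi> (F1 Y) (F2 Y b) (F3 Y c) l + \<phi> (F1 Y') (F2 Y' b') (F3 Y' c') l)"
      using lin[OF Z] 1[OF car[OF Z(1)] car[OF Z(2)]] by simp
  next
    fix Y b c s assume Z: "(Y, b, c) \<in> tcarr n k"
    show "\<phi> (F1 (s \<cdot>\<^sub>m Y)) (F2 (s \<cdot>\<^sub>m Y) (s \<cdot>\<^sub>m b)) (F3 (s \<cdot>\<^sub>m Y) (s \<cdot>\<^sub>m c)) = (\<lambda>l. s * \<phi> (F1 Y) (F2 Y b) (F3 Y c) l)"
      using scl[OF Z, of s] 2[OF car[OF Z], of s] by simp
  next
    fix Y b c assume Z: "(Y, b, c) \<in> stabm n k T" "\<forall>l. \<phi> (F1 Y) (F2 Y b) (F3 Y c) l = 0"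
    have "F1 Y = 0\<^sub>m n n \<and> F2 Y b = 0\<^sub>m k n \<and> F3 Y c = 0\<^sub>m n k" by (rule 4[OF st[OF Z(1)]]) (use Z(2) in auto)
    then show "Y = 0\<^sub>m n n" "b = 0\<^sub>m k n" "c = 0\<^sub>m n k" using inj[OF tc[OF Z(1)]] by auto
  qed (use 3 in auto)
  then show ?thesis by (auto simp: small_def)
qed

lemma conj_cancel:
  fixes g h x :: "complex mat"
  assumes "g \<in> carrier_mat n n" "h \<in> carrier_mat n n" "h * g = 1\<^sub>m n" "x \<in> carrier_mat n m"
  shows "h * (g * x) = x"
  using assms assoc_mult_mat[of h n n g n x m] by simp

lemma conj_cancel':
  fixes g h x :: "complex mat"
  assumes "g \<in> carrier_mat n n" "h \<in> carrier_mat n n" "h * g = 1\<^sub>m n" "x \<in> carrier_mat m n"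
  shows "x * h * g = x"
  using assms assoc_mult_mat[of x m n h n g n] by simp

lemma small_tconj:
  assumes T: "T \<in> carr n k" and g: "g \<in> carrier_mat n n" "h \<in> carrier_mat n n" "g * h = 1\<^sub>m n" "h * g = 1\<^sub>m n"
    and sm: "small n k d (tconj g h T)"
  shows "small n k d T"
proof (rule small_transport[OF sm, where ?F1.0 = "\<lambda>Y. g * Y * h" and ?F2.0 = "\<lambda>Y b. b * h" and ?F3.0 = "\<lambda>Y c. g * c"])
  obtain a u w where T': "T = (a, u, w)" by (cases T)
  have cc: "a \<in> carrier_mat n n" "u \<in> carrier_mat n k" "w \<in> carrier_mat k n" using T by (auto simp: T')
  show "g * (Y + Y') * h = g * Y * h + g * Y' * h \<and> (b + b') * h = b * h + b' * h \<and> g * (c + c') = g * c + g * c'"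
    if "(Y, b, c) \<in> tcarr n k" "(Y', b', c') \<in> tcarr n k" for Y b c Y' b' c'
    using that g by (auto simp: tcarr_def mult_add_distrib_mat[of _ n n] add_mult_distrib_mat[of _ n n _ _ n] add_mult_distrib_mat[of _ k n _ _ n])
  show "g * (s \<cdot>\<^sub>m Y) * h = s \<cdot>\<^sub>m (g * Y * h) \<and> (s \<cdot>\<^sub>m b) * h = s \<cdot>\<^sub>m (b * h) \<and> g * (s \<cdot>\<^sub>m c) = s \<cdot>\<^sub>m (g * c)"
    if "(Y, b, c) \<in> tcarr n k" for Y b c s
    using that g by (auto simp: tcarr_def mult_smult_distrib[of _ n n] mult_smult_assoc_mat[of _ n n _ n] mult_smult_assoc_mat[of _ k n _ n])
  show "(g * Y * h, b * h, g * c) \<in> tcarr n k" if "(Y, b, c) \<in> tcarr n k" for Y b c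
    using that g by (auto simp: tcarr_def)
  show "Y = 0\<^sub>m n n \<and> b = 0\<^sub>m k n \<and> c = 0\<^sub>m n k" if Z: "(Y, b, c) \<in> tcarr n k" and 0: "g * Y * h = 0\<^sub>m n n" "b * h = 0\<^sub>m k n" "g * c = 0\<^sub>m n k" for Y b c
  proof -
    have c: "Y \<in> carrier_mat n n" "b \<in> carrier_mat k n" "c \<in> carrier_mat n k" using Z by (auto simp: tcarr_def)
    have "g * Y = g * Y * h * g" using conj_cancel'[OF g(1,2,4), of "g * Y" n] c g by simp
    then have "g * Y = 0\<^sub>m n n" using 0 g by simp
    then have "Y = 0\<^sub>m n n" using conj_cancel[OF g(1,2,4) c(1)] g by simp
    moreover have "b = 0\<^sub>m k n" using conj_cancel'[OF g(1,2,4) c(2)] 0 g by simp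
    moreover have "c = 0\<^sub>m n k" using conj_cancel[OF g(1,2,4) c(3)] 0 g by simp
    ultimately show ?thesis by simp
  qed
  show "(g * Y * h, b * h, g * c) \<in> stabm n k (tconj g h T)" if Z: "(Y, b, c) \<in> stabm n k T" for Y b c
  proof -
    have c: "Y \<in> carrier_mat n n" "b \<in> carrier_mat k n" "c \<in> carrier_mat n k" and tr: "(\<Sum>i<n. Y $$ (i, i)) = 0"
      and Yu: "Y * u = 0\<^sub>m n k" and wY: "w * Y = 0\<^sub>m k n" and ex: "\<exists>r. Y * a - a * Y + (u * b + c * w) = r \<cdot>\<^sub>m 1\<^sub>m n"
      using Z by (auto simp: stabm_def T')
    obtain r where r: "Y * a - a * Y + (u * b + c * w) = r \<cdot>\<^sub>m 1\<^sub>m n" using ex by blast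
    have prod: "(x * h) * (g * y) = x * y" if "x \<in> carrier_mat p n" "y \<in> carrier_mat n q" for x y p q
      using that g conj_cancel[OF g(1,2,4) that(2)] assoc_mult_mat[of x p n h n "g * y" q] by simp
    have "(\<Sum>i<n. (g * Y * h) $$ (i, i)) = (\<Sum>i<n. (h * (g * Y)) $$ (i, i))"
      using g c by (intro trace_mult_comm) auto
    then have 1: "(\<Sum>i<n. (g * Y * h) $$ (i, i)) = 0" using conj_cancel[OF g(1,2,4) c(1)] tr by simp
    have 2: "g * Y * h * (g * u) = 0\<^sub>m n k"
      using prod[of "g * Y" n u k] c cc g Yu assoc_mult_mat[of g n n Y n u k] by simp
    have 3: "w * h * (g * Y * h) = 0\<^sub>m k n"
    proof -
      have "w * h * (g * Y * h) = w * h * (g * (Y * h))" using g c by (simp add: assoc_mult_mat[of g n n Y n h n])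
      also have "\<dots> = w * (Y * h)" using g c cc by (intro prod[of _ k]) auto
      also have "\<dots> = w * Y * h" using g c cc by (intro assoc_mult_mat[symmetric]) auto
      finally show ?thesis using wY g by simp
    qed
    have gxh: "g * x * h \<in> carrier_mat n n" if "x \<in> carrier_mat n n" for x using that g by auto
    have e1: "g * Y * h * (g * a * h) = g * (Y * a) * h"
    proof -
      have "g * Y * h * (g * a * h) = g * Y * h * (g * (a * h))" using g cc by (simp add: assoc_mult_mat[of g n n a n h n])
      also have "\<dots> = g * Y * (a * h)" using g c cc by (intro prod[of _ n]) auto
      also have "\<dots> = g * Y * a * h" using g c cc by (intro assoc_mult_mat[symmetric]) auto
      also have "g * Y * a = g * (Y * a)" using g c cc by (intro assoc_mult_mat) auto
      finally show ?thesis .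
    qed
    have e2: "g * a * h * (g * Y * h) = g * (a * Y) * h"
    proof -
      have "g * a * h * (g * Y * h) = g * a * h * (g * (Y * h))" using g c by (simp add: assoc_mult_mat[of g n n Y n h n])
      also have "\<dots> = g * a * (Y * h)" using g c cc by (intro prod[of _ n]) auto
      also have "\<dots> = g * a * Y * h" using g c cc by (intro assoc_mult_mat[symmetric]) auto
      also have "g * a * Y = g * (a * Y)" using g c cc by (intro assoc_mult_mat) auto
      finally show ?thesis .
    qed
    have e3: "g * u * (b * h) = g * (u * b) * h"
    proof -
      have "g * u * (b * h) = g * u * b * h" using g c cc by (intro assoc_mult_mat[symmetric]) auto
      also have "g * u * b = g * (u * b)" using g c cc by (intro assoc_mult_mat) auto
      finally show ?thesis .
    qed
    have e4: "g * c * (w * h) = g * (c * w) * h"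
    proof -
      have "g * c * (w * h) = g * c * w * h" using g c cc by (intro assoc_mult_mat[symmetric]) auto
      also have "g * c * w = g * (c * w)" using g c cc by (intro assoc_mult_mat) auto
      finally show ?thesis .
    qed
    have dist: "g * x * h - g * y * h + (g * z * h + g * t * h) = g * (x - y + (z + t)) * h"
      if "x \<in> carrier_mat n n" "y \<in> carrier_mat n n" "z \<in> carrier_mat n n" "t \<in> carrier_mat n n" for x y z t
      using that g by (simp add: mult_add_distrib_mat[of _ n n _ n] mult_minus_distrib_mat[of _ n n _ n]
          add_mult_distrib_mat[of _ n n _ _ n] minus_mult_distrib_mat[of _ n n _ _ n])
    have "g * Y * h * (g * a * h) - g * a * h * (g * Y * h) + (g * u * (b * h) + g * c * (w * h)) = g * (r \<cdot>\<^sub>m 1\<^sub>m n) * h"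
      unfolding e1 e2 e3 e4 using c cc by (subst dist) (auto simp: r intro!: mult_carrier_mat[of _ _ k])
    also have "\<dots> = r \<cdot>\<^sub>m 1\<^sub>m n"
      using g by (simp add: mult_smult_distrib[of _ n n _ n] mult_smult_assoc_mat[of _ n n _ n])
    finally show ?thesis using 1 2 3 c g by (auto simp: stabm_def T')
  qed
qed

text \<open>The adjoint action of the translation. The corrections \<open>b0 Y\<close> and
  \<open>Y c0\<close> compensate the change of \<open>a\<close>; the remaining terms contain
  \<open>Y u\<close> or \<open>w Y\<close>, which vanish on the stabiliser.\<close>

lemma small_ttrans:
  assumes T: "T \<in> carr n k" and b0: "b0 \<in> carrier_mat k n" "c0 \<in> carrier_mat n k"
    and sm: "small n k d (ttrans b0 c0 T)"
  shows "small n k d T"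
proof (rule small_transport[OF sm, where ?F1.0 = "\<lambda>Y. Y" and ?F2.0 = "\<lambda>Y b. b + b0 * Y" and ?F3.0 = "\<lambda>Y c. c - Y * c0"])
  obtain a u w where T': "T = (a, u, w)" by (cases T)
  have cc: "a \<in> carrier_mat n n" "u \<in> carrier_mat n k" "w \<in> carrier_mat k n" using T by (auto simp: T')
  show "Y + Y' = Y + Y' \<and> b + b' + b0 * (Y + Y') = b + b0 * Y + (b' + b0 * Y') \<and> c + c' - (Y + Y') * c0 = c - Y * c0 + (c' - Y' * c0)"
    if Z: "(Y, b, c) \<in> tcarr n k" "(Y', b', c') \<in> tcarr n k" for Y b c Y' b' c'
  proof (intro conjI refl)
    show "b + b' + b0 * (Y + Y') = b + b0 * Y + (b' + b0 * Y')"
      using Z b0 by (auto simp: tcarr_def mult_add_distrib_mat[of _ k n _ n] intro!: eq_matI simp del: index_mult_mat(1))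
    show "c + c' - (Y + Y') * c0 = c - Y * c0 + (c' - Y' * c0)"
      using Z b0 by (auto simp: tcarr_def add_mult_distrib_mat[of _ n n _ _ k] intro!: eq_matI simp del: index_mult_mat(1))
  qed
  show "s \<cdot>\<^sub>m Y = s \<cdot>\<^sub>m Y \<and> s \<cdot>\<^sub>m b + b0 * (s \<cdot>\<^sub>m Y) = s \<cdot>\<^sub>m (b + b0 * Y) \<and> s \<cdot>\<^sub>m c - (s \<cdot>\<^sub>m Y) * c0 = s \<cdot>\<^sub>m (c - Y * c0)"
    if Z: "(Y, b, c) \<in> tcarr n k" for Y b c s
  proof (intro conjI refl)
    show "s \<cdot>\<^sub>m b + b0 * (s \<cdot>\<^sub>m Y) = s \<cdot>\<^sub>m (b + b0 * Y)"
      using Z b0 by (auto simp: tcarr_def mult_smult_distrib[of _ k n _ n] algebra_simps intro!: eq_matI simp del: index_mult_mat(1))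
    show "s \<cdot>\<^sub>m c - (s \<cdot>\<^sub>m Y) * c0 = s \<cdot>\<^sub>m (c - Y * c0)"
      using Z b0 by (auto simp: tcarr_def mult_smult_assoc_mat[of _ n n _ k] algebra_simps intro!: eq_matI simp del: index_mult_mat(1))
  qed
  show "(Y, b + b0 * Y, c - Y * c0) \<in> tcarr n k" if "(Y, b, c) \<in> tcarr n k" for Y b c
    using that b0 by (auto simp: tcarr_def)
  show "Y = 0\<^sub>m n n \<and> b = 0\<^sub>m k n \<and> c = 0\<^sub>m n k" if Z: "(Y, b, c) \<in> tcarr n k" and 0: "Y = 0\<^sub>m n n" "b + b0 * Y = 0\<^sub>m k n" "c - Y * c0 = 0\<^sub>m n k" for Y b c
  proof -
    have "c - 0\<^sub>m n k = c" using Z by (auto simp: tcarr_def intro!: eq_matI)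
    then show ?thesis using Z 0 b0 by (auto simp: tcarr_def)
  qed
  show "(Y, b + b0 * Y, c - Y * c0) \<in> stabm n k (ttrans b0 c0 T)" if Z: "(Y, b, c) \<in> stabm n k T" for Y b c
  proof -
    have c: "Y \<in> carrier_mat n n" "b \<in> carrier_mat k n" "c \<in> carrier_mat n k" and tr: "(\<Sum>i<n. Y $$ (i, i)) = 0"
      and Yu: "Y * u = 0\<^sub>m n k" and wY: "w * Y = 0\<^sub>m k n" and ex: "\<exists>r. Y * a - a * Y + (u * b + c * w) = r \<cdot>\<^sub>m 1\<^sub>m n"
      using Z by (auto simp: stabm_def T')
    obtain r where r: "Y * a - a * Y + (u * b + c * w) = r \<cdot>\<^sub>m 1\<^sub>m n" using ex by blast
    have m1: "Y * (a + (u * b0 + c0 * w)) = Y * a + Y * c0 * w"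
    proof -
      have "Y * (a + (u * b0 + c0 * w)) = Y * a + (Y * (u * b0) + Y * (c0 * w))"
        using c cc b0 by (simp add: mult_add_distrib_mat[of _ n n _ n])
      also have "Y * (u * b0) = Y * u * b0" using c cc b0 by (intro assoc_mult_mat[symmetric]) auto
      also have "Y * (c0 * w) = Y * c0 * w" using c cc b0 by (intro assoc_mult_mat[symmetric]) auto
      finally show ?thesis using Yu b0 c cc by simp
    qed
    have m2: "(a + (u * b0 + c0 * w)) * Y = a * Y + u * (b0 * Y)"
    proof -
      have "(a + (u * b0 + c0 * w)) * Y = a * Y + (u * b0 * Y + c0 * w * Y)"
        using c cc b0 by (simp add: add_mult_distrib_mat[of _ n n _ _ n])
      also have "c0 * w * Y = c0 * (w * Y)" using c cc b0 by (intro assoc_mult_mat) auto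
      also have "u * b0 * Y = u * (b0 * Y)" using c cc b0 by (intro assoc_mult_mat) auto
      finally show ?thesis using wY b0 c cc by simp
    qed
    have m3: "u * (b + b0 * Y) = u * b + u * (b0 * Y)" using c cc b0 by (intro mult_add_distrib_mat) auto
    have m4: "(c - Y * c0) * w = c * w - Y * c0 * w" using c cc b0 by (intro minus_mult_distrib_mat) auto
    have "Y * (a + (u * b0 + c0 * w)) - (a + (u * b0 + c0 * w)) * Y + (u * (b + b0 * Y) + (c - Y * c0) * w) = Y * a - a * Y + (u * b + c * w)"
      unfolding m1 m2 m3 m4 by (rule eq_matI) (use c cc b0 in \<open>auto simp del: index_mult_mat(1)\<close>)
    then show ?thesis using c b0 tr Yu wY r by (auto simp: stabm_def T')
  qed
qed

lemma small_move:
  assumes "move n k T T'" "small n k d T'"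
  shows "small n k d T"
  using assms
proof (cases rule: move.cases)
  case (move_conj Y)
  then show ?thesis using small_tconj[of T n k "1\<^sub>m n + Y" "1\<^sub>m n - Y" d] assms(2) by (simp add: one_plus_minus_Y)
next
  case (move_trans b c)
  then show ?thesis using small_ttrans[of T n k b c d] assms(2) by simp
next
  case (move_shift r)
  obtain a u w where T: "T = (a, u, w)" by (cases T)
  have cc: "a \<in> carrier_mat n n" using move_shift by (simp add: T)
  have "Y * (a + r \<cdot>\<^sub>m 1\<^sub>m n) - (a + r \<cdot>\<^sub>m 1\<^sub>m n) * Y = Y * a - a * Y" if "Y \<in> carrier_mat n n" for Y
  proof -
    have 1: "Y * (a + r \<cdot>\<^sub>m 1\<^sub>m n) = Y * a + r \<cdot>\<^sub>m Y"
      using that cc by (simp add: mult_add_distrib_mat[of _ n n _ n] mult_smult_distrib[of _ n n _ n])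
    have 2: "(a + r \<cdot>\<^sub>m 1\<^sub>m n) * Y = a * Y + r \<cdot>\<^sub>m Y"
      using that cc by (simp add: add_mult_distrib_mat[of _ n n _ _ n] mult_smult_assoc_mat[of _ n n _ n])
    show ?thesis unfolding 1 2 by (rule eq_matI) (use that cc in \<open>auto simp del: index_mult_mat(1)\<close>)
  qed
  then have "stabm n k (tshift n r T) = stabm n k T" by (auto simp: stabm_def T)
  then show ?thesis using assms(2) move_shift by (simp add: small_def small_via_def)
qed

lemma small_moves: "moves n k T T' \<Longrightarrow> small n k d T' \<Longrightarrow> small n k d T"
  by (induction rule: converse_rtranclp_induct) (auto intro: small_move)

lemma small_stab_dim:
  assumes T: "T \<in> carr n k" and n: "0 < n" and sm: "small n k d T"
  shows "fvs.dim (stab n k (proj n k T)) \<le> d"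
proof -
  obtain \<phi> where \<phi>: "small_via n k d T \<phi>" using sm by (auto simp: small_def)
  note 1 = \<phi>[unfolded small_via_def, THEN conjunct1, rule_format]
  note 2 = \<phi>[unfolded small_via_def, THEN conjunct2, THEN conjunct1, rule_format]
  note 3 = \<phi>[unfolded small_via_def, THEN conjunct2, THEN conjunct2, THEN conjunct1, rule_format]
  note 4 = \<phi>[unfolded small_via_def, THEN conjunct2, THEN conjunct2, THEN conjunct2, rule_format]
  have tc: "(Yof n x, bof n k x, cof n k x) \<in> tcarr n k" for x by (simp add: tcarr_def)
  have "fvs.dim (stab n k (proj n k T)) \<le> card {..<d}"
  proof (rule fdim_le_card[where \<phi> = "\<lambda>x. \<phi> (Yof n x) (bof n k x) (cof n k x)"])
    show "\<phi> (Yof n (x + y)) (bof n k (x + y)) (cof n k (x + y)) = \<phi> (Yof n x) (bof n k x) (cof n k x) + \<phi> (Yof n y) (bof n k y) (cof n k y)" for x y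
    proof -
      have "Yof n (x + y) = Yof n x + Yof n y" "bof n k (x + y) = bof n k x + bof n k y" "cof n k (x + y) = cof n k x + cof n k y"
        by (auto simp: Yof_def bof_def cof_def intro!: eq_matI)
      then show ?thesis using 1[OF tc tc, of x y] by (simp add: plus_fun_def)
    qed
    show "\<phi> (Yof n (\<lambda>v. s * x v)) (bof n k (\<lambda>v. s * x v)) (cof n k (\<lambda>v. s * x v)) = (\<lambda>l. s * \<phi> (Yof n x) (bof n k x) (cof n k x) l)" for s x
    proof -
      have "Yof n (\<lambda>v. s * x v) = s \<cdot>\<^sub>m Yof n x" "bof n k (\<lambda>v. s * x v) = s \<cdot>\<^sub>m bof n k x" "cof n k (\<lambda>v. s * x v) = s \<cdot>\<^sub>m cof n k x"
        by (auto simp: Yof_def bof_def cof_def algebra_simps intro!: eq_matI)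
      then show ?thesis using 2[OF tc, of s x] by simp
    qed
    show "fvs.subspace (stab n k (proj n k T))" unfolding stab_rad by (rule subspace_rad)
    show "x = 0" if x: "x \<in> stab n k (proj n k T)" "\<phi> (Yof n x) (bof n k x) (cof n k x) = 0" for x
    proof -
      have z: "Yof n x = 0\<^sub>m n n" "bof n k x = 0\<^sub>m k n" "cof n k x = 0\<^sub>m n k"
        using 4[OF stab_stabm[OF T n x(1)]] x(2) by (auto simp: fun_eq_iff)
      have Hz: "x (H t) = 0" if "t + 1 < n" for t
        using that
      proof (induction t)
        case 0
        have "Yof n x $$ (0, 0) = x (H 0)" using 0 by (simp add: Yof_def)
        then show ?case using 0 by (simp add: z)
      next
        case (Suc t)
        have "Yof n x $$ (Suc t, Suc t) = x (H (Suc t)) - x (H t)" using Suc.prems by (simp add: Yof_def)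
        then show ?case using Suc by (simp add: z)
      qed
      have "x v = 0" if v: "v \<in> qbasis n k" for v
      proof (cases v)
        case (E i j)
        have "Yof n x $$ (j, i) = x (E i j)" using v E by (auto simp: Yof_def)
        then show ?thesis using v E by (simp add: z)
      next
        case (H t)
        then show ?thesis using Hz v by simp
      next
        case (U c i)
        have "bof n k x $$ (c, i) = - x (U c i)" using v U by (simp add: bof_def)
        then show ?thesis using v U by (simp add: z)
      next
        case (W c i)
        have "cof n k x $$ (i, c) = x (W c i)" using v W by (simp add: cof_def)
        then show ?thesis using v W by (simp add: z)
      qed
      then show ?thesis using x(1) by (auto simp: fun_eq_iff stab_def)
    qed
  qed (use 3 in auto)
  then show ?thesis by simp
qed

text \<open>The number \<open>k * k + 1\<close> is the eventual index for \<open>n = k + 2\<close>: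
  the first \<open>k\<close> columns of \<open>b\<close> record the directions that come from the
  moment matrix, and one entry of \<open>Y\<close> records the remaining line.\<close>

lemma smallI:
  assumes p: "p < n" "q < n" and k: "0 < k" "k \<le> n"
    and inj: "\<And>Y b c. (Y, b, c) \<in> stabm n k T \<Longrightarrow> Y $$ (p, q) = 0 \<Longrightarrow> (\<And>i j. i < k \<Longrightarrow> j < k \<Longrightarrow> b $$ (i, j) = 0) \<Longrightarrow>
      Y = 0\<^sub>m n n \<and> b = 0\<^sub>m k n \<and> c = 0\<^sub>m n k"
  shows "small n k (k * k + 1) T"
proof -
  define \<phi> :: "complex mat \<Rightarrow> complex mat \<Rightarrow> complex mat \<Rightarrow> nat \<Rightarrow> complex" where
    "\<phi> Y b c l = (if l < k * k then b $$ (l div k, l mod k) else if l = k * k then Y $$ (p, q) else 0)" for Y b c l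
  have dm: "l div k < k" "l mod k < n" if "l < k * k" for l
  proof -
    show "l div k < k" using that k by (simp add: less_mult_imp_div_less)
    have "l mod k < k" using k by simp
    then show "l mod k < n" using k(2) by (rule less_le_trans)
  qed
  have "small_via n k (k * k + 1) T \<phi>" unfolding small_via_def
  proof (intro conjI allI impI)
    fix Y b c Y' b' c' assume "(Y, b, c) \<in> tcarr n k" "(Y', b', c') \<in> tcarr n k"
    then have cc: "Y \<in> carrier_mat n n" "Y' \<in> carrier_mat n n" "b \<in> carrier_mat k n" "b' \<in> carrier_mat k n" by (auto simp: tcarr_def)
    show "\<phi> (Y + Y') (b + b') (c + c') = (\<lambda>l. \<phi> Y b c l + \<phi> Y' b' c' l)"
    proof
      fix l
      show "\<phi> (Y + Y') (b + b') (c + c') l = \<phi> Y b c l + \<phi> Y' b' c' l"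
      proof (cases "l < k * k")
        case True
        then show ?thesis using dm[OF True] cc by (simp add: \<phi>_def)
      qed (use p cc in \<open>simp add: \<phi>_def\<close>)
    qed
  next
    fix Y b c s assume "(Y, b, c) \<in> tcarr n k"
    then have cc: "Y \<in> carrier_mat n n" "b \<in> carrier_mat k n" by (auto simp: tcarr_def)
    show "\<phi> (s \<cdot>\<^sub>m Y) (s \<cdot>\<^sub>m b) (s \<cdot>\<^sub>m c) = (\<lambda>l. s * \<phi> Y b c l)"
    proof
      fix l
      show "\<phi> (s \<cdot>\<^sub>m Y) (s \<cdot>\<^sub>m b) (s \<cdot>\<^sub>m c) l = s * \<phi> Y b c l"
      proof (cases "l < k * k")
        case True
        then show ?thesis using dm[OF True] cc by (simp add: \<phi>_def)
      qed (use p cc in \<open>simp add: \<phi>_def\<close>)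
    qed
  next
    fix Y b c assume Z: "(Y, b, c) \<in> stabm n k T" "\<forall>l. \<phi> Y b c l = 0"
    have b0: "b $$ (i, j) = 0" if "i < k" "j < k" for i j
    proof -
      have "(i * k + j) div k = i" "(i * k + j) mod k = j" using that by simp_all
      then show ?thesis using Z(2)[rule_format, of "i * k + j"] index_less[OF that] by (simp add: \<phi>_def)
    qed
    have "Y $$ (p, q) = 0" using Z(2)[rule_format, of "k * k"] by (simp add: \<phi>_def)
    then show "Y = 0\<^sub>m n n" "b = 0\<^sub>m k n" "c = 0\<^sub>m n k" using inj[OF Z(1)] b0 by auto
  qed (simp add: \<phi>_def)
  then show ?thesis by (auto simp: small_def)
qed

lemma stabm_entries:
  assumes Z: "(Y, b, c) \<in> stabm n k (a, u, w)" and T: "(a, u, w) \<in> carr n k"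
  obtains r where "Y \<in> carrier_mat n n" "b \<in> carrier_mat k n" "c \<in> carrier_mat n k" "(\<Sum>i<n. Y $$ (i, i)) = 0"
    "\<And>i d. i < n \<Longrightarrow> d < k \<Longrightarrow> (\<Sum>l<n. Y $$ (i, l) * u $$ (l, d)) = 0"
    "\<And>d j. d < k \<Longrightarrow> j < n \<Longrightarrow> (\<Sum>l<n. w $$ (d, l) * Y $$ (l, j)) = 0"
    "\<And>i j. i < n \<Longrightarrow> j < n \<Longrightarrow> (\<Sum>l<n. Y $$ (i, l) * a $$ (l, j)) - (\<Sum>l<n. a $$ (i, l) * Y $$ (l, j))
      + (\<Sum>d<k. u $$ (i, d) * b $$ (d, j)) + (\<Sum>d<k. c $$ (i, d) * w $$ (d, j)) = (if i = j then r else 0)"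
proof -
  have cc: "a \<in> carrier_mat n n" "u \<in> carrier_mat n k" "w \<in> carrier_mat k n" using T by auto
  have c: "Y \<in> carrier_mat n n" "b \<in> carrier_mat k n" "c \<in> carrier_mat n k" and tr: "(\<Sum>i<n. Y $$ (i, i)) = 0"
    and Yu: "Y * u = 0\<^sub>m n k" and wY: "w * Y = 0\<^sub>m k n" and ex: "\<exists>r. Y * a - a * Y + (u * b + c * w) = r \<cdot>\<^sub>m 1\<^sub>m n"
    using Z by (auto simp: stabm_def)
  obtain r where r: "Y * a - a * Y + (u * b + c * w) = r \<cdot>\<^sub>m 1\<^sub>m n" using ex by blast
  show ?thesis
  proof (rule that[of r])
    fix i d assume "i < n" "d < k"
    then show "(\<Sum>l<n. Y $$ (i, l) * u $$ (l, d)) = 0" using mult_mat_entry[OF c(1) cc(2), of i d] Yu by simp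
  next
    fix d j assume "d < k" "j < n"
    then show "(\<Sum>l<n. w $$ (d, l) * Y $$ (l, j)) = 0" using mult_mat_entry[OF cc(3) c(1), of d j] wY by simp
  next
    fix i j assume ij: "i < n" "j < n"
    have "(Y * a - a * Y + (u * b + c * w)) $$ (i, j) = (Y * a) $$ (i, j) - (a * Y) $$ (i, j) + ((u * b) $$ (i, j) + (c * w) $$ (i, j))"
      using ij c cc by (simp del: index_mult_mat(1))
    then show "(\<Sum>l<n. Y $$ (i, l) * a $$ (l, j)) - (\<Sum>l<n. a $$ (i, l) * Y $$ (l, j))
      + (\<Sum>d<k. u $$ (i, d) * b $$ (d, j)) + (\<Sum>d<k. c $$ (i, d) * w $$ (d, j)) = (if i = j then r else 0)"
      unfolding r mult_mat_entry[OF c(1) cc(1) ij] mult_mat_entry[OF cc(1) c(1) ij] mult_mat_entry[OF cc(2) c(2) ij] mult_mat_entry[OF c(3) cc(3) ij]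
      using ij by (auto simp: add.assoc)
  qed (use c tr in auto)
qed

lemma wstd_sums:
  fixes f :: "nat \<Rightarrow> complex"
  shows "d < k \<Longrightarrow> k \<le> n \<Longrightarrow> (\<Sum>l<n. wstd n k $$ (d, l) * f l) = f d"
    and "j < n \<Longrightarrow> (\<Sum>d<k. f d * wstd n k $$ (d, j)) = (if j < k then f j else 0)"
proof -
  assume d: "d < k" "k \<le> n"
  have "(\<Sum>l<n. wstd n k $$ (d, l) * f l) = (\<Sum>l<n. if l = d then f d else 0)"
    by (intro sum.cong refl) (use d in \<open>auto simp: wstd_def\<close>)
  then show "(\<Sum>l<n. wstd n k $$ (d, l) * f l) = f d" using d by simp
next
  assume j: "j < n"
  have "(\<Sum>d<k. f d * wstd n k $$ (d, j)) = (\<Sum>d<k. if d = j then f j else 0)"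
    by (intro sum.cong refl) (use j in \<open>auto simp: wstd_def\<close>)
  then show "(\<Sum>d<k. f d * wstd n k $$ (d, j)) = (if j < k then f j else 0)" by simp
qed

text \<open>Invertibility of \<open>M\<close> confines \<open>Y\<close> to the lower right block.
  There it is traceless and commutes with the companion matrix, up to a scalar that turns out to be
  0; for every \<open>h\<close> such matrices form a line, detected by the entry
  \<open>(k + 1, k)\<close>.\<close>

lemma slice_small:
  assumes k: "1 \<le> k" "n = k + 2" and M: "M \<in> carrier_mat k k" "det M \<noteq> 0"
  shows "small n k (k * k + 1) (slice n k M (comp2 h))"
proof (rule smallI[where p = "k + 1" and q = k])
  fix Y b c
  assume Z: "(Y, b, c) \<in> stabm n k (slice n k M (comp2 h))" and s0: "Y $$ (k + 1, k) = 0" and b0: "\<And>i j. i < k \<Longrightarrow> j < k \<Longrightarrow> b $$ (i, j) = 0"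
  let ?a = "ablk n k (comp2 h)" and ?u = "ublk n k M" and ?w = "wstd n k"
  obtain r where c: "Y \<in> carrier_mat n n" "b \<in> carrier_mat k n" "c \<in> carrier_mat n k" and tr: "(\<Sum>i<n. Y $$ (i, i)) = 0"
    and Yu: "\<And>i d. i < n \<Longrightarrow> d < k \<Longrightarrow> (\<Sum>l<n. Y $$ (i, l) * ?u $$ (l, d)) = 0"
    and wY: "\<And>d j. d < k \<Longrightarrow> j < n \<Longrightarrow> (\<Sum>l<n. ?w $$ (d, l) * Y $$ (l, j)) = 0"
    and e: "\<And>i j. i < n \<Longrightarrow> j < n \<Longrightarrow> (\<Sum>l<n. Y $$ (i, l) * ?a $$ (l, j)) - (\<Sum>l<n. ?a $$ (i, l) * Y $$ (l, j))
      + (\<Sum>d<k. ?u $$ (i, d) * b $$ (d, j)) + (\<Sum>d<k. c $$ (i, d) * ?w $$ (d, j)) = (if i = j then r else 0)"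
    using stabm_entries[OF Z[unfolded slice_def]] by auto
  have Yc: "Y $$ (i, j) = 0" if "i < n" "j < k" for i j
  proof (rule det_nonzero_left_kernel[OF M _ that(2), where x = "\<lambda>j. Y $$ (i, j)"])
    fix d assume d: "d < k"
    have "(\<Sum>l<n. Y $$ (i, l) * ?u $$ (l, d)) = (\<Sum>l<k. Y $$ (i, l) * ?u $$ (l, d))"
      by (rule sum_split_lessThan) (use k d in \<open>auto simp: ublk_def\<close>)
    also have "\<dots> = (\<Sum>l<k. Y $$ (i, l) * M $$ (l, d))" using k d by (simp add: ublk_def)
    finally show "(\<Sum>l<k. Y $$ (i, l) * M $$ (l, d)) = 0" using Yu[OF that(1) d] by simp
  qed
  have Yr: "Y $$ (i, j) = 0" if "i < k" "j < n" for i j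
    using wY[OF that] wstd_sums(1)[of i k n "\<lambda>l. Y $$ (l, j)"] that k by simp
  have "(\<Sum>i<k. Y $$ (i, i)) = 0" by (rule sum.neutral) (use Yr k in auto)
  then have t0: "Y $$ (k, k) + Y $$ (k + 1, k + 1) = 0" using tr k by simp
  have Ya: "(\<Sum>l<n. Y $$ (i, l) * ?a $$ (l, j)) = (if k \<le> i \<and> k \<le> j then Y $$ (i, k) * comp2 h $$ (0, j - k) + Y $$ (i, k + 1) * comp2 h $$ (1, j - k) else 0)"
    if "i < n" "j < n" for i j
  proof -
    have "(\<Sum>l<k. Y $$ (i, l) * ?a $$ (l, j)) = 0" by (rule sum.neutral) (use Yc that in auto)
    then show ?thesis using that k Yr[of i k] Yr[of i "k + 1"] by (simp add: ablk_def)
  qed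
  have aY: "(\<Sum>l<n. ?a $$ (i, l) * Y $$ (l, j)) = (if k \<le> i \<and> k \<le> j then comp2 h $$ (i - k, 0) * Y $$ (k, j) + comp2 h $$ (i - k, 1) * Y $$ (k + 1, j) else 0)"
    if "i < n" "j < n" for i j
  proof -
    have "(\<Sum>l<k. ?a $$ (i, l) * Y $$ (l, j)) = 0" by (rule sum.neutral) (use Yr that in auto)
    then show ?thesis using that k Yc[of k j] Yc[of "k + 1" j] by (simp add: ablk_def)
  qed
  have ub: "(\<Sum>d<k. ?u $$ (i, d) * b $$ (d, j)) = (if i < k then (\<Sum>d<k. M $$ (i, d) * b $$ (d, j)) else 0)" if "i < n" for i j
    using that by (simp add: ublk_def)
  have cw: "(\<Sum>d<k. c $$ (i, d) * ?w $$ (d, j)) = (if j < k then c $$ (i, j) else 0)" if "j < n" for i j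
    by (rule wstd_sums(2)[OF that])
  have co: "comp2 h $$ (0, 0) = 0" "comp2 h $$ (0, 1) = h" "comp2 h $$ (1, 0) = 1" "comp2 h $$ (1, 1) = 0" by (auto simp: comp2_def)
  have e': "(if k \<le> i \<and> k \<le> j then Y $$ (i, k) * comp2 h $$ (0, j - k) + Y $$ (i, k + 1) * comp2 h $$ (1, j - k) else 0)
    - (if k \<le> i \<and> k \<le> j then comp2 h $$ (i - k, 0) * Y $$ (k, j) + comp2 h $$ (i - k, 1) * Y $$ (k + 1, j) else 0)
    + (if i < k then (\<Sum>d<k. M $$ (i, d) * b $$ (d, j)) else 0) + (if j < k then c $$ (i, j) else 0) = (if i = j then r else 0)"
    if "i < n" "j < n" for i j
    using e[OF that] unfolding Ya[OF that] aY[OF that] ub[OF that(1)] cw[OF that(2)] .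
  \<comment> \<open>The equations of the lower right block; the sum of the first two gives
    \<open>2 r = 0\<close>.\<close>
  have e00: "Y $$ (k, k + 1) - h * Y $$ (k + 1, k) = r" using e'[of k k] k co by simp
  have e11: "Y $$ (k + 1, k) * h - Y $$ (k, k + 1) = r" using e'[of "k + 1" "k + 1"] k co by simp
  have e10: "Y $$ (k + 1, k + 1) - Y $$ (k, k) = 0" using e'[of "k + 1" k] k co by simp
  have r0: "r = 0" using e00 e11 s0 by simp
  have Y01: "Y $$ (k, k + 1) = 0" using e00 s0 r0 by simp
  have Y11: "Y $$ (k, k) = 0" "Y $$ (k + 1, k + 1) = 0" using e10 t0 by simp_all
  have Y0: "Y = 0\<^sub>m n n"
  proof (rule eq_matI)
    fix i j assume "i < dim_row (0\<^sub>m n n :: complex mat)" "j < dim_col (0\<^sub>m n n :: complex mat)"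
    then have ij: "i < n" "j < n" by auto
    consider "i < k" | "j < k" | "i = k" "j = k" | "i = k" "j = k + 1" | "i = k + 1" "j = k" | "i = k + 1" "j = k + 1" using ij k by linarith
    then show "Y $$ (i, j) = 0\<^sub>m n n $$ (i, j)" by cases (use ij Yr Yc s0 Y01 Y11 in auto)
  qed (use c in auto)
  have bk: "b $$ (d, j) = 0" if "d < k" "j < n" for d j
  proof (cases "j < k")
    case False
    obtain B where B: "B \<in> carrier_mat k k" "B * M = 1\<^sub>m k" using det_nonzero_inverse[OF M] by metis
    have Mb: "(\<Sum>l<k. M $$ (i, l) * b $$ (l, j)) = 0" if "i < k" for i
      using e'[of i j] that \<open>j < n\<close> False k by simp
    define v where "v = mat k 1 (\<lambda>(l, _). b $$ (l, j))"
    have v: "v \<in> carrier_mat k 1" by (simp add: v_def)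
    have "M * v = 0\<^sub>m k 1"
    proof (rule eq_matI)
      fix i z assume "i < dim_row (0\<^sub>m k 1 :: complex mat)" "z < dim_col (0\<^sub>m k 1 :: complex mat)"
      then have iz: "i < k" "z < 1" by auto
      show "(M * v) $$ (i, z) = 0\<^sub>m k 1 $$ (i, z)"
        unfolding mult_mat_entry[OF M(1) v iz] using Mb[OF iz(1)] iz by (simp add: v_def)
    qed (use M v in auto)
    then have "v = 0\<^sub>m k 1" using conj_cancel[OF M(1) B v] B by simp
    moreover have "b $$ (d, j) = v $$ (d, 0)" using that by (simp add: v_def)
    ultimately show ?thesis using that by simp
  qed (use b0 that in auto)
  have "b = 0\<^sub>m k n" by (rule eq_matI) (use bk c in auto)
  moreover have "c = 0\<^sub>m n k"
  proof (rule eq_matI)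
    fix i j assume "i < dim_row (0\<^sub>m n k :: complex mat)" "j < dim_col (0\<^sub>m n k :: complex mat)"
    then have ij: "i < n" "j < k" by auto
    have "(\<Sum>d<k. M $$ (i, d) * b $$ (d, j)) = 0" by (rule sum.neutral) (use bk ij k in auto)
    then show "c $$ (i, j) = 0\<^sub>m n k $$ (i, j)" using e'[of i j] ij k r0 by (auto split: if_splits)
  qed (use c in auto)
  ultimately show "Y = 0\<^sub>m n n \<and> b = 0\<^sub>m k n \<and> c = 0\<^sub>m n k" using Y0 by simp
qed (use k in auto)

text \<open>Here the moment matrix is singular, yet the bound on the stabiliser is the same: the
  entries 1 that \<open>sect\<close> adds to \<open>u\<close> and \<open>a\<close> make up for the
  missing rank. So the section meets the hypersurface in a regular point.\<close>

lemma sect_small: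
  assumes k: "1 \<le> k" "n = k + 2"
  shows "small n k (k * k + 1) (sect n k (Mdel k 0) 1)"
proof (rule smallI[where p = k and q = "k - 1"])
  fix Y b c
  assume Z: "(Y, b, c) \<in> stabm n k (sect n k (Mdel k 0) 1)" and s0: "Y $$ (k, k - 1) = 0" and b0: "\<And>i j. i < k \<Longrightarrow> j < k \<Longrightarrow> b $$ (i, j) = 0"
  let ?a = "mat n n (\<lambda>(i, j). if i = k - 1 \<and> j = k then 1 else 0) :: complex mat"
  let ?u = "mat n k (\<lambda>(i, d). if i < k then Mdel k 0 $$ (i, d) else if i = k \<and> d = k - 1 then 1 else 0) :: complex mat"
  let ?w = "wstd n k"
  have T: "(?a, ?u, ?w) \<in> carr n k" by simp
  have kn: "k - 1 < n" "k < n" using k by auto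
  obtain r where c: "Y \<in> carrier_mat n n" "b \<in> carrier_mat k n" "c \<in> carrier_mat n k" and tr: "(\<Sum>i<n. Y $$ (i, i)) = 0"
    and Yu: "\<And>i d. i < n \<Longrightarrow> d < k \<Longrightarrow> (\<Sum>l<n. Y $$ (i, l) * ?u $$ (l, d)) = 0"
    and wY: "\<And>d j. d < k \<Longrightarrow> j < n \<Longrightarrow> (\<Sum>l<n. ?w $$ (d, l) * Y $$ (l, j)) = 0"
    and e: "\<And>i j. i < n \<Longrightarrow> j < n \<Longrightarrow> (\<Sum>l<n. Y $$ (i, l) * ?a $$ (l, j)) - (\<Sum>l<n. ?a $$ (i, l) * Y $$ (l, j))
      + (\<Sum>d<k. ?u $$ (i, d) * b $$ (d, j)) + (\<Sum>d<k. c $$ (i, d) * ?w $$ (d, j)) = (if i = j then r else 0)"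
    using stabm_entries[OF Z[unfolded sect_def] T] by blast
  have uent: "?u $$ (l, d) = (if l < k - 1 then (if d = l then 1 else 0) else if l = k \<and> d = k - 1 then 1 else 0)"
    if "l < n" "d < k" for l d
    using that k by (auto simp: Mdel_def)
  have Yu': "(\<Sum>l<n. Y $$ (i, l) * ?u $$ (l, d)) = (if d = k - 1 then Y $$ (i, k) else Y $$ (i, d))" if "i < n" "d < k" for i d
  proof -
    have "(\<Sum>l<n. Y $$ (i, l) * ?u $$ (l, d)) = (\<Sum>l<n. if l = (if d = k - 1 then k else d) then Y $$ (i, if d = k - 1 then k else d) else 0)"
      by (intro sum.cong refl, subst uent) (use that k in auto)
    then show ?thesis using that k by simp
  qed
  have Yr: "Y $$ (i, j) = 0" if "i < k" "j < n" for i j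
    using wY[OF that] wstd_sums(1)[of i k n "\<lambda>l. Y $$ (l, j)"] that k by simp
  have Yc: "Y $$ (i, j) = 0" if "i < n" "j < k - 1" for i j
    using Yu[of i j] Yu'[of i j] that k by simp
  have Yk: "Y $$ (i, k) = 0" if "i < n" for i
    using Yu[of i "k - 1"] Yu'[of i "k - 1"] that k by simp
  have Ya: "(\<Sum>l<n. Y $$ (i, l) * ?a $$ (l, j)) = (if j = k then Y $$ (i, k - 1) else 0)" if "i < n" "j < n" for i j
  proof -
    have "(\<Sum>l<n. Y $$ (i, l) * ?a $$ (l, j)) = (\<Sum>l<n. if l = k - 1 then (if j = k then Y $$ (i, k - 1) else 0) else 0)"
      by (intro sum.cong refl) (use that k in auto)
    then show ?thesis using kn by simp
  qed
  have aY: "(\<Sum>l<n. ?a $$ (i, l) * Y $$ (l, j)) = (if i = k - 1 then Y $$ (k, j) else 0)" if "i < n" "j < n" for i j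
  proof -
    have "(\<Sum>l<n. ?a $$ (i, l) * Y $$ (l, j)) = (\<Sum>l<n. if l = k then (if i = k - 1 then Y $$ (k, j) else 0) else 0)"
      by (intro sum.cong refl) (use that k in auto)
    then show ?thesis using kn by simp
  qed
  have ub: "(\<Sum>d<k. ?u $$ (i, d) * b $$ (d, j)) = (if i < k - 1 then b $$ (i, j) else if i = k then b $$ (k - 1, j) else 0)" if "i < n" for i j
  proof -
    have "(\<Sum>d<k. ?u $$ (i, d) * b $$ (d, j)) = (\<Sum>d<k. if d = (if i < k - 1 then i else k - 1) then
        (if i < k - 1 then b $$ (i, j) else if i = k then b $$ (k - 1, j) else 0) else 0)"
      by (intro sum.cong refl, subst uent) (use that k in auto)
    then show ?thesis using that k by (simp split: if_splits)
  qed
  have cw: "(\<Sum>d<k. c $$ (i, d) * ?w $$ (d, j)) = (if j < k then c $$ (i, j) else 0)" if "j < n" for i j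
    by (rule wstd_sums(2)[OF that])
  have e': "(if j = k then Y $$ (i, k - 1) else 0) - (if i = k - 1 then Y $$ (k, j) else 0)
    + (if i < k - 1 then b $$ (i, j) else if i = k then b $$ (k - 1, j) else 0) + (if j < k then c $$ (i, j) else 0) = (if i = j then r else 0)"
    if "i < n" "j < n" for i j
    using e[OF that] unfolding Ya[OF that] aY[OF that] ub[OF that(1)] cw[OF that(2)] .
  have r0: "r = 0" using e'[of "k + 1" "k + 1"] k by (auto split: if_splits)
  have Y1: "Y $$ (k + 1, k - 1) = 0" using e'[of "k + 1" k] k by (auto split: if_splits)
  have Y2: "Y $$ (k, k + 1) = 0" using e'[OF kn(1), of "k + 1"] k by (auto split: if_splits)
  have "(\<Sum>i<k. Y $$ (i, i)) = 0" by (rule sum.neutral) (use Yr k in auto)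
  then have Y3: "Y $$ (k + 1, k + 1) = 0" using tr k Yk[of k] by simp
  have Y00: "Y $$ (i, j) = 0" if "i < n" "j < n" for i j
  proof -
    have "i < k \<or> i = k \<or> i = k + 1" "j < k - 1 \<or> j = k - 1 \<or> j = k \<or> j = k + 1" using that k by auto
    then show ?thesis using Yr[of i j] Yc[of i j] Yk[of i] s0 Y1 Y2 Y3 that by (elim disjE) simp_all
  qed
  have bk: "b $$ (d, j) = 0" if "d < k" "j < n" for d j
  proof (cases "j < k")
    case False
    have dn: "d < n" using that k by simp
    show ?thesis
    proof (cases "d = k - 1")
      case True
      then show ?thesis using e'[OF kn(2) that(2)] False Y00[OF kn(2,1)] r0 k by (auto split: if_splits)
    next
      case False
      then have "d < k - 1" "d \<noteq> k" using that by auto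
      then show ?thesis using e'[OF dn that(2)] \<open>\<not> j < k\<close> Y00[OF dn kn(1)] r0 by (auto split: if_splits)
    qed
  qed (use b0 that in auto)
  have "Y = 0\<^sub>m n n" by (rule eq_matI) (use Y00 c in auto)
  moreover have "b = 0\<^sub>m k n" by (rule eq_matI) (use bk c in auto)
  moreover have "c = 0\<^sub>m n k"
  proof (rule eq_matI)
    fix i j assume "i < dim_row (0\<^sub>m n k :: complex mat)" "j < dim_col (0\<^sub>m n k :: complex mat)"
    then have ij: "i < n" "j < k" by auto
    then have jn: "j < n" using k by simp
    have "(if i < k - 1 then b $$ (i, j) else if i = k then b $$ (k - 1, j) else 0) = 0"
      using bk[of i j] bk[of "k - 1" j] jn k by auto
    then show "c $$ (i, j) = 0\<^sub>m n k $$ (i, j)"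
      using e'[OF ij(1) jn] ij r0 Y00[OF kn(2) jn] Y00[OF ij(1) kn(1)] by (simp split: if_splits)
  qed (use c in auto)
  ultimately show "Y = 0\<^sub>m n n \<and> b = 0\<^sub>m k n \<and> c = 0\<^sub>m n k" by simp
qed (use k in auto)

text \<open>For every \<open>k\<close> by \<open>k\<close> matrix \<open>Q\<close> the pure
  translation \<open>(0, Q w, - u Q)\<close> fixes \<open>T\<close>, because
  \<open>u (Q w) = (u Q) w\<close>. Up to sign these are differentials of linear forms in the
  entries of \<open>w u\<close>, and they are independent when \<open>w u\<close> is
  invertible.\<close>

lemma moment_stab_dim:
  assumes T: "T \<in> carr n k" and det: "det (tmom T) \<noteq> 0"
  shows "k * k \<le> fvs.dim (stab n k (proj n k T))"
proof -
  obtain a u w where T': "T = (a, u, w)" by (cases T)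
  have cc: "a \<in> carrier_mat n n" "u \<in> carrier_mat n k" "w \<in> carrier_mat k n" using T by (auto simp: T')
  define Qm :: "(nat \<times> nat \<Rightarrow> complex) \<Rightarrow> complex mat" where "Qm q = mat k k q" for q
  have Qm: "Qm q \<in> carrier_mat k k" for q by (simp add: Qm_def)
  define \<phi> where "\<phi> q v = (if v \<in> qbasis n k then (case v of U d i \<Rightarrow> - (Qm q * w) $$ (d, i) | W d i \<Rightarrow> - (u * Qm q) $$ (i, d) | _ \<Rightarrow> 0) else 0)" for q v
  have Qadd: "Qm (x + y) = Qm x + Qm y" for x y by (rule eq_matI) (auto simp: Qm_def)
  have Qscale: "Qm (\<lambda>v. s * x v) = s \<cdot>\<^sub>m Qm x" for s x by (rule eq_matI) (auto simp: Qm_def)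
  have Y: "Yof n (\<phi> q) = 0\<^sub>m n n" for q by (rule eq_matI) (auto simp: Yof_def \<phi>_def)
  have b: "bof n k (\<phi> q) = Qm q * w" for q by (rule eq_matI) (use Qm[of q] cc in \<open>auto simp: bof_def \<phi>_def simp del: index_mult_mat(1)\<close>)
  have c: "cof n k (\<phi> q) = - (u * Qm q)" for q by (rule eq_matI) (use Qm[of q] cc in \<open>auto simp: cof_def \<phi>_def simp del: index_mult_mat(1)\<close>)
  have "card ({..<k} \<times> {..<k}) \<le> fvs.dim (stab n k (proj n k T))"
  proof (rule card_le_fdim[where \<phi> = \<phi> and B = "qbasis n k"])
    show "\<phi> (x + y) = \<phi> x + \<phi> y" for x y
    proof
      fix v
      have 1: "(Qm x + Qm y) * w = Qm x * w + Qm y * w" using Qm cc by (intro add_mult_distrib_mat[of _ k k _ _ n]) auto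
      have 2: "u * (Qm x + Qm y) = u * Qm x + u * Qm y" using Qm cc by (intro mult_add_distrib_mat[of _ n k _ k]) auto
      show "\<phi> (x + y) v = (\<phi> x + \<phi> y) v"
        unfolding plus_fun_def \<phi>_def Qadd[unfolded plus_fun_def] 1 2 using Qm[of x] Qm[of y] cc
        by (cases v) (auto simp del: index_mult_mat(1))
    qed
    show "\<phi> (\<lambda>v. s * x v) = (\<lambda>v. s * \<phi> x v)" for s x
    proof
      fix v
      have 1: "(s \<cdot>\<^sub>m Qm x) * w = s \<cdot>\<^sub>m (Qm x * w)" using Qm cc by (intro mult_smult_assoc_mat[of _ k k _ n]) auto
      have 2: "u * (s \<cdot>\<^sub>m Qm x) = s \<cdot>\<^sub>m (u * Qm x)" using Qm cc by (intro mult_smult_distrib[of _ n k _ k]) auto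
      show "\<phi> (\<lambda>v. s * x v) v = s * \<phi> x v"
        unfolding \<phi>_def Qscale 1 2 using Qm[of x] cc by (cases v) (auto simp del: index_mult_mat(1))
    qed
    show "\<phi> q \<in> stab n k (proj n k T)" for q
    proof -
      have "u * (Qm q * w) + - (u * Qm q) * w = 0\<^sub>m n n"
      proof -
        have "- (u * Qm q) * w = - (u * Qm q * w)" using Qm[of q] cc by (intro uminus_mult_left_mat) auto
        also have "u * Qm q * w = u * (Qm q * w)" using Qm[of q] cc by (intro assoc_mult_mat) auto
        finally show ?thesis using Qm[of q] cc by (auto intro!: eq_matI simp del: index_mult_mat(1))
      qed
      then have d: "dact T (Yof n (\<phi> q), bof n k (\<phi> q), cof n k (\<phi> q)) = (0\<^sub>m n n, 0\<^sub>m n k, - 0\<^sub>m k n)"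
        unfolding Y b c T' using cc by simp
      have "(\<Sum>j\<in>qbasis n k. \<phi> q j * meval (brpoly n k j i) (proj n k T)) = 0" if "i \<in> qbasis n k" for i
        unfolding br_dact[OF T that] d using that by (cases i) auto
      then show ?thesis by (auto simp: stab_def) (auto simp: \<phi>_def)
    qed
    fix q assume q: "\<And>j. j \<notin> {..<k} \<times> {..<k} \<Longrightarrow> q j = 0" "\<phi> q = 0"
    have "Qm q * w = 0\<^sub>m k n" unfolding b[symmetric] q(2) by (rule eq_matI) (auto simp: bof_def)
    then have "Qm q * w * u = 0\<^sub>m k k" using cc by simp
    moreover have "Qm q * w * u = Qm q * tmom T" using Qm[of q] cc by (auto simp: T' intro!: assoc_mult_mat)
    ultimately have Q0: "Qm q * tmom T = 0\<^sub>m k k" by simp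
    have tc: "tmom T \<in> carrier_mat k k" using T by (rule tmom_carrier)
    obtain B where B: "B \<in> carrier_mat k k" "tmom T * B = 1\<^sub>m k" using det_nonzero_inverse[OF tc det] by metis
    have "Qm q = 0\<^sub>m k k" using conj_cancel'[OF B(1) tc B(2) Qm[of q]] Q0 B by simp
    then have "q (i, j) = 0" if "i < k" "j < k" for i j
      using that by (metis Qm_def index_mat(1) index_zero_mat(1))
    then show "q = 0" using q(1) by (auto simp: fun_eq_iff)
  qed (auto simp: stab_def)
  then show ?thesis by (simp add: card_cartesian_product)
qed

text \<open>The summand \<open>k * k + 1\<close> is split off to show a parity: the rank of a skew
  form is even, so every stabiliser has a dimension of the same parity as
  \<open>k * k + 1\<close>.\<close>

lemma card_qbasis:
  assumes "n = k + 2"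
  shows "card (qbasis n k) = 2 * (k * k + 4 * k + 1) + (k * k + 1)"
proof -
  have "card (qbasis n k) = (\<Sum>i<n. \<Sum>j<n. if i \<noteq> j then 1 else 0) + (n - 1) + 2 * (k * n)"
    using sum_qbasis[of "\<lambda>_. 1::nat" n k] by simp
  also have "(\<Sum>i<n. \<Sum>j<n. if i \<noteq> j then 1 else 0) = (\<Sum>i<n. n - 1)"
  proof (intro sum.cong refl)
    fix i assume i: "i \<in> {..<n}"
    have "(\<Sum>j<n. if i \<noteq> j then 1 else 0) = card ({..<n} - {i})"
      unfolding card_eq_sum by (rule sum.mono_neutral_cong_right) auto
    then show "(\<Sum>j<n. if i \<noteq> j then 1 else 0) = n - 1" using i by simp
  qed
  finally show ?thesis using assms by (simp add: algebra_simps)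
qed

text \<open>A divisor in \<open>codim2\<close> may contain any variable; those outside
  \<open>qbasis n k\<close> are held at fixed values \<open>z\<close>.\<close>

lemma polyfun_meval_proj:
  "polyfun UNIV (\<lambda>y. meval f (\<lambda>l. if l \<in> qbasis n k then proj n k (Tof n k y) l else z l))"
proof (rule polyfun_comp[OF polyfun_meval[OF subset_UNIV]])
  show "polyfun UNIV (\<lambda>y. if l \<in> qbasis n k then proj n k (Tof n k y) l else z l)" for l
    by (cases l) (auto simp: proj_def Tof_def intro!: pf)
qed

text \<open>The moment matrix gives \<open>k * k\<close> generically, and parity supplies the
  missing 1. A smaller stabiliser at one point would spread, through the Pfaffian that is nonzero
  there, to points with invertible moment matrix.\<close>

lemma stab_dim_ge:
  assumes k: "1 \<le> k" "n = k + 2"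
  shows "k * k + 1 \<le> fvs.dim (stab n k \<gamma>)"
proof (rule ccontr)
  assume "\<not> k * k + 1 \<le> fvs.dim (stab n k \<gamma>)"
  then have le: "fvs.dim (stab n k \<gamma>) \<le> k * k" by simp
  obtain r xs where xs: "distinct xs" "set xs \<subseteq> qbasis n k" "length xs = 2 * r" "PF (\<lambda>a b. brm n k \<gamma> (xs ! a) (xs ! b)) r \<noteq> 0"
    "card (qbasis n k) = 2 * r + fvs.dim (rad (qbasis n k) (brm n k \<gamma>))"
    by (rule rank_PF[where om = "brm n k \<gamma>", OF finite_qbasis[of n k] brm_skew])
  let ?f = "pfaff (\<lambda>a b. brpoly n k (xs ! a) (xs ! b)) r"
  let ?P = "\<lambda>y l. if l \<in> qbasis n k then proj n k (Tof n k y) l else 0"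
  have ev: "meval ?f \<delta> \<noteq> 0 \<longleftrightarrow> PF (\<lambda>a b. brm n k \<delta> (xs ! a) (xs ! b)) r \<noteq> 0" for \<delta>
    by (simp add: meval_pfaff brm_def)
  have "brm n k (?P (lift n k \<gamma>)) i j = brm n k \<gamma> i j" for i j by (rule brm_cong) (simp add: proj_Tof_lift)
  then have p: "meval ?f (?P (lift n k \<gamma>)) \<noteq> 0" unfolding ev using xs(4) by simp
  obtain y0 where y0: "tmom (Tof n k y0) = 1\<^sub>m k" using ex_Tof_tmom[of k n "1\<^sub>m k"] k by auto
  then have q: "det (tmom (Tof n k y0)) \<noteq> 0" by simp
  obtain y where y: "meval ?f (?P y) \<noteq> 0" "det (tmom (Tof n k y)) \<noteq> 0"
    by (rule polyfun_nonzero_mult[where p = "\<lambda>y. meval ?f (?P y)" and q = "\<lambda>y. det (tmom (Tof n k y))", OF polyfun_meval_proj polyfun_det_tmom q p])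
  let ?\<gamma> = "proj n k (Tof n k y)"
  have P: "?P y = ?\<gamma>" by (auto simp: proj_def)
  have "PF (\<lambda>a b. brm n k ?\<gamma> (xs ! a) (xs ! b)) r \<noteq> 0" using y(1) unfolding P ev .
  then have "2 * r + fvs.dim (stab n k ?\<gamma>) \<le> card (qbasis n k)"
    unfolding stab_rad by (rule PF_rad_dim[OF finite_qbasis brm_skew xs(1-3)])
  then have "fvs.dim (stab n k ?\<gamma>) \<le> k * k" using xs(5) le by (simp add: stab_rad)
  moreover have "k * k \<le> fvs.dim (stab n k ?\<gamma>)" by (rule moment_stab_dim) (use y in auto)
  ultimately have eq: "fvs.dim (rad (qbasis n k) (brm n k ?\<gamma>)) = k * k" by (simp add: stab_rad)
  obtain r' where "card (qbasis n k) = 2 * r' + fvs.dim (rad (qbasis n k) (brm n k ?\<gamma>))"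
    by (rule rank_PF[where om = "brm n k ?\<gamma>", OF finite_qbasis[of n k] brm_skew])
  \<comment> \<open>A stabiliser of dimension \<open>k * k\<close> would leave an odd rank.\<close>
  then have "2 * (k * k + 4 * k + 1) + 1 = 2 * r'" unfolding eq card_qbasis[OF k(2)] by simp
  then show False by presburger
qed

lemma qind_eq:
  assumes k: "1 \<le> k" "n = k + 2"
  shows "qind n k = k * k + 1"
  unfolding qind_def
proof (rule Least_equality)
  let ?T = "slice n k (1\<^sub>m k) (comp2 1)"
  have "fvs.dim (stab n k (proj n k ?T)) \<le> k * k + 1"
    by (rule small_stab_dim) (use k slice_small[OF k, of "1\<^sub>m k" 1] in auto)
  then show "\<exists>\<gamma>. cdim (stab n k \<gamma>) = k * k + 1"
    using stab_dim_ge[OF k, of "proj n k ?T"] by (intro exI[of _ "proj n k ?T"]) (simp add: cdim_eq)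
  show "k * k + 1 \<le> y" if "\<exists>\<gamma>. cdim (stab n k \<gamma>) = y" for y
    using that stab_dim_ge[OF k] by (auto simp: cdim_eq)
qed

section \<open>Common divisors of the Pfaffians\<close>

lemma tconj_tconj:
  assumes T: "T \<in> carr n k" and g: "g \<in> carrier_mat n n" "h \<in> carrier_mat n n" "h * g = 1\<^sub>m n"
  shows "tconj h g (tconj g h T) = T"
proof -
  obtain a u w where T': "T = (a, u, w)" by (cases T)
  have cc: "a \<in> carrier_mat n n" "u \<in> carrier_mat n k" "w \<in> carrier_mat k n" using T by (auto simp: T')
  have "h * (g * a * h) * g = h * (g * a * h * g)" using g cc by (intro assoc_mult_mat) auto
  also have "g * a * h * g = g * a" using g cc by (intro conj_cancel'[of g n h _ n]) auto
  also have "h * (g * a) = a" using g cc by (intro conj_cancel[of g n h _ n]) auto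
  finally show ?thesis using conj_cancel[OF g cc(2)] conj_cancel'[OF g cc(3)] by (simp add: T')
qed

lemma ttrans_ttrans:
  assumes T: "T \<in> carr n k" and b: "b \<in> carrier_mat k n" "c \<in> carrier_mat n k"
  shows "ttrans (- b) (- c) (ttrans b c T) = T"
proof -
  obtain a u w where T': "T = (a, u, w)" by (cases T)
  have cc: "a \<in> carrier_mat n n" "u \<in> carrier_mat n k" "w \<in> carrier_mat k n" using T by (auto simp: T')
  have 1: "u * (- b) = - (u * b)" using cc b by (intro uminus_mult_right_mat) auto
  have 2: "- c * w = - (c * w)" using cc b by (intro uminus_mult_left_mat) auto
  have "a + (u * b + c * w) + (u * (- b) + - c * w) = a"
    unfolding 1 2 by (rule eq_matI) (use cc b in \<open>auto simp del: index_mult_mat(1)\<close>)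
  then show ?thesis by (simp add: T')
qed

text \<open>Isolates what the argument uses of a common divisor: it has no zeros at regular points.
  In \<open>nz\<close> the point \<open>\<gamma>\<close> is prescribed on \<open>qbasis n k\<close>
  alone, since the divisor may contain other variables.\<close>

locale common_divisor =
  fixes n k :: nat and d :: "qidx mpoly"
  assumes k: "1 \<le> k" and n: "n = k + 2"
    and nz: "\<And>T \<gamma>. T \<in> carr n k \<Longrightarrow> small n k (k * k + 1) T \<Longrightarrow> (\<And>l. l \<in> qbasis n k \<Longrightarrow> \<gamma> l = proj n k T l) \<Longrightarrow> meval d \<gamma> \<noteq> 0"
begin

abbreviation sm :: "triple \<Rightarrow> bool" where
  "sm \<equiv> small n k (k * k + 1)"

definition D :: "triple \<Rightarrow> complex" where
  "D T = meval d (proj n k T)"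

lemma D_curve:
  assumes "\<And>t. g t \<in> carr n k" "\<And>t. sm (g t)" "\<And>l. l \<in> qbasis n k \<Longrightarrow> pcurve (\<lambda>t. tproj (g t) l)"
  shows "D (g s) = D (g t)"
  unfolding D_def
proof (rule pcurve_no_zero_imp_const[where g = "\<lambda>t. meval d (proj n k (g t))"])
  show "pcurve (\<lambda>t. meval d (proj n k (g t)))"
    by (rule pcurve_comp[OF polyfun_meval[OF subset_UNIV]]) (use assms(3) in \<open>auto simp: proj_def intro: pf\<close>)
  show "meval d (proj n k (g t)) \<noteq> 0" for t by (rule nz[OF assms(1,2)]) simp
qed

text \<open>On the line that changes only the variables outside the basis, \<open>nz\<close>
  excludes zeros throughout, so the value is constant.\<close>

lemma D_extend:
  assumes T: "T \<in> carr n k" "sm T" and \<gamma>: "\<And>l. l \<in> qbasis n k \<Longrightarrow> \<gamma> l = proj n k T l"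
  shows "meval d \<gamma> = D T"
proof -
  define c where "c t l = proj n k T l + t * (\<gamma> l - proj n k T l)" for t :: complex and l
  have "meval d (c 1) = meval d (c 0)"
  proof (rule pcurve_no_zero_imp_const[where g = "\<lambda>t. meval d (c t)"])
    show "pcurve (\<lambda>t. meval d (c t))"
      by (rule pcurve_comp[OF polyfun_meval[OF subset_UNIV]]) (auto simp: c_def intro!: pf)
    show "meval d (c t) \<noteq> 0" for t by (rule nz[OF T]) (use \<gamma> in \<open>simp add: c_def\<close>)
  qed
  moreover have "c 1 = \<gamma>" "c 0 = proj n k T" by (auto simp: c_def)
  ultimately show ?thesis by (simp add: D_def)
qed

lemma D_qcurve:
  assumes T: "T \<in> carr n k" and P: "P \<in> carr n k" "Q \<in> carrier_mat n n" and s: "\<And>t. sm (qcurve T P Q t)"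
  shows "D (qcurve T P Q 1) = D T"
proof -
  have "D (qcurve T P Q 1) = D (qcurve T P Q 0)"
  proof (rule D_curve[where g = "qcurve T P Q"])
    show "pcurve (\<lambda>t. tproj (qcurve T P Q t) l)" if "l \<in> qbasis n k" for l
      unfolding tproj_qcurve[OF T P that] power2_eq_square by (intro pf)
  qed (use qcurve_carr[OF T P] s in auto)
  then show ?thesis using qcurve_0[OF T P] by simp
qed

text \<open>Apart from shifts, which keep the point, a move is the endpoint of a polynomial curve of
  group elements. Each point of the curve is carried back to \<open>T\<close> by the opposite
  element, so regularity persists along it.\<close>

lemma D_move:
  assumes "move n k T T'" "sm T"
  shows "D T' = D T"
  using assms(1)
proof (cases rule: move.cases)
  case (move_conj Y)
  obtain a u w where T: "T = (a, u, w)" by (cases T)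
  have cc: "a \<in> carrier_mat n n" "u \<in> carrier_mat n k" "w \<in> carrier_mat k n" using move_conj(2) by (auto simp: T)
  let ?P = "(Y * a - a * Y, Y * u, - (w * Y))" and ?Q = "- (Y * a * Y)"
  have q: "qcurve T ?P ?Q t = tconj (1\<^sub>m n + t \<cdot>\<^sub>m Y) (1\<^sub>m n - t \<cdot>\<^sub>m Y) T" for t
    using tconj_qcurve[of a u w n k Y t] move_conj by (simp add: T)
  have "D (qcurve T ?P ?Q 1) = D T"
  proof (rule D_qcurve)
    show "?P \<in> carr n k" "?Q \<in> carrier_mat n n" using cc move_conj(3) by auto
    fix t
    have Y: "t \<cdot>\<^sub>m Y \<in> carrier_mat n n" using move_conj(3) by simp
    have sq: "(t \<cdot>\<^sub>m Y) * (t \<cdot>\<^sub>m Y) = 0\<^sub>m n n"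
      using move_conj(3,4) by (simp add: mult_smult_distrib[of _ n n _ n] mult_smult_assoc_mat[of _ n n _ n])
    have g: "1\<^sub>m n + t \<cdot>\<^sub>m Y \<in> carrier_mat n n" "1\<^sub>m n - t \<cdot>\<^sub>m Y \<in> carrier_mat n n" using Y by auto
    note pm = one_plus_minus_Y[OF Y sq]
    have car: "tconj (1\<^sub>m n + t \<cdot>\<^sub>m Y) (1\<^sub>m n - t \<cdot>\<^sub>m Y) T \<in> carr n k" using g cc by (auto simp: T)
    show "sm (qcurve T ?P ?Q t)" unfolding q
      by (rule small_tconj[OF car g(2,1) pm]) (use tconj_tconj[OF move_conj(2) g pm(1)] assms(2) in simp)
  qed (rule move_conj(2))
  then show ?thesis using move_conj unfolding q by (simp add: smult_one_mat)
next
  case (move_trans b c)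
  obtain a u w where T: "T = (a, u, w)" by (cases T)
  have cc: "a \<in> carrier_mat n n" "u \<in> carrier_mat n k" "w \<in> carrier_mat k n" using move_trans(2) by (auto simp: T)
  let ?P = "(u * b + c * w, 0\<^sub>m n k, 0\<^sub>m k n)" and ?Q = "0\<^sub>m n n"
  have q: "qcurve T ?P ?Q t = ttrans (t \<cdot>\<^sub>m b) (t \<cdot>\<^sub>m c) T" for t
    using ttrans_qcurve[of a u w n k b c t] move_trans by (simp add: T)
  have "D (qcurve T ?P ?Q 1) = D T"
  proof (rule D_qcurve)
    show "?P \<in> carr n k" "?Q \<in> carrier_mat n n" using cc move_trans by auto
    fix t
    have b: "t \<cdot>\<^sub>m b \<in> carrier_mat k n" "t \<cdot>\<^sub>m c \<in> carrier_mat n k" using move_trans by auto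
    then have b': "- (t \<cdot>\<^sub>m b) \<in> carrier_mat k n" "- (t \<cdot>\<^sub>m c) \<in> carrier_mat n k" by auto
    have car: "ttrans (t \<cdot>\<^sub>m b) (t \<cdot>\<^sub>m c) T \<in> carr n k" using b cc by (auto simp: T)
    show "sm (qcurve T ?P ?Q t)" unfolding q
      by (rule small_ttrans[OF car b']) (use ttrans_ttrans[OF move_trans(2) b] assms(2) in simp)
  qed (rule move_trans(2))
  then show ?thesis using move_trans unfolding q by (simp add: smult_one_mat)
next
  case (move_shift r)
  then show ?thesis by (simp add: D_def)
qed

lemma D_moves:
  assumes "moves n k T T'" "sm T'"
  shows "D T' = D T"
  using assms
proof (induction rule: converse_rtranclp_induct)
  case (step T T1)
  then have "sm T" by (intro small_move[OF step(1)] small_moves[OF step(2)])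
  then show ?case using D_move[OF step(1)] step by simp
qed simp

lemma D_slice_curve:
  assumes M: "\<And>t. M t \<in> carrier_mat k k" "\<And>t. det (M t) \<noteq> 0" "\<And>i j. i < k \<Longrightarrow> j < k \<Longrightarrow> pcurve (\<lambda>t. M t $$ (i, j))" and h: "pcurve h"
  shows "D (slice n k (M s) (comp2 (h s))) = D (slice n k (M t) (comp2 (h t)))"
proof (rule D_curve[where g = "\<lambda>t. slice n k (M t) (comp2 (h t))"])
  show "sm (slice n k (M t) (comp2 (h t)))" for t by (rule slice_small[OF k n M(1,2)])
  have a: "pcurve (\<lambda>t. ablk n k (comp2 (h t)) $$ (i, j))" if "i < n" "j < n" for i j
    using that n by (auto simp: ablk_def comp2_def intro!: pf h)
  show "pcurve (\<lambda>t. tproj (slice n k (M t) (comp2 (h t))) l)" if "l \<in> qbasis n k" for l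
    using that by (cases l) (auto simp: slice_def ublk_def intro!: pf a M(3))
qed simp

lemma D_slice_param:
  assumes "M \<in> carrier_mat k k" "det M \<noteq> 0"
  shows "D (slice n k M (comp2 h)) = D (slice n k M (comp2 1))"
  using D_slice_curve[of "\<lambda>_. M" "\<lambda>t. t" h 1] assms by (auto intro: pf)

text \<open>The determinant does not vanish along \<open>M (1 - t Y)\<close>, so the curve stays
  among the companion normal forms with invertible \<open>M\<close>, all of which are
  regular.\<close>

lemma D_slice_unipotent:
  assumes M: "M \<in> carrier_mat k k" "det M \<noteq> 0" and Y: "Y \<in> carrier_mat k k" "Y * Y = 0\<^sub>m k k"
  shows "D (slice n k (M * (1\<^sub>m k - Y)) (comp2 1)) = D (slice n k M (comp2 1))" "det (M * (1\<^sub>m k - Y)) \<noteq> 0"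
proof -
  let ?M = "\<lambda>t. M * (1\<^sub>m k - t \<cdot>\<^sub>m Y)"
  have c: "1\<^sub>m k - t \<cdot>\<^sub>m Y \<in> carrier_mat k k" "1\<^sub>m k + t \<cdot>\<^sub>m Y \<in> carrier_mat k k" for t using Y by auto
  have det: "det (?M t) \<noteq> 0" for t
  proof -
    have sq: "(t \<cdot>\<^sub>m Y) * (t \<cdot>\<^sub>m Y) = 0\<^sub>m k k"
      using Y by (simp add: mult_smult_distrib[of _ k k _ k] mult_smult_assoc_mat[of _ k k _ k])
    have "det (1\<^sub>m k - t \<cdot>\<^sub>m Y) * det (1\<^sub>m k + t \<cdot>\<^sub>m Y) = 1"
      using det_mult[OF c[of t]] one_plus_minus_Y(1)[OF _ sq] Y by simp
    then have "det (1\<^sub>m k - t \<cdot>\<^sub>m Y) \<noteq> 0" by auto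
    then show ?thesis using det_mult[OF M(1) c(1)[of t]] M by simp
  qed
  have "D (slice n k (?M 1) (comp2 1)) = D (slice n k (?M 0) (comp2 1))"
  proof (rule D_slice_curve[where M = ?M and h = "\<lambda>_. 1"])
    show "?M t \<in> carrier_mat k k" for t using M c by auto
    show "pcurve (\<lambda>t. ?M t $$ (i, j))" if "i < k" "j < k" for i j
    proof -
      have "?M t $$ (i, j) = (\<Sum>l<k. M $$ (i, l) * ((if l = j then 1 else 0) - t * Y $$ (l, j)))" for t
        unfolding mult_mat_entry[OF M(1) c(1) that] using that Y by (intro sum.cong refl) auto
      then show ?thesis by (auto intro!: pf)
    qed
  qed (use det in \<open>auto intro: pf\<close>)
  moreover have "1\<^sub>m k - 0 \<cdot>\<^sub>m Y = 1\<^sub>m k" by (rule eq_matI) (use Y in auto)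
  ultimately show "D (slice n k (M * (1\<^sub>m k - Y)) (comp2 1)) = D (slice n k M (comp2 1))"
    using M by (simp add: smult_one_mat)
  show "det (M * (1\<^sub>m k - Y)) \<noteq> 0" using det[of 1] by (simp add: smult_one_mat)
qed

text \<open>Column operations of determinant 1 reduce \<open>M\<close> to diag(1, ..., 1,
  \<open>\<delta>\<close>) but cannot alter \<open>\<delta>\<close>, the determinant of
  \<open>M\<close>. Independence of \<open>\<delta>\<close> is left to the section.\<close>

lemma D_slice_diag:
  assumes M: "M \<in> carrier_mat k k" "det M \<noteq> 0"
  obtains \<delta> where "\<delta> \<noteq> 0" "D (slice n k M (comp2 1)) = D (slice n k (Mdel k \<delta>) (comp2 1))"
proof -
  define P where "P w (z :: complex mat) \<longleftrightarrow> (det w \<noteq> 0 \<longrightarrow> (\<exists>\<delta>. \<delta> \<noteq> 0 \<and> D (slice n k w (comp2 1)) = D (slice n k (Mdel k \<delta>) (comp2 1))))" for w z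
  have "P M (1\<^sub>m k)"
  proof (rule row_elimination[where r = k and n = k and m = "k - 1" and P = P])
    fix w z Y :: "complex mat"
    assume w: "w \<in> carrier_mat k k" and Y: "Y \<in> carrier_mat k k" "Y * Y = 0\<^sub>m k k" and P: "P (w * (1\<^sub>m k - Y)) ((1\<^sub>m k + Y) * z)"
    show "P w z" unfolding P_def
      using P D_slice_unipotent[OF w _ Y] by (auto simp: P_def)
  next
    fix w z :: "complex mat"
    assume w: "w \<in> carrier_mat k k" and std: "std_rows k (k - 1) w"
    show "P w z" unfolding P_def
    proof
      assume det: "det w \<noteq> 0"
      define \<delta> where "\<delta> = w $$ (k - 1, k - 1)"
      \<comment> \<open>Column \<open>k - 1\<close> clears the rest of the last row, once its last
        entry \<open>\<delta>\<close> is known to be nonzero.\<close>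
      define g where "g p = (if p = k - 1 then 0 else w $$ (k - 1, p) / \<delta>)" for p
      have rows: "w $$ (i, p) = (if i = p then 1 else 0)" if "i < k - 1" "p < k" for i p using std that by (auto simp: std_rows_def)
      have \<delta>: "\<delta> \<noteq> 0"
      proof
        assume \<delta>0: "\<delta> = 0"
        obtain B where B: "B \<in> carrier_mat k k" "B * w = 1\<^sub>m k" using det_nonzero_inverse[OF w det] by metis
        have "(B * w) $$ (k - 1, k - 1) = (\<Sum>l<k. B $$ (k - 1, l) * w $$ (l, k - 1))"
          using B w k by (intro mult_mat_entry) auto
        also have "\<dots> = 0"
        proof (rule sum.neutral, intro ballI)
          fix l assume "l \<in> {..<k}"
          then have "w $$ (l, k - 1) = 0" using rows[of l "k - 1"] \<delta>0 by (cases "l = k - 1") (auto simp: \<delta>_def)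
          then show "B $$ (k - 1, l) * w $$ (l, k - 1) = 0" by simp
        qed
        finally show False using B k by simp
      qed
      let ?Y = "Ycol k (k - 1) g"
      have "w * (1\<^sub>m k - ?Y) = Mdel k \<delta>"
      proof (rule eq_matI)
        fix i p assume "i < dim_row (Mdel k \<delta>)" "p < dim_col (Mdel k \<delta>)"
        then have ip: "i < k" "p < k" by (auto simp: Mdel_def)
        have "(w * (1\<^sub>m k - ?Y)) $$ (i, p) = w $$ (i, p) - w $$ (i, k - 1) * g p" using w ip k by (intro Ycol_col_op) auto
        also have "\<dots> = Mdel k \<delta> $$ (i, p)"
        proof (cases "i = k - 1")
          case True
          then show ?thesis using ip \<delta> by (cases "p = k - 1") (auto simp: g_def Mdel_def \<delta>_def)
        next
          case False
          then show ?thesis using ip rows[of i p] rows[of i "k - 1"] k by (auto simp: Mdel_def)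
        qed
        finally show "(w * (1\<^sub>m k - ?Y)) $$ (i, p) = Mdel k \<delta> $$ (i, p)" .
      qed (use w in \<open>auto simp: Mdel_def Ycol_def\<close>)
      moreover have "?Y * ?Y = 0\<^sub>m k k" by (rule Ycol_square) (simp add: g_def)
      ultimately have "D (slice n k (Mdel k \<delta>) (comp2 1)) = D (slice n k w (comp2 1))"
        using D_slice_unipotent(1)[OF w det, of ?Y] by simp
      then show "\<exists>\<delta>. \<delta> \<noteq> 0 \<and> D (slice n k w (comp2 1)) = D (slice n k (Mdel k \<delta>) (comp2 1))" using \<delta> by metis
    qed
  qed (use k M in auto)
  then show ?thesis using that M(2) by (auto simp: P_def)
qed

text \<open>For nonzero \<open>\<delta>\<close> the block of the section has the distinct
  eigenvalues 0 and \<open>- 1 / \<delta>\<close>, so it can be moved to a companion form.\<close>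

lemma sect_Mdel:
  assumes \<delta>: "\<delta> \<noteq> 0"
  shows "sm (sect n k (Mdel k \<delta>) 1)" "D (sect n k (Mdel k \<delta>) 1) = D (slice n k (Mdel k \<delta>) (comp2 1))"
proof -
  have M: "Mdel k \<delta> \<in> carrier_mat k k" "det (Mdel k \<delta>) \<noteq> 0" using k \<delta> by (auto simp: det_Mdel)
  have 1: "moves n k (sect n k (Mdel k \<delta>) 1) (slice n k (Mdel k \<delta>) (e11 2 (- (1 / \<delta>))))"
    using sect_Mdel_moves[of k n \<delta> 1] k n \<delta> by simp
  have "e11 2 (- (1 / \<delta>)) \<in> carrier_mat 2 2" "disc2 (e11 2 (- (1 / \<delta>))) \<noteq> 0" using \<delta> by (auto simp: e11_def disc2_def)
  then obtain h where "moves n k (slice n k (Mdel k \<delta>) (e11 2 (- (1 / \<delta>)))) (slice n k (Mdel k \<delta>) (comp2 h))"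
    using slice_comp2[OF n M] by metis
  with 1 have m: "moves n k (sect n k (Mdel k \<delta>) 1) (slice n k (Mdel k \<delta>) (comp2 h))" by simp
  have s: "sm (slice n k (Mdel k \<delta>) (comp2 h))" by (rule slice_small[OF k n M])
  show "sm (sect n k (Mdel k \<delta>) 1)" by (rule small_moves[OF m s])
  show "D (sect n k (Mdel k \<delta>) 1) = D (slice n k (Mdel k \<delta>) (comp2 1))"
    using D_moves[OF m s] D_slice_param[OF M, of h] by simp
qed

text \<open>The curve \<open>\<delta> \<mapsto> sect n k (Mdel k \<delta>) 1\<close> crosses the hypersurface \<open>det (tmom T) = 0\<close> without leaving the
  set of regular points, so \<open>D\<close> cannot vary with \<open>\<delta>\<close>.\<close>

lemma D_sect_const: "D (sect n k (Mdel k \<delta>) 1) = D (sect n k (Mdel k 1) 1)"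
proof (rule D_curve[where g = "\<lambda>\<delta>. sect n k (Mdel k \<delta>) 1"])
  show "sm (sect n k (Mdel k \<delta>) 1)" for \<delta>
    using sect_Mdel(1)[of \<delta>] sect_small[OF k n] by (cases "\<delta> = 0") auto
  show "pcurve (\<lambda>\<delta>. tproj (sect n k (Mdel k \<delta>) 1) l)" if "l \<in> qbasis n k" for l
    using that n by (cases l) (auto simp: sect_def Mdel_def intro!: pf)
qed simp

text \<open>A generic point moves to a companion normal form, whose parameters \<open>h\<close> and
  \<open>M\<close> are varied until it meets the section.\<close>

lemma D_generic:
  assumes T: "T \<in> carr n k" and det: "det (tmom T) \<noteq> 0" and S2: "S2 n k T \<noteq> 0"
  shows "sm T" "D T = D (sect n k (Mdel k 1) 1)"
proof -
  have kn: "k < n" "2 \<le> n - k" "n - k = 2" using n by auto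
  have M: "tmom T \<in> carrier_mat k k" using T by (rule tmom_carrier)
  obtain A where A: "A \<in> carrier_mat (n - k) (n - k)" "moves n k T (slice n k (tmom T) A)"
    using generic_normal_form[OF kn(1) T det] .
  have A2: "A \<in> carrier_mat 2 2" using A kn by simp
  have "S2 n k (slice n k (tmom T) A) \<noteq> 0" using S2_moves[OF kn(1,2) A(2) T] S2 by simp
  then have "disc2 A \<noteq> 0" unfolding S2_slice[OF n M A2] by auto
  then obtain h where "moves n k (slice n k (tmom T) A) (slice n k (tmom T) (comp2 h))"
    using slice_comp2[OF n M det A2] by metis
  with A(2) have m: "moves n k T (slice n k (tmom T) (comp2 h))" by simp
  have s: "sm (slice n k (tmom T) (comp2 h))" by (rule slice_small[OF k n M det])
  show "sm T" by (rule small_moves[OF m s])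
  obtain \<delta> where \<delta>: "\<delta> \<noteq> 0" "D (slice n k (tmom T) (comp2 1)) = D (slice n k (Mdel k \<delta>) (comp2 1))"
    using D_slice_diag[OF M det] .
  show "D T = D (sect n k (Mdel k 1) 1)"
    using D_moves[OF m s] D_slice_param[OF M det, of h] \<delta> sect_Mdel(2)[OF \<delta>(1)] D_sect_const[of \<delta>] by simp
qed

text \<open>A polynomial function that is constant on a dense set is constant, and a nonzero
  constant is invertible.\<close>

lemma d_unit: "d dvd 1"
proof -
  define \<kappa> where "\<kappa> = D (sect n k (Mdel k 1) 1)"
  have \<kappa>: "\<kappa> \<noteq> 0" unfolding \<kappa>_def D_def by (rule nz[OF sect_carr sect_Mdel(1)]) auto
  have M1: "det (1\<^sub>m k :: complex mat) \<noteq> 0" by simp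
  obtain y0 where y0: "slice n k (1\<^sub>m k) (comp2 1) = Tof n k y0" using Tof_surj[OF slice_carrier(4)] .
  have q0: "det (tmom (Tof n k y0)) * S2 n k (Tof n k y0) \<noteq> 0"
    unfolding y0[symmetric] using n S2_slice[OF n, of "1\<^sub>m k" "comp2 1"] by (simp add: disc2_comp2)
  have "meval d \<gamma> = \<kappa>" for \<gamma>
  proof -
    let ?P = "\<lambda>y l. if l \<in> qbasis n k then proj n k (Tof n k y) l else \<gamma> l"
    have "meval d (?P (lift n k \<gamma>)) - \<kappa> = 0"
    proof (rule polyfun_dense[where p = "\<lambda>y. meval d (?P y) - \<kappa>" and q = "\<lambda>y. det (tmom (Tof n k y)) * S2 n k (Tof n k y)", OF _ _ q0])
      show "polyfun UNIV (\<lambda>y. meval d (?P y) - \<kappa>)" by (intro pf polyfun_meval_proj)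
      show "polyfun UNIV (\<lambda>y. det (tmom (Tof n k y)) * S2 n k (Tof n k y))" unfolding S2_def Let_def by (intro pf)
      fix y assume y: "det (tmom (Tof n k y)) * S2 n k (Tof n k y) \<noteq> 0"
      then have "det (tmom (Tof n k y)) \<noteq> 0" "S2 n k (Tof n k y) \<noteq> 0" by auto
      note g = D_generic[OF Tof_carr this]
      show "meval d (?P y) - \<kappa> = 0" using D_extend[OF Tof_carr g(1), of "?P y"] g(2) by (simp add: \<kappa>_def)
    qed
    moreover have "?P (lift n k \<gamma>) = \<gamma>" by (auto simp: proj_Tof_lift)
    ultimately show ?thesis by simp
  qed
  then have "d * mconst (1 / \<kappa>) = 1" using \<kappa> by (intro meval_inject) simp
  then show ?thesis by (metis dvdI)
qed

end

text \<open>At a regular point the rank of the structure matrix is exactly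
  \<open>card (qbasis n k) - qind n k\<close>, so by \<open>rank_PF\<close> some Pfaffian of this
  size is nonzero there, and with it every common divisor.\<close>

theorem codim2_of_codim_2:
  assumes k: "1 \<le> k" "n = k + 2"
  shows "codim2 n k"
  unfolding codim2_def Let_def
proof (intro allI impI)
  let ?s = "card (qbasis n k) - qind n k"
  fix d :: "qidx mpoly"
  assume d: "\<forall>xs. distinct xs \<and> set xs \<subseteq> qbasis n k \<and> length xs = ?s \<longrightarrow> d dvd pfaff (\<lambda>a b. brpoly n k (xs ! a) (xs ! b)) (?s div 2)"
  have "common_divisor n k d"
  proof
    fix T \<gamma> assume T: "T \<in> carr n k" "small n k (k * k + 1) T" and \<gamma>: "\<And>l. l \<in> qbasis n k \<Longrightarrow> \<gamma> l = proj n k T l"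
    have brm: "brm n k \<gamma> = brm n k (proj n k T)" by (intro ext brm_cong) (rule \<gamma>)
    obtain r xs where xs: "distinct xs" "set xs \<subseteq> qbasis n k" "length xs = 2 * r" "PF (\<lambda>a b. brm n k \<gamma> (xs ! a) (xs ! b)) r \<noteq> 0"
      "card (qbasis n k) = 2 * r + fvs.dim (rad (qbasis n k) (brm n k \<gamma>))"
      by (rule rank_PF[where om = "brm n k \<gamma>", OF finite_qbasis[of n k] brm_skew])
    have "fvs.dim (stab n k (proj n k T)) \<le> k * k + 1" by (rule small_stab_dim[OF T(1) _ T(2)]) (use k in simp)
    then have "fvs.dim (rad (qbasis n k) (brm n k \<gamma>)) = k * k + 1"
      using stab_dim_ge[OF k, of "proj n k T"] unfolding brm stab_rad by simp
    then have s: "?s = 2 * r" using xs(5) qind_eq[OF k] by simp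
    have "d dvd pfaff (\<lambda>a b. brpoly n k (xs ! a) (xs ! b)) (?s div 2)" using d xs(1-3) s by metis
    then obtain e where "pfaff (\<lambda>a b. brpoly n k (xs ! a) (xs ! b)) r = d * e" unfolding s by auto
    then have "meval d \<gamma> * meval e \<gamma> = 1 / (2 ^ r * fact r) * PF (\<lambda>a b. brm n k \<gamma> (xs ! a) (xs ! b)) r"
      using meval_pfaff[of "\<lambda>a b. brpoly n k (xs ! a) (xs ! b)" r \<gamma>] by (simp add: brm_def)
    then show "meval d \<gamma> \<noteq> 0" using xs(4) by auto
  qed (use k in auto)
  then show "d dvd 1" by (rule common_divisor.d_unit)
qed

theorem theorem4p4:
  fixes n k :: nat
  assumes "2 \<le> n" and "1 \<le> k" and "k \<le> n - 1"
  shows "(is_polynomial_ring (invariants n k) \<longleftrightarrow> k \<in> {n - 2, n - 1})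
         \<and> (k = n - 2 \<longrightarrow> codim2 n k)"
proof -
  consider "n = k + 1" | "n = k + 2" | "k + 3 \<le> n" using assms by linarith
  then show ?thesis
  proof cases
    case 1
    then show ?thesis using polynomial_ring_codim_1[OF assms(2)] assms by auto
  next
    case 2
    then show ?thesis using polynomial_ring_codim_2[OF assms(2)] codim2_of_codim_2[OF assms(2)] by auto
  next
    case 3
    then show ?thesis using not_polynomial_ring[OF assms(2)] assms by auto
  qed
qed

end
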